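(* Let $g\ge0$, $k\ge1$, $n\ge1$ be integers, $\mathbb F_q$ a finite field, $\boldsymbol\mu=(\mu^1,\dots,\mu^k)$ a $k$-tuple of partitions of $n$, and $(\mathcal X_1,\dots,\mathcal X_k)$ a generic tuple of semisimple split irreducible characters of $\mathrm{GL}_n(\mathbb F_q)$ of type $\boldsymbol\mu$ (i.e. $\mathcal X_i$ is of type $\mu^i$). Then $$\langle\Lambda\otimes\mathcal X_1\otimes\cdots\otimes\mathcal X_k,1\rangle=A_{\boldsymbol\mu}(q),$$ where $\Lambda(x)=q^{g\cdot\dim C_{\mathrm{GL}_n}(x)}$ and $A_{\boldsymbol\mu}(q)$ is the number of isomorphism classes of absolutely indecomposable representations over $\mathbb F_q$ of the comet-shaped quiver $\Gamma_{\boldsymbol\mu}$ of dimension $\mathbf v_{\boldsymbol\mu}$.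
   Context: Characters. $G=\mathrm{GL}_n(\mathbb F_q)$; $\Lambda:G\to\mathbb C$, $x\mapsto q^{g\dim C_{\mathrm{GL}_n}(x)}$, where $C_{\mathrm{GL}_n}(x)$ is the centralizer of $x$ in $\mathrm{GL}_n(\overline{\mathbb F}_q)$; $\otimes$ of class functions is the pointwise product, and $\langle f,h\rangle=|G|^{-1}\sum_{x\in G}f(x)\overline{h(x)}$. For a partition $\lambda=(\lambda_1,\dots,\lambda_r)$ of $n$, $L_\lambda=\mathrm{GL}_{\lambda_1}(\mathbb F_q)\times\cdots\times\mathrm{GL}_{\lambda_r}(\mathbb F_q)$ is the block diagonal subgroup, $Z_\lambda$ its center, $T=L_{(1^n)}$ the diagonal matrices, and $R_{L_\lambda}^G$ is Harish-Chandra (parabolic) induction: inflate to the parabolic subgroup $P_\lambda=L_\lambda\ltimes U_\lambda$ and induce to $G$. A semisimple split irreducible character of type $\lambda$ is one of the form $R_{L_\lambda}^G(\tilde\alpha)$ with $\tilde\alpha(g_1,\dots,g_r)=\prod_j\alpha_j(\det g_j)$ for pairwise distinct linear characters $\alpha_1,\dots,\alpha_r$ of $\mathbb F_q^\times$. Generic. Let $\mathcal X_i=R_{L_{\mu^i}}^G(\tilde\alpha_i)$ and write $\tilde\alpha_i|_T(t_1,\dots,t_n)=\prod_{m=1}^n\beta_{i,m}(t_m)$. The tuple is generic if for all permutations $w_1,\dots,w_k\in S_n$ the linear character $(t_1,\dots,t_n)\mapsto\prod_{i=1}^k\prod_{m=1}^n\beta_{i,w_i(m)}(t_m)$ of $T$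 is trivial on $Z_{(n)}$ (the scalar matrices) and non-trivial on $Z_\lambda$ for every partition $\lambda\ne(n)$ of $n$. Quiver. $\Gamma_{\boldsymbol\mu}$ has vertices $0$ and $[i,j]$ for $1\le i\le k$, $1\le j\le l(\mu^i)-1$ ($l$ = length), $g$ loops at $0$, and arrows $[i,1]\to0$ and $[i,j]\to[i,j-1]$ for $j\ge2$; $\mathbf v_{\boldsymbol\mu}$ has $v_0=n$, $v_{[i,j]}=n-\sum_{r=1}^j\mu^i_r$. Absolutely indecomposable means indecomposable over every finite extension of the base field. *)

theory Defs
  imports
    "HOL-Analysis.Abstract_Topology"
    "HOL-Algebra.Algebraic_Closure_Type"
    "HOL-Algebra.Embedded_Algebras"
    "HOL-Combinatorics.Permutations"
    "Jordan_Normal_Form.Matrix"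
    "Jordan_Normal_Form.Determinant"
    "Graph_Theory.Digraph"
begin

section \<open>General linear groups and class functions\<close>

definition GL :: "nat \<Rightarrow> 'a::field mat monoid" where
  "GL n = units_of (ring_mat TYPE('a) n ())"

definition class_inner :: "('g, 'r) monoid_scheme \<Rightarrow> ('g \<Rightarrow> complex) \<Rightarrow> ('g \<Rightarrow> complex) \<Rightarrow> complex" where
  "class_inner G f h = (\<Sum>x\<in>carrier G. f x * cnj (h x)) / of_nat (card (carrier G))"

definition induced_class_fun ::
  "('g, 'r) monoid_scheme \<Rightarrow> 'g set \<Rightarrow> ('g \<Rightarrow> complex) \<Rightarrow> 'g \<Rightarrow> complex" where
  "induced_class_fun G H f x =
     (\<Sum>y\<in>carrier G. if y \<otimes>\<^bsub>G\<^esub> x \<otimes>\<^bsub>G\<^esub> inv\<^bsub>G\<^esub> y \<in> H then f (y \<otimes>\<^bsub>G\<^esub> x \<otimes>\<^bsub>G\<^esub> inv\<^bsub>G\<^esub> y) else 0)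
       / of_nat (card H)"

text \<open>Linear characters of the multiplicative group of a field, extended by \<open>0\<close> at \<open>0\<close>.
  Because of this convention two characters are distinct iff they differ as functions.\<close>

definition linear_characters :: "('a::field \<Rightarrow> complex) set" where
  "linear_characters = {\<alpha>. \<alpha> 0 = 0 \<and> \<alpha> 1 = 1 \<and> (\<forall>x y. \<alpha> (x * y) = \<alpha> x * \<alpha> y)}"


section \<open>The function \<open>\<Lambda>\<close>\<close>

inductive_set mat_polyfuns :: "nat \<Rightarrow> ('b::field mat \<Rightarrow> 'b) set" for n :: nat where
  const: "(\<lambda>_. c) \<in> mat_polyfuns n"
| coord: "i < n \<Longrightarrow> j < n \<Longrightarrow> (\<lambda>A. A $$ (i, j)) \<in> mat_polyfuns n"
| add: "p \<in> mat_polyfuns n \<Longrightarrow> r \<in> mat_polyfuns n \<Longrightarrow> (\<lambda>A. p A + r A) \<in> mat_polyfuns n"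
| mult: "p \<in> mat_polyfuns n \<Longrightarrow> r \<in> mat_polyfuns n \<Longrightarrow> (\<lambda>A. p A * r A) \<in> mat_polyfuns n"

text \<open>The Zariski topology on \<open>n \<times> n\<close> matrices, generated by the principal open sets.\<close>

definition zariski :: "nat \<Rightarrow> 'b::field mat topology" where
  "zariski n = topology_generated_by ((\<lambda>p. {A \<in> carrier_mat n n. p A \<noteq> 0}) ` mat_polyfuns n)"

definition irreducible_in :: "'x topology \<Rightarrow> 'x set \<Rightarrow> bool" where
  "irreducible_in T S \<longleftrightarrow> S \<subseteq> topspace T \<and> S \<noteq> {} \<and>
     (\<forall>A B. closedin T A \<longrightarrow> closedin T B \<longrightarrow> S \<subseteq> A \<union> B \<longrightarrow> S \<subseteq> A \<or> S \<subseteq> B)"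

text \<open>The dimension of an algebraic variety is the Krull dimension of its underlying space.
  \<open>Sup\<close> on \<open>nat\<close> is meaningful only for bounded sets; nonempty subspaces of
  \<open>zariski n\<close>, to which this is applied, have Krull dimension at most \<open>n\<^sup>2\<close>.\<close>

definition krull_dim :: "'x topology \<Rightarrow> nat" where
  "krull_dim T = Sup {d. \<exists>Z. (\<forall>i\<le>d. closedin T (Z i) \<and> irreducible_in T (Z i)) \<and>
     (\<forall>i<d. Z i \<subset> Z (Suc i))}"

definition GL_centralizer :: "nat \<Rightarrow> 'a::field mat \<Rightarrow> 'a alg_closure mat set" where
  "GL_centralizer n x = {y \<in> carrier (GL n). y * map_mat to_ac x = map_mat to_ac x * y}"

definition Lambda :: "nat \<Rightarrow> nat \<Rightarrow> 'a::{field,finite} mat \<Rightarrow> complex" where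
  "Lambda g n x =
     of_nat (card (UNIV :: 'a set) ^ (g * krull_dim (subtopology (zariski n) (GL_centralizer n x))))"


section \<open>Harish-Chandra induction\<close>

definition is_partition :: "nat \<Rightarrow> nat list \<Rightarrow> bool" where
  "is_partition n p \<longleftrightarrow> sorted_wrt (\<ge>) p \<and> 0 \<notin> set p \<and> sum_list p = n"

definition levi :: "nat list \<Rightarrow> 'a::field mat set" where
  "levi p = {diag_block_mat gs | gs. length gs = length p \<and>
     (\<forall>j<length p. gs ! j \<in> carrier (GL (p ! j)))}"

definition levi_center :: "nat list \<Rightarrow> 'a::field mat set" where
  "levi_center p = {z \<in> levi p. \<forall>l\<in>levi p. z * l = l * z}"

text \<open>A matrix in the unipotent radical agrees with the identity outside the positions
  \<open>(a, b)\<close> strictly above the block diagonal, i.e. those with a block boundary \<open>s\<close> such that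
  \<open>a < s \<le> b\<close> (rows and columns are counted from \<open>0\<close>).\<close>

definition unipotent_radical :: "nat list \<Rightarrow> 'a::field mat set" where
  "unipotent_radical p = {u \<in> carrier_mat (sum_list p) (sum_list p).
     \<forall>a<sum_list p. \<forall>b<sum_list p.
       u $$ (a, b) = 1\<^sub>m (sum_list p) $$ (a, b) \<or>
       (\<exists>j. a < sum_list (take j p) \<and> sum_list (take j p) \<le> b)}"

definition parabolic :: "nat list \<Rightarrow> 'a::field mat set" where
  "parabolic p = levi p <#>\<^bsub>GL (sum_list p)\<^esub> unipotent_radical p"

definition inflate :: "nat list \<Rightarrow> ('a::field mat \<Rightarrow> complex) \<Rightarrow> 'a mat \<Rightarrow> complex" where
  "inflate p f x = f (THE l. l \<in> levi p \<and> (\<exists>u\<in>unipotent_radical p. x = l * u))"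

definition HC_induction :: "nat list \<Rightarrow> ('a::field mat \<Rightarrow> complex) \<Rightarrow> 'a mat \<Rightarrow> complex" where
  "HC_induction p f = induced_class_fun (GL (sum_list p)) (parabolic p) (inflate p f)"


section \<open>Semisimple split characters and genericity\<close>

definition diag_block :: "nat list \<Rightarrow> nat \<Rightarrow> 'a mat \<Rightarrow> 'a mat" where
  "diag_block p j A =
     mat (p ! j) (p ! j) (\<lambda>(a, b). A $$ (sum_list (take j p) + a, sum_list (take j p) + b))"

definition levi_char :: "nat list \<Rightarrow> (nat \<Rightarrow> 'a::field \<Rightarrow> complex) \<Rightarrow> 'a mat \<Rightarrow> complex" where
  "levi_char p \<alpha> l = (\<Prod>j<length p. \<alpha> j (det (diag_block p j l)))"

definition semisimple_split_data ::
  "nat list \<Rightarrow> (nat \<Rightarrow> 'a::field \<Rightarrow> complex) \<Rightarrow> ('a mat \<Rightarrow> complex) \<Rightarrow> bool" where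
  "semisimple_split_data p \<alpha> \<X> \<longleftrightarrow>
     (\<forall>j<length p. \<alpha> j \<in> linear_characters) \<and> inj_on \<alpha> {..<length p} \<and>
     (\<forall>x\<in>carrier (GL (sum_list p)). \<X> x = HC_induction p (levi_char p \<alpha>) x)"

definition semisimple_split_character :: "nat list \<Rightarrow> ('a::field mat \<Rightarrow> complex) \<Rightarrow> bool" where
  "semisimple_split_character p \<X> \<longleftrightarrow> (\<exists>\<alpha>. semisimple_split_data p \<alpha> \<X>)"

text \<open>The levi subgroup of \<open>replicate n 1\<close> is the diagonal torus, that of \<open>[n]\<close> is the whole
  group.\<close>

definition generic_tuple ::
  "nat \<Rightarrow> nat \<Rightarrow> (nat \<Rightarrow> nat list) \<Rightarrow> (nat \<Rightarrow> 'a::field mat \<Rightarrow> complex) \<Rightarrow> bool" where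
  "generic_tuple n k \<mu> \<X> \<longleftrightarrow>
     (\<exists>\<alpha> \<beta>.
        (\<forall>i\<in>{1..k}. semisimple_split_data (\<mu> i) (\<alpha> i) (\<X> i) \<and>
           (\<forall>m<n. \<beta> i m \<in> linear_characters) \<and>
           (\<forall>t\<in>levi (replicate n 1). levi_char (\<mu> i) (\<alpha> i) t = (\<Prod>m<n. \<beta> i m (t $$ (m, m))))) \<and>
        (\<forall>w. (\<forall>i\<in>{1..k}. w i permutes {..<n}) \<longrightarrow>
           (\<forall>z\<in>levi_center [n]. (\<Prod>i=1..k. \<Prod>m<n. \<beta> i (w i m) (z $$ (m, m))) = 1) \<and>
           (\<forall>p. is_partition n p \<longrightarrow> p \<noteq> [n] \<longrightarrow>
              (\<exists>z\<in>levi_center p. (\<Prod>i=1..k. \<Prod>m<n. \<beta> i (w i m) (z $$ (m, m))) \<noteq> 1))))"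


section \<open>Representations of quivers\<close>

text \<open>Representations are considered over a subfield \<open>K\<close> of an ambient field type. The inverse
  of a matrix with entries in \<open>K\<close> automatically has entries in \<open>K\<close>.\<close>

definition quiver_reps ::
  "('v, 'e) pre_digraph \<Rightarrow> ('v \<Rightarrow> nat) \<Rightarrow> 'b::field set \<Rightarrow> ('e \<Rightarrow> 'b mat) set" where
  "quiver_reps Q v K =
     (\<Pi>\<^sub>E a\<in>arcs Q. {A \<in> carrier_mat (v (head Q a)) (v (tail Q a)). elements_mat A \<subseteq> K})"

definition rep_iso ::
  "('v, 'e) pre_digraph \<Rightarrow> ('v \<Rightarrow> nat) \<Rightarrow> 'b::field set \<Rightarrow> ('e \<Rightarrow> 'b mat) \<Rightarrow> ('e \<Rightarrow> 'b mat) \<Rightarrow> bool" where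
  "rep_iso Q v K \<phi> \<psi> \<longleftrightarrow>
     (\<exists>h. (\<forall>x\<in>verts Q. h x \<in> carrier (GL (v x)) \<and> elements_mat (h x) \<subseteq> K) \<and>
          (\<forall>a\<in>arcs Q. h (head Q a) * \<phi> a = \<psi> a * h (tail Q a)))"

definition rep_direct_sum ::
  "('v, 'e) pre_digraph \<Rightarrow> ('e \<Rightarrow> 'b::field mat) \<Rightarrow> ('e \<Rightarrow> 'b mat) \<Rightarrow> 'e \<Rightarrow> 'b mat" where
  "rep_direct_sum Q \<phi> \<psi> = (\<lambda>a\<in>arcs Q. four_block_mat
     (\<phi> a) (0\<^sub>m (dim_row (\<phi> a)) (dim_col (\<psi> a)))
     (0\<^sub>m (dim_row (\<psi> a)) (dim_col (\<phi> a))) (\<psi> a))"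

definition indecomposable_over ::
  "('v, 'e) pre_digraph \<Rightarrow> ('v \<Rightarrow> nat) \<Rightarrow> 'b::field set \<Rightarrow> ('e \<Rightarrow> 'b mat) \<Rightarrow> bool" where
  "indecomposable_over Q v K \<phi> \<longleftrightarrow>
     (\<exists>x\<in>verts Q. v x \<noteq> 0) \<and>
     \<not> (\<exists>v1 v2 \<phi>1 \<phi>2.
          (\<exists>x\<in>verts Q. v1 x \<noteq> 0) \<and> (\<exists>x\<in>verts Q. v2 x \<noteq> 0) \<and>
          (\<forall>x\<in>verts Q. v x = v1 x + v2 x) \<and>
          \<phi>1 \<in> quiver_reps Q v1 K \<and> \<phi>2 \<in> quiver_reps Q v2 K \<and>
          rep_iso Q v K \<phi> (rep_direct_sum Q \<phi>1 \<phi>2))"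

text \<open>Up to isomorphism, the finite extensions of a field are the intermediate fields of finite
  degree inside its algebraic closure.\<close>

definition finite_extensions :: "'a::field alg_closure set set" where
  "finite_extensions = {K. subfield K ring_of_type_algebra \<and> range (to_ac :: 'a \<Rightarrow> _) \<subseteq> K \<and>
     ring.finite_dimension ring_of_type_algebra (range (to_ac :: 'a \<Rightarrow> _)) K}"

definition absolutely_indecomposable ::
  "('v, 'e) pre_digraph \<Rightarrow> ('v \<Rightarrow> nat) \<Rightarrow> ('e \<Rightarrow> 'a::field mat) \<Rightarrow> bool" where
  "absolutely_indecomposable Q v \<phi> \<longleftrightarrow>
     (\<forall>K\<in>finite_extensions. indecomposable_over Q v K (\<lambda>a\<in>arcs Q. map_mat to_ac (\<phi> a)))"

definition num_abs_indec ::
  "'a::field itself \<Rightarrow> ('v, 'e) pre_digraph \<Rightarrow> ('v \<Rightarrow> nat) \<Rightarrow> nat" where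
  "num_abs_indec F Q v =
     card ({\<phi> \<in> quiver_reps Q v (UNIV :: 'a set). absolutely_indecomposable Q v \<phi>} //
       {(\<phi>, \<psi>). \<phi> \<in> quiver_reps Q v UNIV \<and> \<psi> \<in> quiver_reps Q v UNIV \<and> rep_iso Q v UNIV \<phi> \<psi>})"


section \<open>Comet-shaped quivers\<close>

text \<open>\<open>Leg i j\<close> is the vertex \<open>[i, j]\<close>, and \<open>Leg_Arrow i j\<close> is the arrow starting there.\<close>

datatype comet_vertex = Center | Leg nat nat

datatype comet_arrow = Loop nat | Leg_Arrow nat nat

fun comet_tail :: "comet_arrow \<Rightarrow> comet_vertex" where
  "comet_tail (Loop _) = Center"
| "comet_tail (Leg_Arrow i j) = Leg i j"

fun comet_head :: "comet_arrow \<Rightarrow> comet_vertex" where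
  "comet_head (Loop _) = Center"
| "comet_head (Leg_Arrow i j) = (if j = 1 then Center else Leg i (j - 1))"

definition comet_quiver ::
  "nat \<Rightarrow> nat \<Rightarrow> (nat \<Rightarrow> nat list) \<Rightarrow> (comet_vertex, comet_arrow) pre_digraph" where
  "comet_quiver g k \<mu> =
     \<lparr> verts = insert Center {Leg i j | i j. i \<in> {1..k} \<and> j \<in> {1..length (\<mu> i) - 1}},
       arcs = Loop ` {1..g} \<union> {Leg_Arrow i j | i j. i \<in> {1..k} \<and> j \<in> {1..length (\<mu> i) - 1}},
       tail = comet_tail,
       head = comet_head \<rparr>"

fun comet_dim :: "nat \<Rightarrow> (nat \<Rightarrow> nat list) \<Rightarrow> comet_vertex \<Rightarrow> nat" where
  "comet_dim n \<mu> Center = n"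
| "comet_dim n \<mu> (Leg i j) = n - sum_list (take j (\<mu> i))"

definition A_mu :: "'a::field itself \<Rightarrow> nat \<Rightarrow> nat \<Rightarrow> nat \<Rightarrow> (nat \<Rightarrow> nat list) \<Rightarrow> nat" where
  "A_mu F g k n \<mu> = num_abs_indec F (comet_quiver g k \<mu>) (comet_dim n \<mu>)"

end

theory Submission
  imports Defs "HOL-Algebra.Group_Action" "HOL-Algebra.Product_Groups" "Jordan_Normal_Form.Char_Poly"
begin

text \<open>
Let \<open>q\<close> be the number of elements of \<open>F\<close> and \<open>L\<close> its algebraic closure. Dimensions of centralizers are
counts: the Krull dimension \<open>d\<close> of the centralizer of \<open>x\<close> satisfies \<open>q^d = |C(x)|\<close>, where \<open>C(x)\<close> is the
algebra of matrices over \<open>F\<close> commuting with \<open>x\<close> (\<open>krull_dim_GL_centralizer\<close>). So \<open>\<Lambda>(x) = |C(x)|^g\<close> counts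
the values of the \<open>g\<close> loops that commute with \<open>x\<close>. Inducing in stages, the value of \<open>\<X>\<^sub>i\<close> at the
transpose of \<open>x\<close> is a weighted count of chains of embeddings that intertwine \<open>x\<close> with invertible
matrices at the vertices of the \<open>i\<close>-th leg (\<open>chain_sum\<close>). Hence the inner product is
\<open>|H|^-1 \<Sum>\<theta>(h) |{\<phi>. h \<phi> = \<phi>}|\<close>, where \<open>h\<close> runs through the gauge group \<open>H\<close>, the product of the groups
\<open>GL(v x)\<close> over the vertices, \<open>\<phi>\<close> through the representations whose leg maps are all injective, and \<open>\<theta>\<close> is
a linear character of \<open>H\<close> built from determinants. By a weighted form of Burnside's lemma this is the
number of isomorphism classes of those \<open>\<phi>\<close> for which \<open>\<theta>\<close> is trivial on \<open>Aut \<phi>\<close>.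

It remains to see that these are the absolutely indecomposable representations
(\<open>comet_absolutely_indecomposable_iff\<close>). Absolute indecomposability means that the representation over \<open>L\<close>
has no idempotent endomorphism besides \<open>0\<close> and \<open>1\<close>. If there is none, then the leg maps are
injective, since a kernel splits off a summand supported on a leg, and each automorphism has a single
eigenvalue \<open>c\<close>, which lies in \<open>F\<close>; its determinants are \<open>c^(v x)\<close>, and \<open>\<theta>\<close> is trivial on it by the
condition on scalar matrices in genericity.

Conversely, let \<open>\<theta>\<close> be trivial on \<open>Aut \<phi>\<close>. An eigenvalue of an endomorphism yields an eigenprojection \<open>e\<close>
over \<open>L\<close>, whose \<open>r\<close> Frobenius conjugates are orthogonal. For every unit \<open>c\<close> of \<open>F\<close> they combine
to an automorphism over \<open>F\<close> with determinants \<open>c^rank(e x)\<close>. Since \<open>\<theta>\<close> is \<open>1\<close> there, the ranks of the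
conjugates and of the complementary projection split \<open>\<mu>\<close> into pieces whose characters are all trivial. Genericity
forbids this unless there is one piece. So all endomorphisms are scalars plus
nilpotents at the central vertex, and such an algebra has no nontrivial idempotent, also over \<open>L\<close>.
\<close>

section \<open>Matrices over a field\<close>

abbreviation Mat where "Mat \<equiv> carrier_mat"
abbreviation ac_mat where "ac_mat \<equiv> map_mat to_ac"

text \<open>Stated with dimensions instead of carrier sets, so that the simplifier can discharge the
 premises for products.\<close>

lemma mat_assoc:
 "dim_col A = dim_row B ==> dim_col B = dim_row C ==> (A * B) * C = A * (B * C)"
 for A B C :: "'a::semiring_0 mat"
 by (rule assoc_mult_mat[of _ "dim_row A" "dim_col A" _ "dim_col B" _ "dim_col C"]) auto

lemma mat_one_left: "dim_row A = n ==> 1\<^sub>m n * A = A"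
 and mat_one_right: "dim_col A = n ==> A * 1\<^sub>m n = A" for A :: "'a::semiring_1 mat"
 using left_mult_one_mat[of A n "dim_col A"] right_mult_one_mat[of A "dim_row A" n] by auto

lemma mat_mult_entry:
 "A \<in> Mat r s ==> B \<in> Mat s c ==> i < r ==> j < c ==> (A * B) $$ (i,j) = (\<Sum>l<s. A $$ (i,l) * B $$ (l,j))"
 by (simp add: scalar_prod_def lessThan_atLeast0)

lemma GL_iff: "A \<in> carrier (GL n) \<longleftrightarrow> A \<in> Mat n n & (\<exists>B\<in>Mat n n. A * B = 1\<^sub>m n & B * A = 1\<^sub>m n)"
 unfolding GL_def units_of_def Units_def by (auto simp: ring_mat_simps)

lemma GL_I: "A \<in> Mat n n ==> B \<in> Mat n n ==> A * B = 1\<^sub>m n ==> A \<in> carrier (GL n)"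
 using mat_mult_left_right_inverse[of A n B] unfolding GL_iff by auto

lemma GL_mat: "A \<in> carrier (GL n) ==> A \<in> Mat n n"
 by (simp add: GL_iff)

lemma GL_E:
 assumes "A \<in> carrier (GL n)"
 obtains B where "A \<in> Mat n n" "B \<in> Mat n n" "A * B = 1\<^sub>m n" "B * A = 1\<^sub>m n"
  "B \<in> carrier (GL n)"
proof -
 obtain B where B: "A \<in> Mat n n" "B \<in> Mat n n" "A * B = 1\<^sub>m n" "B * A = 1\<^sub>m n"
  using assms unfolding GL_iff by auto
 then have "B \<in> carrier (GL n)" unfolding GL_iff by auto
 with B that show ?thesis by auto
qed

lemma GL_iff_det: "A \<in> carrier (GL n) \<longleftrightarrow> A \<in> Mat n n & det A ~= 0" for A :: "'a::field mat"
proof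
 assume "A \<in> carrier (GL n)"
 then obtain B where "A \<in> Mat n n" "B \<in> Mat n n" "A * B = 1\<^sub>m n"
  by (rule GL_E)
 then have "det A * det B = 1" using det_mult[of A n B] by simp
 then show "A \<in> Mat n n & det A ~= 0" using \<open>A \<in> Mat n n\<close> by auto
next
 assume "A \<in> Mat n n & det A ~= 0"
 then have "A \<in> Units (ring_mat TYPE('a) n ())"
  using det_non_zero_imp_unit[of A n "()"] by simp
 then show "A \<in> carrier (GL n)" by (simp add: GL_def units_of_def)
qed

lemma GL_group: "group (GL n :: 'a::field mat monoid)"
proof -
 have "ring (ring_mat TYPE('a) n ())" by (rule ring_mat)
 then interpret ring "ring_mat TYPE('a) n ()" .
 show ?thesis unfolding GL_def by (rule units_group)
qed

lemma GL_mult: "A \<otimes>\<^bsub>GL n\<^esub> B = A * B"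
 by (simp add: GL_def units_of_def ring_mat_simps)

lemma GL_one: "\<one>\<^bsub>GL n\<^esub> = 1\<^sub>m n"
 by (simp add: GL_def units_of_def ring_mat_simps)

lemma GL_inv:
 assumes "A \<in> carrier (GL n)" "B \<in> Mat n n" "A * B = 1\<^sub>m n"
 shows "m_inv (GL n) A = B"
proof -
 interpret group "GL n" by (rule GL_group)
 have BA: "B * A = 1\<^sub>m n"
  using mat_mult_left_right_inverse[OF GL_mat[OF assms(1)] assms(2,3)] .
 have "B \<in> carrier (GL n)"
  using GL_I[OF assms(2) GL_mat[OF assms(1)] BA] .
 then show ?thesis
  using inv_equality[of B A] BA assms(1) by (simp add: GL_mult GL_one)
qed

lemma GL_one_closed: "1\<^sub>m n \<in> carrier (GL n)"
 by (rule GL_I[of _ _ "1\<^sub>m n"]) auto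

lemma GL_mult_closed: "A \<in> carrier (GL n) ==> B \<in> carrier (GL n) ==> A * B \<in> carrier (GL n)"
 using group.is_monoid[OF GL_group] monoid.m_closed GL_mult by metis

lemma GL_inv_closed: "A \<in> carrier (GL n) ==> m_inv (GL n) A \<in> carrier (GL n)"
 using group.inv_closed[OF GL_group] by metis

lemma GL_l_inv: "A \<in> carrier (GL n) ==> m_inv (GL n) A * A = 1\<^sub>m n"
 using group.l_inv[OF GL_group] GL_mult GL_one by metis

lemma GL_r_inv: "A \<in> carrier (GL n) ==> A * m_inv (GL n) A = 1\<^sub>m n"
 using group.r_inv[OF GL_group] GL_mult GL_one by metis

lemma GL_block_lower:
 assumes "a \<in> Mat m m" "b \<in> Mat r m" "d \<in> Mat r r"
 shows "four_block_mat a (0\<^sub>m m r) b d \<in> carrier (GL (m + r)) \<longleftrightarrow> a \<in> carrier (GL m) & d \<in> carrier (GL r)"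
 using assms by (auto simp: GL_iff_det det_four_block_mat_upper_right_zero)

lemma GL_block_upper:
 assumes "a \<in> Mat m m" "b \<in> Mat m r" "d \<in> Mat r r"
 shows "four_block_mat a b (0\<^sub>m r m) d \<in> carrier (GL (m + r)) \<longleftrightarrow> a \<in> carrier (GL m) & d \<in> carrier (GL r)"
 using assms by (auto simp: GL_iff_det det_four_block_mat_lower_left_zero)

text \<open>A step of Gaussian elimination without coordinates: a vector and a functional with value \<open>1\<close> on it
can be made the first coordinate vector and the first coordinate.\<close>

lemma dual_vectors_extend_to_dual_bases:
 fixes w \<xi> :: "'a::field vec"
 assumes w: "w \<in> carrier_vec (Suc m)" and \<xi>: "\<xi> \<in> carrier_vec (Suc m)" and "\<xi> \<bullet> w = 1"
 obtains B C where "B \<in> Mat (Suc m) (Suc m)" "C \<in> Mat (Suc m) (Suc m)"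
  "C * B = 1\<^sub>m (Suc m)" "B * C = 1\<^sub>m (Suc m)" "row C 0 = \<xi>" "col B 0 = w"
proof -
 let ?N = "Suc m"
 have sw: "(\<Sum>j<?N. \<xi> $ j * w $ j) = 1"
  using assms by (simp add: scalar_prod_def lessThan_atLeast0)
 then obtain i where i: "i < ?N" "w $ i ~= 0"
  by (metis (no_types, lifting) lessThan_iff mult_zero_right sum.neutral zero_neq_one)
 define s where "s a = insert_index i (a - 1)" for a
 have s: "s a < ?N" "s a ~= i" if "a < ?N" "a ~= 0" for a
  using that i by (auto simp: s_def insert_index_def)
 have s_inj: "s a = s b \<longleftrightarrow> a = b" if "a < ?N" "a ~= 0" "b < ?N" "b ~= 0" for a b
  using that by (auto simp: s_def insert_index_def split: if_splits)
 define C where "C = mat ?N ?N (%(a,j). if a = 0 then \<xi> $ j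
   else (if j = s a then 1 else 0) - (if j = i then w $ s a / w $ i else 0))"
 define B where "B = mat ?N ?N (%(j,a). if a = 0 then w $ j
   else (if j = s a then 1 else 0) - \<xi> $ s a * w $ j)"
 have BC: "B \<in> Mat ?N ?N" "C \<in> Mat ?N ?N" by (auto simp: B_def C_def)
 have entry: "(C * B) $$ (a, b) = (\<Sum>j<?N. C $$ (a,j) * B $$ (j,b))" if "a < ?N" "b < ?N" for a b
  using that BC by (simp add: scalar_prod_def lessThan_atLeast0)
 have row0: "(\<Sum>j<?N. \<xi> $ j * B $$ (j,b)) = (if b = 0 then 1 else 0)" if "b < ?N" for b
 proof (cases "b = 0")
  case True then show ?thesis using sw by (simp add: B_def)
 next
  case False
  have "(\<Sum>j<?N. \<xi> $ j * B $$ (j,b)) = (\<Sum>j<?N. \<xi> $ j * (if j = s b then 1 else 0) - \<xi> $ s b * (\<xi> $ j * w $ j))"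
   using False that by (intro sum.cong) (auto simp: B_def algebra_simps)
  also have "... = (\<Sum>j<?N. \<xi> $ j * (if j = s b then 1 else 0)) - \<xi> $ s b * (\<Sum>j<?N. \<xi> $ j * w $ j)"
   by (simp only: sum_subtractf sum_distrib_left)
  also have "(\<Sum>j<?N. \<xi> $ j * (if j = s b then 1 else 0)) = \<xi> $ s b"
   using s[OF that False] by (simp add: if_distrib[of "%x. _ * x"] cong: if_cong)
  finally show ?thesis using False unfolding sw by simp
 qed
 have rowa: "(\<Sum>j<?N. C $$ (a,j) * B $$ (j,b)) = B $$ (s a, b) - w $ s a / w $ i * B $$ (i, b)"
  if "a < ?N" "a ~= 0" "b < ?N" for a b
 proof -
  have "(\<Sum>j<?N. C $$ (a,j) * B $$ (j,b)) =
    (\<Sum>j<?N. (if j = s a then 1 else 0) * B $$ (j,b)) - (\<Sum>j<?N. (if j = i then w $ s a / w $ i else 0) * B $$ (j,b))"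
   unfolding sum_subtractf[symmetric] using that
   by (intro sum.cong) (auto simp: C_def algebra_simps)
  then show ?thesis using s[OF that(1,2)] i
   by (simp add: if_distrib[of "%x. x * _"] cong: if_cong)
 qed
 have "C * B = 1\<^sub>m ?N"
 proof (rule eq_matI)
  fix a b assume "a < dim_row (1\<^sub>m ?N)" "b < dim_col (1\<^sub>m ?N)"
  then have ab: "a < ?N" "b < ?N" by auto
  show "(C * B) $$ (a, b) = 1\<^sub>m ?N $$ (a, b)"
  proof (cases "a = 0")
   case True
   have "(C * B) $$ (a, b) = (\<Sum>j<?N. \<xi> $ j * B $$ (j,b))"
    unfolding entry[OF ab] using True by (intro sum.cong) (auto simp: C_def)
   then show ?thesis using row0[OF ab(2)] ab True by simp
  next
   case False
   show ?thesis unfolding entry[OF ab] rowa[OF ab(1) False ab(2)]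
    using False ab s[OF ab(1) False] i s_inj[OF ab(1) False ab(2)] s[OF ab(2)]
    by (auto simp: B_def field_simps)
  qed
 qed (use BC in auto)
 moreover from this have "B * C = 1\<^sub>m ?N" using mat_mult_left_right_inverse[OF BC(2,1)] by simp
 moreover have "row C 0 = \<xi>" using \<xi> by (intro eq_vecI) (auto simp: C_def)
 moreover have "col B 0 = w" using w by (intro eq_vecI) (auto simp: B_def)
 ultimately show ?thesis using that BC by blast
qed

definition unit_diag :: "nat => nat => nat => 'a::field mat" where
 "unit_diag r c \<rho> = mat r c (%(i,j). if i = j & i < \<rho> then 1 else 0)"

lemma unit_diag_carrier [simp]: "unit_diag r c \<rho> \<in> Mat r c"
 "dim_row (unit_diag r c \<rho>) = r" "dim_col (unit_diag r c \<rho>) = c"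
 by (auto simp: unit_diag_def)

lemma unit_diag_0: "unit_diag r c 0 = 0\<^sub>m r c"
 by (auto simp: unit_diag_def)

definition one_oplus :: "'a::field mat => 'a mat" where
 "one_oplus A = mat (Suc (dim_row A)) (Suc (dim_col A))
   (%(i,j). if i = 0 \<or> j = 0 then (if i = j then 1 else 0) else A $$ (i - 1, j - 1))"

lemma one_oplus_carrier [simp]: "A \<in> Mat r c ==> one_oplus A \<in> Mat (Suc r) (Suc c)"
 by (auto simp: one_oplus_def)

lemma unit_diag_Suc: "unit_diag (Suc r) (Suc c) (Suc \<rho>) = one_oplus (unit_diag r c \<rho>)"
 by (rule eq_matI) (auto simp: unit_diag_def one_oplus_def)

lemma split_off_corner:
 assumes "M \<in> Mat (Suc r) (Suc c)"
  and "col M 0 = unit_vec (Suc r) 0" and "row M 0 = unit_vec (Suc c) 0"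
 obtains A where "A \<in> Mat r c" "M = one_oplus A"
proof
 let ?A = "mat r c (%(i,j). M $$ (Suc i, Suc j))"
 show "?A \<in> Mat r c" by simp
 have "M $$ (i, 0) = (if i = 0 then 1 else 0)" if "i < Suc r" for i
  using assms that index_col[of i M 0] by (simp add: unit_vec_def)
 moreover have "M $$ (0, j) = (if j = 0 then 1 else 0)" if "j < Suc c" for j
  using assms that index_row(1)[of 0 M j] by (simp add: unit_vec_def)
 ultimately show "M = one_oplus ?A"
  using assms(1) by (intro eq_matI) (auto simp: one_oplus_def)
qed

lemma one_oplus_mult:
 fixes A B :: "'a::field mat"
 assumes "A \<in> Mat r s" "B \<in> Mat s c"
 shows "one_oplus A * one_oplus B = one_oplus (A * B)"
proof (rule eq_matI)
 fix i j assume "i < dim_row (one_oplus (A * B))" "j < dim_col (one_oplus (A * B))"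
 then have ij: "i < Suc r" "j < Suc c" using assms by (auto simp: one_oplus_def)
 have "(one_oplus A * one_oplus B) $$ (i, j) = (\<Sum>l<Suc s. one_oplus A $$ (i,l) * one_oplus B $$ (l,j))"
  using ij assms by (simp add: one_oplus_def scalar_prod_def lessThan_atLeast0)
 also have "... = one_oplus A $$ (i,0) * one_oplus B $$ (0,j) + (\<Sum>l<s. one_oplus A $$ (i,Suc l) * one_oplus B $$ (Suc l,j))"
  by (rule sum.lessThan_Suc_shift)
 also have "... = one_oplus (A * B) $$ (i,j)"
  using ij assms by (cases i; cases j) (auto simp: one_oplus_def scalar_prod_def lessThan_atLeast0)
 finally show "(one_oplus A * one_oplus B) $$ (i, j) = one_oplus (A * B) $$ (i,j)" .
qed (use assms in \<open>auto simp: one_oplus_def\<close>)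

lemma one_oplus_one: "one_oplus (1\<^sub>m r) = 1\<^sub>m (Suc r)"
 by (rule eq_matI) (auto simp: one_oplus_def)

lemma one_oplus_inj: "one_oplus A = one_oplus B ==> A = B"
proof (rule eq_matI)
 assume eq: "one_oplus A = one_oplus B"
 show "dim_row A = dim_row B" "dim_col A = dim_col B"
  using arg_cong[OF eq, of dim_row] arg_cong[OF eq, of dim_col] by (auto simp: one_oplus_def)
 fix i j assume "i < dim_row B" "j < dim_col B"
 then show "A $$ (i,j) = B $$ (i,j)"
  using arg_cong[OF eq, of "%M. M $$ (Suc i, Suc j)"] \<open>dim_row A = dim_row B\<close> \<open>dim_col A = dim_col B\<close>
  by (simp add: one_oplus_def)
qed

lemma one_oplus_GL: "A \<in> carrier (GL r) ==> one_oplus A \<in> carrier (GL (Suc r))"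
proof (erule GL_E)
 fix B assume "A \<in> Mat r r" "B \<in> Mat r r" "A * B = 1\<^sub>m r"
 then show ?thesis by (intro GL_I[of _ _ "one_oplus B"]) (auto simp: one_oplus_mult one_oplus_one)
qed

text \<open>As long as \<open>A ~= 0\<close>, a nonzero entry provides dual pairs in source and target that \<open>A\<close> matches, so a
block \<open>1\<close> splits off.\<close>

theorem rank_normal_form:
 fixes A :: "'a::field mat"
 assumes "A \<in> Mat r c"
 shows "\<exists>P\<in>carrier (GL r). \<exists>Q\<in>carrier (GL c). \<exists>\<rho>\<le>min r c. P * A * Q = unit_diag r c \<rho>"
 using assms
proof (induction r arbitrary: c A)
 case 0
 then have "1\<^sub>m 0 * A * 1\<^sub>m c = unit_diag 0 c 0" by (auto simp: unit_diag_def)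
 then show ?case using GL_one_closed by fastforce
next
 case (Suc r)
 show ?case
 proof (cases "A = 0\<^sub>m (Suc r) c")
  case True
  then have "1\<^sub>m (Suc r) * A * 1\<^sub>m c = unit_diag (Suc r) c 0" by (simp add: unit_diag_0)
  then show ?thesis using GL_one_closed by fastforce
 next
  case False
  then obtain i j where ij: "i < Suc r" "j < c" "A $$ (i,j) ~= 0"
   using Suc.prems by (metis eq_matI index_zero_mat carrier_matD)
  then obtain c' where c: "c = Suc c'" by (cases c) auto
  note A = Suc.prems[unfolded c]
  let ?u = "unit_vec (Suc c') j"
  define w where "w = A *\<^sub>v ?u"
  define \<xi> where "\<xi> = inverse (A $$ (i,j)) \<cdot>\<^sub>v unit_vec (Suc r) i"
  define \<eta> where "\<eta> = A\<^sup>T *\<^sub>v \<xi>"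
  have car: "w \<in> carrier_vec (Suc r)" "\<xi> \<in> carrier_vec (Suc r)" "\<eta> \<in> carrier_vec (Suc c')"
   using A by (auto simp: w_def \<xi>_def \<eta>_def)
  have w1: "\<xi> \<bullet> w = 1"
   using ij A unfolding \<xi>_def w_def c by (simp add: scalar_prod_left_unit[of _ "Suc r"])
  have "\<eta> \<bullet> ?u = \<eta> $ j" using car ij c by simp
  also have "... = col A j \<bullet> \<xi>" using ij c A by (simp add: \<eta>_def)
  also have "... = 1" using ij A by (simp add: \<xi>_def c)
  finally have e1: "\<eta> \<bullet> ?u = 1" .
  obtain B C where P: "B \<in> Mat (Suc r) (Suc r)" "C \<in> Mat (Suc r) (Suc r)"
   "C * B = 1\<^sub>m (Suc r)" "B * C = 1\<^sub>m (Suc r)" "row C 0 = \<xi>" "col B 0 = w"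
   using dual_vectors_extend_to_dual_bases[OF car(1,2) w1] .
  obtain B' C' where Q: "B' \<in> Mat (Suc c') (Suc c')" "C' \<in> Mat (Suc c') (Suc c')"
   "C' * B' = 1\<^sub>m (Suc c')" "B' * C' = 1\<^sub>m (Suc c')" "row C' 0 = \<eta>" "col B' 0 = ?u"
   using dual_vectors_extend_to_dual_bases[OF _ car(3) e1] by auto
  let ?M = "C * A * B'"
  have M: "?M \<in> Mat (Suc r) (Suc c')" using P Q A by auto
  have "col ?M 0 = C * A *\<^sub>v ?u" using P Q A by (subst col_mult2[of _ "Suc r" "Suc c'" _ "Suc c'"]) auto
  also have "... = C *\<^sub>v w" unfolding w_def using P A by (intro assoc_mult_mat_vec[of _ _ "Suc r" _ "Suc c'"]) auto
  also have "... = C *\<^sub>v (B *\<^sub>v unit_vec (Suc r) 0)"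
   using P by (intro arg_cong[of _ _ "%v. C *\<^sub>v v"]) (auto intro!: eq_vecI simp flip: P(6))
  also have "... = (C * B) *\<^sub>v unit_vec (Suc r) 0" using P by (intro assoc_mult_mat_vec[symmetric, of _ _ "Suc r" _ "Suc r"]) auto
  also have "... = unit_vec (Suc r) 0" using P by simp
  finally have c0: "col ?M 0 = unit_vec (Suc r) 0" .
  have CA: "row (C * A) 0 = \<eta>"
  proof (rule eq_vecI)
   fix i assume "i < dim_vec \<eta>"
   then have i: "i < Suc c'" using car by simp
   have "row (C * A) 0 $ i = \<xi> \<bullet> col A i" using P A i by simp
   also have "... = \<eta> $ i" using comm_scalar_prod[OF car(2), of "col A i"] A i by (simp add: \<eta>_def)
   finally show "row (C * A) 0 $ i = \<eta> $ i" .
  qed (use car A P in auto)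
  have "row ?M 0 = unit_vec (Suc c') 0"
  proof (rule eq_vecI)
   fix j' assume "j' < dim_vec (unit_vec (Suc c') 0 :: 'a vec)"
   then have j': "j' < Suc c'" by simp
   have "row ?M 0 $ j' = (C * A * B') $$ (0, j')" using P Q A j' by (subst index_row(1)) auto
   also have "... = row (C * A) 0 \<bullet> col B' j'" using P Q A j' by (subst index_mult_mat(1)) auto
   also have "... = row C' 0 \<bullet> col B' j'" unfolding CA Q(5) ..
   also have "... = (C' * B') $$ (0, j')" using Q(1,2) j' by (subst index_mult_mat(1)) auto
   also have "... = unit_vec (Suc c') 0 $ j'" unfolding Q(3) using j' by (auto simp: unit_vec_def)
   finally show "row ?M 0 $ j' = unit_vec (Suc c') 0 $ j'" .
  qed (use M in auto)
  from split_off_corner[OF M c0 this] obtain A' where A': "A' \<in> Mat r c'"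
   "?M = one_oplus A'" .
  from Suc.IH[OF A'(1)] obtain P' Q' \<rho> where IH: "P' \<in> carrier (GL r)" "Q' \<in> carrier (GL c')" "\<rho> <= min r c'"
   "P' * A' * Q' = unit_diag r c' \<rho>" by blast
  define P2 where "P2 = one_oplus P'"
  define Q2 where "Q2 = one_oplus Q'"
  have cars: "P' \<in> Mat r r" "Q' \<in> Mat c' c'" using IH GL_mat by auto
  have G: "P2 \<in> carrier (GL (Suc r))" "Q2 \<in> carrier (GL (Suc c'))"
   using one_oplus_GL IH unfolding P2_def Q2_def by auto
  have "P2 * ?M * Q2 = one_oplus (P' * A' * Q')"
   unfolding A'(2) P2_def Q2_def using cars A'(1) by (simp add: one_oplus_mult[of _ r r _ c'] one_oplus_mult[of _ r c' _ c'] del: assoc_mult_mat)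
  then have "P2 * ?M * Q2 = unit_diag (Suc r) (Suc c') (Suc \<rho>)"
   unfolding IH(4) unit_diag_Suc .
  moreover have "P2 * ?M * Q2 = (P2 * C) * A * (B' * Q2)"
   using GL_mat[OF G(1)] GL_mat[OF G(2)] P(1,2) Q(1,2) A by (simp add: mat_assoc del: assoc_mult_mat)
  moreover have "P2 * C \<in> carrier (GL (Suc r))" "B' * Q2 \<in> carrier (GL (Suc c'))"
   using G GL_I[OF P(2,1,3)] GL_I[OF Q(1,2,4)] GL_mult_closed by auto
  ultimately have "P2 * C * A * (B' * Q2) = unit_diag (Suc r) c (Suc \<rho>)" "P2 * C \<in> carrier (GL (Suc r))"
   "B' * Q2 \<in> carrier (GL c)" unfolding c by simp_all
  moreover have "Suc \<rho> <= min (Suc r) c" using IH(3) c by simp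
  ultimately show ?thesis by blast
 qed
qed

text \<open>A nonzero entry of an idempotent \<open>e\<close> provides a column and a multiple of a row of \<open>e\<close>
that are dual to each other. Both are fixed by \<open>e\<close>, so a block \<open>1\<close> splits off, and the rest is again idempotent.\<close>

theorem idempotent_normal_form:
 fixes e :: "'a::field mat"
 assumes "e \<in> Mat m m" "e * e = e"
 shows "\<exists>h\<in>carrier (GL m). \<exists>\<rho>\<le>m. h * e = unit_diag m m \<rho> * h"
 using assms
proof (induction m arbitrary: e)
 case 0
 then have "1\<^sub>m 0 * e = unit_diag 0 0 0 * 1\<^sub>m 0" by auto
 then show ?case using GL_one_closed by blast
next
 case (Suc m)
 note e = Suc.prems
 show ?case
 proof (cases "e = 0\<^sub>m (Suc m) (Suc m)")
  case True
  then have "1\<^sub>m (Suc m) * e = unit_diag (Suc m) (Suc m) 0 * 1\<^sub>m (Suc m)" by (simp add: unit_diag_0)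
  then show ?thesis using GL_one_closed by blast
 next
  case False
  then obtain i j where ij: "i < Suc m" "j < Suc m" "e $$ (i,j) ~= 0"
   using e by (metis eq_matI index_zero_mat carrier_matD)
  define w where "w = col e j"
  define \<xi> where "\<xi> = inverse (e $$ (i,j)) \<cdot>\<^sub>v row e i"
  have car: "w \<in> carrier_vec (Suc m)" "\<xi> \<in> carrier_vec (Suc m)"
   using e(1) ij by (auto simp: w_def \<xi>_def)
  have ee: "row e a \<bullet> col e b = e $$ (a,b)" if "a < Suc m" "b < Suc m" for a b
  proof -
   have "(e * e) $$ (a,b) = row e a \<bullet> col e b" using e(1) that by (intro index_mult_mat(1)) auto
   then show ?thesis unfolding e(2) ..
  qed
  have "row e i \<bullet> col e j = e $$ (i,j)" using ee ij by blast
  then have w1: "\<xi> \<bullet> w = 1" using ij e by (simp add: \<xi>_def w_def)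
  obtain B C where P: "B \<in> Mat (Suc m) (Suc m)" "C \<in> Mat (Suc m) (Suc m)"
   "C * B = 1\<^sub>m (Suc m)" "B * C = 1\<^sub>m (Suc m)" "row C 0 = \<xi>" "col B 0 = w"
   using dual_vectors_extend_to_dual_bases[OF car w1] .
  let ?M = "C * (e * B)"
  have M: "?M \<in> Mat (Suc m) (Suc m)" using P e by auto
  have ew: "e *\<^sub>v w = w" using ij e ee by (intro eq_vecI) (auto simp: w_def)
  have "col ?M 0 = C *\<^sub>v (e *\<^sub>v col B 0)" using P e by (simp add: col_mult2[of _ "Suc m" "Suc m" _ "Suc m"])
  also have "... = C *\<^sub>v col B 0" using ew P by simp
  also have "... = col (C * B) 0" using P(1,2) by (subst col_mult2[of _ "Suc m" "Suc m" _ "Suc m"]) auto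
  finally have c0: "col ?M 0 = unit_vec (Suc m) 0" unfolding P(3) by simp
  have "row (C * e) 0 = \<xi>"
  proof (rule eq_vecI)
   fix j' assume "j' < dim_vec \<xi>"
   then have j': "j' < Suc m" using car by simp
   have "row (C * e) 0 $ j' = \<xi> \<bullet> col e j'" using P e j' by simp
   also have "... = \<xi> $ j'" using ij e j' ee by (simp add: \<xi>_def)
   finally show "row (C * e) 0 $ j' = \<xi> $ j'" .
  qed (use car e in auto)
  note CE = this
  have "row ?M 0 = unit_vec (Suc m) 0"
  proof (rule eq_vecI)
   fix j' assume "j' < dim_vec (unit_vec (Suc m) 0 :: 'a vec)"
   then have j': "j' < Suc m" by simp
   have "row ?M 0 $ j' = (C * e * B) $$ (0, j')" using P(1,2) e(1) j'
    by (subst index_row(1)) (auto simp: assoc_mult_mat[OF P(2) e(1) P(1)])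
   also have "... = row (C * e) 0 \<bullet> col B j'" using P(1,2) e(1) j' by (subst index_mult_mat(1)) auto
   also have "... = row C 0 \<bullet> col B j'" unfolding CE P(5) ..
   also have "... = (C * B) $$ (0, j')" using P(1,2) j' by (subst index_mult_mat(1)) auto
   also have "... = unit_vec (Suc m) 0 $ j'" unfolding P(3) using j' by (auto simp: unit_vec_def)
   finally show "row ?M 0 $ j' = unit_vec (Suc m) 0 $ j'" .
  qed (use M in auto)
  from split_off_corner[OF M c0 this] obtain A' where A': "A' \<in> Mat m m"
   "?M = one_oplus A'" .
  have BC: "B * (C * Z) = Z" if "Z \<in> Mat (Suc m) (Suc m)" for Z
   using P(1,2,4) that by (simp flip: mat_assoc)
  have eX: "e * (e * Z) = e * Z" if "Z \<in> Mat (Suc m) (Suc m)" for Z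
   using e that by (simp flip: mat_assoc)
  have "?M * ?M = C * (e * (B * (C * (e * B))))" using P(1,2) e(1) by (simp add: mat_assoc del: assoc_mult_mat)
  also have "... = ?M" using P(1,2) e(1) by (simp add: BC eX)
  finally have "?M * ?M = ?M" .
  then have "one_oplus (A' * A') = one_oplus A'"
   unfolding A'(2) using A'(1) by (simp add: one_oplus_mult)
  then have "A' * A' = A'" by (rule one_oplus_inj)
  from Suc.IH[OF A'(1) this] obtain h \<rho> where IH: "h \<in> carrier (GL m)" "\<rho> <= m" "h * A' = unit_diag m m \<rho> * h" by blast
  define h2 where "h2 = one_oplus h"
  have h2: "h2 \<in> carrier (GL (Suc m))" using IH one_oplus_GL unfolding h2_def by auto
  have "h2 * ?M = unit_diag (Suc m) (Suc m) (Suc \<rho>) * h2"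
   unfolding A'(2) h2_def unit_diag_Suc using GL_mat[OF IH(1)] A'(1) IH(3)
   by (simp add: one_oplus_mult[of _ m m _ m])
  then have "h2 * ?M * C = unit_diag (Suc m) (Suc m) (Suc \<rho>) * (h2 * C)"
   using P(1,2) e(1) GL_mat[OF h2] by (simp add: mat_assoc del: assoc_mult_mat)
  moreover have "h2 * ?M * C = (h2 * C) * (e * (B * C))"
   using P(1,2) e(1) GL_mat[OF h2] by (simp add: mat_assoc del: assoc_mult_mat)
  then have "h2 * ?M * C = (h2 * C) * e" using P(4) e(1) by simp
  moreover have "h2 * C \<in> carrier (GL (Suc m))" using h2 GL_I[OF P(2,1,3)] GL_mult_closed by blast
  ultimately have "h2 * C * e = unit_diag (Suc m) (Suc m) (Suc \<rho>) * (h2 * C)" "h2 * C \<in> carrier (GL (Suc m))"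
   by simp_all
  moreover have "Suc \<rho> <= Suc m" using IH(2) by simp
  ultimately show ?thesis by blast
 qed
qed

definition left_inv :: "'a::field mat => bool" where
 "left_inv A \<longleftrightarrow> (\<exists>B\<in>Mat (dim_col A) (dim_row A). B * A = 1\<^sub>m (dim_col A))"

lemma left_invE:
 assumes "left_inv A" "A \<in> Mat r c"
 obtains B where "B \<in> Mat c r" "B * A = 1\<^sub>m c"
 using assms unfolding left_inv_def by auto

lemma left_invI: "A \<in> Mat r c ==> B \<in> Mat c r ==> B * A = 1\<^sub>m c ==> left_inv A"
 unfolding left_inv_def by (metis carrier_matD)

lemma unit_diag_mult: "\<rho> <= s ==> unit_diag r s \<rho> * unit_diag s c \<rho> = unit_diag r c \<rho>"
 by (rule eq_matI) (auto simp: unit_diag_def scalar_prod_def if_distrib[of "%x. x * _"] sum.If_cases cong: if_cong)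

lemma unit_diag_full: "unit_diag n n n = 1\<^sub>m n"
 by (rule eq_matI) (auto simp: unit_diag_def)

lemma rank_normal_formE:
 fixes A :: "'a::field mat"
 assumes "A \<in> Mat r c"
 obtains P P' Q Q' \<rho> where "P \<in> Mat r r" "P' \<in> Mat r r" "P' * P = 1\<^sub>m r" "P * P' = 1\<^sub>m r"
  "Q \<in> Mat c c" "Q' \<in> Mat c c" "Q' * Q = 1\<^sub>m c" "Q * Q' = 1\<^sub>m c"
  "\<rho> <= r" "\<rho> <= c" "P * A = unit_diag r c \<rho> * Q'" "A * Q = P' * unit_diag r c \<rho>"
proof -
 obtain P Q \<rho> where *: "P \<in> carrier (GL r)" "Q \<in> carrier (GL c)" "\<rho> <= min r c" "P * A * Q = unit_diag r c \<rho>"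
  using rank_normal_form[OF assms] by blast
 obtain P' where P: "P \<in> Mat r r" "P' \<in> Mat r r" "P * P' = 1\<^sub>m r" "P' * P = 1\<^sub>m r" by (rule GL_E[OF *(1)])
 obtain Q' where Q: "Q \<in> Mat c c" "Q' \<in> Mat c c" "Q * Q' = 1\<^sub>m c" "Q' * Q = 1\<^sub>m c" by (rule GL_E[OF *(2)])
 have "P * A = P * A * (Q * Q')" using assms P Q(3) by simp
 also have "... = P * A * Q * Q'" using assms P(1,2) Q(1,2) by (simp add: mat_assoc del: assoc_mult_mat)
 finally have 1: "P * A = unit_diag r c \<rho> * Q'" unfolding *(4) .
 have "A * Q = (P' * P) * (A * Q)" using assms P(4) Q(1) by simp
 also have "... = P' * (P * A * Q)" using assms P(1,2) Q(1,2) by (simp add: mat_assoc del: assoc_mult_mat)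
 finally have 2: "A * Q = P' * unit_diag r c \<rho>" unfolding *(4) .
 show ?thesis using that P Q 1 2 *(3) by auto
qed

lemma left_inv_cases:
 fixes A :: "'a::field mat"
 assumes A: "A \<in> Mat r c"
 obtains (inj) P P' Q Q' where "c <= r" "left_inv A" "P \<in> Mat r r" "P' \<in> Mat r r" "P' * P = 1\<^sub>m r" "P * P' = 1\<^sub>m r"
  "Q \<in> Mat c c" "Q' \<in> Mat c c" "Q' * Q = 1\<^sub>m c" "Q * Q' = 1\<^sub>m c" "P * A = unit_diag r c c * Q'"
 | (kernel) U where "\<not> left_inv A" "U \<in> Mat c 1" "U ~= 0\<^sub>m c 1" "A * U = 0\<^sub>m r 1"
proof -
 from A obtain P P' Q Q' \<rho> where PQ: "P \<in> Mat r r" "P' \<in> Mat r r" "P' * P = 1\<^sub>m r" "P * P' = 1\<^sub>m r"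
  "Q \<in> Mat c c" "Q' \<in> Mat c c" "Q' * Q = 1\<^sub>m c" "Q * Q' = 1\<^sub>m c"
  "\<rho> <= r" "\<rho> <= c" "P * A = unit_diag r c \<rho> * Q'" "A * Q = P' * unit_diag r c \<rho>"
  by (rule rank_normal_formE)
 show ?thesis
 proof (cases "\<rho> = c")
  case True
  have "Q * unit_diag c r c * P * A = Q * (unit_diag c r c * (P * A))"
   using A PQ(1,5) by (simp add: mat_assoc del: assoc_mult_mat)
  also have "... = Q * ((unit_diag c r c * unit_diag r c c) * Q')"
   unfolding PQ(11) using True PQ(6) by (simp add: mat_assoc del: assoc_mult_mat)
  also have "... = 1\<^sub>m c" using True PQ by (simp add: unit_diag_mult unit_diag_full)
  finally have "left_inv A"
   using A PQ(1,5) by (intro left_invI[of _ r c "Q * unit_diag c r c * P"]) auto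
  then show ?thesis using inj PQ True by blast
 next
  case False
  define E :: "'a mat" where "E = mat c 1 (%(i,j). if i = \<rho> then 1 else 0)"
  have E: "E \<in> Mat c 1" by (auto simp: E_def)
  have nz: "E $$ (\<rho>, 0) = 1" using False PQ by (auto simp: E_def)
  have "unit_diag r c \<rho> * E = 0\<^sub>m r 1"
   by (rule eq_matI) (auto simp: E_def unit_diag_def scalar_prod_def intro!: sum.neutral)
  then have "P' * unit_diag r c \<rho> * E = 0\<^sub>m r 1" using PQ(2) E by (simp add: mat_assoc del: assoc_mult_mat)
  then have 1: "A * (Q * E) = 0\<^sub>m r 1" using A PQ(5,12) E by (simp flip: mat_assoc)
  have 2: "Q * E ~= 0\<^sub>m c 1"
  proof
   assume "Q * E = 0\<^sub>m c 1"
   then have "Q' * Q * E = 0\<^sub>m c 1" using PQ(5,6) E by (simp add: mat_assoc del: assoc_mult_mat)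
   then have "E = 0\<^sub>m c 1" using PQ E by simp
   then show False using nz False PQ by simp
  qed
  have "\<not> left_inv A"
  proof
   assume "left_inv A"
   then obtain B where B: "B \<in> Mat c r" "B * A = 1\<^sub>m c" using left_invE A by blast
   have "Q * E = B * A * (Q * E)" using B PQ E by simp
   also have "... = B * (A * (Q * E))" using A B(1) PQ(5) E by (simp add: mat_assoc del: assoc_mult_mat)
   also have "... = 0\<^sub>m c 1" using 1 B by simp
   finally show False using 2 by simp
  qed
  then show ?thesis using kernel[of "Q * E"] 1 2 PQ(5) E by auto
 qed
qed

lemma left_inv_dim: "left_inv A ==> A \<in> Mat r c ==> c <= r"
 by (erule left_inv_cases) auto

text \<open>For \<open>M\<close> in normal form, a vector lies in the image iff its last coordinates vanish, and those
coordinates kill the image.\<close>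

lemma separating_functional:
 fixes M :: "'a::field mat"
 assumes M: "M \<in> Mat r c" and U: "U \<in> Mat r 1" and "\<not> (\<exists>V\<in>Mat c 1. M * V = U)"
 obtains X\<^sub>0 where "X\<^sub>0 \<in> Mat 1 r" "X\<^sub>0 * M = 0\<^sub>m 1 c" "X\<^sub>0 * U = 1\<^sub>m 1"
proof -
 from M obtain P P' Q Q' \<rho> where PQ: "P \<in> Mat r r" "P' \<in> Mat r r" "P' * P = 1\<^sub>m r" "P * P' = 1\<^sub>m r"
  "Q \<in> Mat c c" "Q' \<in> Mat c c" "Q' * Q = 1\<^sub>m c" "Q * Q' = 1\<^sub>m c"
  "\<rho> <= r" "\<rho> <= c" "P * M = unit_diag r c \<rho> * Q'" "M * Q = P' * unit_diag r c \<rho>"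
  by (rule rank_normal_formE)
 define W where "W = P * U"
 have W: "W \<in> Mat r 1" using PQ(1) U by (simp add: W_def)
 have "\<exists>t. \<rho> <= t & t < r & W $$ (t,0) ~= 0"
 proof (rule ccontr)
  assume "\<not> ?thesis"
  then have z: "W $$ (t,0) = 0" if "\<rho> <= t" "t < r" for t using that by auto
  have WW: "unit_diag r c \<rho> * (unit_diag c r \<rho> * W) = W"
  proof -
   have "unit_diag r c \<rho> * (unit_diag c r \<rho> * W) = unit_diag r r \<rho> * W"
    using W PQ(10) by (simp flip: mat_assoc add: unit_diag_mult)
   also have "... = W"
   proof (rule eq_matI)
    fix i j assume "i < dim_row W" "j < dim_col W"
    then have ij: "i < r" "j = 0" using W by auto
    have "(unit_diag r r \<rho> * W) $$ (i,j) = (\<Sum>l<r. unit_diag r r \<rho> $$ (i,l) * W $$ (l,j))"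
     using ij W by (intro mat_mult_entry[of _ r r _ 1]) auto
    also have "... = (\<Sum>l<r. if l = i then (if i < \<rho> then W $$ (i,0) else 0) else 0)"
     using ij by (intro sum.cong) (auto simp: unit_diag_def)
    also have "... = W $$ (i,j)" using ij z[of i] by (simp add: sum.delta)
    finally show "(unit_diag r r \<rho> * W) $$ (i,j) = W $$ (i,j)" .
   qed (use W in auto)
   finally show ?thesis .
  qed
  have "M * (Q * (unit_diag c r \<rho> * W)) = P' * (unit_diag r c \<rho> * (unit_diag c r \<rho> * W))"
   using M PQ(2,5,12) W by (simp flip: mat_assoc)
  also have "... = P' * P * U" unfolding WW using PQ(1,2) U by (simp add: W_def mat_assoc del: assoc_mult_mat)
  also have "... = U" using PQ(3) U by simp
  finally show False using assms(3) PQ(5) W by (metis mult_carrier_mat unit_diag_carrier(1))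
 qed
 then obtain t where t: "\<rho> <= t" "t < r" "W $$ (t,0) ~= 0" by blast
 define E where "E = mat 1 r (%(i,j). if j = t then inverse (W $$ (t,0)) else 0)"
 have E: "E \<in> Mat 1 r" by (simp add: E_def)
 have "E * unit_diag r c \<rho> = 0\<^sub>m 1 c"
  using t by (intro eq_matI) (auto simp: E_def unit_diag_def scalar_prod_def intro!: sum.neutral)
 then have "E * P * M = 0\<^sub>m 1 c" using M PQ(1,6,11) E by (simp add: mat_assoc[of E P M] flip: mat_assoc[of E "unit_diag r c \<rho>" Q'] del: assoc_mult_mat)
 moreover have "E * P * U = 1\<^sub>m 1"
 proof -
  have "E * P * U = E * W" using E PQ(1) U by (simp add: W_def mat_assoc del: assoc_mult_mat)
  also have "... = 1\<^sub>m 1" using t W by (intro eq_matI) (auto simp: E_def scalar_prod_def if_distrib[of "%x. x * _"] cong: if_cong)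
  finally show ?thesis .
 qed
 ultimately show ?thesis using that[of "E * P"] E PQ(1) by auto
qed

section \<open>Ranks of idempotent matrices\<close>

definition idem_rank :: "'a::field mat => nat => nat => bool" where
 "idem_rank e m \<rho> \<longleftrightarrow> e \<in> Mat m m & \<rho> <= m & (\<exists>h\<in>carrier (GL m). h * e = unit_diag m m \<rho> * h)"

lemma idem_rank_exists: "e \<in> Mat m m ==> e * e = e ==> \<exists>\<rho>. idem_rank e m \<rho>"
 using idempotent_normal_form[of e m] unfolding idem_rank_def by blast

lemma idem_rank_factorization:
 assumes "idem_rank e m \<rho>"
 obtains F G where "F \<in> Mat m \<rho>" "G \<in> Mat \<rho> m" "e = F * G" "G * F = 1\<^sub>m \<rho>"
proof -
 obtain h where h: "h \<in> carrier (GL m)" "h * e = unit_diag m m \<rho> * h" "\<rho> <= m" "e \<in> Mat m m"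
  using assms unfolding idem_rank_def by blast
 obtain h' where h': "h \<in> Mat m m" "h' \<in> Mat m m" "h * h' = 1\<^sub>m m" "h' * h = 1\<^sub>m m" by (rule GL_E[OF h(1)])
 let ?F = "h' * unit_diag m \<rho> \<rho>" and ?G = "unit_diag \<rho> m \<rho> * h"
 have "e = h' * h * e" using h h' by simp
 also have "... = h' * (h * e)" using h(4) h'(1,2) by (simp add: mat_assoc del: assoc_mult_mat)
 also have "... = h' * ((unit_diag m \<rho> \<rho> * unit_diag \<rho> m \<rho>) * h)" unfolding h(2) by (simp add: unit_diag_mult)
 also have "... = ?F * ?G" using h'(1,2) by (simp add: mat_assoc del: assoc_mult_mat)
 finally have 1: "e = ?F * ?G" .
 have "?G * ?F = unit_diag \<rho> m \<rho> * ((h * h') * unit_diag m \<rho> \<rho>)" using h'(1,2) by (simp add: mat_assoc del: assoc_mult_mat)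
 also have "... = 1\<^sub>m \<rho>" unfolding h'(3) using h(3) by (simp add: unit_diag_mult unit_diag_full)
 finally have 2: "?G * ?F = 1\<^sub>m \<rho>" .
 show ?thesis by (rule that[OF _ _ 1 2]) (use h'(1,2) in auto)
qed

text \<open>Determinants recover the rank of an idempotent in every characteristic; the trace would only
give it modulo the characteristic.\<close>

lemma idem_rank_det:
 assumes "idem_rank e m \<rho>"
 shows "det (1\<^sub>m m + (z - 1) \<cdot>\<^sub>m e) = z ^ \<rho>"
proof -
 obtain h where h: "h \<in> carrier (GL m)" "h * e = unit_diag m m \<rho> * h" "\<rho> <= m" "e \<in> Mat m m"
  using assms unfolding idem_rank_def by blast
 then have hc: "h \<in> Mat m m" "det h ~= 0" by (auto simp: GL_iff_det)
 let ?D = "1\<^sub>m m + (z - 1) \<cdot>\<^sub>m unit_diag m m \<rho>"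
 have "h * (1\<^sub>m m + (z - 1) \<cdot>\<^sub>m e) = h + (z - 1) \<cdot>\<^sub>m (h * e)"
  using hc h(4) by (subst mult_add_distrib_mat[of _ m m _ m]) (auto simp: mult_smult_distrib[of _ m m _ m])
 also have "... = ?D * h" unfolding h(2) using hc
  by (subst add_mult_distrib_mat[of _ m m _ _ m]) (auto simp: mult_smult_assoc_mat[of _ m m _ m])
 finally have "det h * det (1\<^sub>m m + (z - 1) \<cdot>\<^sub>m e) = det ?D * det h"
  using hc h(4) by (metis add_carrier_mat det_mult smult_carrier_mat unit_diag_carrier(1))
 then have "det (1\<^sub>m m + (z - 1) \<cdot>\<^sub>m e) = det ?D" using hc by (simp add: mult.commute)
 also have "... = (\<Prod>i\<leftarrow>diag_mat ?D. i)"
  by (subst det_upper_triangular[of _ m]) (auto simp: upper_triangular_def unit_diag_def)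
 also have "... = (\<Prod>i<m. if i < \<rho> then z else 1)"
  unfolding diag_mat_def prod.list_conv_set_nth
  by (intro prod.cong) (auto simp: unit_diag_def lessThan_atLeast0)
 also have "... = (\<Prod>i\<in>{..<m} \<inter> {i. i < \<rho>}. z)" by (simp add: prod.If_cases)
 also have "... = z ^ \<rho>"
 proof -
  have "{..<m} \<inter> {i. i < \<rho>} = {..<\<rho>}" using h(3) by auto
  then show ?thesis by simp
 qed
 finally show ?thesis .
qed

lemma idem_rank_mono:
 assumes "idem_rank e m \<rho>" "idem_rank e' m' \<rho>'" "f \<in> Mat m' m" "left_inv f" "e' * f = f * e"
 shows "\<rho> <= \<rho>'"
proof -
 obtain F G where F: "F \<in> Mat m \<rho>" "G \<in> Mat \<rho> m" "e = F * G" "G * F = 1\<^sub>m \<rho>"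
  by (rule idem_rank_factorization[OF assms(1)])
 obtain F' G' where F': "F' \<in> Mat m' \<rho>'" "G' \<in> Mat \<rho>' m'" "e' = F' * G'" "G' * F' = 1\<^sub>m \<rho>'"
  by (rule idem_rank_factorization[OF assms(2)])
 obtain B where B: "B \<in> Mat m m'" "B * f = 1\<^sub>m m" using left_invE[OF assms(4,3)] .
 have "(G * B * F') * (G' * f * F) = G * (B * ((F' * G') * f)) * F"
  using F(1,2) F'(1,2) B(1) assms(3) by (simp add: mat_assoc del: assoc_mult_mat)
 also have "... = G * ((B * f) * (F * G)) * F"
  unfolding F'(3)[symmetric] assms(5) unfolding F(3) using F(1,2) B(1) assms(3) by (simp add: mat_assoc del: assoc_mult_mat)
 also have "... = (G * F) * (G * F)" unfolding B(2) using F(1,2) by (simp add: mat_assoc del: assoc_mult_mat)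
 also have "... = 1\<^sub>m \<rho>" unfolding F(4) by simp
 finally have "left_inv (G' * f * F)"
  using F(1,2) F'(1,2) B(1) assms(3) by (intro left_invI[of _ \<rho>' \<rho> "G * B * F'"]) auto
 then show ?thesis using F'(2) assms(3) F(1) by (intro left_inv_dim[of "G' * f * F"]) auto
qed

lemma idem_rank_compl:
 assumes "idem_rank e m \<rho>" shows "idem_rank (1\<^sub>m m - e) m (m - \<rho>)"
proof -
 obtain h where h: "h \<in> carrier (GL m)" "h * e = unit_diag m m \<rho> * h" "\<rho> <= m" "e \<in> Mat m m"
  using assms unfolding idem_rank_def by blast
 have hc: "h \<in> Mat m m" using h by (simp add: GL_iff)
 \<comment> \<open>The complement of \<open>e\<close> is diagonalized by \<open>h\<close> followed by reversing the order of the basis.\<close>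
 define R where "R = mat m m (%(i,j). if i + j + 1 = m then 1 else 0 :: 'a)"
 have R: "R \<in> Mat m m" by (simp add: R_def)
 have RM: "(R * M) $$ (i,j) = M $$ (m - 1 - i, j)" if "M \<in> Mat m m" "i < m" "j < m" for M i j
 proof -
  have "(R * M) $$ (i,j) = (\<Sum>l<m. R $$ (i,l) * M $$ (l,j))"
   using that R by (intro mat_mult_entry) auto
  also have "... = (\<Sum>l<m. (if l = m - 1 - i then M $$ (l,j) else 0))"
   using that by (intro sum.cong) (auto simp: R_def)
  finally show ?thesis using that by (simp add: sum.delta)
 qed
 have MR: "(M * R) $$ (i,j) = M $$ (i, m - 1 - j)" if "M \<in> Mat m m" "i < m" "j < m" for M i j
 proof -
  have "(M * R) $$ (i,j) = (\<Sum>l<m. M $$ (i,l) * R $$ (l,j))"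
   using that R by (intro mat_mult_entry) auto
  also have "... = (\<Sum>l<m. (if l = m - 1 - j then M $$ (i,l) else 0))"
   using that by (intro sum.cong) (auto simp: R_def)
  finally show ?thesis using that by (simp add: sum.delta)
 qed
 have "R * R = 1\<^sub>m m"
 proof (rule eq_matI)
  fix i j assume "i < dim_row (1\<^sub>m m :: 'a mat)" "j < dim_col (1\<^sub>m m :: 'a mat)"
  then have ij: "i < m" "j < m" by auto
  then show "(R * R) $$ (i,j) = 1\<^sub>m m $$ (i,j)" unfolding RM[OF R ij] by (auto simp: R_def)
 qed (use R in auto)
 then have RG: "R \<in> carrier (GL m)" using GL_I[OF R R] by blast
 have RD: "R * (1\<^sub>m m - unit_diag m m \<rho>) = unit_diag m m (m - \<rho>) * R"
 proof (rule eq_matI)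
  fix i j assume "i < dim_row (unit_diag m m (m - \<rho>) * R)" "j < dim_col (unit_diag m m (m - \<rho>) * R)"
  then have ij: "i < m" "j < m" by (auto simp: R_def)
  show "(R * (1\<^sub>m m - unit_diag m m \<rho>)) $$ (i,j) = (unit_diag m m (m - \<rho>) * R) $$ (i,j)"
   unfolding RM[OF minus_carrier_mat[OF unit_diag_carrier(1)] ij] MR[OF unit_diag_carrier(1) ij]
   using ij h(3) by (auto simp: unit_diag_def)
 qed (use R in auto)
 have "(R * h) * (1\<^sub>m m - e) = R * (h - h * e)"
  using R hc h(4) by (simp add: mat_assoc mult_minus_distrib_mat[of h m m _ m] del: assoc_mult_mat)
 also have "... = R * ((1\<^sub>m m - unit_diag m m \<rho>) * h)"
  unfolding h(2) using hc by (simp add: minus_mult_distrib_mat[of _ m m])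
 also have "... = (R * (1\<^sub>m m - unit_diag m m \<rho>)) * h" using R hc by (simp add: mat_assoc del: assoc_mult_mat)
 also have "... = unit_diag m m (m - \<rho>) * (R * h)" unfolding RD using R hc by (simp add: mat_assoc del: assoc_mult_mat)
 finally show ?thesis unfolding idem_rank_def using h GL_mult_closed[OF RG h(1)] by (auto intro!: bexI[of _ "R * h"])
qed

lemma idem_rank_0: "idem_rank e m 0 ==> e = 0\<^sub>m m m"
 by (erule idem_rank_factorization) (auto simp: scalar_prod_def)

lemma idem_rank_full: "idem_rank e m m ==> e = 1\<^sub>m m"
proof (erule idem_rank_factorization)
 fix F G assume "F \<in> Mat m m" "G \<in> Mat m m" "e = F * G" "G * F = 1\<^sub>m m"
 then show ?thesis using mat_mult_left_right_inverse[of G m F] by simp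
qed

section \<open>Coordinates with respect to a basis of the algebraic closure\<close>

text \<open>The functionals of the algebraic closure over the base field. Applied entrywise, they carry linear equations over \<open>L\<close>
with coefficients in \<open>F\<close> down to \<open>F\<close>.\<close>

definition base_linear :: "('a::field alg_closure => 'a) => bool" where
 "base_linear t \<longleftrightarrow> (\<forall>x y. t (x + y) = t x + t y) & (\<forall>c x. t (to_ac c * x) = c * t x)"

lemma base_linear_add: "base_linear t ==> t (x + y) = t x + t y"
 and base_linear_scale: "base_linear t ==> t (to_ac c * x) = c * t x"
 by (auto simp: base_linear_def)

lemma base_linear_scale': "base_linear t ==> t (x * to_ac c) = t x * c"
 using base_linear_scale[of t c x] by (simp add: mult.commute)

lemma base_linear_0: "base_linear t ==> t 0 = 0"
 using base_linear_scale[of t 0 0] by simp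

lemma base_linear_sum: "base_linear t ==> t (\<Sum>i\<in>I. f i) = (\<Sum>i\<in>I. t (f i))"
 by (induction I rule: infinite_finite_induct) (auto simp: base_linear_0 base_linear_add)

text \<open>Finitely many elements involve only finitely many vectors of a Hamel basis.\<close>

theorem base_coordinates:
 fixes S :: "'a::field alg_closure set"
 assumes "finite S"
 obtains B :: "'a alg_closure set" and t where "finite B" "!!b. b \<in> B ==> base_linear (t b)"
  "!!x. x \<in> S ==> x = (\<Sum>b\<in>B. to_ac (t b x) * b)"
proof -
 interpret V: vector_space "%(c::'a) x. to_ac c * x"
  by unfold_locales (auto simp: algebra_simps)
 define A where "A = V.extend_basis {}"
 have A: "V.independent A" "V.span A = UNIV"
  unfolding A_def using V.independent_extend_basis[of "{}"] V.span_extend_basis[of "{}"] by (auto simp: V.dependent_def)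
 define t where "t b x = V.representation A x b" for b x
 define B where "B = (\<Union>x\<in>S. {b. t b x ~= 0})"
 have B: "finite B"
  unfolding B_def t_def using assms by (intro finite_UN_I V.finite_representation) auto
 have lin: "base_linear (t b)" for b
  unfolding base_linear_def t_def using A by (auto simp: V.representation_add V.representation_scale)
 have "x = (\<Sum>b\<in>B. to_ac (t b x) * b)" if "x \<in> S" for x
 proof -
  have "{b. V.representation A x b ~= 0} \<subseteq> B" using that by (auto simp: B_def t_def)
  moreover have "(\<Sum>b | V.representation A x b ~= 0. to_ac (V.representation A x b) * b) = x"
   using V.sum_nonzero_representation_eq[of A x] A by simp
  ultimately show ?thesis
   using B by (subst (asm) sum.mono_neutral_left[of B]) (auto simp: t_def)
 qed
 then show ?thesis using that B lin by blast
qed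

lemma base_linear_separates:
 fixes x :: "'a::field alg_closure"
 assumes "!!t. base_linear t ==> t x = 0" shows "x = 0"
proof -
 obtain B :: "'a alg_closure set" and t where "finite B" "!!b. b \<in> B ==> base_linear (t b)"
  "!!y. y \<in> {x} ==> y = (\<Sum>b\<in>B. to_ac (t b y) * b)"
  using base_coordinates[of "{x}"] by auto
 then have "x = (\<Sum>b\<in>B. to_ac (t b x) * b)" by blast
 also have "... = 0" using assms \<open>!!b. b \<in> B ==> base_linear (t b)\<close> by (intro sum.neutral) auto
 finally show ?thesis .
qed

lemma base_linear_mult_left:
 assumes "base_linear t" "A \<in> Mat r s" "B \<in> Mat s c"
 shows "map_mat t (ac_mat A * B) = A * map_mat t B"
proof (rule eq_matI)
 fix i j assume "i < dim_row (A * map_mat t B)" "j < dim_col (A * map_mat t B)"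
 then have ij: "i < r" "j < c" using assms by auto
 have "map_mat t (ac_mat A * B) $$ (i,j) = t (\<Sum>l<s. ac_mat A $$ (i,l) * B $$ (l,j))"
  using ij assms by (subst index_map_mat) (auto simp: mat_mult_entry[of _ r s _ c] simp del: index_mult_mat(1))
 also have "... = (\<Sum>l<s. A $$ (i,l) * t (B $$ (l,j)))"
  using ij assms by (auto simp: base_linear_sum base_linear_scale intro!: sum.cong)
 also have "... = (A * map_mat t B) $$ (i,j)"
  using ij assms by (subst mat_mult_entry[of _ r s _ c]) (auto intro!: sum.cong)
 finally show "map_mat t (ac_mat A * B) $$ (i,j) = (A * map_mat t B) $$ (i,j)" .
qed (use assms in auto)

lemma base_linear_mult_right:
 assumes "base_linear t" "A \<in> Mat s c" "B \<in> Mat r s"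
 shows "map_mat t (B * ac_mat A) = map_mat t B * A"
proof (rule eq_matI)
 fix i j assume "i < dim_row (map_mat t B * A)" "j < dim_col (map_mat t B * A)"
 then have ij: "i < r" "j < c" using assms by auto
 have "map_mat t (B * ac_mat A) $$ (i,j) = t (\<Sum>l<s. B $$ (i,l) * ac_mat A $$ (l,j))"
  using ij assms by (subst index_map_mat) (auto simp: mat_mult_entry[of _ r s _ c] simp del: index_mult_mat(1))
 also have "... = (\<Sum>l<s. t (B $$ (i,l)) * A $$ (l,j))"
  using ij assms by (auto simp: base_linear_sum base_linear_scale' intro!: sum.cong)
 also have "... = (map_mat t B * A) $$ (i,j)"
  using ij assms by (subst mat_mult_entry[of _ r s _ c]) (auto intro!: sum.cong)
 finally show "map_mat t (B * ac_mat A) $$ (i,j) = (map_mat t B * A) $$ (i,j)" .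
qed (use assms in auto)

section \<open>The Zariski topology and univariate restrictions\<close>

lemma alg_closed_infinite: "infinite (UNIV :: 'b::alg_closed_field set)"
proof
 assume fin: "finite (UNIV :: 'b set)"
 define p :: "'b poly" where "p = (\<Prod>a\<in>UNIV. [:- a, 1:]) + 1"
 have "degree (\<Prod>a\<in>(UNIV::'b set). [:- a, 1:]) = card (UNIV :: 'b set)"
  by (subst degree_prod_eq_sum_degree) auto
 moreover have "card (UNIV :: 'b set) > 0" using fin by (simp add: card_gt_0_iff)
 ultimately have "degree p > 0" unfolding p_def by (subst degree_add_eq_left) auto
 then obtain z where "poly p z = 0" using alg_closed_imp_poly_has_root by blast
 moreover have "poly p z = 1" unfolding p_def using fin by (simp add: poly_prod prod_zero_iff)
 ultimately show False by simp
qed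

lemma nonzero_poly_has_nonroot: "p ~= 0 ==> \<exists>z. poly p z ~= 0" for p :: "'b::alg_closed_field poly"
proof (rule ccontr)
 assume "p ~= 0" "\<nexists>z. poly p z ~= 0"
 then have "finite {z. poly p z = 0}" "{z. poly p z = 0} = UNIV" using poly_roots_finite[of p] by auto
 then show False using alg_closed_infinite[where 'b = 'b] by simp
qed

lemma mat_polyfuns_sum:
 "(!!i. i \<in> I ==> f i \<in> mat_polyfuns n) ==> (%A. \<Sum>i\<in>I. f i A) \<in> mat_polyfuns n"
 by (induction I rule: infinite_finite_induct) (auto intro: mat_polyfuns.intros)

lemma mat_polyfuns_prod:
 "(!!i. i \<in> I ==> f i \<in> mat_polyfuns n) ==> (%A. \<Prod>i\<in>I. f i A) \<in> mat_polyfuns n"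
 by (induction I rule: infinite_finite_induct) (auto intro: mat_polyfuns.intros)

lemma mat_polyfuns_power: "f \<in> mat_polyfuns n ==> (%A. f A ^ k) \<in> mat_polyfuns n"
 by (induction k) (auto intro: mat_polyfuns.intros)

lemma mat_polyfuns_det:
 obtains D :: "'b::field mat => 'b" where "D \<in> mat_polyfuns n" "!!A. A \<in> Mat n n ==> D A = det A"
proof
 let ?D = "%A :: 'b mat. \<Sum>p\<in>{p. p permutes {0..<n}}. signof p * (\<Prod>i\<in>{0..<n}. A $$ (i, p i))"
 show "?D \<in> mat_polyfuns n"
  by (intro mat_polyfuns_sum mat_polyfuns.mult mat_polyfuns.const mat_polyfuns_prod mat_polyfuns.coord)
   (auto simp: permutes_in_image dest: permutes_in_image)
 show "?D A = det A" if "A \<in> Mat n n" for A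
  using det_def'[OF that] by simp
qed

definition mat_line :: "'b::field mat => 'b mat => 'b => 'b mat" where
 "mat_line A B z = A + z \<cdot>\<^sub>m (B - A)"

lemma mat_line_carrier: "A \<in> Mat n n ==> B \<in> Mat n n ==> mat_line A B z \<in> Mat n n"
 by (auto simp: mat_line_def)

lemma mat_polyfuns_line:
 assumes "p \<in> mat_polyfuns n" "A \<in> Mat n n" "B \<in> Mat n n"
 shows "\<exists>P. \<forall>z. p (mat_line A B z) = poly P z"
 using assms(1)
proof induction
 case (const c)
 show ?case by (rule exI[of _ "[:c:]"]) auto
next
 case (coord i j)
 show ?case using assms(2,3) coord
  by (intro exI[of _ "[:A $$ (i,j), B $$ (i,j) - A $$ (i,j):]"]) (auto simp: mat_line_def)
next
 case (add p r)
 then show ?case by (metis poly_add)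
next
 case (mult p r)
 then show ?case by (metis poly_mult)
qed

lemma zariski_open_basis:
 assumes "openin (zariski n) U" "A \<in> U"
 shows "\<exists>p\<in>mat_polyfuns n. p A ~= 0 & {B \<in> Mat n n. p B ~= 0} \<subseteq> U"
proof -
 have "generate_topology_on ((%p. {A \<in> Mat n n. p A ~= 0}) ` mat_polyfuns n) U"
  using assms(1) unfolding zariski_def openin_topology_generated_by_iff .
 then show ?thesis using assms(2)
 proof induction
  case (Int a b)
  then obtain p r where "p \<in> mat_polyfuns n" "p A ~= 0" "{B \<in> Mat n n. p B ~= 0} \<subseteq> a"
   "r \<in> mat_polyfuns n" "r A ~= 0" "{B \<in> Mat n n. r B ~= 0} \<subseteq> b" by auto
  then show ?case by (intro bexI[of _ "%A. p A * r A"]) (auto intro: mat_polyfuns.mult)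
 next
  case (UN K)
  then show ?case by (meson Sup_upper UnionE subset_trans)
 qed auto
qed

lemma topspace_zariski: "topspace (zariski n) = Mat n n"
proof -
 have "(%_. 1) \<in> mat_polyfuns n" by (rule mat_polyfuns.const)
 then have "Mat n n \<subseteq> (\<Union>p\<in>mat_polyfuns n. {A \<in> Mat n n. p A ~= 0})"
  by (intro subsetI UN_I[of "%_. 1"]) auto
 then show ?thesis unfolding zariski_def topology_generated_by_topspace by auto
qed

lemma zariski_closed_separate:
 assumes S: "S \<subseteq> Mat n n" and Z: "closedin (subtopology (zariski n) S) Z" and A: "A \<in> S" "A \<notin> Z"
 obtains p where "p \<in> mat_polyfuns n" "p A ~= 0" "!!B. B \<in> Z ==> p B = 0"
proof -
 have tS: "topspace (subtopology (zariski n) S) = S" using S by (auto simp: topspace_zariski)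
 have "openin (subtopology (zariski n) S) (S - Z)" "Z \<subseteq> S" using Z unfolding closedin_def tS by auto
 then obtain U where U: "openin (zariski n) U" "S - Z = U \<inter> S" by (auto simp: openin_subtopology)
 then obtain p where p: "p \<in> mat_polyfuns n" "p A ~= 0" "{B \<in> Mat n n. p B ~= 0} \<subseteq> U"
  using zariski_open_basis[OF U(1), of A] A by blast
 have "p B = 0" if "B \<in> Z" for B
 proof (rule ccontr)
  assume "p B ~= 0"
  then have "B \<in> U \<inter> S" using p(3) that \<open>Z \<subseteq> S\<close> S by auto
  then show False using U(2) that by auto
 qed
 then show ?thesis using that[of p] p by simp
qed

lemma zariski_zero_set_closed:
 assumes "S \<subseteq> Mat n n" "p \<in> mat_polyfuns n"
 shows "closedin (subtopology (zariski n) S) {A \<in> S. p A = 0}"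
proof -
 have "openin (zariski n) {A \<in> Mat n n. p A ~= 0}"
  unfolding zariski_def by (rule topology_generated_by_Basis) (use assms in auto)
 moreover have "S - {A \<in> S. p A = 0} = {A \<in> Mat n n. p A ~= 0} \<inter> S" using assms by auto
 ultimately show ?thesis unfolding closedin_def using assms(1)
  by (auto simp: topspace_zariski openin_subtopology)
qed

lemma irreducible_product_zero:
 assumes S: "S \<subseteq> Mat n n" and Z: "irreducible_in (subtopology (zariski n) S) Z"
  and "p \<in> mat_polyfuns n" "r \<in> mat_polyfuns n" "!!A. A \<in> Z ==> p A * r A = 0"
 shows "(\<forall>A\<in>Z. p A = 0) \<or> (\<forall>A\<in>Z. r A = 0)"
proof -
 have "Z \<subseteq> S" using Z S unfolding irreducible_in_def by (auto simp: topspace_zariski)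
 then have "Z \<subseteq> {A \<in> S. p A = 0} \<union> {A \<in> S. r A = 0}" using assms(5) by auto
 then have "Z \<subseteq> {A \<in> S. p A = 0} \<or> Z \<subseteq> {A \<in> S. r A = 0}"
  using Z zariski_zero_set_closed[OF S assms(3)] zariski_zero_set_closed[OF S assms(4)]
  unfolding irreducible_in_def by blast
 then show ?thesis by blast
qed

text \<open>If closed sets \<open>C\<close>, \<open>D\<close> cover \<open>Z\<close> and neither contains it, polynomials vanishing on \<open>C\<close> and on \<open>D\<close> restrict to
nonzero polynomials on a line joining two points of \<open>Z\<close>; a point of the line where neither they nor
the determinant vanish is in \<open>Z\<close> but in neither of the sets.\<close>

lemma irreducible_if_line_closed:
 fixes Z :: "'b::{alg_closed_field} mat set"
 assumes S: "S \<subseteq> carrier (GL n)" and "Z \<subseteq> S" "Z ~= {}"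
  and lines: "!!A B z. A \<in> Z ==> B \<in> Z ==> mat_line A B z \<in> carrier (GL n) ==> mat_line A B z \<in> Z"
 shows "irreducible_in (subtopology (zariski n) S) Z"
proof -
 have Sc: "S \<subseteq> Mat n n" using S by (auto simp: GL_iff)
 have "Z \<subseteq> C \<or> Z \<subseteq> D" if CD: "closedin (subtopology (zariski n) S) C" "closedin (subtopology (zariski n) S) D" "Z \<subseteq> C \<union> D" for C D
 proof (rule ccontr)
  assume "\<not> ?thesis"
  then obtain A B where AB: "A \<in> Z" "A \<notin> C" "B \<in> Z" "B \<notin> D" by blast
  then have ABc: "A \<in> Mat n n" "B \<in> Mat n n" using assms(2) Sc by auto
  obtain p where p: "p \<in> mat_polyfuns n" "p A ~= 0" "!!B. B \<in> C ==> p B = 0"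
   using zariski_closed_separate[OF Sc CD(1), of A] AB assms(2) by blast
  obtain r where r: "r \<in> mat_polyfuns n" "r B ~= 0" "!!B. B \<in> D ==> r B = 0"
   using zariski_closed_separate[OF Sc CD(2), of B] AB assms(2) by blast
  obtain \<Delta> :: "'b mat => 'b" where \<Delta>: "\<Delta> \<in> mat_polyfuns n" "!!A. A \<in> Mat n n ==> \<Delta> A = det A"
   using mat_polyfuns_det by blast
  obtain P R Q where PRQ: "\<forall>z. p (mat_line A B z) = poly P z" "\<forall>z. r (mat_line A B z) = poly R z"
   "\<forall>z. \<Delta> (mat_line A B z) = poly Q z"
   using mat_polyfuns_line[OF _ ABc] p(1) r(1) \<Delta>(1) by metis
  have e0: "mat_line A B 0 = A" and e1: "mat_line A B 1 = B"
   using ABc by (auto simp: mat_line_def)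
  have "poly P 0 ~= 0" using PRQ(1) p(2) e0 by metis
  moreover have "poly R 1 ~= 0" using PRQ(2) r(2) e1 by metis
  moreover have "poly Q 0 ~= 0"
  proof -
   have "A \<in> carrier (GL n)" using AB(1) assms(2) S by auto
   then have "\<Delta> A ~= 0" using \<Delta>(2)[OF ABc(1)] by (simp add: GL_iff_det)
   then show ?thesis using PRQ(3)[rule_format, of 0] e0 by simp
  qed
  ultimately have nz: "P * R * Q ~= 0" by auto
  then obtain z where z: "poly (P * R * Q) z ~= 0" using nonzero_poly_has_nonroot by blast
  have "mat_line A B z \<in> carrier (GL n)"
   using z PRQ(3) \<Delta>(2)[OF mat_line_carrier[OF ABc]] mat_line_carrier[OF ABc] by (auto simp: GL_iff_det)
  then have "mat_line A B z \<in> C \<union> D" using lines AB CD(3) by blast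
  moreover have "p (mat_line A B z) ~= 0" "r (mat_line A B z) ~= 0" using z PRQ by auto
  ultimately show False using p(3) r(3) by blast
 qed
 then show ?thesis unfolding irreducible_in_def using assms(2,3) Sc by (auto simp: topspace_zariski)
qed

section \<open>Strict chains of irreducible closed sets\<close>

definition expos :: "nat => nat => (nat => nat) set" where
 "expos m N = ({..<m} \<rightarrow>\<^sub>E {..N})"

lemma finite_expos: "finite (expos m N)" and card_expos: "card (expos m N) = Suc N ^ m"
 unfolding expos_def by (auto simp: finite_PiE card_PiE)

lemma sum_expos_Suc:
 fixes h :: "(nat => nat) => 'b::comm_monoid_add"
 shows "(\<Sum>a\<in>expos (Suc m) N. h a) = (\<Sum>j\<le>N. \<Sum>a\<in>expos m N. h (a(m := j)))"
proof -
 have "expos (Suc m) N = (%(j, a). a(m := j)) ` ({..N} \<times> expos m N)"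
  unfolding expos_def lessThan_Suc PiE_insert_eq by auto
 moreover have "inj_on (%(j, a). a(m := j)) ({..N} \<times> expos m N)"
  unfolding expos_def by (rule inj_combinator) simp
 ultimately have "sum h (expos (Suc m) N) = (\<Sum>(j,a)\<in>{..N} \<times> expos m N. h (a(m := j)))"
  by (simp add: sum.reindex case_prod_unfold)
 then show ?thesis by (simp add: sum.cartesian_product)
qed

text \<open>Sort a relation on \<open>Z m\<close> by powers of the last function. As \<open>Z m\<close> is irreducible, the lowest power that
occurs can be cancelled. On \<open>Z (m - 1)\<close>, where the last function vanishes, the coefficient of this power
remains: a relation for a shorter chain.\<close>

lemma chain_monomials_independent:
 fixes Z :: "nat => 'b::field mat set"
 assumes S: "S \<subseteq> Mat n n"
  and irr: "!!i. i <= m ==> irreducible_in (subtopology (zariski n) S) (Z i)"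
  and sub: "!!i. i < m ==> Z i \<subseteq> Z (Suc i)"
  and f: "!!i. i < m ==> f i \<in> mat_polyfuns n"
  and f0: "!!i A. i < m ==> A \<in> Z i ==> f i A = 0"
  and f1: "!!i. i < m ==> \<exists>A\<in>Z (Suc i). f i A ~= 0"
  and rel: "!!A. A \<in> Z m ==> (\<Sum>a\<in>expos m N. c a * (\<Prod>i<m. f i A ^ a i)) = 0"
 shows "\<forall>a\<in>expos m N. c a = 0"
 using assms(2-)
proof (induction m arbitrary: c)
 case 0
 have "Z 0 ~= {}" using 0(1)[of 0] by (simp add: irreducible_in_def)
 moreover have "expos 0 N = {%_. undefined}" by (simp add: expos_def)
 ultimately show ?case using 0(6) by auto
next
 case (Suc m)
 define G where "G j A = (\<Sum>a\<in>expos m N. c (a(m := j)) * (\<Prod>i<m. f i A ^ a i))" for j A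
 have G_poly: "G j \<in> mat_polyfuns n" for j
  unfolding G_def using Suc.prems(3)
  by (intro mat_polyfuns_sum mat_polyfuns.mult mat_polyfuns.const mat_polyfuns_prod mat_polyfuns_power) auto
 have rel: "(\<Sum>j\<le>N. G j A * f m A ^ j) = 0" if "A \<in> Z (Suc m)" for A
 proof -
  have "(\<Sum>j\<le>N. G j A * f m A ^ j) = (\<Sum>a\<in>expos (Suc m) N. c a * (\<Prod>i<Suc m. f i A ^ a i))"
   unfolding sum_expos_Suc G_def sum_distrib_right
   by (intro sum.cong refl) (auto simp: mult_ac intro!: prod.cong)
  then show ?thesis using Suc.prems(6)[OF that] by simp
 qed
 have irr: "irreducible_in (subtopology (zariski n) S) (Z (Suc m))" using Suc.prems(1) by simp
 have "\<forall>a\<in>expos m N. c (a(m := j)) = 0" if "j <= N" for j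
  using that
 proof (induction j rule: less_induct)
  case (less j)
  have Gz: "G j' A = 0" if "j' < j" for j' A
  proof -
   have "\<forall>a\<in>expos m N. c (a(m := j')) = 0" by (rule less.IH) (use that less.prems in auto)
   then show ?thesis unfolding G_def by (intro sum.neutral) auto
  qed
  define R where "R A = (\<Sum>j'\<in>{j..N}. G j' A * f m A ^ (j' - j))" for A
  have R_poly: "R \<in> mat_polyfuns n"
   unfolding R_def using Suc.prems(3)[of m] G_poly
   by (intro mat_polyfuns_sum mat_polyfuns.mult mat_polyfuns_power) auto
  have "f m A ^ j * R A = 0" if "A \<in> Z (Suc m)" for A
  proof -
   have "(\<Sum>j'\<le>N. G j' A * f m A ^ j') = (\<Sum>j'\<in>{j..N}. G j' A * f m A ^ j')"
    using Gz by (intro sum.mono_neutral_right) (auto simp: not_le)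
   also have "... = f m A ^ j * R A"
    unfolding R_def sum_distrib_left by (intro sum.cong refl) (simp add: mult_ac flip: power_add)
   finally show ?thesis using rel[OF that] by simp
  qed
  moreover have "\<not> (\<forall>A\<in>Z (Suc m). f m A ^ j = 0)" using Suc.prems(5)[of m] by auto
  ultimately have "\<forall>A\<in>Z (Suc m). R A = 0"
   using irreducible_product_zero[OF S irr mat_polyfuns_power[OF Suc.prems(3)[of m], of j] R_poly] by auto
  moreover have "R A = G j A" if "A \<in> Z m" for A
  proof -
   have "R A = (\<Sum>j'\<in>{j}. G j' A * f m A ^ (j' - j))"
    unfolding R_def using less.prems Suc.prems(4)[of m A] that by (intro sum.mono_neutral_right) auto
   then show ?thesis by simp
  qed
  ultimately have G0: "G j A = 0" if "A \<in> Z m" for A using that Suc.prems(2)[of m] by (metis lessI subsetD)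
  show ?case
   by (rule Suc.IH[of "%a. c (a(m := j))"]) (use Suc.prems G0 in \<open>auto simp: G_def\<close>)
 qed
 then show ?case
  unfolding expos_def lessThan_Suc PiE_insert_eq by auto
qed

section \<open>Algebraic dependence of polynomial functions\<close>

inductive_set poly_span :: "nat => nat => ((nat => 'b::field) => 'b) set" for d E where
 zero: "(%_. 0) \<in> poly_span d E"
| step: "g \<in> poly_span d E ==> b \<in> expos d E ==> (%y. c * (\<Prod>s<d. y s ^ b s) + g y) \<in> poly_span d E"

lemma poly_span_add: "g \<in> poly_span d E ==> h \<in> poly_span d E ==> (%y. g y + h y) \<in> poly_span d E"
proof (induction rule: poly_span.induct)
 case (step g b c)
 then show ?case using poly_span.step[of "%y. g y + h y" d E b c] by (simp add: add.assoc)
qed simp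

lemma poly_span_mono: "g \<in> poly_span d E ==> E <= E' ==> g \<in> poly_span d E'"
proof (induction rule: poly_span.induct)
 case (step g b c)
 have "b \<in> expos d E'" using step.hyps(2) step.prems by (auto simp: expos_def PiE_iff intro: order_trans)
 then show ?case using step poly_span.step by blast
qed (rule poly_span.zero)

lemma poly_span_monom_mult:
 assumes "b \<in> expos d E" "h \<in> poly_span d E'"
 shows "(%y :: nat => 'b::field. c * (\<Prod>s<d. y s ^ b s) * h y) \<in> poly_span d (E + E')"
 using assms(2)
proof induction
 case (step g b' c')
 let ?b = "\<lambda>s\<in>{..<d}. b s + b' s"
 have "?b \<in> expos d (E + E')" using assms(1) step(2) by (auto simp: expos_def PiE_iff add_mono)
 moreover have "(\<Prod>s<d. y s ^ ?b s) = (\<Prod>s<d. y s ^ b s) * (\<Prod>s<d. y s ^ b' s)" for y :: "nat => 'b"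
  unfolding prod.distrib[symmetric] by (intro prod.cong) (auto simp: power_add)
 ultimately show ?case
  using poly_span.step[OF step(3), of ?b "c * c'"] by (simp add: algebra_simps)
qed (simp add: poly_span.zero)

lemma poly_span_mult: "g \<in> poly_span d E ==> h \<in> poly_span d E' ==> (%y. g y * h y) \<in> poly_span d (E + E')"
proof (induction rule: poly_span.induct)
 case (step g b c)
 then show ?case using poly_span_add[OF poly_span_monom_mult[of b d E h E' c]] by (simp add: algebra_simps)
qed (simp add: poly_span.zero)

lemma poly_span_const: "(%_. c) \<in> poly_span d E" for c :: "'a::field"
proof -
 have "(\<lambda>s\<in>{..<d}. 0) \<in> expos d E" by (auto simp: expos_def)
 moreover have "(\<Prod>s<d. y s ^ (\<lambda>s\<in>{..<d}. 0) s) = 1" for y :: "nat => 'a"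
  by (intro prod.neutral) auto
 ultimately show ?thesis using poly_span.step[OF poly_span.zero, of "\<lambda>s\<in>{..<d}. 0" d E c] by simp
qed

lemma poly_span_linear: "(%y. \<Sum>s<d. c s * y s) \<in> poly_span d 1" for c :: "nat => 'b::field"
proof -
 have "(%y. \<Sum>s\<in>I. c s * y s) \<in> poly_span d 1" if "finite I" "I \<subseteq> {..<d}" for I
  using that
 proof induction
  case (insert s I)
  have b: "(\<lambda>s'\<in>{..<d}. if s' = s then 1 else 0) \<in> expos d 1" by (auto simp: expos_def)
  have "(\<Prod>s'<d. y s' ^ (\<lambda>s'\<in>{..<d}. if s' = s then 1 else 0) s') = y s" for y :: "nat => 'b"
  proof -
   have "(\<Prod>s'<d. y s' ^ (\<lambda>s'\<in>{..<d}. if s' = s then 1 else 0) s') = (\<Prod>s'<d. if s' = s then y s' else 1)"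
    by (intro prod.cong) auto
   then show ?thesis using insert by simp
  qed
  with poly_span.step[OF insert(3) b, of "c s"] insert show ?case by simp
 qed (simp add: poly_span.zero)
 then show ?thesis by auto
qed

lemma poly_span_power: "g \<in> poly_span d E ==> (%y. g y ^ k) \<in> poly_span d (k * E)"
proof (induction k)
 case 0
 show ?case using poly_span_const[of 1] by simp
next
 case (Suc k)
 then show ?case using poly_span_mult[OF Suc.prems Suc.IH] by simp
qed

lemma poly_span_coeffs:
 "g \<in> poly_span d E ==> \<exists>k. \<forall>y. g y = (\<Sum>b\<in>expos d E. k b * (\<Prod>s<d. y s ^ b s))"
proof (induction rule: poly_span.induct)
 case zero
 show ?case by (rule exI[of _ "%_. 0"]) simp
next
 case (step g b c)
 then obtain k where k: "\<forall>y. g y = (\<Sum>b\<in>expos d E. k b * (\<Prod>s<d. y s ^ b s))" by blast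
 have "c * (\<Prod>s<d. y s ^ b s) + g y = (\<Sum>b'\<in>expos d E. (if b' = b then c + k b' else k b') * (\<Prod>s<d. y s ^ b' s))" for y
 proof -
  have "(\<Sum>b'\<in>expos d E. (if b' = b then c + k b' else k b') * (\<Prod>s<d. y s ^ b' s)) =
   (\<Sum>b'\<in>expos d E. (if b' = b then c * (\<Prod>s<d. y s ^ b' s) else 0) + k b' * (\<Prod>s<d. y s ^ b' s))"
   by (intro sum.cong) (auto simp: algebra_simps)
  also have "... = c * (\<Prod>s<d. y s ^ b s) + g y"
   unfolding sum.distrib k[rule_format] using step(2) finite_expos[of d E] by simp
  finally show ?thesis by simp
 qed
 then show ?case by (intro exI[of _ "%b'. if b' = b then c + k b' else k b'"]) simp
qed

lemma wide_matrix_kernel: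
 fixes K :: "'a::field mat"
 assumes "K \<in> Mat r c" "r < c"
 obtains u where "\<exists>j<c. u j ~= 0" "!!i. i < r ==> (\<Sum>j<c. K $$ (i,j) * u j) = 0"
 using assms(1)
proof (cases rule: left_inv_cases)
 case inj
 then show ?thesis using assms(2) by simp
next
 case (kernel U)
 have "(\<Sum>j<c. K $$ (i,j) * U $$ (j,0)) = 0" if "i < r" for i
  using mat_mult_entry[OF assms(1) kernel(2) that, of 0] kernel(4) that by simp
 moreover have "\<exists>j<c. U $$ (j,0) ~= 0"
  using kernel(2,3) by (metis carrier_matD eq_matI index_zero_mat less_one)
 ultimately show ?thesis using that[of "%j. U $$ (j,0)"] by blast
qed

text \<open>There are \<open>(N + 1)^m\<close> monomials of degree at most \<open>N\<close> in each of \<open>m\<close> functions, and they lie in a space of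
dimension \<open>(mNE + 1)^d\<close>, which is smaller for large \<open>N\<close> when \<open>d < m\<close>.\<close>

theorem algebraic_dependence:
 fixes g :: "nat => (nat => 'b::field) => 'b"
 assumes g: "!!i. i < m ==> g i \<in> poly_span d E" and "d < m"
 shows "\<exists>N c. (\<exists>a\<in>expos m N. c a ~= 0) & (\<forall>y. (\<Sum>a\<in>expos m N. c a * (\<Prod>i<m. g i y ^ a i)) = 0)"
proof -
 define C where "C = m * E + 1"
 \<comment> \<open>For this \<open>N\<close> the monomials outnumber the dimension.\<close>
 define N where "N = C ^ d"
 define M where "M = m * (N * E)"
 have "Suc M <= C * Suc N" by (simp add: M_def C_def algebra_simps)
 then have "Suc M ^ d <= C ^ d * Suc N ^ d" by (metis power_mono power_mult_distrib zero_le)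
 also have "... < Suc N * Suc N ^ d" by (simp add: N_def)
 also have "... <= Suc N ^ m" using assms(2) by (metis Suc_leI power_Suc power_increasing le_add1 plus_1_eq_Suc)
 finally have lt: "card (expos d M) < card (expos m N)" unfolding card_expos .
 have mono: "(%y. \<Prod>i<m. g i y ^ a i) \<in> poly_span d M" if "a \<in> expos m N" for a
 proof -
  note a_in = that
  have "(%y. \<Prod>i<k. g i y ^ a i) \<in> poly_span d (k * (N * E))" if k: "k <= m" for k
   using k
  proof (induction k)
   case 0
   show ?case using poly_span_const[of 1] by simp
  next
   case (Suc k)
   have "a k <= N" using PiE_mem[OF a_in[unfolded expos_def], of k] Suc.prems by simp
   have "(%y. g k y ^ a k) \<in> poly_span d (a k * E)"
    using Suc.prems by (intro poly_span_power g) simp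
   then have "(%y. g k y ^ a k) \<in> poly_span d (N * E)"
    by (rule poly_span_mono) (simp add: \<open>a k <= N\<close>)
   then have "(%y. g k y ^ a k * (\<Prod>i<k. g i y ^ a i)) \<in> poly_span d (N * E + k * (N * E))"
    by (rule poly_span_mult) (use Suc.prems in \<open>auto intro: Suc.IH\<close>)
   then show ?case by (simp add: mult.commute)
  qed
  then show ?thesis unfolding M_def by blast
 qed
 have "\<forall>a\<in>expos m N. \<exists>k. \<forall>y. (\<Prod>i<m. g i y ^ a i) = (\<Sum>b\<in>expos d M. k b * (\<Prod>s<d. y s ^ b s))"
  by (intro ballI poly_span_coeffs mono)
 then obtain k where k: "!!a y. a \<in> expos m N ==> (\<Prod>i<m. g i y ^ a i) = (\<Sum>b\<in>expos d M. k a b * (\<Prod>s<d. y s ^ b s))"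
  by (auto dest!: bchoice)
 obtain ea where ea: "bij_betw ea {..<card (expos m N)} (expos m N)"
  using ex_bij_betw_nat_finite[OF finite_expos] by (metis lessThan_atLeast0)
 obtain eb where eb: "bij_betw eb {..<card (expos d M)} (expos d M)"
  using ex_bij_betw_nat_finite[OF finite_expos] by (metis lessThan_atLeast0)
 let ?K = "mat (card (expos d M)) (card (expos m N)) (%(i,j). k (ea j) (eb i))"
 obtain u where u: "\<exists>j<card (expos m N). u j ~= 0" "!!i. i < card (expos d M) ==> (\<Sum>j<card (expos m N). ?K $$ (i,j) * u j) = 0"
  using wide_matrix_kernel[OF mat_carrier lt, of "%(i,j). k (ea j) (eb i)"] by blast
 define c where "c a = u (the_inv_into {..<card (expos m N)} ea a)" for a
 have cu: "c (ea j) = u j" if "j < card (expos m N)" for j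
  using ea that unfolding c_def by (simp add: bij_betw_def the_inv_into_f_f)
 have rel: "(\<Sum>a\<in>expos m N. c a * k a b) = 0" if "b \<in> expos d M" for b
 proof -
  obtain i where i: "i < card (expos d M)" "b = eb i" using eb \<open>b \<in> expos d M\<close> by (auto simp: bij_betw_def)
  have "(\<Sum>a\<in>expos m N. c a * k a b) = (\<Sum>j<card (expos m N). c (ea j) * k (ea j) b)"
   using sum.reindex_bij_betw[OF ea, of "%a. c a * k a b"] by simp
  also have "... = (\<Sum>j<card (expos m N). ?K $$ (i,j) * u j)" using i by (intro sum.cong) (auto simp: cu)
  finally show ?thesis using u(2)[OF i(1)] by simp
 qed
 have "(\<Sum>a\<in>expos m N. c a * (\<Prod>i<m. g i y ^ a i)) = 0" for y
 proof -
  have "(\<Sum>a\<in>expos m N. c a * (\<Prod>i<m. g i y ^ a i)) = (\<Sum>a\<in>expos m N. \<Sum>b\<in>expos d M. c a * k a b * (\<Prod>s<d. y s ^ b s))"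
   by (intro sum.cong refl) (simp add: k sum_distrib_left mult.assoc)
  also have "... = (\<Sum>b\<in>expos d M. (\<Sum>a\<in>expos m N. c a * k a b) * (\<Prod>s<d. y s ^ b s))"
   unfolding sum_distrib_right by (rule sum.swap)
  finally show ?thesis by (simp add: rel)
 qed
 moreover have "\<exists>a\<in>expos m N. c a ~= 0"
 proof -
  obtain j where "j < card (expos m N)" "u j ~= 0" using u(1) by blast
  then show ?thesis using cu[of j] ea by (intro bexI[of _ "ea j"]) (auto simp: bij_betw_def)
 qed
 ultimately show ?thesis by (intro exI[of _ N] exI[of _ c]) simp
qed

section \<open>The dimension of a centralizer\<close>

text \<open>A maximal set of coordinates on which the subspace takes arbitrary values already determines its elements.\<close>

lemma coordinate_subset:
 fixes S :: "('i => 'a::field) set"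
 assumes "finite I" and add: "!!f g. f \<in> S ==> g \<in> S ==> (%i. f i + g i) \<in> S"
  and scale: "!!c f. f \<in> S ==> (%i. c * f i) \<in> S" and zero: "(%_. 0) \<in> S"
 shows "\<exists>J\<subseteq>I. (\<forall>y. \<exists>f\<in>S. \<forall>i\<in>J. f i = y i) & (\<forall>f\<in>S. (\<forall>i\<in>J. f i = 0) --> (\<forall>i\<in>I. f i = 0))"
proof -
 define P where "P J \<longleftrightarrow> J \<subseteq> I & (\<forall>y. \<exists>f\<in>S. \<forall>i\<in>J. f i = y i)" for J
 have "P {}" using zero by (auto simp: P_def)
 moreover have "card J <= card I" if "P J" for J using that assms(1) by (auto simp: P_def intro: card_mono)
 ultimately obtain J where J: "P J" "!!J'. P J' ==> card J' <= card J"
  using ex_has_greatest_nat[of P "{}" card "Suc (card I)"] by (auto simp: less_Suc_eq_le)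
 have "\<forall>i\<in>I. f i = 0" if f: "f \<in> S" "!!i. i \<in> J ==> f i = 0" for f
 proof (rule ccontr)
  assume "\<not> ?thesis"
  then obtain i where i: "i \<in> I" "f i ~= 0" by blast
  then have "i \<notin> J" using f by auto
  have ex: "\<exists>h\<in>S. \<forall>l\<in>insert i J. h l = y l" for y
  proof -
   obtain g where g: "g \<in> S" "\<forall>l\<in>J. g l = y l" using J(1) unfolding P_def by blast
   show ?thesis
    using add[OF g(1) scale[OF f(1), of "(y i - g i) / f i"]] g(2) f(2) i
    by (intro bexI[of _ "%l. g l + (y i - g i) / f i * f l"]) auto
  qed
  have "J \<subseteq> I" using J(1) by (simp add: P_def)
  then have "P (insert i J)" unfolding P_def using i(1) ex by simp
  moreover have "finite J" using finite_subset[OF \<open>J \<subseteq> I\<close> assms(1)] .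
  ultimately show False using J(2)[of "insert i J"] \<open>i \<notin> J\<close> by simp
 qed
 then show ?thesis using J(1) unfolding P_def by (intro exI[of _ J]) simp
qed

definition centralizer :: "nat => 'a::field mat => 'a mat set" where
 "centralizer n x = {A \<in> Mat n n. A * x = x * A}"

lemma centralizer_base_linear:
 assumes "x \<in> Mat n n" "base_linear t" "A \<in> centralizer n (ac_mat x)"
 shows "map_mat t A \<in> centralizer n x"
proof -
 have A: "A \<in> Mat n n" "A * ac_mat x = ac_mat x * A"
  using assms(3) by (auto simp: centralizer_def)
 have "map_mat t A * x = map_mat t (A * ac_mat x)"
  by (rule base_linear_mult_right[OF assms(2,1) A(1), symmetric])
 also have "... = x * map_mat t A"
  unfolding A(2) by (rule base_linear_mult_left[OF assms(2,1) A(1)])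
 finally show ?thesis using A(1) by (simp add: centralizer_def)
qed

lemma centralizer_of_base:
 assumes "x \<in> Mat n n" "A \<in> centralizer n x"
 shows "ac_mat A \<in> centralizer n (ac_mat x)"
proof -
 interpret to_ac: comm_ring_hom "to_ac :: 'a => 'a alg_closure" by unfold_locales auto
 have A: "A \<in> Mat n n" "A * x = x * A" using assms(2) by (auto simp: centralizer_def)
 have "ac_mat A * ac_mat x = ac_mat (A * x)"
  by (rule to_ac.mat_hom_mult[OF A(1) assms(1), symmetric])
 also have "... = ac_mat x * ac_mat A"
  unfolding A(2) by (rule to_ac.mat_hom_mult[OF assms(1) A(1)])
 finally show ?thesis using A(1) by (simp add: centralizer_def)
qed

lemma centralizer_add: "A \<in> centralizer n x ==> B \<in> centralizer n x ==> x \<in> Mat n n ==> A + B \<in> centralizer n x"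
 unfolding centralizer_def by (simp add: add_mult_distrib_mat[of _ n n] mult_add_distrib_mat[of x n n A n B])

lemma centralizer_smult: "A \<in> centralizer n x ==> x \<in> Mat n n ==> c \<cdot>\<^sub>m A \<in> centralizer n x"
 for c :: "'a::field"
 unfolding centralizer_def by (simp add: mult_smult_distrib[of x n n A n] mult_smult_assoc_mat[of _ n n])

lemma centralizer_zero: "x \<in> Mat n n ==> 0\<^sub>m n n \<in> centralizer n x"
 by (auto simp: centralizer_def)

lemma centralizer_one: "x \<in> Mat n n ==> 1\<^sub>m n \<in> centralizer n x"
 by (auto simp: centralizer_def)

text \<open>The centralizer is the solution space of linear equations over \<open>F\<close>, so it has coordinates: some \<open>d\<close> of the matrix
entries, with a dual basis. The same equations describe it over \<open>L\<close>.\<close>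

lemma centralizer_parametrization:
 fixes x :: "'a::{field,finite} mat"
 assumes x: "x \<in> Mat n n"
 shows "\<exists>d pos (h :: nat => 'a alg_closure mat). card (centralizer n x) = card (UNIV :: 'a set) ^ d &
  (\<forall>s<d. pos s \<in> {..<n} \<times> {..<n} & h s \<in> centralizer n (ac_mat x) &
    (\<forall>s'<d. h s $$ pos s' = (if s = s' then 1 else 0))) &
  (\<forall>A\<in>centralizer n (ac_mat x). \<forall>i<n. \<forall>j<n. A $$ (i,j) = (\<Sum>s<d. A $$ pos s * h s $$ (i,j)))"
proof -
 define S where "S = {f. mat n n f \<in> centralizer n x}"
 let ?I = "{..<n} \<times> {..<n}"
 have m_eq: "mat n n (%p. A $$ p) = A" if "A \<in> Mat n n" for A :: "'a mat"
  using that by (intro eq_matI) auto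
 have S_add: "(%p. f p + g p) \<in> S" if "f \<in> S" "g \<in> S" for f g
 proof -
  have "mat n n (%p. f p + g p) = mat n n f + mat n n g" by (intro eq_matI) auto
  then show ?thesis using that centralizer_add x by (simp add: S_def)
 qed
 have S_scale: "(%p. c * f p) \<in> S" if "f \<in> S" for f c
 proof -
  have "mat n n (%p. c * f p) = c \<cdot>\<^sub>m mat n n f" by (intro eq_matI) auto
  then show ?thesis using that centralizer_smult x by (simp add: S_def)
 qed
 have S_zero: "(%_. 0) \<in> S"
 proof -
  have "mat n n (%_. 0) = (0\<^sub>m n n :: 'a mat)" by (intro eq_matI) auto
  then show ?thesis using centralizer_zero x by (simp add: S_def)
 qed
 have fin: "finite ?I" by simp
 have "\<exists>J\<subseteq>?I. (\<forall>y. \<exists>f\<in>S. \<forall>i\<in>J. f i = y i) & (\<forall>f\<in>S. (\<forall>i\<in>J. f i = 0) --> (\<forall>i\<in>?I. f i = 0))"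
  by (rule coordinate_subset, rule fin, erule (1) S_add, erule S_scale, rule S_zero)
 then obtain J where J': "J \<subseteq> ?I" "\<forall>y. \<exists>f\<in>S. \<forall>i\<in>J. f i = y i"
  "\<forall>f\<in>S. (\<forall>i\<in>J. f i = 0) --> (\<forall>i\<in>?I. f i = 0)"
  by (elim exE conjE) (rule that)
 have J: "J \<subseteq> ?I" "!!y. \<exists>f\<in>S. \<forall>i\<in>J. f i = y i"
  "!!f. f \<in> S ==> (!!i. i \<in> J ==> f i = 0) ==> (\<forall>i\<in>?I. f i = 0)"
  using J' by simp_all
 have finJ: "finite J" using finite_subset[OF J(1) fin] .
 define d where "d = card J"
 obtain pos where pos: "bij_betw pos {..<d} J"
  using ex_bij_betw_nat_finite[OF finJ] unfolding d_def by (metis lessThan_atLeast0)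
 have pos_in: "pos s \<in> J" "pos s \<in> ?I" if "s < d" for s using pos that J(1) by (auto simp: bij_betw_def)
 have pos_inj: "pos s = pos s' \<longleftrightarrow> s = s'" if "s < d" "s' < d" for s s'
  using pos that by (auto simp: bij_betw_def inj_on_def)
 have zero: "A = 0\<^sub>m n n" if A: "A \<in> centralizer n x" "!!p. p \<in> J ==> A $$ p = 0" for A
 proof -
  have "(%p. A $$ p) \<in> S" using A m_eq by (simp add: S_def centralizer_def)
  from J(3)[OF this A(2)] show ?thesis using A(1) by (intro eq_matI) (auto simp: centralizer_def)
 qed
 define R where "R A = (\<lambda>p\<in>J. A $$ p)" for A :: "'a mat"
 have "bij_betw R (centralizer n x) (J \<rightarrow>\<^sub>E UNIV)"
 proof (intro bij_betw_imageI inj_onI)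
  fix A B assume AB: "A \<in> centralizer n x" "B \<in> centralizer n x" "R A = R B"
  have c: "A \<in> Mat n n" "B \<in> Mat n n" using AB by (auto simp: centralizer_def)
  have "A + (-1) \<cdot>\<^sub>m B = 0\<^sub>m n n"
  proof (rule zero)
   show "A + (-1) \<cdot>\<^sub>m B \<in> centralizer n x" using AB x centralizer_add centralizer_smult by blast
   show "(A + (-1) \<cdot>\<^sub>m B) $$ p = 0" if "p \<in> J" for p
    using fun_cong[OF AB(3), of p] that J(1) c by (auto simp: R_def)
  qed
  then have "(A + (-1) \<cdot>\<^sub>m B) $$ (i,j) = 0" if "i < n" "j < n" for i j using that by simp
  then show "A = B" using c by (intro eq_matI) auto
 next
  show "R ` centralizer n x = (J \<rightarrow>\<^sub>E UNIV)"
  proof (intro equalityI subsetI)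
   fix y :: "nat \<times> nat => 'a" assume y: "y \<in> J \<rightarrow>\<^sub>E UNIV"
   obtain f where f: "f \<in> S" "\<forall>p\<in>J. f p = y p" using J(2)[of y] by blast
   have "R (mat n n f) = y" using y f(2) J(1) by (auto simp: R_def PiE_iff extensional_def fun_eq_iff)
   then show "y \<in> R ` centralizer n x" using f(1) by (intro image_eqI[of _ _ "mat n n f"]) (auto simp: S_def)
  qed (auto simp: R_def)
 qed
 then have card: "card (centralizer n x) = card (UNIV :: 'a set) ^ d"
  using finJ by (auto dest!: bij_betw_same_card simp: card_PiE d_def)
 have "\<exists>f. f \<in> S & (\<forall>p\<in>J. f p = (if p = pos s then 1 else 0))" for s
  using J(2)[of "%p. if p = pos s then 1 else 0"] by blast
 then have "\<forall>s. \<exists>f. f \<in> S & (\<forall>p\<in>J. f p = (if p = pos s then 1 else 0))"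
  by blast
 then obtain f where f: "!!s. f s \<in> S" "!!s p. p \<in> J ==> f s p = (if p = pos s then 1 else 0)"
  by (auto dest!: choice)
 define h :: "nat => 'a alg_closure mat" where "h s = ac_mat (mat n n (f s))" for s
 have hc: "h s \<in> centralizer n (ac_mat x)" for s
  unfolding h_def using f(1) centralizer_of_base[OF x] by (simp add: S_def)
 then have hcar: "h s \<in> Mat n n" for s by (auto simp: centralizer_def)
 have h_pos: "h s $$ pos s' = (if s = s' then 1 else 0)" if "s < d" "s' < d" for s s'
  using pos_in[OF that(2)] pos_inj[OF that] f(2)[of "pos s'" s] by (auto simp: h_def)
 have expand: "A $$ (i,j) = (\<Sum>s<d. A $$ pos s * h s $$ (i,j))"
  if A: "A \<in> centralizer n (ac_mat x)" and ij: "i < n" "j < n" for A i j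
 proof -
  have Ac: "A \<in> Mat n n" using A by (simp add: centralizer_def)
  have "t (A $$ (i,j) - (\<Sum>s<d. A $$ pos s * h s $$ (i,j))) = 0" if t: "base_linear t" for t
  proof -
   let ?tA = "map_mat t A"
   have tA: "?tA \<in> centralizer n x" using centralizer_base_linear[OF x t A] .
   have Sk: "(%p. ?tA $$ p + (\<Sum>s<k. - t (A $$ pos s) * f s p)) \<in> S" for k
   proof (induction k)
    case 0
    show ?case using tA m_eq[of ?tA] Ac by (simp add: S_def)
   next
    case (Suc k)
    have "mat n n (%p. ?tA $$ p + (\<Sum>s<Suc k. - t (A $$ pos s) * f s p)) =
     mat n n (%p. ?tA $$ p + (\<Sum>s<k. - t (A $$ pos s) * f s p)) + (- t (A $$ pos k)) \<cdot>\<^sub>m mat n n (f k)"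
     by (intro eq_matI) auto
    then show ?case using Suc f(1)[of k] centralizer_add[OF _ centralizer_smult] x by (simp add: S_def)
   qed
   have z: "\<forall>p\<in>?I. ?tA $$ p + (\<Sum>s<d. - t (A $$ pos s) * f s p) = 0"
   proof (rule J(3)[OF Sk])
    fix p assume p_J: "p \<in> J"
    show "?tA $$ p + (\<Sum>s<d. - t (A $$ pos s) * f s p) = 0"
    proof -
     have "p \<in> pos ` {..<d}" using bij_betw_imp_surj_on[OF pos] p_J by simp
     then obtain s where s: "s < d" "p = pos s" by blast
     have "(\<Sum>s'<d. - t (A $$ pos s') * f s' p) = (\<Sum>s'<d. if s' = s then - t (A $$ pos s') else 0)"
      using s pos_inj f(2)[OF p_J] by (intro sum.cong) auto
     then show ?thesis using s Ac pos_in[OF s(1)] by auto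
    qed
   qed
   have "t (A $$ (i,j) - (\<Sum>s<d. A $$ pos s * h s $$ (i,j))) = t (A $$ (i,j) + (\<Sum>s<d. A $$ pos s * to_ac (- f s (i,j))))"
    using ij by (simp add: h_def sum_negf)
   also have "... = ?tA $$ (i,j) + (\<Sum>s<d. t (A $$ pos s) * (- f s (i,j)))"
    using ij Ac unfolding base_linear_add[OF t] base_linear_sum[OF t] base_linear_scale'[OF t] by simp
   also have "... = 0" using z ij by auto
   finally show ?thesis .
  qed
  then have "A $$ (i,j) - (\<Sum>s<d. A $$ pos s * h s $$ (i,j)) = 0" by (rule base_linear_separates)
  then show ?thesis by simp
 qed
 show ?thesis using card pos_in(2) hc h_pos expand by (intro exI[of _ d] exI[of _ pos] exI[of _ h]) simp
qed

lemma GL_centralizer_eq: "GL_centralizer n x = centralizer n (ac_mat x) \<inter> carrier (GL n)"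
 by (auto simp: GL_centralizer_def centralizer_def GL_iff)

text \<open>Freeing the \<open>d\<close> coordinates of the centralizer one after the other gives a strict chain of irreducible
sets, as affine subspaces meet \<open>GL\<close> in irreducible sets. A longer chain would give more than \<open>d\<close>
functions with independent monomials in \<open>d\<close> coordinates.\<close>

theorem krull_dim_GL_centralizer:
 fixes x :: "'a::{field,finite} mat"
 assumes x: "x \<in> Mat n n"
 shows "card (UNIV :: 'a set) ^ krull_dim (subtopology (zariski n) (GL_centralizer n x)) = card (centralizer n x)"
proof -
 obtain d pos and h :: "nat => 'a alg_closure mat" where
  card: "card (centralizer n x) = card (UNIV :: 'a set) ^ d"
  and *: "\<forall>s<d. pos s \<in> {..<n} \<times> {..<n} & h s \<in> centralizer n (ac_mat x) &
    (\<forall>s'<d. h s $$ pos s' = (if s = s' then 1 else 0))"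
  and **: "\<forall>A\<in>centralizer n (ac_mat x). \<forall>i<n. \<forall>j<n. A $$ (i,j) = (\<Sum>s<d. A $$ pos s * h s $$ (i,j))"
  using centralizer_parametrization[OF x] by blast
 have pos: "!!s. s < d ==> pos s \<in> {..<n} \<times> {..<n}"
  and h: "!!s. s < d ==> h s \<in> centralizer n (ac_mat x)"
  and h_pos: "!!s s'. s < d ==> s' < d ==> h s $$ pos s' = (if s = s' then 1 else 0)"
  using * by blast+
 have expand: "!!A i j. A \<in> centralizer n (ac_mat x) ==> i < n ==> j < n ==>
    A $$ (i,j) = (\<Sum>s<d. A $$ pos s * h s $$ (i,j))"
  using ** by blast
 let ?x = "ac_mat x"
 define S where "S = GL_centralizer n x"
 define T where "T = subtopology (zariski n) S"
 have xc: "?x \<in> Mat n n" using x by simp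
 have S: "S \<subseteq> Mat n n" "S \<subseteq> carrier (GL n)" "S \<subseteq> centralizer n ?x"
  by (auto simp: S_def GL_centralizer_eq centralizer_def)
 have one: "1\<^sub>m n \<in> S" using centralizer_one[OF xc] GL_one_closed by (auto simp: S_def GL_centralizer_eq)
 have h_car: "h s \<in> Mat n n" if "s < d" for s using h[OF that] by (simp add: centralizer_def)
 define D where "D = {m. \<exists>Z. (\<forall>i\<le>m. closedin T (Z i) & irreducible_in T (Z i)) & (\<forall>i<m. Z i \<subset> Z (Suc i))}"

 have "d \<in> D"
 proof -
  \<comment> \<open>The coordinates from \<open>i\<close> on are kept as in the identity matrix.\<close>
  define Z where "Z i = {A \<in> S. \<forall>s\<in>{i..<d}. A $$ pos s = (1\<^sub>m n) $$ pos s}" for i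
  have one_Z: "1\<^sub>m n \<in> Z i" for i using one by (simp add: Z_def)
  have "closedin T (Z i)" for i
  proof -
   have "closedin T {A \<in> S. A $$ pos s - (1\<^sub>m n) $$ pos s = 0}" if s: "s < d" for s
   proof -
    obtain a b where ab: "pos s = (a,b)" "a < n" "b < n" using pos[OF s] by auto
    have "(%A. A $$ (a,b) + - (1\<^sub>m n $$ (a,b))) \<in> mat_polyfuns n"
     using ab by (intro mat_polyfuns.add mat_polyfuns.coord mat_polyfuns.const)
    from zariski_zero_set_closed[OF S(1) this] show ?thesis unfolding T_def ab(1) by simp
   qed
   then have "closedin T (\<Inter> (insert (topspace T) ((%s. {A \<in> S. A $$ pos s - (1\<^sub>m n) $$ pos s = 0}) ` {i..<d})))"
    by (intro closedin_Inter) auto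
   moreover have "topspace T = S" unfolding T_def using S by (auto simp: topspace_zariski)
   moreover have "\<Inter> (insert S ((%s. {A \<in> S. A $$ pos s - (1\<^sub>m n) $$ pos s = 0}) ` {i..<d})) = Z i"
    by (auto simp: Z_def)
   ultimately show ?thesis by simp
  qed
  moreover have "irreducible_in T (Z i)" for i
   unfolding T_def
  proof (rule irreducible_if_line_closed[OF S(2)])
   show "Z i \<subseteq> S" "Z i ~= {}" using one_Z by (auto simp: Z_def)
   fix A B z assume AB: "A \<in> Z i" "B \<in> Z i" "mat_line A B z \<in> carrier (GL n)"
   have c: "A \<in> centralizer n ?x" "B \<in> centralizer n ?x" using AB S by (auto simp: Z_def)
   then have c': "A \<in> Mat n n" "B \<in> Mat n n" by (auto simp: centralizer_def)
   have "mat_line A B z = A + z \<cdot>\<^sub>m (B + (-1) \<cdot>\<^sub>m A)"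
    using c' by (intro eq_matI) (auto simp: mat_line_def)
   then have "mat_line A B z \<in> centralizer n ?x"
    using c xc centralizer_add centralizer_smult by metis
   then have "mat_line A B z \<in> S" using AB(3) by (simp add: S_def GL_centralizer_eq)
   moreover have "mat_line A B z $$ pos s = (1\<^sub>m n) $$ pos s" if s: "s \<in> {i..<d}" for s
   proof -
    have "pos s \<in> {..<n} \<times> {..<n}" using pos[of s] s by simp
    then obtain a b where ab: "pos s = (a,b)" "a < n" "b < n" by auto
    have "A $$ pos s = 1\<^sub>m n $$ pos s" "B $$ pos s = 1\<^sub>m n $$ pos s" using AB s unfolding Z_def by blast+
    then have "A $$ (a,b) = 1\<^sub>m n $$ (a,b)" "B $$ (a,b) = 1\<^sub>m n $$ (a,b)" unfolding ab(1) .
    then show ?thesis using ab c' by (simp add: mat_line_def)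
   qed
   ultimately show "mat_line A B z \<in> Z i" by (simp add: Z_def)
  qed
  moreover have "Z i \<subset> Z (Suc i)" if i: "i < d" for i
  proof -
   obtain \<Delta> :: "'a alg_closure mat => 'a alg_closure" where \<Delta>: "\<Delta> \<in> mat_polyfuns n" "!!A. A \<in> Mat n n ==> \<Delta> A = det A"
    using mat_polyfuns_det by blast
   let ?B = "1\<^sub>m n + h i"
   have Bc: "?B \<in> Mat n n" using h_car[OF i] by simp
   obtain Q where Q: "\<forall>z. \<Delta> (mat_line (1\<^sub>m n) ?B z) = poly Q z"
    using mat_polyfuns_line[OF \<Delta>(1) one_carrier_mat Bc] by blast
   have l: "mat_line (1\<^sub>m n) ?B z = 1\<^sub>m n + z \<cdot>\<^sub>m h i" for z
    using h_car[OF i] by (intro eq_matI) (auto simp: mat_line_def)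
   have "mat_line (1\<^sub>m n) ?B 0 = 1\<^sub>m n" unfolding l using h_car[OF i] by (intro eq_matI) auto
   then have "poly Q 0 = 1" using Q[rule_format, of 0] \<Delta>(2)[OF one_carrier_mat] by simp
   then have "Q * [:0,1:] ~= 0" by auto
   then obtain z where z: "poly (Q * [:0,1:]) z ~= 0" using nonzero_poly_has_nonroot by blast
   let ?A = "1\<^sub>m n + z \<cdot>\<^sub>m h i"
   have Ac: "?A \<in> Mat n n" using h_car[OF i] by simp
   have "det ?A ~= 0" using z Q[rule_format, of z] l[of z] \<Delta>(2)[OF Ac] by auto
   then have "?A \<in> S" using Ac h[OF i] xc centralizer_add[OF centralizer_one[OF xc] centralizer_smult]
    by (simp add: S_def GL_centralizer_eq GL_iff_det)
   have pos_A: "?A $$ pos s = 1\<^sub>m n $$ pos s + (if s = i then z else 0)" if "s < d" for s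
    using that pos[OF that] h_pos[OF i that] h_car[OF i] by auto
   have "?A \<in> Z (Suc i)" using \<open>?A \<in> S\<close> pos_A by (auto simp: Z_def)
   moreover have "?A $$ pos i ~= 1\<^sub>m n $$ pos i" using pos_A[OF i] z by simp
   then have "?A \<notin> Z i" using i by (auto simp: Z_def)
   moreover have "Z i \<subseteq> Z (Suc i)" by (auto simp: Z_def)
   ultimately show ?thesis by blast
  qed
  ultimately show ?thesis unfolding D_def by blast
 qed
 moreover have "m <= d" if "m \<in> D" for m
 proof (rule ccontr)
  assume "\<not> m <= d"
  then have dm: "d < m" by simp
  obtain Z where Z: "!!i. i <= m ==> closedin T (Z i)" "!!i. i <= m ==> irreducible_in T (Z i)" "!!i. i < m ==> Z i \<subset> Z (Suc i)"
   using \<open>m \<in> D\<close> unfolding D_def by blast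
  have Z_S: "Z i \<subseteq> S" if "i <= m" for i
   using Z(2)[OF that] unfolding irreducible_in_def T_def by auto
  have "\<exists>p. p \<in> mat_polyfuns n & (\<forall>A\<in>Z i. p A = 0) & (\<exists>A\<in>Z (Suc i). p A ~= 0)" if i: "i < m" for i
  proof -
   obtain A where A: "A \<in> Z (Suc i)" "A \<notin> Z i" using Z(3)[OF i] by blast
   have "closedin (subtopology (zariski n) S) (Z i)" "A \<in> S"
    using Z(1)[of i] Z_S[of "Suc i"] i A unfolding T_def by auto
   from zariski_closed_separate[OF S(1) this A(2)] show ?thesis using A by metis
  qed
  then obtain f where f: "!!i. i < m ==> f i \<in> mat_polyfuns n" "!!i A. i < m ==> A \<in> Z i ==> f i A = 0"
   "!!i. i < m ==> \<exists>A\<in>Z (Suc i). f i A ~= 0" by metis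
  define \<gamma> where "\<gamma> y = mat n n (%(i,j). \<Sum>s<d. h s $$ (i,j) * y s)" for y :: "nat => 'a alg_closure"
  have span: "\<exists>E. (%y. p (\<gamma> y)) \<in> poly_span d E" if "p \<in> mat_polyfuns n" for p
   using that
  proof induction
   case (const c)
   show ?case by (rule exI[of _ 0], rule poly_span_const)
  next
   case (coord i j)
   then have "(%y. \<gamma> y $$ (i,j)) = (%y. \<Sum>s<d. h s $$ (i,j) * y s)" by (auto simp: \<gamma>_def)
   then show ?case by (intro exI[of _ 1]) (simp only: poly_span_linear)
  next
   case (add p r)
   then obtain E E' where "(%y. p (\<gamma> y)) \<in> poly_span d E" "(%y. r (\<gamma> y)) \<in> poly_span d E'" by blast
   then have "(%y. p (\<gamma> y) + r (\<gamma> y)) \<in> poly_span d (E + E')"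
    by (intro poly_span_add) (auto intro: poly_span_mono[where E = E] poly_span_mono[where E = E'])
   then show ?case by (rule exI)
  next
   case (mult p r)
   then obtain E E' where "(%y. p (\<gamma> y)) \<in> poly_span d E" "(%y. r (\<gamma> y)) \<in> poly_span d E'" by blast
   then have "(%y. p (\<gamma> y) * r (\<gamma> y)) \<in> poly_span d (E + E')" by (rule poly_span_mult)
   then show ?case by (rule exI)
  qed
  define e where "e i = (SOME E. (%y. f i (\<gamma> y)) \<in> poly_span d E)" for i
  have e: "(%y. f i (\<gamma> y)) \<in> poly_span d (e i)" if "i < m" for i
   unfolding e_def by (rule someI_ex, rule span, rule f(1), rule that)
  define E where "E = (\<Sum>i<m. e i)"
  have "(%y. f i (\<gamma> y)) \<in> poly_span d E" if "i < m" for i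
   by (rule poly_span_mono[OF e[OF that]]) (use that in \<open>auto simp: E_def intro: member_le_sum\<close>)
  then have "\<exists>N c. (\<exists>a\<in>expos m N. c a ~= 0) & (\<forall>y. (\<Sum>a\<in>expos m N. c a * (\<Prod>i<m. f i (\<gamma> y) ^ a i)) = 0)"
   by (rule algebraic_dependence[OF _ dm])
  then obtain N c where nz: "\<exists>a\<in>expos m N. c a ~= 0" and rel: "\<forall>y. (\<Sum>a\<in>expos m N. c a * (\<Prod>i<m. f i (\<gamma> y) ^ a i)) = 0"
   by (elim exE conjE) (rule that)
  have "(\<Sum>a\<in>expos m N. c a * (\<Prod>i<m. f i A ^ a i)) = 0" if "A \<in> Z m" for A
  proof -
   have A: "A \<in> centralizer n ?x" using that Z_S[of m] S(3) by auto
   have "\<gamma> (%s. A $$ pos s) = A"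
    using A expand[OF A] by (intro eq_matI) (auto simp: \<gamma>_def centralizer_def mult.commute)
   then show ?thesis using rel[rule_format, of "%s. A $$ pos s"] by simp
  qed
  moreover have "Z i \<subseteq> Z (Suc i)" if "i < m" for i using Z(3)[OF that] by blast
  ultimately have "\<forall>a\<in>expos m N. c a = 0"
   by (intro chain_monomials_independent[OF S(1), where Z = Z and f = f])
    (use Z(2) f in \<open>simp_all add: T_def\<close>)
  then show False using nz by blast
 qed
 ultimately have "Sup D = d" by (intro cSup_eq_maximum) auto
 then have "krull_dim (subtopology (zariski n) (GL_centralizer n x)) = d"
  unfolding krull_dim_def D_def T_def S_def .
 then show ?thesis using card by simp
qed

section \<open>Blocks\<close>

definition ul_block :: "nat => 'a mat => 'a mat" where
 "ul_block m x = mat m m (%(i,j). x $$ (i,j))"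

definition lr_block :: "nat => 'a mat => 'a mat" where
 "lr_block m x = mat (dim_row x - m) (dim_col x - m) (%(i,j). x $$ (m + i, m + j))"

definition ll_zero :: "nat => 'a::zero mat => bool" where
 "ll_zero m x \<longleftrightarrow> (\<forall>i j. m <= i --> i < dim_row x --> j < m --> x $$ (i,j) = 0)"

lemma block_carrier [simp]:
 "ul_block m x \<in> Mat m m"
 "x \<in> Mat (m + r) (m + r) ==> lr_block m x \<in> Mat r r"
 "dim_row (ul_block m x) = m" "dim_col (ul_block m x) = m"
 "dim_row (lr_block m x) = dim_row x - m" "dim_col (lr_block m x) = dim_col x - m"
 by (auto simp: ul_block_def lr_block_def)

lemma blocks_of_upper:
 assumes "a \<in> Mat m m" "b \<in> Mat m r" "d \<in> Mat r r"
 shows "ul_block m (four_block_mat a b (0\<^sub>m r m) d) = a" "lr_block m (four_block_mat a b (0\<^sub>m r m) d) = d"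
  "ll_zero m (four_block_mat a b (0\<^sub>m r m) d)"
 using assms by (auto simp: ul_block_def lr_block_def ll_zero_def)

lemma upper_blocks:
 fixes x :: "'a::field mat"
 assumes "x \<in> Mat (m + r) (m + r)" "ll_zero m x"
 shows "\<exists>b\<in>Mat m r. x = four_block_mat (ul_block m x) b (0\<^sub>m r m) (lr_block m x)"
proof
 let ?b = "mat m r (%(i,j). x $$ (i, m + j))"
 show "?b \<in> Mat m r" by simp
 show "x = four_block_mat (ul_block m x) ?b (0\<^sub>m r m) (lr_block m x)"
  using assms by (intro eq_matI) (auto simp: ul_block_def lr_block_def ll_zero_def)
qed

lemma upper_mult:
 fixes a :: "'a::field mat"
 assumes "a \<in> Mat m m" "b \<in> Mat m r" "d \<in> Mat r r"
  and "a' \<in> Mat m m" "b' \<in> Mat m r" "d' \<in> Mat r r"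
 shows "four_block_mat a b (0\<^sub>m r m) d * four_block_mat a' b' (0\<^sub>m r m) d'
  = four_block_mat (a * a') (a * b' + b * d') (0\<^sub>m r m) (d * d')"
proof -
 have "a * a' + b * 0\<^sub>m r m = a * a'" "0\<^sub>m r m * a' + d * 0\<^sub>m r m = 0\<^sub>m r m" "0\<^sub>m r m * b' + d * d' = d * d'"
  using assms by auto
 then show ?thesis using assms by (subst mult_four_block_mat[of _ m m _ r _ r _ _ m _ r]) auto
qed

lemma upper_eq_iff:
 assumes "a \<in> Mat m m" "b \<in> Mat m r" "d \<in> Mat r r"
  and "a' \<in> Mat m m" "b' \<in> Mat m r" "d' \<in> Mat r r"
 shows "four_block_mat a b (0\<^sub>m r m) d = four_block_mat a' b' (0\<^sub>m r m) d' \<longleftrightarrow> a = a' & b = b' & d = (d' :: 'a::field mat)"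
proof
 assume eq: "four_block_mat a b (0\<^sub>m r m) d = four_block_mat a' b' (0\<^sub>m r m) d'"
 have "b $$ (i,j) = b' $$ (i,j)" if "i < m" "j < r" for i j
  using arg_cong[OF eq, of "%M. M $$ (i, m + j)"] assms that by simp
 then have "b = b'" using assms by (intro eq_matI) auto
 then show "a = a' & b = b' & d = d'"
  using blocks_of_upper(1,2)[OF assms(1-3)] blocks_of_upper(1,2)[OF assms(4-6)] eq by metis
qed simp

section \<open>Parabolic subgroups\<close>

lemma levi_Nil: "levi [] = {1\<^sub>m 0}"
 by (auto simp: levi_def)

lemma levi_Cons:
 "levi (m # p) = {four_block_mat a (0\<^sub>m m (sum_list p)) (0\<^sub>m (sum_list p) m) l | a l :: 'a::field mat. a \<in> carrier (GL m) & l \<in> levi p}"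
proof -
 have dim: "diag_block_mat gs \<in> Mat (sum_list p) (sum_list p)"
  if "length gs = length p" "\<forall>j<length p. gs ! j \<in> carrier (GL (p ! j))" for gs :: "'a mat list" and p
  using that
 proof (induction gs p rule: list_induct2)
  case (Cons g gs m p)
  then have "g \<in> Mat m m" "diag_block_mat gs \<in> Mat (sum_list p) (sum_list p)"
   using Cons.prems[rule_format, of 0] Cons.prems[rule_format, of "Suc _"] Cons.IH by (auto simp: GL_iff)
  then show ?case by (simp add: Let_def)
 qed simp
 show ?thesis
 proof (intro equalityI subsetI)
  fix x :: "'a mat" assume "x \<in> levi (m # p)"
  then obtain gs where gs: "x = diag_block_mat gs" "length gs = length (m # p)" "\<forall>j<length (m # p). gs ! j \<in> carrier (GL ((m # p) ! j))"
   unfolding levi_def by blast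
  then obtain g gs' where g: "gs = g # gs'" by (cases gs) auto
  have gs': "length gs' = length p" "\<forall>j<length p. gs' ! j \<in> carrier (GL (p ! j))" "g \<in> carrier (GL m)"
   using gs unfolding g by auto
  then have "g \<in> Mat m m" "diag_block_mat gs' \<in> Mat (sum_list p) (sum_list p)" "diag_block_mat gs' \<in> levi p"
   using dim by (auto simp: GL_iff levi_def)
  then show "x \<in> {four_block_mat a (0\<^sub>m m (sum_list p)) (0\<^sub>m (sum_list p) m) l | a l. a \<in> carrier (GL m) & l \<in> levi p}"
   using gs(1) gs'(3) unfolding g by (auto simp: Let_def)
 next
  fix x :: "'a mat" assume "x \<in> {four_block_mat a (0\<^sub>m m (sum_list p)) (0\<^sub>m (sum_list p) m) l | a l. a \<in> carrier (GL m) & l \<in> levi p}"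
  then obtain a l where x: "x = four_block_mat a (0\<^sub>m m (sum_list p)) (0\<^sub>m (sum_list p) m) l" "a \<in> carrier (GL m)" "l \<in> levi p"
   by blast
  obtain gs where gs: "l = diag_block_mat gs" "length gs = length p" "\<forall>j<length p. gs ! j \<in> carrier (GL (p ! j))"
   using x(3) unfolding levi_def by blast
  have "x = diag_block_mat (a # gs)" using x(1,2) gs(1) dim[OF gs(2,3)] by (auto simp: Let_def GL_iff)
  moreover have "\<forall>j<length (m # p). (a # gs) ! j \<in> carrier (GL ((m # p) ! j))"
   using x(2) gs(3) by (auto simp: nth_Cons split: nat.splits)
  ultimately show "x \<in> levi (m # p)" using gs(2) unfolding levi_def by (intro CollectI exI[of _ "a # gs"]) simp
 qed
qed

lemma levi_carrier: "l \<in> levi p ==> l \<in> carrier (GL (sum_list p))"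
proof (induction p arbitrary: l)
 case Nil
 then show ?case using GL_one_closed[of 0] by (simp add: levi_Nil)
next
 case (Cons m p)
 then obtain a l' where "l = four_block_mat a (0\<^sub>m m (sum_list p)) (0\<^sub>m (sum_list p) m) l'" "a \<in> carrier (GL m)" "l' \<in> levi p"
  unfolding levi_Cons by blast
 moreover from this Cons.IH have "l' \<in> carrier (GL (sum_list p))" by blast
 ultimately show ?case using GL_block_lower[of a m "0\<^sub>m (sum_list p) m" "sum_list p" l'] by (auto simp: GL_iff)
qed

lemma unipotent_radical_carrier: "u \<in> unipotent_radical p ==> u \<in> Mat (sum_list p) (sum_list p)"
 by (simp add: unipotent_radical_def)

lemma block_boundary_Cons:
 "(\<exists>j. a < sum_list (take j (m # p)) & sum_list (take j (m # p)) <= b) \<longleftrightarrow>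
  (a < m & m <= b) \<or> (m <= a & m <= b & (\<exists>j. a - m < sum_list (take j p) & sum_list (take j p) <= b - m))"
 (is "?L \<longleftrightarrow> ?R") for a b m :: nat
proof
 assume ?L
 then obtain j where j: "a < sum_list (take j (m # p))" "sum_list (take j (m # p)) <= b" by blast
 then obtain j' where "j = Suc j'" by (cases j) auto
 then have j': "a < m + sum_list (take j' p)" "m + sum_list (take j' p) <= b" using j by auto
 show ?R
 proof (cases "a < m")
  case True
  then show ?thesis using j' by simp
 next
  case False
  then have "a - m < sum_list (take j' p)" "sum_list (take j' p) <= b - m" using j' by linarith+
  then show ?thesis using False j' by auto
 qed
next
 assume ?R
 then show ?L
 proof
  assume "a < m & m <= b" then show ?L by (intro exI[of _ 1]) auto
 next
  assume "m <= a & m <= b & (\<exists>j. a - m < sum_list (take j p) & sum_list (take j p) <= b - m)"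
  then obtain j where "m <= a" "m <= b" "a - m < sum_list (take j p)" "sum_list (take j p) <= b - m" by blast
  then have "a < m + sum_list (take j p)" "m + sum_list (take j p) <= b" by linarith+
  then show ?L by (intro exI[of _ "Suc j"]) simp
 qed
qed

lemma unipotent_radical_Nil: "unipotent_radical [] = {1\<^sub>m 0}"
 by (auto simp: unipotent_radical_def)

lemma unipotent_radical_Cons:
 "unipotent_radical (m # p) = {four_block_mat (1\<^sub>m m) b (0\<^sub>m (sum_list p) m) u | b u :: 'a::field mat.
   b \<in> Mat m (sum_list p) & u \<in> unipotent_radical p}"
proof (intro equalityI subsetI)
 fix x :: "'a mat" assume x: "x \<in> unipotent_radical (m # p)"
 let ?r = "sum_list p"
 have xc: "x \<in> Mat (m + ?r) (m + ?r)" using unipotent_radical_carrier[OF x] by simp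
 have xe: "x $$ (a,b) = 1\<^sub>m (m + ?r) $$ (a,b) \<or> (a < m & m <= b) \<or>
   (m <= a & m <= b & (\<exists>j. a - m < sum_list (take j p) & sum_list (take j p) <= b - m))" if "a < m + ?r" "b < m + ?r" for a b
  using x that unfolding unipotent_radical_def block_boundary_Cons by simp
 have "x $$ (i,j) = 0" if "m <= i" "i < m + ?r" "j < m" for i j
  using xe[of i j] that by auto
 then have "ll_zero m x" unfolding ll_zero_def using xc by auto
 then obtain b where b: "b \<in> Mat m ?r" "x = four_block_mat (ul_block m x) b (0\<^sub>m ?r m) (lr_block m x)"
  using upper_blocks[OF xc] by blast
 have "x $$ (i,j) = 1\<^sub>m m $$ (i,j)" if "i < m" "j < m" for i j
  using xe[of i j] that by auto
 then have "ul_block m x = 1\<^sub>m m" by (intro eq_matI) (auto simp: ul_block_def)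
 moreover have "lr_block m x \<in> unipotent_radical p"
  unfolding unipotent_radical_def
 proof (intro CollectI conjI allI impI)
  show "lr_block m x \<in> Mat ?r ?r" using xc by simp
  fix a b assume "a < ?r" "b < ?r"
  then show "lr_block m x $$ (a,b) = 1\<^sub>m ?r $$ (a,b) \<or> (\<exists>j. a < sum_list (take j p) & sum_list (take j p) <= b)"
   using xe[of "m + a" "m + b"] xc by (auto simp: lr_block_def)
 qed
 ultimately show "x \<in> {four_block_mat (1\<^sub>m m) b (0\<^sub>m ?r m) u | b u. b \<in> Mat m ?r & u \<in> unipotent_radical p}"
  using b by (intro CollectI exI[of _ b] exI[of _ "lr_block m x"]) simp
next
 let ?r = "sum_list p"
 fix x :: "'a mat" assume "x \<in> {four_block_mat (1\<^sub>m m) b (0\<^sub>m ?r m) u | b u. b \<in> Mat m ?r & u \<in> unipotent_radical p}"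
 then obtain b u where x: "x = four_block_mat (1\<^sub>m m) b (0\<^sub>m ?r m) u" "b \<in> Mat m ?r" "u \<in> unipotent_radical p" by blast
 have uc: "u \<in> Mat ?r ?r" using unipotent_radical_carrier[OF x(3)] .
 have ue: "u $$ (a,c) = 1\<^sub>m ?r $$ (a,c) \<or> (\<exists>j. a < sum_list (take j p) & sum_list (take j p) <= c)" if "a < ?r" "c < ?r" for a c
  using x(3) that unfolding unipotent_radical_def by simp
 show "x \<in> unipotent_radical (m # p)"
  unfolding unipotent_radical_def block_boundary_Cons
 proof (intro CollectI conjI allI impI)
  show "x \<in> Mat (sum_list (m # p)) (sum_list (m # p))" using x(1,2) uc by simp
  fix a c assume "a < sum_list (m # p)" "c < sum_list (m # p)"
  then have ac: "a < m + ?r" "c < m + ?r" by auto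
  show "x $$ (a, c) = 1\<^sub>m (sum_list (m # p)) $$ (a, c) \<or> (a < m & m <= c) \<or>
    (m <= a & m <= c & (\<exists>j. a - m < sum_list (take j p) & sum_list (take j p) <= c - m))"
  proof (cases "m <= a & m <= c")
   case True
   then show ?thesis using ue[of "a - m" "c - m"] ac x(1,2) uc by auto
  next
   case False
   then show ?thesis using ac x(1,2) uc by auto
  qed
 qed
qed

text \<open>The inflated character of the Levi subgroup, extended by zero from the parabolic subgroup to the
whole group. The recursion strips off the first block.\<close>

fun pweight :: "nat list => (nat => 'a::field => complex) => 'a mat => complex" where
 "pweight [] \<alpha> x = 1"
| "pweight (m # p) \<alpha> x = (if ll_zero m x then \<alpha> 0 (det (ul_block m x)) * pweight p (%j. \<alpha> (Suc j)) (lr_block m x) else 0)"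

lemma levi_char_Cons:
 assumes "a \<in> Mat m m" "l \<in> Mat (sum_list p) (sum_list p)"
 shows "levi_char (m # p) \<alpha> (four_block_mat a (0\<^sub>m m (sum_list p)) (0\<^sub>m (sum_list p) m) l)
  = \<alpha> 0 (det a) * levi_char p (%j. \<alpha> (Suc j)) l"
proof -
 let ?x = "four_block_mat a (0\<^sub>m m (sum_list p)) (0\<^sub>m (sum_list p) m) l"
 have "diag_block (m # p) 0 ?x = a"
  using assms by (intro eq_matI) (auto simp: diag_block_def)
 moreover have "diag_block (m # p) (Suc j) ?x = diag_block p j l" if "j < length p" for j
 proof -
  have "sum_list (take (Suc j) p) <= sum_list p"
   by (metis append_take_drop_id le_add1 sum_list_append)
  then have "sum_list (take j p) + p ! j <= sum_list p" using that by (simp add: take_Suc_conv_app_nth)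
  then show ?thesis using assms that by (intro eq_matI) (auto simp: diag_block_def)
 qed
 ultimately show ?thesis unfolding levi_char_def
  by (simp add: prod.lessThan_Suc_shift del: prod.lessThan_Suc cong: prod.cong_simp)
qed

lemma levi_unipotent_cases:
 assumes "l \<in> levi (m # p)" "u \<in> unipotent_radical (m # p)"
 obtains a l' b u' where "l = four_block_mat a (0\<^sub>m m (sum_list p)) (0\<^sub>m (sum_list p) m) l'"
  "u = four_block_mat (1\<^sub>m m) b (0\<^sub>m (sum_list p) m) u'" "a \<in> carrier (GL m)" "l' \<in> levi p" "u' \<in> unipotent_radical p"
  "b \<in> Mat m (sum_list p)" "a \<in> Mat m m" "l' \<in> Mat (sum_list p) (sum_list p)"
  "u' \<in> Mat (sum_list p) (sum_list p)" "l * u = four_block_mat a (a * b) (0\<^sub>m (sum_list p) m) (l' * u')"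
proof -
 let ?r = "sum_list p"
 obtain a l' where l: "l = four_block_mat a (0\<^sub>m m ?r) (0\<^sub>m ?r m) l'" "a \<in> carrier (GL m)" "l' \<in> levi p"
  using assms(1) unfolding levi_Cons by blast
 obtain b u' where u: "u = four_block_mat (1\<^sub>m m) b (0\<^sub>m ?r m) u'" "b \<in> Mat m ?r" "u' \<in> unipotent_radical p"
  using assms(2) unfolding unipotent_radical_Cons by blast
 have c: "a \<in> Mat m m" "l' \<in> Mat ?r ?r" "u' \<in> Mat ?r ?r"
  using l levi_carrier[OF l(3)] unipotent_radical_carrier[OF u(3)] by (auto simp: GL_iff)
 have "l * u = four_block_mat a (a * b) (0\<^sub>m ?r m) (l' * u')"
  unfolding l(1) u(1) using c u(2) by (subst upper_mult) auto
 with that l u c show ?thesis by blast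
qed

lemma pweight_levi_unipotent: "l \<in> levi p ==> u \<in> unipotent_radical p ==> pweight p \<alpha> (l * u) = levi_char p \<alpha> l"
proof (induction p arbitrary: l u \<alpha>)
 case Nil
 then show ?case by (simp add: levi_char_def)
next
 case (Cons m p)
 obtain a l' b u' where lu: "l = four_block_mat a (0\<^sub>m m (sum_list p)) (0\<^sub>m (sum_list p) m) l'"
  "u = four_block_mat (1\<^sub>m m) b (0\<^sub>m (sum_list p) m) u'" "a \<in> carrier (GL m)" "l' \<in> levi p" "u' \<in> unipotent_radical p"
  "b \<in> Mat m (sum_list p)" "a \<in> Mat m m" "l' \<in> Mat (sum_list p) (sum_list p)"
  "u' \<in> Mat (sum_list p) (sum_list p)" "l * u = four_block_mat a (a * b) (0\<^sub>m (sum_list p) m) (l' * u')"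
  using levi_unipotent_cases[OF Cons.prems] .
 have "a * b \<in> Mat m (sum_list p)" "l' * u' \<in> Mat (sum_list p) (sum_list p)" using lu(6-9) by auto
 note bl = blocks_of_upper[OF lu(7) this]
 show ?case unfolding lu(10) using bl Cons.IH[OF lu(4,5)] levi_char_Cons[OF lu(7,8)] lu(1) by simp
qed

lemma levi_unipotent_unique:
 "l \<in> levi p ==> u \<in> unipotent_radical p ==> l2 \<in> levi p ==> u2 \<in> unipotent_radical p ==> l * u = l2 * u2 ==> l = l2"
proof (induction p arbitrary: l u l2 u2)
 case Nil
 then show ?case by (simp add: levi_Nil)
next
 case (Cons m p)
 obtain a l' b u' where lu: "l = four_block_mat a (0\<^sub>m m (sum_list p)) (0\<^sub>m (sum_list p) m) l'"
  "u = four_block_mat (1\<^sub>m m) b (0\<^sub>m (sum_list p) m) u'" "a \<in> carrier (GL m)" "l' \<in> levi p" "u' \<in> unipotent_radical p"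
  "b \<in> Mat m (sum_list p)" "a \<in> Mat m m" "l' \<in> Mat (sum_list p) (sum_list p)"
  "u' \<in> Mat (sum_list p) (sum_list p)" "l * u = four_block_mat a (a * b) (0\<^sub>m (sum_list p) m) (l' * u')"
  using levi_unipotent_cases[OF Cons.prems(1,2)] .
 obtain a2 l2' b2 u2' where lu2: "l2 = four_block_mat a2 (0\<^sub>m m (sum_list p)) (0\<^sub>m (sum_list p) m) l2'"
  "u2 = four_block_mat (1\<^sub>m m) b2 (0\<^sub>m (sum_list p) m) u2'" "a2 \<in> carrier (GL m)" "l2' \<in> levi p" "u2' \<in> unipotent_radical p"
  "b2 \<in> Mat m (sum_list p)" "a2 \<in> Mat m m" "l2' \<in> Mat (sum_list p) (sum_list p)"
  "u2' \<in> Mat (sum_list p) (sum_list p)" "l2 * u2 = four_block_mat a2 (a2 * b2) (0\<^sub>m (sum_list p) m) (l2' * u2')"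
  using levi_unipotent_cases[OF Cons.prems(3,4)] .
 have c: "a * b \<in> Mat m (sum_list p)" "l' * u' \<in> Mat (sum_list p) (sum_list p)"
  "a2 * b2 \<in> Mat m (sum_list p)" "l2' * u2' \<in> Mat (sum_list p) (sum_list p)"
  using lu(6-9) lu2(6-9) by auto
 have "a = a2" "l' * u' = l2' * u2'"
  using Cons.prems(5) unfolding lu(10) lu2(10) using upper_eq_iff[OF lu(7) c(1,2) lu2(7) c(3,4)] by auto
 then show ?case using Cons.IH[OF lu(4,5) lu2(4,5)] lu(1) lu2(1) by simp
qed

lemma parabolic_iff: "x \<in> parabolic p \<longleftrightarrow> (\<exists>l\<in>levi p. \<exists>u\<in>unipotent_radical p. x = l * u)"
 unfolding parabolic_def set_mult_def by (auto simp: GL_mult)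

lemma pweight_outside_parabolic: "x \<in> carrier (GL (sum_list p)) ==> x \<notin> parabolic p ==> pweight p \<alpha> x = 0"
proof (induction p arbitrary: x \<alpha>)
 case Nil
 then have "x = 1\<^sub>m 0" by (auto simp: GL_iff)
 then have "x \<in> parabolic []" unfolding parabolic_iff levi_Nil unipotent_radical_Nil by simp
 then show ?case using Nil by simp
next
 case (Cons m p)
 let ?r = "sum_list p"
 have xc: "x \<in> Mat (m + ?r) (m + ?r)" using Cons.prems(1) by (simp add: GL_iff)
 show ?case
 proof (cases "ll_zero m x")
  case True
  let ?a = "ul_block m x" and ?d = "lr_block m x"
  obtain b where b: "b \<in> Mat m ?r" "x = four_block_mat ?a b (0\<^sub>m ?r m) ?d"
   using upper_blocks[OF xc True] by blast
  have c: "?a \<in> Mat m m" "?d \<in> Mat ?r ?r" using xc by auto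
  have "four_block_mat ?a b (0\<^sub>m ?r m) ?d \<in> carrier (GL (m + ?r))" using Cons.prems(1) b(2) by simp
  then have G: "?a \<in> carrier (GL m)" "?d \<in> carrier (GL ?r)" using GL_block_upper[OF c(1) b(1) c(2)] by auto
  have "?d \<notin> parabolic p"
  proof
   assume "?d \<in> parabolic p"
   then obtain l u where lu: "l \<in> levi p" "u \<in> unipotent_radical p" "?d = l * u" unfolding parabolic_iff by blast
   obtain a' where a': "a' \<in> Mat m m" "?a * a' = 1\<^sub>m m" using GL_E[OF G(1)] by metis
   let ?l = "four_block_mat ?a (0\<^sub>m m ?r) (0\<^sub>m ?r m) l" and ?u = "four_block_mat (1\<^sub>m m) (a' * b) (0\<^sub>m ?r m) u"
   have lc: "l \<in> Mat ?r ?r" "u \<in> Mat ?r ?r" using levi_carrier[OF lu(1)] unipotent_radical_carrier[OF lu(2)] by (auto simp: GL_iff)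
   have "?l * ?u = four_block_mat (?a * 1\<^sub>m m) (?a * (a' * b) + 0\<^sub>m m ?r * u) (0\<^sub>m ?r m) (l * u)"
    using c lc a' b by (intro upper_mult) auto
   also have "?a * (a' * b) = b" using a' b c by (simp flip: mat_assoc)
   finally have "?l * ?u = x" using b lc c lu(3) by simp
   moreover have "?l \<in> levi (m # p)" unfolding levi_Cons using G(1) lu(1) by blast
   moreover have "?u \<in> unipotent_radical (m # p)"
    unfolding unipotent_radical_Cons using lu(2) mult_carrier_mat[OF a'(1) b(1)] by blast
   ultimately show False using Cons.prems(2) unfolding parabolic_iff by metis
  qed
  then show ?thesis using Cons.IH[OF G(2)] by simp
 qed simp
qed

lemma inflate_levi_char:
 assumes "x \<in> parabolic p" shows "inflate p (levi_char p \<alpha>) x = pweight p \<alpha> x"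
proof -
 obtain l u where lu: "l \<in> levi p" "u \<in> unipotent_radical p" "x = l * u" using assms unfolding parabolic_iff by blast
 have "(THE l. l \<in> levi p & (\<exists>u\<in>unipotent_radical p. x = l * u)) = l"
 proof (rule the_equality)
  show "l \<in> levi p & (\<exists>u\<in>unipotent_radical p. x = l * u)" using lu by blast
  fix l' assume "l' \<in> levi p & (\<exists>u\<in>unipotent_radical p. x = l' * u)"
  then obtain u' where "l' \<in> levi p" "u' \<in> unipotent_radical p" "l * u = l' * u'" using lu by auto
  then show "l' = l" using levi_unipotent_unique[OF lu(1,2)] by simp
 qed
 then show ?thesis unfolding inflate_def using pweight_levi_unipotent lu by metis
qed

lemma HC_induction_levi_char:
 fixes x :: "'a::{field,finite} mat"
 assumes "x \<in> carrier (GL (sum_list p))"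
 shows "HC_induction p (levi_char p \<alpha>) x =
  (\<Sum>y\<in>carrier (GL (sum_list p)). pweight p \<alpha> (y * x * inv\<^bsub>GL (sum_list p)\<^esub> y)) / of_nat (card (parabolic p :: 'a mat set))"
proof -
 let ?G = "GL (sum_list p) :: 'a mat monoid"
 have "(if y * x * inv\<^bsub>?G\<^esub> y \<in> parabolic p then inflate p (levi_char p \<alpha>) (y * x * inv\<^bsub>?G\<^esub> y) else 0) =
  pweight p \<alpha> (y * x * inv\<^bsub>?G\<^esub> y)" if "y \<in> carrier ?G" for y
  using inflate_levi_char pweight_outside_parabolic[of "y * x * inv\<^bsub>?G\<^esub> y" p \<alpha>]
   GL_mult_closed[OF GL_mult_closed[OF that assms] GL_inv_closed[OF that]] by auto
 then show ?thesis unfolding HC_induction_def induced_class_fun_def GL_mult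
  by (intro arg_cong2[of _ _ _ _ "(/)"] sum.cong) auto
qed

lemma finite_carrier_mat: "finite (Mat r c :: 'a::finite mat set)"
proof -
 have "Mat r c \<subseteq> (%f. mat r c f) ` ({..<r} \<times> {..<c} \<rightarrow>\<^sub>E (UNIV :: 'a set))"
 proof
  fix A :: "'a mat" assume A: "A \<in> Mat r c"
  then have "A = mat r c (restrict (%p. A $$ p) ({..<r} \<times> {..<c}))" by (intro eq_matI) auto
  moreover have "restrict (%p. A $$ p) ({..<r} \<times> {..<c}) \<in> {..<r} \<times> {..<c} \<rightarrow>\<^sub>E UNIV" by auto
  ultimately show "A \<in> (%f. mat r c f) ` ({..<r} \<times> {..<c} \<rightarrow>\<^sub>E UNIV)" by blast
 qed
 then show ?thesis by (rule finite_subset) (auto intro!: finite_imageI finite_PiE)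
qed

lemma finite_GL: "finite (carrier (GL n :: 'a::{field,finite} mat monoid))"
 by (rule finite_subset[OF _ finite_carrier_mat[of n n]]) (auto simp: GL_iff)

lemma card_GL_pos: "card (carrier (GL n :: 'a::{field,finite} mat monoid)) > 0"
 using finite_GL GL_one_closed by (metis card_gt_0_iff empty_iff)

lemma card_transpose_carrier: "card (Mat r c :: 'a mat set) = card (Mat c r :: 'a mat set)"
 by (rule bij_betw_same_card[of transpose_mat], rule bij_betw_byWitness[of _ transpose_mat]) auto

lemma parabolic_GL: "x \<in> parabolic p ==> x \<in> carrier (GL (sum_list p))"
proof (induction p arbitrary: x)
 case Nil
 then show ?case unfolding parabolic_iff levi_Nil unipotent_radical_Nil using GL_one_closed[of 0] by simp
next
 case (Cons m p)
 obtain l u where lu: "l \<in> levi (m # p)" "u \<in> unipotent_radical (m # p)" "x = l * u" using Cons.prems unfolding parabolic_iff by blast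
 obtain a l' b u' where lu2: "l = four_block_mat a (0\<^sub>m m (sum_list p)) (0\<^sub>m (sum_list p) m) l'"
  "u = four_block_mat (1\<^sub>m m) b (0\<^sub>m (sum_list p) m) u'" "a \<in> carrier (GL m)" "l' \<in> levi p" "u' \<in> unipotent_radical p"
  "b \<in> Mat m (sum_list p)" "a \<in> Mat m m" "l' \<in> Mat (sum_list p) (sum_list p)"
  "u' \<in> Mat (sum_list p) (sum_list p)" "l * u = four_block_mat a (a * b) (0\<^sub>m (sum_list p) m) (l' * u')"
  using levi_unipotent_cases[OF lu(1,2)] .
 have "l' * u' \<in> carrier (GL (sum_list p))" using Cons.IH[of "l' * u'"] lu2(4,5) unfolding parabolic_iff by blast
 then show ?case unfolding lu(3) lu2(10) using lu2 GL_block_upper[of a m "a * b" "sum_list p" "l' * u'"] by auto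
qed

lemma parabolic_Cons:
 "parabolic (m # p) = (%(a, b, d). four_block_mat a b (0\<^sub>m (sum_list p) m) d) `
   (carrier (GL m) \<times> Mat m (sum_list p) \<times> (parabolic p :: 'a::field mat set))"
proof (intro equalityI subsetI)
 fix x :: "'a mat" assume "x \<in> parabolic (m # p)"
 then obtain l u where lu: "l \<in> levi (m # p)" "u \<in> unipotent_radical (m # p)" "x = l * u" unfolding parabolic_iff by blast
 obtain a l' b u' where lu2: "l = four_block_mat a (0\<^sub>m m (sum_list p)) (0\<^sub>m (sum_list p) m) l'"
  "u = four_block_mat (1\<^sub>m m) b (0\<^sub>m (sum_list p) m) u'" "a \<in> carrier (GL m)" "l' \<in> levi p" "u' \<in> unipotent_radical p"
  "b \<in> Mat m (sum_list p)" "a \<in> Mat m m" "l' \<in> Mat (sum_list p) (sum_list p)"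
  "u' \<in> Mat (sum_list p) (sum_list p)" "l * u = four_block_mat a (a * b) (0\<^sub>m (sum_list p) m) (l' * u')"
  using levi_unipotent_cases[OF lu(1,2)] .
 have "l' * u' \<in> parabolic p" "a * b \<in> Mat m (sum_list p)" using lu2 unfolding parabolic_iff by auto
 then show "x \<in> (%(a, b, d). four_block_mat a b (0\<^sub>m (sum_list p) m) d) ` (carrier (GL m) \<times> Mat m (sum_list p) \<times> parabolic p)"
  unfolding lu(3) lu2(10) using lu2(3) by (intro image_eqI[of _ _ "(a, a * b, l' * u')"]) auto
next
 fix x :: "'a mat" assume "x \<in> (%(a, b, d). four_block_mat a b (0\<^sub>m (sum_list p) m) d) ` (carrier (GL m) \<times> Mat m (sum_list p) \<times> parabolic p)"
 then obtain a b d where x: "x = four_block_mat a b (0\<^sub>m (sum_list p) m) d" "a \<in> carrier (GL m)" "b \<in> Mat m (sum_list p)" "d \<in> parabolic p"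
  by auto
 let ?r = "sum_list p"
 obtain l u where lu: "l \<in> levi p" "u \<in> unipotent_radical p" "d = l * u" using x(4) unfolding parabolic_iff by blast
 obtain a' where a': "a \<in> Mat m m" "a' \<in> Mat m m" "a * a' = 1\<^sub>m m" using GL_E[OF x(2)] by metis
 let ?l = "four_block_mat a (0\<^sub>m m ?r) (0\<^sub>m ?r m) l" and ?u = "four_block_mat (1\<^sub>m m) (a' * b) (0\<^sub>m ?r m) u"
 have lc: "l \<in> Mat ?r ?r" "u \<in> Mat ?r ?r" using levi_carrier[OF lu(1)] unipotent_radical_carrier[OF lu(2)] by (auto simp: GL_iff)
 have "?l * ?u = four_block_mat (a * 1\<^sub>m m) (a * (a' * b) + 0\<^sub>m m ?r * u) (0\<^sub>m ?r m) (l * u)"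
  using lc a' x(3) by (intro upper_mult) auto
 also have "a * (a' * b) = b" using a' x(3) by (simp flip: mat_assoc)
 finally have "?l * ?u = x" using x lc a' lu(3) by simp
 moreover have "?l \<in> levi (m # p)" unfolding levi_Cons using x(2) lu(1) by blast
 moreover have "?u \<in> unipotent_radical (m # p)"
  unfolding unipotent_radical_Cons using lu(2) mult_carrier_mat[OF a'(2) x(3)] by blast
 ultimately show "x \<in> parabolic (m # p)" unfolding parabolic_iff by metis
qed

lemma card_parabolic_Cons:
 "card (parabolic (m # p) :: 'a::{field,finite} mat set) =
   card (carrier (GL m) :: 'a mat set) * card (Mat m (sum_list p) :: 'a mat set) * card (parabolic p :: 'a mat set)"
proof -
 have "inj_on (%(a, b, d). four_block_mat a b (0\<^sub>m (sum_list p) m) d)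
   (carrier (GL m) \<times> Mat m (sum_list p) \<times> (parabolic p :: 'a mat set))"
 proof (rule inj_onI, clarify)
  fix a b d a' b' d' :: "'a mat"
  assume "a \<in> carrier (GL m)" "b \<in> Mat m (sum_list p)" "d \<in> parabolic p"
   "a' \<in> carrier (GL m)" "b' \<in> Mat m (sum_list p)" "d' \<in> parabolic p"
   "four_block_mat a b (0\<^sub>m (sum_list p) m) d = four_block_mat a' b' (0\<^sub>m (sum_list p) m) d'"
  then have "a = a' & b = b' & d = d'"
   using upper_eq_iff[of a m b "sum_list p" d a' b' d'] parabolic_GL[of d p] parabolic_GL[of d' p] by (simp add: GL_iff)
  then show "a = a' & (b, d) = (b', d')" by simp
 qed
 then show ?thesis unfolding parabolic_Cons by (simp add: card_image card_cartesian_product)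
qed

lemma card_parabolic_pos: "card (parabolic p :: 'a::{field,finite} mat set) > 0"
proof -
 have "parabolic p \<subseteq> carrier (GL (sum_list p))" using parabolic_GL by blast
 then have fin: "finite (parabolic p :: 'a mat set)" using finite_GL finite_subset by blast
 have "card (parabolic q :: 'a mat set) > 0" for q
 proof (induction q)
  case Nil
  have "(1\<^sub>m 0 :: 'a mat) \<in> parabolic []" unfolding parabolic_iff levi_Nil unipotent_radical_Nil by simp
  moreover have "finite (parabolic [] :: 'a mat set)"
   by (rule finite_subset[OF _ finite_GL[of 0]]) (use parabolic_GL[of _ "[]"] in auto)
  ultimately show ?case by (metis card_gt_0_iff empty_iff)
 next
  case (Cons m q)
  have "card (Mat m (sum_list q) :: 'a mat set) > 0"
   using finite_carrier_mat[of m "sum_list q"] zero_carrier_mat[of m "sum_list q"] by (metis card_gt_0_iff empty_iff)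
  then show ?case unfolding card_parabolic_Cons using Cons card_GL_pos by simp
 qed
 then show ?thesis .
qed

section \<open>Harish-Chandra induction in stages\<close>

text \<open>The embedding of the last \<open>r\<close> coordinates.\<close>

definition std_emb :: "nat => nat => 'a::field mat" where
 "std_emb m r = mat (m + r) r (%(i,j). if i = m + j then 1 else 0)"

definition ur_zero :: "nat => 'a::zero mat => bool" where
 "ur_zero m x \<longleftrightarrow> (\<forall>i j. i < m --> m <= j --> j < dim_col x --> x $$ (i,j) = 0)"

lemma std_emb_carrier [simp]: "std_emb m r \<in> Mat (m + r) r"
 "dim_row (std_emb m r) = m + r" "dim_col (std_emb m r) = r"
 by (auto simp: std_emb_def)

lemma mult_std_emb:
 assumes "M \<in> Mat (m + r) (m + r)" "i < m + r" "j < r"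
 shows "(M * std_emb m r) $$ (i,j) = M $$ (i, m + j)"
proof -
 have "(M * std_emb m r) $$ (i,j) = (\<Sum>l<m + r. M $$ (i,l) * std_emb m r $$ (l,j))"
  using assms by (intro mat_mult_entry) auto
 also have "... = (\<Sum>l<m + r. if l = m + j then M $$ (i,l) else 0)"
  using assms by (intro sum.cong) (auto simp: std_emb_def)
 finally show ?thesis using assms by simp
qed

lemma std_emb_mult:
 assumes "h \<in> Mat r r" "i < m + r" "j < r"
 shows "(std_emb m r * h) $$ (i,j) = (if i < m then 0 else h $$ (i - m, j))"
proof -
 have "(std_emb m r * h) $$ (i,j) = (\<Sum>l<r. std_emb m r $$ (i,l) * h $$ (l,j))"
  using assms by (intro mat_mult_entry) auto
 also have "... = (\<Sum>l<r. if l = i - m then (if i < m then 0 else h $$ (i - m, j)) else 0)"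
  using assms by (intro sum.cong) (auto simp: std_emb_def)
 finally show ?thesis using assms by auto
qed

lemma std_emb_intertwine:
 fixes M :: "'a::field mat"
 assumes M: "M \<in> Mat (m + r) (m + r)" and h: "h \<in> Mat r r"
 shows "M * std_emb m r = std_emb m r * h \<longleftrightarrow> ur_zero m M & lr_block m M = h"
proof
 assume eq: "M * std_emb m r = std_emb m r * h"
 have e: "M $$ (i, m + j) = (if i < m then 0 else h $$ (i - m, j))" if "i < m + r" "j < r" for i j
  using mult_std_emb[OF M that] std_emb_mult[OF h that] eq by simp
 have "M $$ (i, j) = 0" if "i < m" "m <= j" "j < m + r" for i j
  using e[of i "j - m"] that by simp
 then have "ur_zero m M" unfolding ur_zero_def using M by auto
 moreover have "lr_block m M = h" using e M h by (intro eq_matI) (auto simp: lr_block_def)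
 ultimately show "ur_zero m M & lr_block m M = h" ..
next
 assume *: "ur_zero m M & lr_block m M = h"
 have "M $$ (i, m + j) = (if i < m then 0 else h $$ (i - m, j))" if "i < m + r" "j < r" for i j
  using * M that by (auto simp: ur_zero_def lr_block_def)
 then show "M * std_emb m r = std_emb m r * h"
  using mult_std_emb[OF M] std_emb_mult[OF h] M h by (intro eq_matI) (auto simp del: index_mult_mat(1))
qed

lemma blocks_of_square:
 fixes M :: "'a::field mat"
 assumes "M \<in> Mat (m + r) (m + r)"
 obtains b c where "b \<in> Mat m r" "c \<in> Mat r m" "M = four_block_mat (ul_block m M) b c (lr_block m M)"
  "ur_zero m M \<longleftrightarrow> b = 0\<^sub>m m r"
proof
 let ?b = "mat m r (%(i,j). M $$ (i, m + j))" and ?c = "mat r m (%(i,j). M $$ (m + i, j))"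
 show "?b \<in> Mat m r" "?c \<in> Mat r m" by auto
 show "M = four_block_mat (ul_block m M) ?b ?c (lr_block m M)"
  using assms by (intro eq_matI) (auto simp: ul_block_def lr_block_def)
 show "ur_zero m M \<longleftrightarrow> ?b = 0\<^sub>m m r"
 proof
  assume "ur_zero m M"
  then show "?b = 0\<^sub>m m r" using assms by (intro eq_matI) (auto simp: ur_zero_def)
 next
  assume b: "?b = 0\<^sub>m m r"
  have "M $$ (i,j) = 0" if "i < m" "m <= j" "j < m + r" for i j
   using arg_cong[OF b, of "%B. B $$ (i, j - m)"] that by simp
  then show "ur_zero m M" using assms by (auto simp: ur_zero_def)
 qed
qed

lemma blocks_of_four_block:
 assumes "a \<in> Mat m m" "b \<in> Mat m r" "c \<in> Mat r m" "d \<in> Mat r r"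
 shows "ul_block m (four_block_mat a b c d) = a" "lr_block m (four_block_mat a b c d) = d"
  "ur_zero m (four_block_mat a b c d) \<longleftrightarrow> b = (0\<^sub>m m r :: 'a::field mat)"
proof -
 show "ul_block m (four_block_mat a b c d) = a" "lr_block m (four_block_mat a b c d) = d"
  using assms by (auto simp: ul_block_def lr_block_def)
 show "ur_zero m (four_block_mat a b c d) \<longleftrightarrow> b = (0\<^sub>m m r :: 'a::field mat)"
 proof
  assume ur: "ur_zero m (four_block_mat a b c d)"
  define M where "M = four_block_mat a b c d"
  have "dim_col M = m + r" using assms by (simp add: M_def)
  then have "M $$ (i, m + j) = 0" if "i < m" "j < r" for i j
   using ur that unfolding ur_zero_def M_def[symmetric] by simp
  moreover have "M $$ (i, m + j) = b $$ (i,j)" if "i < m" "j < r" for i j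
   using that assms by (simp add: M_def)
  ultimately have "b $$ (i,j) = 0" if "i < m" "j < r" for i j using that by simp
  then show "b = 0\<^sub>m m r" using assms by (intro eq_matI) auto
 qed (use assms in \<open>auto simp: ur_zero_def\<close>)
qed

text \<open>Transposing turns quotients into subspaces, so that induction matches embeddings instead of projections.\<close>

definition lower_weight :: "nat list => (nat => 'a::field => complex) => 'a mat => complex" where
 "lower_weight p \<alpha> x = pweight p \<alpha> x\<^sup>T"

lemma lower_weight_Nil: "lower_weight [] \<alpha> x = 1"
 by (simp add: lower_weight_def)

lemma lower_weight_Cons:
 assumes "x \<in> Mat (m + r) (m + r)"
 shows "lower_weight (m # p) \<alpha> x =
  (if ur_zero m x then \<alpha> 0 (det (ul_block m x)) * lower_weight p (%j. \<alpha> (Suc j)) (lr_block m x) else 0)"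
proof -
 have "ll_zero m x\<^sup>T \<longleftrightarrow> ur_zero m x" using assms by (auto simp: ll_zero_def ur_zero_def)
 moreover have "ul_block m x\<^sup>T = (ul_block m x)\<^sup>T" using assms by (intro eq_matI) (auto simp: ul_block_def)
 moreover have "lr_block m x\<^sup>T = (lr_block m x)\<^sup>T" using assms by (intro eq_matI) (auto simp: lr_block_def)
 moreover have "det (ul_block m x)\<^sup>T = det (ul_block m x)" by (rule det_transpose[of _ m]) simp
 ultimately show ?thesis by (simp add: lower_weight_def)
qed

definition ind_weight :: "nat list => (nat => 'a::{field,finite} => complex) => 'a mat => complex" where
 "ind_weight p \<alpha> x = (\<Sum>z\<in>carrier (GL (sum_list p)). lower_weight p \<alpha> (inv\<^bsub>GL (sum_list p)\<^esub> z * x * z))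
   / of_nat (card (parabolic p :: 'a mat set))"

lemma GL_transpose:
 assumes "A \<in> carrier (GL n)" shows "A\<^sup>T \<in> carrier (GL n)" "inv\<^bsub>GL n\<^esub> A\<^sup>T = (inv\<^bsub>GL n\<^esub> A)\<^sup>T"
proof -
 have c: "A \<in> Mat n n" "inv\<^bsub>GL n\<^esub> A \<in> Mat n n" using assms GL_inv_closed[OF assms] by (auto simp: GL_iff)
 have *: "A\<^sup>T * (inv\<^bsub>GL n\<^esub> A)\<^sup>T = 1\<^sub>m n"
  using transpose_mult[OF c(2,1)] GL_l_inv[OF assms] by simp
 then show "A\<^sup>T \<in> carrier (GL n)" using c by (intro GL_I[of _ _ "(inv\<^bsub>GL n\<^esub> A)\<^sup>T"]) auto
 then show "inv\<^bsub>GL n\<^esub> A\<^sup>T = (inv\<^bsub>GL n\<^esub> A)\<^sup>T" using * c by (intro GL_inv) auto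
qed

lemma HC_induction_transpose:
 fixes x :: "'a::{field,finite} mat"
 assumes x: "x \<in> carrier (GL (sum_list p))"
 shows "HC_induction p (levi_char p \<alpha>) x\<^sup>T = ind_weight p \<alpha> x"
proof -
 let ?n = "sum_list p"
 have xc: "x \<in> Mat ?n ?n" using x by (simp add: GL_iff)
 have "(\<Sum>y\<in>carrier (GL ?n). pweight p \<alpha> (y * x\<^sup>T * inv\<^bsub>GL ?n\<^esub> y)) =
   (\<Sum>z\<in>carrier (GL ?n). lower_weight p \<alpha> (inv\<^bsub>GL ?n\<^esub> z * x * z))"
 proof (rule sum.reindex_bij_witness[of _ transpose_mat transpose_mat])
  fix y :: "'a mat" assume y: "y \<in> carrier (GL ?n)"
  show "y\<^sup>T\<^sup>T = y" "y\<^sup>T \<in> carrier (GL ?n)" using GL_transpose[OF y] by auto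
  have yc: "y \<in> Mat ?n ?n" "inv\<^bsub>GL ?n\<^esub> y \<in> Mat ?n ?n"
   using y GL_inv_closed[OF y] by (auto simp: GL_iff)
  have "(inv\<^bsub>GL ?n\<^esub> y\<^sup>T * x * y\<^sup>T)\<^sup>T = y * x\<^sup>T * inv\<^bsub>GL ?n\<^esub> y"
   unfolding GL_transpose(2)[OF y] using yc xc
   by (simp add: transpose_mult[of _ ?n ?n _ ?n] mat_assoc del: assoc_mult_mat)
  then show "lower_weight p \<alpha> (inv\<^bsub>GL ?n\<^esub> y\<^sup>T * x * y\<^sup>T) = pweight p \<alpha> (y * x\<^sup>T * inv\<^bsub>GL ?n\<^esub> y)"
   by (simp add: lower_weight_def)
 qed (use GL_transpose in auto)
 then show ?thesis unfolding ind_weight_def HC_induction_levi_char[OF GL_transpose(1)[OF x]] by simp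
qed

text \<open>At an arrow of a leg these are the injective values that are fixed under base change by the matrices at its two ends.\<close>

definition emb_count :: "'a::field mat => 'a mat => nat" where
 "emb_count x h = card {f \<in> Mat (dim_row x) (dim_row h). left_inv f & x * f = f * h}"

lemma std_emb_transitive:
 fixes f :: "'a::field mat"
 assumes "f \<in> Mat (m + r) r" "left_inv f"
 shows "\<exists>y\<in>carrier (GL (m + r)). y * std_emb m r = f"
 using assms(1)
proof (cases rule: left_inv_cases)
 case (inj P P' Q Q')
 let ?U = "four_block_mat (0\<^sub>m r m) Q' (1\<^sub>m m) (0\<^sub>m m r)" and ?V = "four_block_mat (0\<^sub>m m r) (1\<^sub>m m) Q (0\<^sub>m r m)"
 have Uc: "?U \<in> Mat (m + r) (m + r)" "?V \<in> Mat (m + r) (m + r)"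
  using inj by (auto simp: add.commute)
 have "?U * ?V = four_block_mat (0\<^sub>m r m * 0\<^sub>m m r + Q' * Q) (0\<^sub>m r m * 1\<^sub>m m + Q' * 0\<^sub>m r m)
   (1\<^sub>m m * 0\<^sub>m m r + 0\<^sub>m m r * Q) (1\<^sub>m m * 1\<^sub>m m + 0\<^sub>m m r * 0\<^sub>m r m)"
  using inj by (intro mult_four_block_mat) auto
 also have "... = four_block_mat (1\<^sub>m r) (0\<^sub>m r m) (0\<^sub>m m r) (1\<^sub>m m)"
  using inj by (intro cong_four_block_mat) auto
 also have "... = 1\<^sub>m (m + r)" by (intro eq_matI) auto
 finally have UG: "?U \<in> carrier (GL (m + r))" using Uc by (intro GL_I[of _ _ ?V])
 have P'G: "P' \<in> carrier (GL (m + r))" using inj by (intro GL_I[of _ _ P]) auto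
 have "?U * std_emb m r = unit_diag (m + r) r r * Q'"
 proof (rule eq_matI)
  fix i j assume "i < dim_row (unit_diag (m + r) r r * Q')" "j < dim_col (unit_diag (m + r) r r * Q')"
  then have ij: "i < m + r" "j < r" using inj by auto
  have "(unit_diag (m + r) r r * Q') $$ (i,j) = (\<Sum>l<r. unit_diag (m + r) r r $$ (i,l) * Q' $$ (l,j))"
   using ij inj by (intro mat_mult_entry[of _ "m + r" r _ r]) auto
  also have "... = (\<Sum>l<r. if l = i then Q' $$ (i,j) else 0)"
   using ij by (intro sum.cong) (auto simp: unit_diag_def)
  finally have "(unit_diag (m + r) r r * Q') $$ (i,j) = (if i < r then Q' $$ (i,j) else 0)" by simp
  moreover have "(?U * std_emb m r) $$ (i,j) = (if i < r then Q' $$ (i,j) else 0)"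
   unfolding mult_std_emb[OF Uc(1) ij] using ij inj by auto
  ultimately show "(?U * std_emb m r) $$ (i,j) = (unit_diag (m + r) r r * Q') $$ (i,j)" by simp
 qed (use inj Uc in auto)
 then have "P' * ?U * std_emb m r = P' * (P * f)"
  using inj(11) inj(4) Uc by (simp add: mat_assoc del: assoc_mult_mat)
 also have "... = (P' * P) * f" using inj(3,4) assms(1) by (simp add: mat_assoc del: assoc_mult_mat)
 also have "... = f" using inj(5) assms(1) by simp
 finally show ?thesis using GL_mult_closed[OF P'G UG] by blast
next
 case kernel
 then show ?thesis using assms(2) by simp
qed

lemma GL_mult_left_inv:
 assumes "y \<in> carrier (GL n)" "f \<in> Mat n r" "left_inv f"
 shows "left_inv (y * f)"
proof -
 obtain B where B: "B \<in> Mat r n" "B * f = 1\<^sub>m r" using left_invE[OF assms(3,2)] .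
 obtain y' where y': "y \<in> Mat n n" "y' \<in> Mat n n" "y' * y = 1\<^sub>m n" using GL_E[OF assms(1)] by metis
 have "(B * y') * (y * f) = B * ((y' * y) * f)" using B y'(1,2) assms(2) by (simp add: mat_assoc del: assoc_mult_mat)
 also have "... = 1\<^sub>m r" unfolding y'(3) using assms(2) B by simp
 finally show ?thesis using B y' assms(2) by (intro left_invI[of _ n r "B * y'"]) auto
qed

lemma std_emb_left_inv: "left_inv (std_emb m r)"
proof -
 have "(std_emb m r)\<^sup>T * std_emb m r = (1\<^sub>m r :: 'a mat)"
 proof (rule eq_matI)
  fix i j assume "i < dim_row (1\<^sub>m r :: 'a mat)" "j < dim_col (1\<^sub>m r :: 'a mat)"
  then have ij: "i < r" "j < r" by auto
  have "((std_emb m r)\<^sup>T * std_emb m r) $$ (i,j) = (\<Sum>l<m + r. (std_emb m r)\<^sup>T $$ (i,l) * std_emb m r $$ (l,j) :: 'a)"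
   using ij by (intro mat_mult_entry[of _ r "m + r" _ r]) auto
  also have "... = (\<Sum>l<m + r. if l = m + i then (if i = j then 1 else 0) else 0)"
   using ij by (intro sum.cong) (auto simp: std_emb_def)
  finally show "((std_emb m r)\<^sup>T * std_emb m r) $$ (i,j) = (1\<^sub>m r :: 'a mat) $$ (i,j)" using ij by simp
 qed auto
 then show ?thesis by (intro left_invI[of _ "m + r" r "(std_emb m r)\<^sup>T"]) auto
qed

text \<open>The group acts transitively on embeddings. The stabilizer of the standard one has prescribed last columns and, up to
invertibility of a block, arbitrary first columns.\<close>

lemma card_std_emb_fiber:
 fixes f :: "'a::{field,finite} mat"
 assumes f: "f \<in> Mat (m + r) r" "left_inv f"
 shows "card {y \<in> carrier (GL (m + r)). y * std_emb m r = f}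
  = card (carrier (GL m) :: 'a mat set) * card (Mat r m :: 'a mat set)"
proof -
 let ?E = "std_emb m r :: 'a mat" and ?n = "m + r"
 obtain y0 where y0: "y0 \<in> carrier (GL ?n)" "y0 * ?E = f" using std_emb_transitive[OF f] by blast
 obtain y1 where y1: "y0 \<in> Mat ?n ?n" "y1 \<in> Mat ?n ?n" "y0 * y1 = 1\<^sub>m ?n" "y1 * y0 = 1\<^sub>m ?n" "y1 \<in> carrier (GL ?n)"
  using GL_E[OF y0(1)] by metis
 have "bij_betw (%y. y0 * y) {y \<in> carrier (GL ?n). y * ?E = ?E} {y \<in> carrier (GL ?n). y * ?E = f}"
 proof (rule bij_betw_byWitness[of _ "%y. y1 * y"])
  show "\<forall>y\<in>{y \<in> carrier (GL ?n). y * ?E = ?E}. y1 * (y0 * y) = y"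
   "\<forall>y\<in>{y \<in> carrier (GL ?n). y * ?E = f}. y0 * (y1 * y) = y"
   using y1(1-4) by (auto simp: GL_iff mat_assoc[symmetric] simp del: assoc_mult_mat)
  have "y0 * y * ?E = f" if "y \<in> Mat ?n ?n" "y * ?E = ?E" for y
   using that y1(1) y0(2) by (simp add: mat_assoc del: assoc_mult_mat)
  then show "(%y. y0 * y) ` {y \<in> carrier (GL ?n). y * ?E = ?E} \<subseteq> {y \<in> carrier (GL ?n). y * ?E = f}"
   using GL_mult_closed[OF y0(1)] by (auto simp: GL_mat)
  have "y1 * y * ?E = ?E" if "y \<in> Mat ?n ?n" "y * ?E = f" for y
  proof -
   have "y1 * y * ?E = y1 * (y0 * ?E)" using that y1(2) y0(2) by (simp add: mat_assoc del: assoc_mult_mat)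
   also have "... = (y1 * y0) * ?E" using y1(1,2) by (simp add: mat_assoc del: assoc_mult_mat)
   finally show ?thesis using y1(4) by simp
  qed
  then show "(%y. y1 * y) ` {y \<in> carrier (GL ?n). y * ?E = f} \<subseteq> {y \<in> carrier (GL ?n). y * ?E = ?E}"
   using GL_mult_closed[OF y1(5)] by (auto simp: GL_mat)
 qed
 then have "card {y \<in> carrier (GL ?n). y * ?E = f} = card {y \<in> carrier (GL ?n). y * ?E = ?E}"
  by (rule bij_betw_same_card[symmetric])
 also have "{y \<in> carrier (GL ?n). y * ?E = ?E} = (%(a, c). four_block_mat a (0\<^sub>m m r) c (1\<^sub>m r)) ` (carrier (GL m) \<times> Mat r m)"
 proof (intro equalityI subsetI)
  fix y assume "y \<in> {y \<in> carrier (GL ?n). y * ?E = ?E}"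
  then have y: "y \<in> carrier (GL ?n)" "y \<in> Mat ?n ?n" "y * ?E = ?E * 1\<^sub>m r" by (auto simp: GL_iff)
  then have u: "ur_zero m y" "lr_block m y = 1\<^sub>m r" using std_emb_intertwine[OF y(2), of "1\<^sub>m r"] by auto
  obtain b c where bc: "b \<in> Mat m r" "c \<in> Mat r m" "y = four_block_mat (ul_block m y) b c (lr_block m y)"
   "ur_zero m y \<longleftrightarrow> b = 0\<^sub>m m r" using blocks_of_square[OF y(2)] .
  have yy: "y = four_block_mat (ul_block m y) (0\<^sub>m m r) c (1\<^sub>m r)" using bc(3,4) u by simp
  have "ul_block m y \<in> carrier (GL m)" using GL_block_lower[of "ul_block m y" m c r "1\<^sub>m r"] bc(2) y(1) yy by simp
  then show "y \<in> (%(a, c). four_block_mat a (0\<^sub>m m r) c (1\<^sub>m r)) ` (carrier (GL m) \<times> Mat r m)"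
   using yy bc(2) by (intro image_eqI[of _ _ "(ul_block m y, c)"]) auto
 next
  fix y :: "'a mat" assume "y \<in> (%(a, c). four_block_mat a (0\<^sub>m m r) c (1\<^sub>m r)) ` (carrier (GL m) \<times> Mat r m)"
  then obtain a c where y: "y = four_block_mat a (0\<^sub>m m r) c (1\<^sub>m r)" "a \<in> carrier (GL m)" "c \<in> Mat r m" by auto
  have ac: "a \<in> Mat m m" using y(2) by (simp add: GL_iff)
  have yG: "y \<in> carrier (GL ?n)" unfolding y(1) using GL_block_lower[OF ac y(3)] y(2) GL_one_closed[of r] by auto
  have "ur_zero m y" "lr_block m y = 1\<^sub>m r" unfolding y(1) using blocks_of_four_block[OF ac _ y(3), of "0\<^sub>m m r" "1\<^sub>m r"] by auto
  then have "y * ?E = ?E * 1\<^sub>m r" using std_emb_intertwine[of y m r "1\<^sub>m r"] yG by (simp add: GL_iff)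
  then show "y \<in> {y \<in> carrier (GL ?n). y * ?E = ?E}" using yG by simp
 qed
 also have "card ... = card (carrier (GL m) \<times> Mat r m :: ('a mat \<times> 'a mat) set)"
 proof (rule card_image, rule inj_onI, clarify)
  fix a c a' c' :: "'a mat"
  assume *: "a \<in> carrier (GL m)" "c \<in> Mat r m" "a' \<in> carrier (GL m)" "c' \<in> Mat r m"
   "four_block_mat a (0\<^sub>m m r) c (1\<^sub>m r) = four_block_mat a' (0\<^sub>m m r) c' (1\<^sub>m r)"
  then have ac: "a \<in> Mat m m" "a' \<in> Mat m m" by (auto simp: GL_iff)
  have "a = a'"
   using blocks_of_four_block(1)[OF ac(1) zero_carrier_mat *(2) one_carrier_mat] blocks_of_four_block(1)[OF ac(2) zero_carrier_mat *(4) one_carrier_mat] *(5) by simp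
  moreover have "c $$ (i,j) = c' $$ (i,j)" if "i < r" "j < m" for i j
   using arg_cong[OF *(5), of "%M. M $$ (m + i, j)"] ac *(2,4) that by simp
  then have "c = c'" using *(2,4) by (intro eq_matI) auto
  ultimately show "a = a' & c = c'" ..
 qed
 finally show ?thesis by (simp add: card_cartesian_product)
qed

lemma conj_by_block:
 fixes M :: "'a::field mat"
 assumes M: "M \<in> Mat (m + r) (m + r)" and z: "z \<in> Mat r r" "z' \<in> Mat r r" "z * z' = 1\<^sub>m r"
 shows "lower_weight (m # p) \<alpha> (four_block_mat (1\<^sub>m m) (0\<^sub>m m r) (0\<^sub>m r m) z' * M * four_block_mat (1\<^sub>m m) (0\<^sub>m m r) (0\<^sub>m r m) z)
  = (if ur_zero m M then \<alpha> 0 (det (ul_block m M)) * lower_weight p (%j. \<alpha> (Suc j)) (z' * lr_block m M * z) else 0)"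
proof -
 define a where "a = ul_block m M"
 define d where "d = lr_block m M"
 have ad: "a \<in> Mat m m" "d \<in> Mat r r" using M by (auto simp: a_def d_def)
 obtain b c where bc: "b \<in> Mat m r" "c \<in> Mat r m" "M = four_block_mat a b c d" "ur_zero m M \<longleftrightarrow> b = 0\<^sub>m m r"
  using blocks_of_square[OF M] unfolding a_def d_def .
 have "four_block_mat (1\<^sub>m m) (0\<^sub>m m r) (0\<^sub>m r m) z' * four_block_mat a b c d =
  four_block_mat (1\<^sub>m m * a + 0\<^sub>m m r * c) (1\<^sub>m m * b + 0\<^sub>m m r * d) (0\<^sub>m r m * a + z' * c) (0\<^sub>m r m * b + z' * d)"
  using ad bc(1,2) z by (intro mult_four_block_mat) auto
 also have "... = four_block_mat a b (z' * c) (z' * d)"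
  using ad bc(1,2) z by (intro cong_four_block_mat) auto
 finally have 1: "four_block_mat (1\<^sub>m m) (0\<^sub>m m r) (0\<^sub>m r m) z' * M = four_block_mat a b (z' * c) (z' * d)"
  using bc(3) by simp
 have "four_block_mat a b (z' * c) (z' * d) * four_block_mat (1\<^sub>m m) (0\<^sub>m m r) (0\<^sub>m r m) z =
  four_block_mat (a * 1\<^sub>m m + b * 0\<^sub>m r m) (a * 0\<^sub>m m r + b * z) (z' * c * 1\<^sub>m m + z' * d * 0\<^sub>m r m) (z' * c * 0\<^sub>m m r + z' * d * z)"
  using ad bc(1,2) z by (intro mult_four_block_mat) auto
 also have "... = four_block_mat a (b * z) (z' * c) (z' * d * z)"
  using ad bc(1,2) z by (intro cong_four_block_mat) auto
 finally have 2: "four_block_mat (1\<^sub>m m) (0\<^sub>m m r) (0\<^sub>m r m) z' * M * four_block_mat (1\<^sub>m m) (0\<^sub>m m r) (0\<^sub>m r m) z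
  = four_block_mat a (b * z) (z' * c) (z' * d * z)" unfolding 1 .
 have car: "b * z \<in> Mat m r" "z' * c \<in> Mat r m" "z' * d * z \<in> Mat r r" using ad bc(1,2) z by auto
 have "b * z = 0\<^sub>m m r \<longleftrightarrow> b = 0\<^sub>m m r"
 proof
  assume "b * z = 0\<^sub>m m r"
  then have "b * z * z' = 0\<^sub>m m r" using z by simp
  moreover have "b * z * z' = b" using bc(1) z by (simp add: mat_assoc del: assoc_mult_mat)
  ultimately show "b = 0\<^sub>m m r" by simp
 qed (use z in auto)
 then show ?thesis unfolding 2 using blocks_of_four_block[OF ad(1) car] bc(4) ad car
  by (subst lower_weight_Cons[of _ m r]) (auto simp: a_def[symmetric] d_def[symmetric])
qed

text \<open>The sum over \<open>z\<close> depends on the embedding that \<open>z\<close> makes of the last coordinates, on the restriction \<open>h\<close> of \<open>x\<close> to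
its image, and on a base change of this image. Sorting by \<open>h\<close> yields embeddings counted by
\<open>emb_count\<close> and, averaged over the base changes, the induced weight of \<open>h\<close>.\<close>

theorem ind_weight_Cons:
 fixes x :: "'a::{field,finite} mat"
 assumes x: "x \<in> carrier (GL (m + sum_list p))"
 shows "ind_weight (m # p) \<alpha> x = (\<Sum>h\<in>carrier (GL (sum_list p)).
   \<alpha> 0 (det x / det h) * of_nat (emb_count x h) * ind_weight p (%j. \<alpha> (Suc j)) h) / of_nat (card (carrier (GL (sum_list p)) :: 'a mat set))"
proof -
 let ?r = "sum_list p" and ?n = "m + sum_list p"
 let ?G = "carrier (GL ?n) :: 'a mat set" and ?H = "carrier (GL ?r) :: 'a mat set"
 let ?E = "std_emb m ?r :: 'a mat"
 define \<alpha>' where "\<alpha>' = (%j. \<alpha> (Suc j))"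
 define M where "M y = inv\<^bsub>GL ?n\<^esub> y * x * y" for y
 define C where "C = card (carrier (GL m) :: 'a mat set) * card (Mat ?r m :: 'a mat set)"
 have xc: "x \<in> Mat ?n ?n" using x by (simp add: GL_iff)
 have M_G: "M y \<in> ?G" if "y \<in> ?G" for y
  unfolding M_def using GL_mult_closed[OF GL_mult_closed[OF GL_inv_closed[OF that] x] that] .
 have inv_c: "y \<in> Mat ?n ?n" "inv\<^bsub>GL ?n\<^esub> y \<in> Mat ?n ?n" if "y \<in> ?G" for y
  using that GL_inv_closed[OF that] by (auto simp: GL_iff)
 have M_c: "M y \<in> Mat ?n ?n" if "y \<in> ?G" for y using M_G[OF that] by (simp add: GL_iff)
 have det_M: "det (M y) = det x" if "y \<in> ?G" for y
 proof -
  have "det (M y) = det (inv\<^bsub>GL ?n\<^esub> y) * det x * det y"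
   unfolding M_def using inv_c[OF that] xc by (simp add: det_mult[of _ ?n])
  moreover have "det (inv\<^bsub>GL ?n\<^esub> y) * det y = 1"
   using GL_l_inv[OF that] inv_c[OF that] by (metis det_mult det_one)
  ultimately show ?thesis by (simp add: mult.commute mult.left_commute)
 qed
 have intertwine: "x * (y * ?E) = (y * ?E) * h \<longleftrightarrow> ur_zero m (M y) & lr_block m (M y) = h"
  if y: "y \<in> ?G" and h: "h \<in> Mat ?r ?r" for y h
 proof -
  have "x * (y * ?E) = (y * ?E) * h \<longleftrightarrow> M y * ?E = ?E * h"
  proof
   assume eq: "x * (y * ?E) = (y * ?E) * h"
   have "M y * ?E = inv\<^bsub>GL ?n\<^esub> y * (x * (y * ?E))"
    unfolding M_def using inv_c[OF y] xc by (simp add: mat_assoc del: assoc_mult_mat)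
   also have "... = (inv\<^bsub>GL ?n\<^esub> y * y) * (?E * h)"
    unfolding eq using inv_c[OF y] h by (simp add: mat_assoc del: assoc_mult_mat)
   finally show "M y * ?E = ?E * h" using GL_l_inv[OF y] mult_carrier_mat[OF std_emb_carrier(1) h, of m] by simp
  next
   assume eq: "M y * ?E = ?E * h"
   have "(y * ?E) * h = y * (M y * ?E)" unfolding eq using inv_c[OF y] h by (simp add: mat_assoc del: assoc_mult_mat)
   also have "... = (y * inv\<^bsub>GL ?n\<^esub> y) * (x * (y * ?E))"
    unfolding M_def using inv_c[OF y] xc by (simp add: mat_assoc del: assoc_mult_mat)
   also have "... = x * (y * ?E)" unfolding GL_r_inv[OF y] using xc inv_c[OF y] by (intro left_mult_one_mat) auto
   finally show "x * (y * ?E) = (y * ?E) * h" by simp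
  qed
  then show ?thesis using std_emb_intertwine[OF M_c[OF y] h] by simp
 qed
 have lr_GL: "ul_block m (M y) \<in> carrier (GL m)" "lr_block m (M y) \<in> ?H" "det x = det (ul_block m (M y)) * det (lr_block m (M y))"
  if y: "y \<in> ?G" and "ur_zero m (M y)" for y
 proof -
  obtain b c where bc: "b \<in> Mat m ?r" "c \<in> Mat ?r m" "M y = four_block_mat (ul_block m (M y)) b c (lr_block m (M y))"
   "ur_zero m (M y) \<longleftrightarrow> b = 0\<^sub>m m ?r" using blocks_of_square[OF M_c[OF y]] .
  have eq: "M y = four_block_mat (ul_block m (M y)) (0\<^sub>m m ?r) c (lr_block m (M y))" using bc(3,4) that by simp
  have c: "ul_block m (M y) \<in> Mat m m" "lr_block m (M y) \<in> Mat ?r ?r" using M_c[OF y] by auto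
  show "ul_block m (M y) \<in> carrier (GL m)" "lr_block m (M y) \<in> ?H"
   using GL_block_lower[OF c(1) bc(2) c(2)] M_G[OF y] eq by auto
  show "det x = det (ul_block m (M y)) * det (lr_block m (M y))"
   using det_four_block_mat_upper_right_zero[OF c(1) refl bc(2) c(2)] eq det_M[OF y] by simp
 qed
 have emb: "of_nat (emb_count x h * C) = (\<Sum>y\<in>{y \<in> ?G. ur_zero m (M y) & lr_block m (M y) = h}. 1 :: complex)"
  if h: "h \<in> ?H" for h
 proof -
  have hc: "h \<in> Mat ?r ?r" using h by (simp add: GL_iff)
  let ?F = "{f \<in> Mat ?n ?r. left_inv f & x * f = f * h}"
  let ?Y = "{y \<in> ?G. ur_zero m (M y) & lr_block m (M y) = h}"
  have finF: "finite ?F" by (rule finite_subset[OF _ finite_carrier_mat[of ?n ?r]]) auto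
  have finY: "finite ?Y" by (rule finite_subset[OF _ finite_GL]) auto
  have im: "(%y. y * ?E) ` ?Y \<subseteq> ?F"
  proof (intro image_subsetI)
   fix y assume "y \<in> ?Y"
   then have y: "y \<in> ?G" "ur_zero m (M y) & lr_block m (M y) = h" by auto
   have "left_inv (y * ?E)" by (rule GL_mult_left_inv[OF y(1) std_emb_carrier(1) std_emb_left_inv])
   then show "y * ?E \<in> ?F" using y intertwine[OF y(1) hc] inv_c[OF y(1)] by auto
  qed
  have fib: "(\<Sum>y\<in>{y \<in> ?Y. y * ?E = f}. 1 :: complex) = of_nat C" if f: "f \<in> ?F" for f
  proof -
   have "{y \<in> ?Y. y * ?E = f} = {y \<in> ?G. y * ?E = f}" using f intertwine hc by auto
   then show ?thesis using card_std_emb_fiber[of f m ?r] f by (simp add: C_def)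
  qed
  have "(\<Sum>y\<in>?Y. 1 :: complex) = (\<Sum>f\<in>?F. \<Sum>y\<in>{y \<in> ?Y. y * ?E = f}. 1)"
   by (rule sum.group[OF finY finF im, symmetric])
  also have "... = (\<Sum>f\<in>?F. of_nat C)" by (intro sum.cong refl fib)
  finally show ?thesis using xc hc by (simp add: emb_count_def)
 qed
 define blk where "blk z = four_block_mat (1\<^sub>m m) (0\<^sub>m m ?r) (0\<^sub>m ?r m) z" for z :: "'a mat"
 have blk_G: "blk z \<in> ?G" if "z \<in> ?H" for z
  unfolding blk_def using GL_block_lower[of "1\<^sub>m m" m "0\<^sub>m ?r m" ?r z] that GL_one_closed[of m] by (simp add: GL_iff[of z])
 have blk_c: "blk z \<in> Mat ?n ?n" if "z \<in> ?H" for z using blk_G[OF that] by (simp add: GL_iff)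
 define W where "W y = lower_weight (m # p) \<alpha> (M y)" for y
 have trans: "(\<Sum>y\<in>?G. W (y * blk z)) = (\<Sum>y\<in>?G. W y)" if z: "z \<in> ?H" for z
 proof -
  let ?D = "blk z"
  have D: "?D \<in> ?G" using blk_G[OF z] .
  obtain D' where D': "?D \<in> Mat ?n ?n" "D' \<in> Mat ?n ?n" "?D * D' = 1\<^sub>m ?n" "D' * ?D = 1\<^sub>m ?n" "D' \<in> ?G"
   by (rule GL_E[OF D])
  show ?thesis
  proof (rule sum.reindex_bij_witness[of _ "%y. y * D'" "%y. y * ?D"])
   fix y assume y: "y \<in> ?G"
   note yc = inv_c(1)[OF y]
   show "y * ?D * D' = y" "y * D' * ?D = y"
    using yc D'(1-4) by (simp_all add: mat_assoc[of y] del: assoc_mult_mat)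
   show "y * ?D \<in> ?G" "y * D' \<in> ?G" using GL_mult_closed y D D'(5) by auto
  qed auto
 qed
 have W_block: "W (y * blk z) =
   (if ur_zero m (M y) then \<alpha> 0 (det (ul_block m (M y))) * lower_weight p \<alpha>' (inv\<^bsub>GL ?r\<^esub> z * lr_block m (M y) * z) else 0)"
  if y: "y \<in> ?G" and z: "z \<in> ?H" for y z
 proof -
  let ?z' = "inv\<^bsub>GL ?r\<^esub> z"
  let ?D = "blk z" and ?D' = "blk ?z'"
  have zc: "z \<in> Mat ?r ?r" "?z' \<in> Mat ?r ?r" using z GL_inv_closed[OF z] by (auto simp: GL_iff)
  have D: "?D \<in> ?G" using blk_G[OF z] .
  have Dc: "?D \<in> Mat ?n ?n" "?D' \<in> Mat ?n ?n" using blk_c[OF z] blk_c[OF GL_inv_closed[OF z]] by auto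
  have "?D * ?D' = four_block_mat (1\<^sub>m m * 1\<^sub>m m) (1\<^sub>m m * 0\<^sub>m m ?r + 0\<^sub>m m ?r * ?z') (0\<^sub>m ?r m) (z * ?z')"
   unfolding blk_def using zc by (intro upper_mult) auto
  also have "... = 1\<^sub>m ?n" using GL_r_inv[OF z] zc by (intro eq_matI) auto
  finally have DD: "?D * ?D' = 1\<^sub>m ?n" .
  have "(y * ?D) * (?D' * inv\<^bsub>GL ?n\<^esub> y) = y * ((?D * ?D') * inv\<^bsub>GL ?n\<^esub> y)"
   using inv_c[OF y] Dc by (simp add: mat_assoc del: assoc_mult_mat)
  also have "... = 1\<^sub>m ?n" unfolding DD using inv_c[OF y] GL_r_inv[OF y] by simp
  finally have "inv\<^bsub>GL ?n\<^esub> (y * ?D) = ?D' * inv\<^bsub>GL ?n\<^esub> y"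
   using inv_c[OF y] Dc GL_mult_closed[OF y D] by (intro GL_inv) auto
  then have "M (y * ?D) = ?D' * M y * ?D"
   unfolding M_def using inv_c[OF y] Dc xc by (simp add: mat_assoc del: assoc_mult_mat)
  then show ?thesis unfolding W_def \<alpha>'_def using conj_by_block[OF M_c[OF y] zc GL_r_inv[OF z], folded blk_def] by simp
 qed
 have step: "(\<Sum>h\<in>?H. \<alpha> 0 (det x / det h) * of_nat (emb_count x h) * ind_weight p \<alpha>' h) * of_nat C
  = of_nat (card ?H) * (\<Sum>y\<in>?G. W y) / of_nat (card (parabolic p :: 'a mat set))"
 proof -
  let ?Y = "{y \<in> ?G. ur_zero m (M y)}"
  have "(\<Sum>h\<in>?H. \<alpha> 0 (det x / det h) * of_nat (emb_count x h) * ind_weight p \<alpha>' h) * of_nat C =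
   (\<Sum>h\<in>?H. \<alpha> 0 (det x / det h) * ind_weight p \<alpha>' h * of_nat (emb_count x h * C))"
   unfolding sum_distrib_right by (intro sum.cong refl) (simp add: mult_ac)
  also have "... = (\<Sum>h\<in>?H. \<Sum>y\<in>{y \<in> ?Y. lr_block m (M y) = h}. \<alpha> 0 (det x / det (lr_block m (M y))) * ind_weight p \<alpha>' (lr_block m (M y)))"
  proof (intro sum.cong refl)
   fix h assume h: "h \<in> ?H"
   have "{y \<in> ?G. ur_zero m (M y) & lr_block m (M y) = h} = {y \<in> ?Y. lr_block m (M y) = h}" by auto
   then show "\<alpha> 0 (det x / det h) * ind_weight p \<alpha>' h * of_nat (emb_count x h * C) =
    (\<Sum>y\<in>{y \<in> ?Y. lr_block m (M y) = h}. \<alpha> 0 (det x / det (lr_block m (M y))) * ind_weight p \<alpha>' (lr_block m (M y)))"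
    unfolding emb[OF h] sum_distrib_left by (intro sum.cong) auto
  qed
  also have "... = (\<Sum>y\<in>?Y. \<alpha> 0 (det x / det (lr_block m (M y))) * ind_weight p \<alpha>' (lr_block m (M y)))"
   by (rule sum.group) (auto intro: lr_GL(2) simp: finite_GL)
  also have "... = (\<Sum>y\<in>?Y. \<alpha> 0 (det (ul_block m (M y))) * ind_weight p \<alpha>' (lr_block m (M y)))"
  proof (intro sum.cong refl)
   fix y assume "y \<in> ?Y"
   then have "lr_block m (M y) \<in> ?H" "det x = det (ul_block m (M y)) * det (lr_block m (M y))" using lr_GL by auto
   then show "\<alpha> 0 (det x / det (lr_block m (M y))) * ind_weight p \<alpha>' (lr_block m (M y)) = \<alpha> 0 (det (ul_block m (M y))) * ind_weight p \<alpha>' (lr_block m (M y))"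
    by (simp add: GL_iff_det)
  qed
  also have "... = (\<Sum>y\<in>?G. if ur_zero m (M y) then \<alpha> 0 (det (ul_block m (M y))) * ind_weight p \<alpha>' (lr_block m (M y)) else 0)"
   using finite_GL by (intro sum.mono_neutral_cong_left) auto
  also have "... = (\<Sum>y\<in>?G. \<Sum>z\<in>?H. W (y * blk z)) / of_nat (card (parabolic p :: 'a mat set))"
   unfolding sum_divide_distrib by (intro sum.cong refl) (simp add: W_block ind_weight_def sum_distrib_left sum_divide_distrib)
  also have "... = (\<Sum>z\<in>?H. \<Sum>y\<in>?G. W (y * blk z)) / of_nat (card (parabolic p :: 'a mat set))"
   by (subst sum.swap) simp
  also have "... = of_nat (card ?H) * (\<Sum>y\<in>?G. W y) / of_nat (card (parabolic p :: 'a mat set))"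
   by (simp add: trans)
  finally show ?thesis .
 qed
 have Cpos: "C > 0"
  unfolding C_def using card_GL_pos finite_carrier_mat[of ?r m] zero_carrier_mat[of ?r m] by (metis card_gt_0_iff empty_iff nat_0_less_mult_iff)
 have ind: "ind_weight (m # p) \<alpha> x = (\<Sum>y\<in>?G. W y) / (of_nat C * of_nat (card (parabolic p :: 'a mat set)))"
  unfolding ind_weight_def card_parabolic_Cons C_def W_def M_def card_transpose_carrier[of m ?r]
  by (simp add: mult_ac)
 define A where "A = (\<Sum>h\<in>?H. \<alpha> 0 (det x / det h) * of_nat (emb_count x h) * ind_weight p \<alpha>' h)"
 define B where "B = (\<Sum>y\<in>?G. W y)"
 define c where "c = (of_nat C :: complex)"
 define N where "N = (of_nat (card ?H) :: complex)"
 define P where "P = (of_nat (card (parabolic p :: 'a mat set)) :: complex)"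
 have nz: "c ~= 0" "N ~= 0" "P ~= 0"
  using Cpos card_GL_pos[of ?r, where 'a = 'a] card_parabolic_pos[of p, where 'a = 'a] by (auto simp: c_def N_def P_def)
 have "A * c = N * B / P" using step unfolding A_def B_def c_def N_def P_def .
 then have "B / (c * P) = A / N" using nz by (simp add: field_simps)
 then show ?thesis unfolding ind A_def B_def c_def N_def P_def \<alpha>'_def .
qed

section \<open>Sums over chains\<close>

text \<open>The quotients of determinants are those of the action of \<open>h j\<close> on successive quotients of the
flag; the group of rank zero at the end has determinant \<open>1\<close>.\<close>

definition chain_weight :: "nat list => (nat => 'a::field => complex) => (nat => 'a mat) => complex" where
 "chain_weight p \<alpha> h = (\<Prod>j<length p. \<alpha> j (det (h j) / (if Suc j < length p then det (h (Suc j)) else 1))) *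
   (\<Prod>j\<in>{1..<length p}. of_nat (emb_count (h (j - 1)) (h j)))"

theorem chain_sum:
 fixes x :: "'a::{field,finite} mat"
 assumes "p ~= []" "x \<in> carrier (GL (sum_list p))"
 shows "(\<Sum>h\<in>PiE {1..<length p} (%j. carrier (GL (sum_list (drop j p)))). chain_weight p \<alpha> (h(0 := x)))
  = ind_weight p \<alpha> x * (\<Prod>j\<in>{1..<length p}. of_nat (card (carrier (GL (sum_list (drop j p))) :: 'a mat set)))"
 using assms
proof (induction p arbitrary: x \<alpha>)
 case (Cons m p)
 let ?H = "%p. PiE {1..<length p} (%j. carrier (GL (sum_list (drop j p))) :: 'a mat set)"
 let ?\<alpha> = "%j. \<alpha> (Suc j)"
 have x: "x \<in> carrier (GL (m + sum_list p))" using Cons.prems by simp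
 show ?case
 proof (cases "p = []")
  case True
  have G0: "carrier (GL 0) = {1\<^sub>m 0 :: 'a mat}" using GL_one_closed[of 0] by (auto simp: GL_iff intro!: eq_matI)
  have xm: "x \<in> Mat m m" using x True by (simp add: GL_iff)
  have "{f \<in> Mat m 0. left_inv f & x * f = f * 1\<^sub>m 0} = {0\<^sub>m m 0 :: 'a mat}"
   using xm by (auto simp: left_inv_def intro!: eq_matI bexI[of _ "0\<^sub>m 0 m"])
  then have "emb_count x (1\<^sub>m 0) = 1" using xm by (simp add: emb_count_def)
  moreover have "parabolic [] = {1\<^sub>m 0 :: 'a mat}"
   unfolding set_eq_iff parabolic_iff levi_Nil unipotent_radical_Nil by simp
  then have "ind_weight [] (%j. \<alpha> (Suc j)) (1\<^sub>m 0) = 1"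
   by (simp add: ind_weight_def G0 lower_weight_Nil)
  ultimately have "ind_weight [m] \<alpha> x = \<alpha> 0 (det x)"
   using ind_weight_Cons[of x m "[]" \<alpha>] x True by (simp add: G0)
  then show ?thesis using True by (simp add: chain_weight_def)
 next
  case False
  let ?N = "sum_list p" and ?l = "length p"
  have l: "?l >= 1" using False by (cases p) auto
  define sh where "sh = (%(h, k). \<lambda>j\<in>{1..<Suc ?l}. (k(0 := h)) (j - 1) :: 'a mat)"
  have sh: "sh (h, k) j = (k(0 := h)) (j - 1)" if "1 <= j" "j < Suc ?l" for h k j
   using that by (simp add: sh_def)
  have "(\<Sum>h\<in>?H (m # p). chain_weight (m # p) \<alpha> (h(0 := x))) =
   (\<Sum>(h,k)\<in>carrier (GL ?N) \<times> ?H p. \<alpha> 0 (det x / det h) * of_nat (emb_count x h) * chain_weight p ?\<alpha> (k(0 := h)))"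
  proof (rule sum.reindex_bij_witness[of _ sh "%k. (k 1, \<lambda>j\<in>{1..<?l}. k (Suc j))"])
   fix k assume k: "k \<in> ?H (m # p)"
   have ext: "k j = undefined" if "j \<notin> {1..<Suc ?l}" for j using k that by (auto simp: PiE_iff extensional_def)
   show "sh (k 1, \<lambda>j\<in>{1..<?l}. k (Suc j)) = k"
   proof
    fix j show "sh (k 1, \<lambda>j\<in>{1..<?l}. k (Suc j)) j = k j"
    proof (cases "j \<in> {1..<Suc ?l}")
     case True
     then show ?thesis by (cases "j = 1") (auto simp: sh)
    next
     case False
     then show ?thesis using ext[OF False] by (simp add: sh_def)
    qed
   qed
   have "k 1 \<in> carrier (GL ?N)" using PiE_mem[OF k, of 1] l False by simp
   moreover have "(\<lambda>j\<in>{1..<?l}. k (Suc j)) \<in> ?H p" using PiE_mem[OF k, of "Suc _"] by (auto simp: PiE_iff)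
   ultimately show "(k 1, \<lambda>j\<in>{1..<?l}. k (Suc j)) \<in> carrier (GL ?N) \<times> ?H p" by simp
   define K where "K = (\<lambda>j\<in>{1..<?l}. k (Suc j))(0 := k 1)"
   have kk: "K j = k (Suc j)" if "j < ?l" for j using that by (cases j) (auto simp: K_def)
   have "chain_weight (m # p) \<alpha> (k(0 := x)) = \<alpha> 0 (det x / det (k 1)) * of_nat (emb_count x (k 1)) * chain_weight p ?\<alpha> K"
   proof -
    have "(\<Prod>j<Suc ?l. \<alpha> j (det ((k(0 := x)) j) / (if Suc j < Suc ?l then det ((k(0 := x)) (Suc j)) else 1)))
     = \<alpha> 0 (det x / det (k 1)) * (\<Prod>j<?l. ?\<alpha> j (det (K j) / (if Suc j < ?l then det (K (Suc j)) else 1)))"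
     unfolding prod.lessThan_Suc_shift using l by (intro arg_cong2[of _ _ _ _ "(*)"] prod.cong) (auto simp: kk)
    moreover have "(\<Prod>j\<in>{1..<Suc ?l}. of_nat (emb_count ((k(0 := x)) (j - 1)) ((k(0 := x)) j)))
     = of_nat (emb_count x (k 1)) * (\<Prod>j\<in>{1..<?l}. of_nat (emb_count (K (j - 1)) (K j)) :: complex)"
    proof -
     have "(\<Prod>j\<in>{1..<Suc ?l}. of_nat (emb_count ((k(0 := x)) (j - 1)) ((k(0 := x)) j)))
      = (\<Prod>j\<in>{0..<?l}. of_nat (emb_count ((k(0 := x)) j) (k (Suc j))) :: complex)"
      by (rule prod.reindex_bij_witness[of _ Suc "%j. j - 1"]) auto
     also have "{0..<?l} = insert 0 {1..<?l}" using l by auto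
     also have "(\<Prod>j\<in>insert 0 {1..<?l}. of_nat (emb_count ((k(0 := x)) j) (k (Suc j))))
      = of_nat (emb_count x (k 1)) * (\<Prod>j\<in>{1..<?l}. of_nat (emb_count (k j) (k (Suc j))) :: complex)" by simp
     also have "(\<Prod>j\<in>{1..<?l}. of_nat (emb_count (k j) (k (Suc j))) :: complex) = (\<Prod>j\<in>{1..<?l}. of_nat (emb_count (K (j - 1)) (K j)))"
      by (intro prod.cong refl) (auto simp: kk)
     finally show ?thesis .
    qed
    ultimately show ?thesis unfolding chain_weight_def by (simp only: length_Cons mult_ac)
   qed
   then show "(case (k 1, \<lambda>j\<in>{1..<?l}. k (Suc j)) of (h, k) => \<alpha> 0 (det x / det h) * of_nat (emb_count x h) * chain_weight p ?\<alpha> (k(0 := h)))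
    = chain_weight (m # p) \<alpha> (k(0 := x))" by (simp add: K_def)
  next
   fix hk :: "'a mat \<times> (nat => 'a mat)" assume "hk \<in> carrier (GL ?N) \<times> ?H p"
   then obtain h k where hk: "hk = (h, k)" "h \<in> carrier (GL ?N)" "k \<in> ?H p" by auto
   have "(\<lambda>j\<in>{1..<?l}. sh (h, k) (Suc j)) = k"
   proof
    fix j show "(\<lambda>j\<in>{1..<?l}. sh (h, k) (Suc j)) j = k j"
     using hk(3) by (cases "j \<in> {1..<?l}") (auto simp: sh PiE_iff extensional_def)
   qed
   then show "(sh hk 1, \<lambda>j\<in>{1..<?l}. sh hk (Suc j)) = hk" using l False by (simp add: hk(1) sh)
   show "sh hk \<in> ?H (m # p)"
   proof (rule PiE_I)
    fix j assume j: "j \<in> {1..<length (m # p)}"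
    show "sh hk j \<in> carrier (GL (sum_list (drop j (m # p))))"
    proof (cases "j = 1")
     case True
     then show ?thesis using hk(2) False by (simp add: hk(1) sh)
    next
     case neq: False
     then have "j - 1 \<in> {1..<?l}" "j - 1 ~= 0" using j by auto
     then show ?thesis using PiE_mem[OF hk(3), of "j - 1"] j by (simp add: hk(1) sh drop_Cons')
    qed
   qed (auto simp: hk(1) sh_def)
  qed
  also have "... = (\<Sum>h\<in>carrier (GL ?N). \<alpha> 0 (det x / det h) * of_nat (emb_count x h) * (\<Sum>k\<in>?H p. chain_weight p ?\<alpha> (k(0 := h))))"
   by (simp add: sum.cartesian_product[symmetric] sum_distrib_left)
  also have "... = (\<Sum>h\<in>carrier (GL ?N). \<alpha> 0 (det x / det h) * of_nat (emb_count x h) * ind_weight p ?\<alpha> h) *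
    (\<Prod>j\<in>{1..<?l}. of_nat (card (carrier (GL (sum_list (drop j p))) :: 'a mat set)))"
   unfolding sum_distrib_right
  proof (intro sum.cong refl)
   fix h :: "'a mat" assume "h \<in> carrier (GL ?N)"
   then show "\<alpha> 0 (det x / det h) * of_nat (emb_count x h) * (\<Sum>k\<in>?H p. chain_weight p ?\<alpha> (k(0 := h))) =
    \<alpha> 0 (det x / det h) * of_nat (emb_count x h) * ind_weight p ?\<alpha> h *
    (\<Prod>j\<in>{1..<?l}. of_nat (card (carrier (GL (sum_list (drop j p))) :: 'a mat set)))"
    using Cons.IH[OF False, of h ?\<alpha>] by (simp only: mult.assoc)
  qed
  also have "... = ind_weight (m # p) \<alpha> x * of_nat (card (carrier (GL ?N) :: 'a mat set)) *
    (\<Prod>j\<in>{1..<?l}. of_nat (card (carrier (GL (sum_list (drop j p))) :: 'a mat set)))"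
   using ind_weight_Cons[OF x, of \<alpha>] card_GL_pos[of ?N, where 'a = 'a] by simp
  also have "... = ind_weight (m # p) \<alpha> x * (of_nat (card (carrier (GL ?N) :: 'a mat set)) *
    (\<Prod>j\<in>{1..<?l}. of_nat (card (carrier (GL (sum_list (drop j p))) :: 'a mat set))))"
   by (simp only: mult.assoc)
  also have "of_nat (card (carrier (GL ?N) :: 'a mat set)) * (\<Prod>j\<in>{1..<?l}. of_nat (card (carrier (GL (sum_list (drop j p))) :: 'a mat set)))
   = (\<Prod>j\<in>{1..<Suc ?l}. of_nat (card (carrier (GL (sum_list (drop j (m # p)))) :: 'a mat set)) :: complex)"
  proof -
   have "(\<Prod>j\<in>{1..<Suc ?l}. of_nat (card (carrier (GL (sum_list (drop j (m # p)))) :: 'a mat set)) :: complex)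
    = (\<Prod>j\<in>{0..<?l}. of_nat (card (carrier (GL (sum_list (drop j p))) :: 'a mat set)))"
    by (rule prod.reindex_bij_witness[of _ Suc "%j. j - 1"]) (auto simp: drop_Cons')
   also have "{0..<?l} = insert 0 {1..<?l}" using l by auto
   finally show ?thesis by simp
  qed
  finally show ?thesis by simp
 qed
qed simp

section \<open>Counting orbits with trivial character on the stabilizers\<close>

lemma group_actionI:
 assumes "Group.group G" and closed: "!!g x. g \<in> carrier G ==> x \<in> E ==> act g x \<in> E"
  and one: "!!x. x \<in> E ==> act \<one>\<^bsub>G\<^esub> x = x"
  and mult: "!!g h x. g \<in> carrier G ==> h \<in> carrier G ==> x \<in> E ==> act (g \<otimes>\<^bsub>G\<^esub> h) x = act g (act h x)"
 shows "group_action G E (%g. restrict (act g) E)"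
proof -
 interpret Group.group G by fact
 have bij: "restrict (act g) E \<in> Bij E" if g: "g \<in> carrier G" for g
 proof -
  have "bij_betw (act g) E E"
   by (rule bij_betw_byWitness[of _ "act (inv\<^bsub>G\<^esub> g)"])
    (use g closed one mult[of "inv\<^bsub>G\<^esub> g" g] mult[of g "inv\<^bsub>G\<^esub> g"] in auto)
  then show ?thesis by (auto simp: Bij_def)
 qed
 have "(%g. restrict (act g) E) \<in> hom G (BijGroup E)"
 proof (rule homI)
  show "restrict (act g) E \<in> carrier (BijGroup E)" if "g \<in> carrier G" for g
   using bij[OF that] by (simp add: BijGroup_def)
  show "restrict (act (g \<otimes>\<^bsub>G\<^esub> h)) E = restrict (act g) E \<otimes>\<^bsub>BijGroup E\<^esub> restrict (act h) E"
   if gh: "g \<in> carrier G" "h \<in> carrier G" for g h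
   using bij[OF gh(1)] bij[OF gh(2)] mult[OF gh] closed[OF gh(2)]
   by (auto simp: BijGroup_def compose_def fun_eq_iff)
 qed
 then show ?thesis unfolding group_action_def group_hom_def group_hom_axioms_def
  using group_BijGroup is_group by blast
qed

text \<open>Summed over a stabilizer, a linear character gives the order of the stabilizer if it is trivial there and \<open>0\<close>
otherwise; triviality depends only on the orbit. The orbit-stabilizer theorem does the rest.\<close>

theorem (in group_action) weighted_burnside:
 fixes \<theta> :: "_ => complex"
 assumes fin: "finite (carrier G)" "finite E"
  and hom: "!!g h. g \<in> carrier G ==> h \<in> carrier G ==> \<theta> (g \<otimes> h) = \<theta> g * \<theta> h"
  and one: "\<theta> \<one> = 1"
 shows "(\<Sum>g\<in>carrier G. \<theta> g * of_nat (card {x \<in> E. \<phi> g x = x})) =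
  of_nat (card (carrier G)) * of_nat (card (orbit G \<phi> ` {x \<in> E. \<forall>g\<in>carrier G. \<phi> g x = x --> \<theta> g = 1}))"
proof -
 interpret G: Group.group G using group_hom by (simp add: group_hom_def)
 define S where "S x = {g \<in> carrier G. \<phi> g x = x}" for x
 define T where "T x \<longleftrightarrow> (\<forall>g\<in>S x. \<theta> g = 1)" for x
 have S_sub: "subgroup (S x) G" if "x \<in> E" for x
  using stabilizer_subgroup[OF that] by (simp add: S_def stabilizer_def)
 have finS: "finite (S x)" for x using fin(1) by (simp add: S_def)
 have sumS: "(\<Sum>g\<in>S x. \<theta> g) = (if T x then of_nat (card (S x)) else 0)" if x: "x \<in> E" for x
 proof (cases "T x")
  case True then show ?thesis by (simp add: T_def)
 next
  case False
  then obtain s where s: "s \<in> S x" "\<theta> s ~= 1" by (auto simp: T_def)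
  have sG: "s \<in> carrier G" using s(1) by (simp add: S_def)
  have "(\<Sum>g\<in>S x. \<theta> g) = (\<Sum>g\<in>S x. \<theta> (s \<otimes> g))"
  proof (rule sum.reindex_bij_witness[of _ "%g. s \<otimes> g" "%g. inv s \<otimes> g"])
   fix g assume g: "g \<in> S x"
   then have gG: "g \<in> carrier G" by (simp add: S_def)
   show "s \<otimes> (inv s \<otimes> g) = g" "inv s \<otimes> (s \<otimes> g) = g"
    using gG sG by (simp_all add: G.m_assoc[symmetric])
   then show "\<theta> (s \<otimes> (inv s \<otimes> g)) = \<theta> g" by simp
   show "inv s \<otimes> g \<in> S x" "s \<otimes> g \<in> S x" 
    using subgroup.m_closed[OF S_sub[OF x]] subgroup.m_inv_closed[OF S_sub[OF x]] s(1) g by blast+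
  qed
  also have "... = \<theta> s * (\<Sum>g\<in>S x. \<theta> g)"
   unfolding sum_distrib_left by (intro sum.cong refl hom sG) (simp add: S_def)
  finally have "(\<theta> s - 1) * (\<Sum>g\<in>S x. \<theta> g) = 0" by (simp add: algebra_simps)
  then show ?thesis using s(2) False by simp
 qed
 have inv_act: "\<phi> (inv g) (\<phi> g x) = x" if g: "g \<in> carrier G" and x: "x \<in> E" for g x
 proof -
  have "\<phi> (inv g) (\<phi> g x) = \<phi> (inv g \<otimes> g) x" using composition_rule[OF x G.inv_closed[OF g] g] by simp
  also have "... = (\<lambda>x\<in>E. x) x" using g id_eq_one by simp
  finally show ?thesis using x by simp
 qed
 have T_inv: "T (\<phi> g x)" if g: "g \<in> carrier G" and x: "x \<in> E" and T: "T x" for g x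
  unfolding T_def
 proof
  fix s assume s: "s \<in> S (\<phi> g x)"
  then have sG: "s \<in> carrier G" and fx: "\<phi> s (\<phi> g x) = \<phi> g x" by (auto simp: S_def)
  let ?c = "inv g \<otimes> s \<otimes> g"
  have "\<phi> ?c x = \<phi> (inv g) (\<phi> s (\<phi> g x))"
   using g x sG composition_rule[of "\<phi> g x" "inv g" s] composition_rule[of x "inv g \<otimes> s" g] element_image[OF g x refl] by simp
  also have "... = x" unfolding fx using inv_act[OF g x] .
  finally have "?c \<in> S x" using g sG by (simp add: S_def)
  then have "\<theta> ?c = 1" using T by (simp add: T_def)
  then have "\<theta> (inv g) * \<theta> s * \<theta> g = 1" using hom g sG by simp
  moreover have "\<theta> (inv g) * \<theta> g = 1" using hom[of "inv g" g] g one by simp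
  ultimately show "\<theta> s = 1" 
  proof -
   assume 1: "\<theta> (inv g) * \<theta> s * \<theta> g = 1" and 2: "\<theta> (inv g) * \<theta> g = 1"
   have "\<theta> s * (\<theta> (inv g) * \<theta> g) = 1" using 1 by (simp add: mult_ac)
   then show ?thesis unfolding 2 by simp
  qed
 qed
 have T_orbit: "T y \<longleftrightarrow> T x" if x: "x \<in> E" and y: "y \<in> orbit G \<phi> x" for x y
 proof -
  obtain g where g: "g \<in> carrier G" "y = \<phi> g x" using y by (auto simp: orbit_def)
  have yE: "y \<in> E" using element_image[OF g(1) x] g(2) by simp
  have "x = \<phi> (inv g) y" unfolding g(2) using inv_act[OF g(1) x] by simp
  then show ?thesis using T_inv[OF g(1) x] T_inv[OF G.inv_closed[OF g(1)] yE] g(2) by auto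
 qed
 have orb_eq: "orbit G \<phi> y = orbit G \<phi> x" if x: "x \<in> E" and y: "y \<in> orbit G \<phi> x" for x y
 proof -
  have yE: "y \<in> E" using y x element_image by (auto simp: orbit_def)
  have "orbit G \<phi> y \<in> orbits G E \<phi>" "orbit G \<phi> x \<in> orbits G E \<phi>" using x yE by (auto simp: orbits_def)
  from disjoint_union[OF this] show ?thesis using y orbit_refl[OF yE] by blast
 qed
 have finO: "finite (orbit G \<phi> x)" if "x \<in> E" for x
  using fin(1) by (simp add: orbit_def)
 have "(\<Sum>g\<in>carrier G. \<theta> g * of_nat (card {x \<in> E. \<phi> g x = x})) = (\<Sum>g\<in>carrier G. \<Sum>x\<in>{x \<in> E. \<phi> g x = x}. \<theta> g)"
  by (simp add: mult.commute)
 also have "... = (\<Sum>x\<in>E. \<Sum>g\<in>S x. \<theta> g)"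
  unfolding S_def by (rule sum.swap_restrict[OF fin])
 also have "... = (\<Sum>x\<in>E. if T x then of_nat (card (S x)) else 0)" by (intro sum.cong refl sumS)
 also have "... = (\<Sum>Ob\<in>orbits G E \<phi>. \<Sum>x\<in>Ob. if T x then of_nat (card (S x)) else 0)"
  by (rule disjoint_sum[OF fin(2), symmetric])
 also have "... = (\<Sum>Ob\<in>orbits G E \<phi>. if Ob \<in> orbit G \<phi> ` {x \<in> E. T x} then of_nat (card (carrier G)) else 0)"
 proof (intro sum.cong refl)
  fix Ob assume "Ob \<in> orbits G E \<phi>"
  then obtain x where x: "x \<in> E" "Ob = orbit G \<phi> x" by (auto simp: orbits_def)
  have "Ob \<in> orbit G \<phi> ` {x \<in> E. T x} \<longleftrightarrow> T x"
  proof
   assume "Ob \<in> orbit G \<phi> ` {x \<in> E. T x}"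
   then obtain y where y: "y \<in> E" "T y" "orbit G \<phi> y = orbit G \<phi> x" using x by auto
   then have "y \<in> orbit G \<phi> x" using orbit_refl[OF y(1)] by simp
   then show "T x" using T_orbit[OF x(1)] y(2) by blast
  qed (use x in auto)
  moreover have "(\<Sum>y\<in>Ob. if T y then of_nat (card (S y)) else 0) = (if T x then of_nat (card (carrier G)) else (0 :: complex))"
  proof (cases "T x")
   case True
   have st: "card Ob * card (S y) = card (carrier G)" if y: "y \<in> Ob" for y
   proof -
    have "y \<in> E" using y x element_image by (auto simp: orbit_def)
    then show ?thesis using orbit_stabilizer_theorem[of y] orb_eq[OF x(1)] y x(2)
     by (simp add: S_def stabilizer_def Coset.order_def)
   qed
   have "x \<in> Ob" using orbit_refl x by simp
   then have pos: "card Ob > 0" using finO x by (auto simp: card_gt_0_iff)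
   have "(\<Sum>y\<in>Ob. if T y then of_nat (card (S y)) else (0::complex)) = (\<Sum>y\<in>Ob. of_nat (card (carrier G)) / of_nat (card Ob))"
   proof (intro sum.cong refl)
    fix y assume y: "y \<in> Ob"
    have "of_nat (card (carrier G)) = (of_nat (card Ob) * of_nat (card (S y)) :: complex)"
     unfolding st[OF y, symmetric] by simp
    then show "(if T y then of_nat (card (S y)) else (0::complex)) = of_nat (card (carrier G)) / of_nat (card Ob)"
     using T_orbit[OF x(1)] y x(2) True pos by simp
   qed
   then show ?thesis using True pos by simp
  next
   case False
   then show ?thesis using T_orbit[OF x(1)] x(2) by simp
  qed
  ultimately show "(\<Sum>y\<in>Ob. if T y then of_nat (card (S y)) else 0) =
   (if Ob \<in> orbit G \<phi> ` {x \<in> E. T x} then of_nat (card (carrier G)) else (0 :: complex))" by simp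
 qed
 also have "... = of_nat (card (carrier G)) * of_nat (card (orbit G \<phi> ` {x \<in> E. T x}))"
 proof -
  have "orbit G \<phi> ` {x \<in> E. T x} \<subseteq> orbits G E \<phi>" by (auto simp: orbits_def)
  moreover have "finite (orbits G E \<phi>)"
  proof -
   have "orbits G E \<phi> = orbit G \<phi> ` E" by (auto simp: orbits_def)
   then show ?thesis using fin(2) by simp
  qed
  ultimately show ?thesis by (simp add: sum.If_cases Int_absorb1 Int_commute)
 qed
 also have "{x \<in> E. T x} = {x \<in> E. \<forall>g\<in>carrier G. \<phi> g x = x --> \<theta> g = 1}"
  by (auto simp: T_def S_def)
 finally show ?thesis .
qed

section \<open>Finite sets lie in finite extensions\<close>

lemma to_ac_subfield: "subfield (range (to_ac :: 'a::field => _)) (ring_of_type_algebra :: 'a alg_closure ring)"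
proof -
 let ?R = "ring_of_type_algebra :: 'a alg_closure ring"
 interpret R: field ?R by (rule field_from_type_algebra)
 have R_simps: "carrier ?R = UNIV" "!!x y. x \<otimes>\<^bsub>?R\<^esub> y = x * y" "!!x y. x \<oplus>\<^bsub>?R\<^esub> y = x + y" "\<one>\<^bsub>?R\<^esub> = 1" "\<zero>\<^bsub>?R\<^esub> = 0"
  by (simp_all add: ring_of_type_algebra_def)
 have neg: "\<ominus>\<^bsub>?R\<^esub> x = - x" for x
  by (rule R.minus_equality) (auto simp: R_simps)
 have inv: "inv\<^bsub>?R\<^esub> x = inverse x" if "x ~= 0" for x
  by (rule R.comm_inv_char) (use that in \<open>auto simp: R_simps\<close>)
 show ?thesis
 proof (rule R.subfieldI')
  show "subring (range to_ac) ?R"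
   by (rule R.subringI) (auto simp: R_simps neg simp flip: to_ac_1 to_ac_minus to_ac_mult to_ac_add)
  fix k assume "k \<in> range to_ac - {\<zero>\<^bsub>?R\<^esub>}"
  then show "inv\<^bsub>?R\<^esub> k \<in> range (to_ac :: 'a => _)"
   using inv[of k] by (auto simp: R_simps simp flip: to_ac_inverse)
 qed
qed

lemma alg_closure_algebraic_over_base:
 fixes x :: "'a::field alg_closure"
 shows "(ring.algebraic ring_of_type_algebra over (range (to_ac :: 'a => _))) x"
proof -
 let ?R = "ring_of_type_algebra :: 'a alg_closure ring"
 interpret R: field ?R by (rule field_from_type_algebra)
 have R_simps: "carrier ?R = UNIV" "!!x y. x \<otimes>\<^bsub>?R\<^esub> y = x * y" "!!x y. x \<oplus>\<^bsub>?R\<^esub> y = x + y" "\<one>\<^bsub>?R\<^esub> = 1" "\<zero>\<^bsub>?R\<^esub> = 0"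
  by (simp_all add: ring_of_type_algebra_def)
 have pow: "y [^]\<^bsub>?R\<^esub> n = y ^ n" for y and n :: nat
  by (induction n) (auto simp: R_simps mult.commute)
 obtain P :: "'a poly" where P: "P ~= 0" "poly (map_poly to_ac P) x = 0"
  using alg_closure_algebraic by blast
 have ev: "R.eval (rev cs) x = poly (Poly cs) x" for cs
 proof (induction cs rule: rev_induct)
  case Nil
  then show ?case by (simp add: R_simps)
 next
  case (snoc c cs)
  then show ?case by (simp add: R_simps pow Poly_append poly_monom add.commute)
 qed
 let ?p = "rev (coeffs (map_poly to_ac P))"
 have nz: "map_poly to_ac P ~= 0" using P(1) by (simp add: map_poly_eq_0_iff)
 have "R.eval ?p x = 0" unfolding ev using P(2) by simp
 moreover have "?p ~= []" using nz by simp
 moreover have "set ?p \<subseteq> range to_ac"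
  by (auto simp: coeffs_def coeff_map_poly split: if_splits)
 moreover have "hd ?p ~= 0" using nz by (simp add: hd_rev last_coeffs_eq_coeff_degree)
 ultimately show ?thesis
  by (intro R.algebraicI[of ?p]) (auto simp: univ_poly_carrier[symmetric] polynomial_def R_simps)
qed

text \<open>Every element of the closure is algebraic, so adjoining finitely many is a finite extension.\<close>

lemma finite_subset_of_finite_extension:
 assumes "finite (S :: 'a::field alg_closure set)"
 shows "\<exists>K\<in>finite_extensions. S \<subseteq> K"
proof -
 let ?R = "ring_of_type_algebra :: 'a alg_closure ring"
 interpret R: field ?R by (rule field_from_type_algebra)
 have car: "carrier ?R = UNIV" by (simp add: ring_of_type_algebra_def)
 obtain xs where xs: "set xs = S" using finite_list[OF assms] by blast
 let ?F = "range (to_ac :: 'a => _)"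
 let ?K = "R.finite_extension ?F xs"
 note sub = to_ac_subfield[where 'a = 'a]
 have xsc: "set xs \<subseteq> carrier ?R" by (simp add: car)
 have "subfield ?K ?R" by (rule R.finite_extension_is_subfield[OF sub xsc alg_closure_algebraic_over_base])
 moreover have "?F \<subseteq> ?K" by (rule R.finite_extension_incl) (auto simp: car)
 moreover have "R.finite_dimension ?F ?K" by (rule R.finite_extension_finite_dimension(1)[OF sub xsc alg_closure_algebraic_over_base])
 moreover have "S \<subseteq> ?K" using R.finite_extension_mem[OF subfieldE(1)[OF sub] xsc] xs by simp
 ultimately show ?thesis unfolding finite_extensions_def by blast
qed

section \<open>Decompositions and idempotent endomorphisms\<close>

definition finite_quiver :: "('v, 'e) pre_digraph => bool" where
 "finite_quiver Q \<longleftrightarrow> finite (verts Q) & finite (arcs Q) & head Q ` arcs Q \<subseteq> verts Q & tail Q ` arcs Q \<subseteq> verts Q"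

definition rep_endo :: "('v, 'e) pre_digraph => ('v => nat) => ('e => 'b::field mat) => ('v => 'b mat) => bool" where
 "rep_endo Q v \<phi> e \<longleftrightarrow> (\<forall>x\<in>verts Q. e x \<in> Mat (v x) (v x)) &
   (\<forall>a\<in>arcs Q. e (head Q a) * \<phi> a = \<phi> a * e (tail Q a))"

definition idem_endo :: "('v, 'e) pre_digraph => ('v => nat) => ('e => 'b::field mat) => ('v => 'b mat) => bool" where
 "idem_endo Q v \<phi> e \<longleftrightarrow> rep_endo Q v \<phi> e & (\<forall>x\<in>verts Q. e x * e x = e x) &
   (\<exists>x\<in>verts Q. e x ~= 0\<^sub>m (v x) (v x)) & (\<exists>x\<in>verts Q. e x ~= 1\<^sub>m (v x))"

lemma unit_diag_mult_left:
 assumes "M \<in> Mat r c" "i < r" "j < c"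
 shows "(unit_diag r r \<rho> * M) $$ (i,j) = (if i < \<rho> then M $$ (i,j) else 0)"
proof -
 have "(unit_diag r r \<rho> * M) $$ (i,j) = (\<Sum>l<r. unit_diag r r \<rho> $$ (i,l) * M $$ (l,j))"
  using assms by (intro mat_mult_entry) auto
 also have "... = (\<Sum>l<r. if l = i then (if i < \<rho> then M $$ (i,j) else 0) else 0)"
  using assms by (intro sum.cong) (auto simp: unit_diag_def)
 finally show ?thesis using assms by simp
qed

lemma unit_diag_mult_right:
 assumes "M \<in> Mat r c" "i < r" "j < c"
 shows "(M * unit_diag c c \<rho>) $$ (i,j) = (if j < \<rho> then M $$ (i,j) else 0)"
proof -
 have "(M * unit_diag c c \<rho>) $$ (i,j) = (\<Sum>l<c. M $$ (i,l) * unit_diag c c \<rho> $$ (l,j))"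
  using assms by (intro mat_mult_entry) auto
 also have "... = (\<Sum>l<c. if l = j then (if j < \<rho> then M $$ (i,j) else 0) else 0)"
  using assms by (intro sum.cong) (auto simp: unit_diag_def)
 finally show ?thesis using assms by simp
qed

lemma decomposition_imp_idem_endo:
 fixes \<phi> :: "'e => 'b::field mat"
 assumes Q: "finite_quiver Q" and \<phi>: "\<phi> \<in> quiver_reps Q v UNIV"
  and v1: "\<exists>x\<in>verts Q. v1 x ~= 0" and v2: "\<exists>x\<in>verts Q. v2 x ~= 0" and v: "\<forall>x\<in>verts Q. v x = v1 x + v2 x"
  and \<phi>1: "\<phi>1 \<in> quiver_reps Q v1 UNIV" and \<phi>2: "\<phi>2 \<in> quiver_reps Q v2 UNIV"
  and iso: "rep_iso Q v UNIV \<phi> (rep_direct_sum Q \<phi>1 \<phi>2)"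
 shows "\<exists>e. idem_endo Q v \<phi> e"
proof -
 obtain h where h: "!!x. x \<in> verts Q ==> h x \<in> carrier (GL (v x))"
  and h_arc: "!!a. a \<in> arcs Q ==> h (head Q a) * \<phi> a = rep_direct_sum Q \<phi>1 \<phi>2 a * h (tail Q a)"
  using iso unfolding rep_iso_def by blast
 define h' where "h' x = inv\<^bsub>GL (v x)\<^esub> (h x)" for x
 have hc: "h x \<in> Mat (v x) (v x)" "h' x \<in> Mat (v x) (v x)" "h x * h' x = 1\<^sub>m (v x)" "h' x * h x = 1\<^sub>m (v x)"
  if "x \<in> verts Q" for x
  using h[OF that] GL_inv_closed[OF h[OF that]] GL_l_inv[OF h[OF that]] GL_r_inv[OF h[OF that]] by (auto simp: h'_def GL_iff)
 define \<Delta> where "\<Delta> x = (unit_diag (v x) (v x) (v1 x) :: 'b mat)" for x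
 have \<Delta>c: "\<Delta> x \<in> Mat (v x) (v x)" "dim_row (\<Delta> x) = v x" "dim_col (\<Delta> x) = v x" for x by (auto simp: \<Delta>_def)
 have \<Delta>\<Delta>: "\<Delta> x * \<Delta> x = \<Delta> x" if "x \<in> verts Q" for x unfolding \<Delta>_def using v that by (simp add: unit_diag_mult)
 define e where "e x = h' x * (\<Delta> x * h x)" for x
 have ec: "e x \<in> Mat (v x) (v x)" if "x \<in> verts Q" for x using hc[OF that] \<Delta>c by (auto simp: e_def)
 have he: "h x * e x = \<Delta> x * h x" if "x \<in> verts Q" for x
 proof -
  have "h x * e x = (h x * h' x) * (\<Delta> x * h x)" unfolding e_def using hc(1,2)[OF that] \<Delta>c by (simp add: mat_assoc del: assoc_mult_mat)
  then show ?thesis using hc[OF that] \<Delta>c by (simp add: mat_one_left)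
 qed
 have idem: "e x * e x = e x" if "x \<in> verts Q" for x
 proof -
  have "e x * e x = h' x * (\<Delta> x * (h x * e x))" using hc(1,2)[OF that] \<Delta>c ec[OF that] by (simp add: e_def mat_assoc del: assoc_mult_mat)
  also have "... = h' x * ((\<Delta> x * \<Delta> x) * h x)" unfolding he[OF that] using hc(1,2)[OF that] \<Delta>c by (simp add: mat_assoc del: assoc_mult_mat)
  finally show ?thesis unfolding \<Delta>\<Delta>[OF that] e_def .
 qed
 have ends: "head Q a \<in> verts Q" "tail Q a \<in> verts Q" if "a \<in> arcs Q" for a using Q that by (auto simp: finite_quiver_def)
 have endo: "e (head Q a) * \<phi> a = \<phi> a * e (tail Q a)" if a: "a \<in> arcs Q" for a
 proof -
  let ?x = "head Q a" and ?y = "tail Q a"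
  note x = ends(1)[OF a] and y = ends(2)[OF a]
  have \<phi>c: "\<phi> a \<in> Mat (v ?x) (v ?y)" using \<phi> a by (auto simp: quiver_reps_def PiE_iff)
  have c1: "\<phi>1 a \<in> Mat (v1 ?x) (v1 ?y)" "\<phi>2 a \<in> Mat (v2 ?x) (v2 ?y)"
   using \<phi>1 \<phi>2 a by (auto simp: quiver_reps_def PiE_iff)
  define S where "S = rep_direct_sum Q \<phi>1 \<phi>2 a"
  have S: "S = four_block_mat (\<phi>1 a) (0\<^sub>m (v1 ?x) (v2 ?y)) (0\<^sub>m (v2 ?x) (v1 ?y)) (\<phi>2 a)"
   using a c1 by (simp add: S_def rep_direct_sum_def)
  have Sc: "S \<in> Mat (v ?x) (v ?y)" unfolding S using c1 v x y by auto
  have DS: "\<Delta> ?x * S = S * \<Delta> ?y"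
  proof (rule eq_matI)
   fix i j assume "i < dim_row (S * \<Delta> ?y)" "j < dim_col (S * \<Delta> ?y)"
   then have ij: "i < v ?x" "j < v ?y" using Sc \<Delta>c by auto
   have "S $$ (i,j) = 0" if "(i < v1 ?x) ~= (j < v1 ?y)" using that ij c1 v x y unfolding S by auto
   then show "(\<Delta> ?x * S) $$ (i,j) = (S * \<Delta> ?y) $$ (i,j)"
    unfolding \<Delta>_def unit_diag_mult_left[OF Sc ij] unit_diag_mult_right[OF Sc ij] by auto
  qed (use Sc \<Delta>c in auto)
  have hS: "h ?x * \<phi> a = S * h ?y" using h_arc[OF a] by (simp add: S_def)
  have "e ?x * \<phi> a = h' ?x * (\<Delta> ?x * (h ?x * \<phi> a))" using hc(1,2)[OF x] \<Delta>c \<phi>c by (simp add: e_def mat_assoc del: assoc_mult_mat)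
  also have "... = h' ?x * ((\<Delta> ?x * S) * h ?y)" unfolding hS using hc(1,2)[OF x] hc(1,2)[OF y] \<Delta>c Sc by (simp add: mat_assoc del: assoc_mult_mat)
  also have "... = h' ?x * (S * (h ?y * e ?y))" unfolding DS he[OF y] using hc(1,2)[OF x] hc(1,2)[OF y] \<Delta>c Sc by (simp add: mat_assoc del: assoc_mult_mat)
  also have "... = h' ?x * ((S * h ?y) * e ?y)" using hc(1,2)[OF x] hc(1,2)[OF y] Sc ec[OF y] by (simp add: mat_assoc del: assoc_mult_mat)
  also have "... = (h' ?x * h ?x) * (\<phi> a * e ?y)" unfolding hS[symmetric] using hc(1,2)[OF x] \<phi>c ec[OF y] by (simp add: mat_assoc del: assoc_mult_mat)
  also have "... = \<phi> a * e ?y" using hc(4)[OF x] \<phi>c by (simp add: mat_one_left)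
  finally show ?thesis .
 qed
 have conj: "h x * e x * h' x = \<Delta> x" if "x \<in> verts Q" for x
  unfolding he[OF that] using hc[OF that] \<Delta>c by (simp add: mat_assoc del: assoc_mult_mat)
 have "\<exists>x\<in>verts Q. e x ~= 0\<^sub>m (v x) (v x)"
 proof -
  obtain x where x: "x \<in> verts Q" "v1 x ~= 0" using v1 by blast
  have "\<Delta> x $$ (0,0) = 1" using x v by (simp add: \<Delta>_def unit_diag_def)
  moreover have "\<Delta> x = 0\<^sub>m (v x) (v x)" if "e x = 0\<^sub>m (v x) (v x)" using conj[OF x(1)] hc[OF x(1)] unfolding that by simp
  ultimately show ?thesis using x v by (intro bexI[of _ x]) auto
 qed
 moreover have "\<exists>x\<in>verts Q. e x ~= 1\<^sub>m (v x)"
 proof -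
  obtain x where x: "x \<in> verts Q" "v2 x ~= 0" using v2 by blast
  have "\<Delta> x $$ (v1 x, v1 x) = 0" using x v by (simp add: \<Delta>_def unit_diag_def)
  moreover have "\<Delta> x = 1\<^sub>m (v x)" if "e x = 1\<^sub>m (v x)" using conj[OF x(1)] hc[OF x(1)] unfolding that by simp
  ultimately show ?thesis using x v by (intro bexI[of _ x]) auto
 qed
 ultimately show ?thesis unfolding idem_endo_def rep_endo_def using ec idem endo by (intro exI[of _ e]) blast
qed

text \<open>Diagonalizing the idempotent at each vertex makes every arrow block diagonal.\<close>

lemma idem_endo_imp_decomposition:
 fixes \<phi> :: "'e => 'b::field mat"
 assumes Q: "finite_quiver Q" and \<phi>: "\<phi> \<in> quiver_reps Q v UNIV" and e: "idem_endo Q v \<phi> e"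
 shows "\<exists>v1 v2 \<phi>1 \<phi>2. (\<exists>x\<in>verts Q. v1 x ~= 0) & (\<exists>x\<in>verts Q. v2 x ~= 0) & (\<forall>x\<in>verts Q. v x = v1 x + v2 x) &
  \<phi>1 \<in> quiver_reps Q v1 UNIV & \<phi>2 \<in> quiver_reps Q v2 UNIV & rep_iso Q v UNIV \<phi> (rep_direct_sum Q \<phi>1 \<phi>2)"
proof -
 have ec: "!!x. x \<in> verts Q ==> e x \<in> Mat (v x) (v x)" and idem: "!!x. x \<in> verts Q ==> e x * e x = e x"
  and endo: "!!a. a \<in> arcs Q ==> e (head Q a) * \<phi> a = \<phi> a * e (tail Q a)"
  using e unfolding idem_endo_def rep_endo_def by auto
 have "\<forall>x\<in>verts Q. \<exists>\<rho>. idem_rank (e x) (v x) \<rho>" using idem_rank_exists ec idem by blast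
 then obtain \<rho> where \<rho>: "!!x. x \<in> verts Q ==> idem_rank (e x) (v x) (\<rho> x)" by (auto dest!: bchoice)
 then have "\<forall>x\<in>verts Q. \<exists>h. h \<in> carrier (GL (v x)) & h * e x = unit_diag (v x) (v x) (\<rho> x) * h"
  unfolding idem_rank_def by blast
 then obtain h where h: "!!x. x \<in> verts Q ==> h x \<in> carrier (GL (v x))" "!!x. x \<in> verts Q ==> h x * e x = unit_diag (v x) (v x) (\<rho> x) * h x"
  by (auto dest!: bchoice)
 have \<rho>_le: "\<rho> x <= v x" if "x \<in> verts Q" for x using \<rho>[OF that] by (simp add: idem_rank_def)
 define h' where "h' x = inv\<^bsub>GL (v x)\<^esub> (h x)" for x
 have hc: "h x \<in> Mat (v x) (v x)" "h' x \<in> Mat (v x) (v x)" "h x * h' x = 1\<^sub>m (v x)" "h' x * h x = 1\<^sub>m (v x)"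
  if "x \<in> verts Q" for x
  using h(1)[OF that] GL_inv_closed[OF h(1)[OF that]] GL_l_inv[OF h(1)[OF that]] GL_r_inv[OF h(1)[OF that]] by (auto simp: h'_def GL_iff)
 have ends: "head Q a \<in> verts Q" "tail Q a \<in> verts Q" if "a \<in> arcs Q" for a using Q that by (auto simp: finite_quiver_def)
 define S where "S a = h (head Q a) * \<phi> a * h' (tail Q a)" for a
 define v2 where "v2 x = v x - \<rho> x" for x
 define \<phi>1 where "\<phi>1 = (\<lambda>a\<in>arcs Q. mat (\<rho> (head Q a)) (\<rho> (tail Q a)) (%(i,j). S a $$ (i,j)))"
 define \<phi>2 where "\<phi>2 = (\<lambda>a\<in>arcs Q. mat (v2 (head Q a)) (v2 (tail Q a)) (%(i,j). S a $$ (\<rho> (head Q a) + i, \<rho> (tail Q a) + j)))"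
 have S_arc: "h (head Q a) * \<phi> a = S a * h (tail Q a)" and S_block: "rep_direct_sum Q \<phi>1 \<phi>2 a = S a" if a: "a \<in> arcs Q" for a
 proof -
  let ?x = "head Q a" and ?y = "tail Q a"
  note x = ends(1)[OF a] and y = ends(2)[OF a]
  have \<phi>c: "\<phi> a \<in> Mat (v ?x) (v ?y)" using \<phi> a by (auto simp: quiver_reps_def PiE_iff)
  have Sc: "S a \<in> Mat (v ?x) (v ?y)" unfolding S_def using hc[OF x] hc[OF y] \<phi>c by auto
  show hS: "h ?x * \<phi> a = S a * h ?y" unfolding S_def using hc[OF x] hc[OF y] \<phi>c by (simp add: mat_assoc del: assoc_mult_mat)
  have hey: "h ?y * e ?y * h' ?y = unit_diag (v ?y) (v ?y) (\<rho> ?y)"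
   unfolding h(2)[OF y] using hc[OF y] by (simp add: mat_assoc del: assoc_mult_mat)
  have "unit_diag (v ?x) (v ?x) (\<rho> ?x) * S a = (h ?x * e ?x) * (\<phi> a * h' ?y)"
   unfolding h(2)[OF x] S_def using hc(1,2)[OF x] hc(1,2)[OF y] \<phi>c by (simp add: mat_assoc del: assoc_mult_mat)
  also have "... = h ?x * ((e ?x * \<phi> a) * h' ?y)" using hc(1,2)[OF x] hc(1,2)[OF y] \<phi>c ec[OF x] by (simp add: mat_assoc del: assoc_mult_mat)
  also have "... = (h ?x * \<phi> a) * (e ?y * h' ?y)" unfolding endo[OF a] using hc(1,2)[OF x] hc(1,2)[OF y] \<phi>c ec[OF y] by (simp add: mat_assoc del: assoc_mult_mat)
  also have "... = S a * (h ?y * e ?y * h' ?y)" unfolding hS using hc(1,2)[OF y] Sc ec[OF y] by (simp add: mat_assoc del: assoc_mult_mat)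
  finally have DS: "unit_diag (v ?x) (v ?x) (\<rho> ?x) * S a = S a * unit_diag (v ?y) (v ?y) (\<rho> ?y)" unfolding hey .
  have z: "S a $$ (i,j) = 0" if "i < v ?x" "j < v ?y" "(i < \<rho> ?x) ~= (j < \<rho> ?y)" for i j
   using arg_cong[OF DS, of "%M. M $$ (i,j)"] that unfolding unit_diag_mult_left[OF Sc that(1,2)] unit_diag_mult_right[OF Sc that(1,2)] by (auto split: if_splits)
  have d1: "\<phi>1 a = mat (\<rho> ?x) (\<rho> ?y) (%(i,j). S a $$ (i,j))"
   and d2: "\<phi>2 a = mat (v2 ?x) (v2 ?y) (%(i,j). S a $$ (\<rho> ?x + i, \<rho> ?y + j))" using a by (auto simp: \<phi>1_def \<phi>2_def)
  have "rep_direct_sum Q \<phi>1 \<phi>2 a = four_block_mat (\<phi>1 a) (0\<^sub>m (\<rho> ?x) (v2 ?y)) (0\<^sub>m (v2 ?x) (\<rho> ?y)) (\<phi>2 a)"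
   using a by (simp add: rep_direct_sum_def d1 d2)
  also have "... = S a"
  proof (rule eq_matI)
   fix i j assume "i < dim_row (S a)" "j < dim_col (S a)"
   then have ij: "i < v ?x" "j < v ?y" using Sc by auto
   then show "four_block_mat (\<phi>1 a) (0\<^sub>m (\<rho> ?x) (v2 ?y)) (0\<^sub>m (v2 ?x) (\<rho> ?y)) (\<phi>2 a) $$ (i,j) = S a $$ (i,j)"
    using z[OF ij] \<rho>_le[OF x] \<rho>_le[OF y] by (auto simp: d1 d2 v2_def)
  qed (use Sc \<rho>_le[OF x] \<rho>_le[OF y] in \<open>auto simp: d1 d2 v2_def\<close>)
  finally show "rep_direct_sum Q \<phi>1 \<phi>2 a = S a" .
 qed
 have "rep_iso Q v UNIV \<phi> (rep_direct_sum Q \<phi>1 \<phi>2)"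
  unfolding rep_iso_def using h(1) S_arc S_block by (intro exI[of _ h]) auto
 moreover have "\<phi>1 \<in> quiver_reps Q \<rho> UNIV" "\<phi>2 \<in> quiver_reps Q v2 UNIV"
  by (auto simp: quiver_reps_def \<phi>1_def \<phi>2_def)
 moreover have "\<exists>x\<in>verts Q. \<rho> x ~= 0"
 proof -
  obtain x where x: "x \<in> verts Q" "e x ~= 0\<^sub>m (v x) (v x)" using e unfolding idem_endo_def by blast
  then have "\<rho> x ~= 0" using \<rho>[OF x(1)] idem_rank_0[of "e x" "v x"] by auto
  then show ?thesis using x(1) by blast
 qed
 moreover have "\<exists>x\<in>verts Q. v2 x ~= 0"
 proof -
  obtain x where x: "x \<in> verts Q" "e x ~= 1\<^sub>m (v x)" using e unfolding idem_endo_def by blast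
  then have "\<rho> x ~= v x" using \<rho>[OF x(1)] idem_rank_full[of "e x" "v x"] by auto
  then show ?thesis using \<rho>_le[OF x(1)] x(1) by (intro bexI[of _ x]) (auto simp: v2_def)
 qed
 moreover have "\<forall>x\<in>verts Q. v x = \<rho> x + v2 x" using \<rho>_le by (auto simp: v2_def)
 ultimately show ?thesis by (intro exI[of _ \<rho>] exI[of _ v2] exI[of _ \<phi>1] exI[of _ \<phi>2]) simp
qed

lemma finite_elements_mat: "finite (elements_mat A)"
proof -
 have "elements_mat A \<subseteq> (%(i,j). A $$ (i,j)) ` ({..<dim_row A} \<times> {..<dim_col A})" by auto
 then show ?thesis by (rule finite_subset) auto
qed

text \<open>A decomposition over \<open>L\<close> involves finitely many matrix entries, and these lie in a finite extension.\<close>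

theorem absolutely_indecomposable_iff:
 fixes \<phi> :: "'e => 'a::field mat"
 assumes Q: "finite_quiver Q" and \<phi>: "\<phi> \<in> quiver_reps Q v UNIV"
 shows "absolutely_indecomposable Q v \<phi> \<longleftrightarrow>
  (\<exists>x\<in>verts Q. v x ~= 0) & \<not> (\<exists>e. idem_endo Q v (\<lambda>a\<in>arcs Q. ac_mat (\<phi> a)) e)"
proof -
 define \<psi> where "\<psi> = (\<lambda>a\<in>arcs Q. ac_mat (\<phi> a))"
 have \<psi>: "\<psi> \<in> quiver_reps Q v UNIV" using \<phi> by (auto simp: \<psi>_def quiver_reps_def PiE_iff)
 obtain K0 :: "'a alg_closure set" where K0: "K0 \<in> finite_extensions" using finite_subset_of_finite_extension[of "{}"] by auto
 have "absolutely_indecomposable Q v \<phi> \<longleftrightarrow> (\<forall>K\<in>finite_extensions. indecomposable_over Q v K \<psi>)"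
  by (simp add: absolutely_indecomposable_def \<psi>_def)
 also have "... \<longleftrightarrow> (\<exists>x\<in>verts Q. v x ~= 0) & \<not> (\<exists>e. idem_endo Q v \<psi> e)"
 proof (intro iffI conjI notI)
  assume ind: "\<forall>K\<in>finite_extensions. indecomposable_over Q v K \<psi>"
  have "indecomposable_over Q v K0 \<psi>" using ind K0 by (rule bspec)
  then show "\<exists>x\<in>verts Q. v x ~= 0" unfolding indecomposable_over_def by (rule conjunct1)
  assume "\<exists>e. idem_endo Q v \<psi> e"
  then obtain e where "idem_endo Q v \<psi> e" by blast
  from idem_endo_imp_decomposition[OF Q \<psi> this] obtain v1 v2 \<phi>1 \<phi>2 where
   d: "\<exists>x\<in>verts Q. v1 x ~= 0" "\<exists>x\<in>verts Q. v2 x ~= 0" "\<forall>x\<in>verts Q. v x = v1 x + v2 x"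
    "\<phi>1 \<in> quiver_reps Q v1 UNIV" "\<phi>2 \<in> quiver_reps Q v2 UNIV" "rep_iso Q v UNIV \<psi> (rep_direct_sum Q \<phi>1 \<phi>2)"
   by (elim exE conjE) (rule that)
  obtain h where h: "!!x. x \<in> verts Q ==> h x \<in> carrier (GL (v x))"
   "!!a. a \<in> arcs Q ==> h (head Q a) * \<psi> a = rep_direct_sum Q \<phi>1 \<phi>2 a * h (tail Q a)"
   using d(6) unfolding rep_iso_def by blast
  let ?S = "(\<Union>x\<in>verts Q. elements_mat (h x)) \<union> (\<Union>a\<in>arcs Q. elements_mat (\<phi>1 a) \<union> elements_mat (\<phi>2 a))"
  have "finite ?S" using Q by (auto simp: finite_quiver_def finite_elements_mat)
  from finite_subset_of_finite_extension[OF this] obtain K where K: "K \<in> finite_extensions" "?S \<subseteq> K"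
   by (elim bexE) (rule that)
  have Ka: "elements_mat (\<phi>1 a) \<subseteq> K" "elements_mat (\<phi>2 a) \<subseteq> K" if "a \<in> arcs Q" for a
   using K(2) that by blast+
  have Kx: "elements_mat (h x) \<subseteq> K" if "x \<in> verts Q" for x using K(2) that by blast
  have "\<phi>1 \<in> quiver_reps Q v1 K" "\<phi>2 \<in> quiver_reps Q v2 K"
   using d(4,5) Ka by (simp_all add: quiver_reps_def PiE_iff)
  moreover have "rep_iso Q v K \<psi> (rep_direct_sum Q \<phi>1 \<phi>2)"
   unfolding rep_iso_def using h Kx by (intro exI[of _ h] conjI ballI) simp_all
  ultimately have E: "\<exists>v1 v2 \<phi>1 \<phi>2. (\<exists>x\<in>verts Q. v1 x ~= 0) & (\<exists>x\<in>verts Q. v2 x ~= 0) & (\<forall>x\<in>verts Q. v x = v1 x + v2 x) &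
    \<phi>1 \<in> quiver_reps Q v1 K & \<phi>2 \<in> quiver_reps Q v2 K & rep_iso Q v K \<psi> (rep_direct_sum Q \<phi>1 \<phi>2)"
   using d(1-3) by (intro exI conjI)
  have "\<not> indecomposable_over Q v K \<psi>" unfolding indecomposable_over_def by (intro notI, elim conjE, erule notE, rule E)
  then show False using ind K(1) by blast
 next
  assume *: "(\<exists>x\<in>verts Q. v x ~= 0) & \<not> (\<exists>e. idem_endo Q v \<psi> e)"
  show "\<forall>K\<in>finite_extensions. indecomposable_over Q v K \<psi>"
  proof (intro ballI, rule ccontr)
   fix K assume nK: "\<not> indecomposable_over Q v K \<psi>"
   have "\<exists>v1 v2 \<phi>1 \<phi>2. (\<exists>x\<in>verts Q. v1 x ~= 0) & (\<exists>x\<in>verts Q. v2 x ~= 0) & (\<forall>x\<in>verts Q. v x = v1 x + v2 x) &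
     \<phi>1 \<in> quiver_reps Q v1 K & \<phi>2 \<in> quiver_reps Q v2 K & rep_iso Q v K \<psi> (rep_direct_sum Q \<phi>1 \<phi>2)"
    (is ?E)
   proof (rule ccontr)
    assume "\<not> ?E"
    with conjunct1[OF *] have "indecomposable_over Q v K \<psi>" unfolding indecomposable_over_def by (rule conjI)
    then show False using nK by simp
   qed
   then obtain v1 v2 \<phi>1 \<phi>2 where
    d: "\<exists>x\<in>verts Q. v1 x ~= 0" "\<exists>x\<in>verts Q. v2 x ~= 0" "\<forall>x\<in>verts Q. v x = v1 x + v2 x"
     "\<phi>1 \<in> quiver_reps Q v1 K" "\<phi>2 \<in> quiver_reps Q v2 K" "rep_iso Q v K \<psi> (rep_direct_sum Q \<phi>1 \<phi>2)"
    by (elim exE conjE) (rule that)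
   have "\<phi>1 \<in> quiver_reps Q v1 UNIV" "\<phi>2 \<in> quiver_reps Q v2 UNIV" using d(4,5) by (simp_all add: quiver_reps_def PiE_iff)
   moreover have "rep_iso Q v UNIV \<psi> (rep_direct_sum Q \<phi>1 \<phi>2)" using d(6) unfolding rep_iso_def by blast
   ultimately have "\<exists>e. idem_endo Q v \<psi> e" by (rule decomposition_imp_idem_endo[OF Q \<psi> d(1-3)])
   then show False using * by blast
  qed
 qed
 finally show ?thesis unfolding \<psi>_def .
qed

section \<open>The Frobenius automorphisms of the algebraic closure\<close>

lemma finite_field_power_card:
 fixes x :: "'a::{field,finite}"
 shows "x ^ card (UNIV :: 'a set) = x"
proof (cases "x = 0")
 case True
 then show ?thesis by (simp add: finite_UNIV_card_ge_0)
next
 case False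
 have card: "card (UNIV :: 'a set) = Suc (card (UNIV - {0 :: 'a}))" using card.remove[of UNIV "0 :: 'a"] by simp
 have "(\<Prod>y\<in>UNIV - {0}. y) = (\<Prod>y\<in>UNIV - {0}. x * y)"
  using False by (intro prod.reindex_bij_witness[of _ "%y. x * y" "%y. y / x"]) auto
 also have "... = x ^ card (UNIV - {0 :: 'a}) * (\<Prod>y\<in>UNIV - {0}. y)" by (simp add: prod.distrib)
 finally have "x ^ card (UNIV - {0 :: 'a}) = 1" by simp
 then show ?thesis unfolding card by simp
qed

lemma to_ac_hom: "comm_ring_hom (to_ac :: 'a::field => 'a alg_closure)"
 by unfold_locales auto

text \<open>The \<open>i\<close>-th power of the Frobenius automorphism.\<close>

definition frob :: "nat => 'a::{field,finite} alg_closure => 'a alg_closure" where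
 "frob i x = x ^ (card (UNIV :: 'a set) ^ i)"

lemma finite_range_repeats:
 fixes f :: "nat => 'b"
 assumes "finite (range f)"
 shows "\<exists>i j. i < j & f i = f j"
proof -
 have "\<not> inj f" using assms finite_imageD infinite_UNIV_nat by blast
 then obtain i j where "i ~= j" "f i = f j" unfolding inj_on_def by blast
 then show ?thesis by (cases i j rule: linorder_cases) (auto intro: sym)
qed

lemma card_field_ge_2: "card (UNIV :: 'a::{field,finite} set) >= 2"
 using card_mono[of "UNIV :: 'a set" "{0, 1}"] by simp

text \<open>The polynomial \<open>(X + 1)^q - X^q - 1\<close> has degree less than \<open>q\<close> and vanishes on all of \<open>F\<close>, so it is zero.\<close>

lemma power_card_add:
 fixes x y :: "'a::{field,finite} alg_closure"
 shows "(x + y) ^ card (UNIV :: 'a set) = x ^ card (UNIV :: 'a set) + y ^ card (UNIV :: 'a set)"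
proof -
 let ?q = "card (UNIV :: 'a set)"
 interpret comm_ring_hom "to_ac :: 'a => 'a alg_closure" by (rule to_ac_hom)
 interpret tp: map_poly_comm_ring_hom "to_ac :: 'a => 'a alg_closure" ..
 have q: "?q >= 2" by (rule card_field_ge_2)
 define P :: "'a poly" where "P = [:1, 1:] ^ ?q - monom 1 ?q - 1"
 have "P = 0"
 proof (rule ccontr)
  assume "P ~= 0"
  have deg: "degree ([:1, 1:] ^ ?q :: 'a poly) = ?q" by (rule degree_linear_power)
  have "degree P < ?q"
  proof (rule degree_lessI)
   show "P ~= 0 \<or> 0 < ?q" using \<open>P ~= 0\<close> by simp
   show "\<forall>k\<ge>?q. poly.coeff P k = 0"
   proof (intro allI impI)
    fix k assume k: "k >= ?q"
    show "poly.coeff P k = 0"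
    proof (cases "k = ?q")
     case True
     then show ?thesis using q coeff_linear_power[of "1 :: 'a" ?q] by (simp add: P_def)
    next
     case False
     then have "poly.coeff ([:1, 1:] ^ ?q :: 'a poly) k = 0" using k deg by (intro coeff_eq_0) simp
     then show ?thesis using q k False by (simp add: P_def)
    qed
   qed
  qed
  moreover have "poly P a = 0" for a by (simp add: P_def poly_monom finite_field_power_card)
  then have "{a. poly P a = 0} = UNIV" by auto
  ultimately show False using card_poly_roots_bound[OF \<open>P ~= 0\<close>] by simp
 qed
 then have "[:1, 1:] ^ ?q = monom (1 :: 'a) ?q + 1" by (simp add: P_def algebra_simps)
 then have "map_poly to_ac ([:1, 1:] ^ ?q) = map_poly to_ac (monom (1 :: 'a) ?q + 1)" by simp
 then have *: "[:1, 1:] ^ ?q = monom (1 :: 'a alg_closure) ?q + 1"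
  by (simp add: tp.hom_power tp.hom_add map_poly_pCons map_poly_monom)
 have one: "(z + 1) ^ ?q = z ^ ?q + 1" for z :: "'a alg_closure"
  using arg_cong[OF *, of "%p. poly p z"] by (simp add: poly_monom add.commute)
 show ?thesis
 proof (cases "y = 0")
  case True
  then show ?thesis using q by simp
 next
  case False
  then have "(x + y) ^ ?q = ((x / y + 1) * y) ^ ?q" by (simp add: distrib_right)
  also have "... = ((x / y) ^ ?q + 1) * y ^ ?q" unfolding power_mult_distrib one ..
  also have "... = x ^ ?q + y ^ ?q" using False by (simp add: distrib_right power_divide)
  finally show ?thesis .
 qed
qed

lemma frob_0: "frob 0 x = x" and frob_Suc: "frob (Suc i) x = frob i x ^ card (UNIV :: 'a set)"
 for x :: "'a::{field,finite} alg_closure"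
 by (simp_all add: frob_def mult.commute flip: power_mult)

lemma frob_add: "frob i (x + y) = frob i x + frob i y" for x :: "'a::{field,finite} alg_closure"
 by (induction i) (simp_all add: frob_0 frob_Suc power_card_add)

lemma frob_hom: "comm_ring_hom (frob i :: 'a::{field,finite} alg_closure => _)"
proof unfold_locales
 fix x y :: "'a alg_closure"
 show "frob i (x + y) = frob i x + frob i y" by (rule frob_add)
 show "frob i (0 :: 'a alg_closure) = 0" using card_field_ge_2[where 'a = 'a] by (simp add: frob_def power_0_left)
qed (auto simp: frob_def power_mult_distrib)

lemma frob_comp: "frob i (frob j x) = frob (i + j) x"
 by (simp add: frob_def power_add mult.commute flip: power_mult)

lemma frob_mult_period: "frob m x = x ==> frob (m * k) x = x"
 by (induction k) (simp_all add: frob_0 flip: frob_comp)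

lemma frob_to_ac [simp]: "frob i (to_ac a) = to_ac a"
 by (induction i) (simp_all add: frob_0 frob_Suc finite_field_power_card flip: to_ac_power)

lemma frob_eq_0_iff: "frob i x = 0 \<longleftrightarrow> x = 0"
 for x :: "'a::{field,finite} alg_closure"
 using card_field_ge_2[where 'a = 'a] by (auto simp: frob_def power_0_left)

lemma frob_inj: "frob i x = frob i y ==> x = y" for x :: "'a::{field,finite} alg_closure"
proof -
 assume *: "frob i x = frob i y"
 interpret comm_ring_hom "frob i :: 'a alg_closure => _" by (rule frob_hom)
 have "frob i (x - y) = 0" using * by (simp add: hom_minus)
 then show ?thesis by (simp add: frob_eq_0_iff)
qed

lemma frob_fixed_points:
 assumes "m >= 1"
 shows "finite {x :: 'a::{field,finite} alg_closure. frob m x = x}"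
  and "card {x :: 'a::{field,finite} alg_closure. frob m x = x} <= card (UNIV :: 'a set) ^ m"
proof -
 let ?Q = "card (UNIV :: 'a set) ^ m"
 have "card (UNIV :: 'a set) ^ 1 <= ?Q" using card_field_ge_2[where 'a = 'a] assms by (intro power_increasing) auto
 then have Q: "?Q >= 2" using card_field_ge_2[where 'a = 'a] by simp
 define P :: "'a alg_closure poly" where "P = monom 1 ?Q - monom 1 1"
 have "poly.coeff P ?Q = 1" using Q by (simp add: P_def)
 then have nz: "P ~= 0" by auto
 have eq: "{x. frob m x = x} = {x. poly P x = 0}" by (simp add: P_def poly_monom frob_def)
 show "finite {x :: 'a alg_closure. frob m x = x}" unfolding eq by (rule poly_roots_finite[OF nz])
 have "degree P <= ?Q" unfolding P_def using Q by (intro degree_diff_le degree_monom_le) (simp_all add: degree_monom_eq)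
 then show "card {x :: 'a alg_closure. frob m x = x} <= ?Q" unfolding eq using card_poly_roots_bound[OF nz] by simp
qed

lemma frob_fixed: "frob 1 x = x ==> x \<in> range to_ac" for x :: "'a::{field,finite} alg_closure"
proof -
 let ?S = "{x :: 'a alg_closure. frob 1 x = x}"
 have sub: "range to_ac \<subseteq> ?S" by auto
 have "card (range (to_ac :: 'a => _)) = card (UNIV :: 'a set)" by (intro card_image inj_to_ac)
 then have "range to_ac = ?S"
  using frob_fixed_points[of 1, where 'a = 'a] sub by (intro card_seteq) auto
 moreover assume "frob 1 x = x"
 ultimately show ?thesis by auto
qed

text \<open>The conjugates of \<open>x\<close> are roots of the same polynomial over \<open>F\<close>, so two of them coincide.\<close>

lemma frob_periodic:
 fixes x :: "'a::{field,finite} alg_closure"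
 shows "\<exists>m\<ge>1. frob m x = x"
proof -
 obtain P :: "'a poly" where P: "P ~= 0" "poly (map_poly to_ac P) x = 0" using alg_closure_algebraic by blast
 have nz: "map_poly to_ac P ~= 0" using P(1) by (simp add: map_poly_eq_0_iff)
 have "poly (map_poly to_ac P) (frob i x) = 0" for i
 proof -
  interpret comm_ring_hom "frob i :: 'a alg_closure => _" by (rule frob_hom)
  have "frob i (poly (map_poly to_ac P) x) = (\<Sum>k\<le>degree (map_poly to_ac P). poly.coeff (map_poly to_ac P) k * frob i x ^ k)"
   unfolding poly_altdef by (simp add: hom_sum hom_mult hom_power coeff_map_poly)
  then show ?thesis using P(2) unfolding poly_altdef[of _ "frob i x"] by simp
 qed
 then have "range (%i. frob i x) \<subseteq> {y. poly (map_poly to_ac P) y = 0}" by auto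
 then have "finite (range (%i. frob i x))" using poly_roots_finite[OF nz] by (rule finite_subset)
 from finite_range_repeats[OF this] obtain i j where "i < j" "frob i x = frob j x" by blast
 then have "frob i (frob (j - i) x) = frob i x" by (simp add: frob_comp)
 then have "frob (j - i) x = x" by (rule frob_inj)
 then show ?thesis using \<open>i < j\<close> by (intro exI[of _ "j - i"]) simp
qed

lemma frob_periodic_finite:
 fixes S :: "'a::{field,finite} alg_closure set"
 assumes "finite S"
 shows "\<exists>m\<ge>1. \<forall>x\<in>S. frob m x = x"
 using assms
proof (induction S rule: finite_induct)
 case empty
 then show ?case by auto
next
 case (insert x S)
 then obtain m where m: "m >= 1" "\<forall>x\<in>S. frob m x = x" by blast
 obtain m' where m': "m' >= 1" "frob m' x = x" using frob_periodic[of x] by blast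
 show ?case
 proof (intro exI[of _ "m * m'"] conjI ballI)
  show "1 <= m * m'" using m m' by (metis mult_le_mono nat_mult_1)
  fix y assume "y \<in> insert x S"
  then show "frob (m * m') y = y" using frob_mult_period[OF m'(2), of m] frob_mult_period[of m y m'] m(2) by (auto simp: mult.commute)
 qed
qed

section \<open>Intertwining matrices and powers\<close>

lemma mat_pow_add: "A \<in> Mat n n ==> A ^\<^sub>m (i + j) = A ^\<^sub>m i * A ^\<^sub>m j" for A :: "'a::comm_ring_1 mat"
proof (induction j)
 case 0
 then show ?case by (simp add: mat_one_right)
next
 case (Suc j)
 then show ?case by (simp add: mat_assoc del: assoc_mult_mat)
qed

lemma mat_pow_idem:
 assumes A: "A \<in> Mat n n" and idem: "A ^\<^sub>m M * A ^\<^sub>m M = A ^\<^sub>m M" and "k >= 1"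
 shows "A ^\<^sub>m (M * k) = (A ^\<^sub>m M :: 'a::comm_ring_1 mat)"
 using \<open>k >= 1\<close>
proof (induction k rule: dec_induct)
 case (step k)
 have "A ^\<^sub>m (M * Suc k) = A ^\<^sub>m (M + M * k)" by simp
 also have "... = A ^\<^sub>m M" unfolding mat_pow_add[OF A] step.IH by (rule idem)
 finally show ?case .
qed simp

text \<open>Homomorphisms from \<open>B\<close> to \<open>A\<close>. Since the relation is closed under the ring operations, polynomials in an endomorphism of a
representation are endomorphisms, and for square \<open>f\<close> and \<open>A = B\<close> it expresses commutation.\<close>

definition intertwines :: "'a::field mat => 'a mat => 'a mat => bool" where
 "intertwines f A B \<longleftrightarrow> A \<in> Mat (dim_row f) (dim_row f) & B \<in> Mat (dim_col f) (dim_col f) & A * f = f * B"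

lemma intertwinesI: "A \<in> Mat r r ==> B \<in> Mat c c ==> f \<in> Mat r c ==> A * f = f * B ==> intertwines f A B"
 by (auto simp: intertwines_def)

lemma intertwinesD: "intertwines f A B ==> A * f = f * B"
 by (simp add: intertwines_def)

lemma intertwines_one: "f \<in> Mat r c ==> intertwines f (1\<^sub>m r) (1\<^sub>m c)"
 by (auto simp: intertwines_def)

lemma intertwines_zero: "f \<in> Mat r c ==> intertwines f (0\<^sub>m r r) (0\<^sub>m c c)"
 by (auto simp: intertwines_def)

lemma intertwines_mult: "intertwines f A B ==> intertwines f A' B' ==> intertwines f (A * A') (B * B')"
proof (unfold intertwines_def, elim conjE, intro conjI)
 assume a: "A \<in> Mat (dim_row f) (dim_row f)" "B \<in> Mat (dim_col f) (dim_col f)" "A * f = f * B"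
  "A' \<in> Mat (dim_row f) (dim_row f)" "B' \<in> Mat (dim_col f) (dim_col f)" "A' * f = f * B'"
 have "A * A' * f = A * (A' * f)" using a(1,4) by (simp add: mat_assoc del: assoc_mult_mat)
 also have "... = (A * f) * B'" unfolding a(6) using a(1,5) by (simp add: mat_assoc del: assoc_mult_mat)
 also have "... = f * (B * B')" unfolding a(3) using a(2,5) by (simp add: mat_assoc del: assoc_mult_mat)
 finally show "A * A' * f = f * (B * B')" .
qed auto

lemma intertwines_add: "intertwines f A B ==> intertwines f A' B' ==> intertwines f (A + A') (B + B')"
proof (unfold intertwines_def, elim conjE, intro conjI)
 assume a: "A \<in> Mat (dim_row f) (dim_row f)" "B \<in> Mat (dim_col f) (dim_col f)" "A * f = f * B"
  "A' \<in> Mat (dim_row f) (dim_row f)" "B' \<in> Mat (dim_col f) (dim_col f)" "A' * f = f * B'"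
 have f: "f \<in> Mat (dim_row f) (dim_col f)" by simp
 show "(A + A') * f = f * (B + B')" unfolding add_mult_distrib_mat[OF a(1,4) f] mult_add_distrib_mat[OF f a(2,5)] a(3,6) ..
qed (simp_all)

lemma intertwines_diff: "intertwines f A B ==> intertwines f A' B' ==> intertwines f (A - A') (B - B')"
proof (unfold intertwines_def, elim conjE, intro conjI)
 assume a: "A \<in> Mat (dim_row f) (dim_row f)" "B \<in> Mat (dim_col f) (dim_col f)" "A * f = f * B"
  "A' \<in> Mat (dim_row f) (dim_row f)" "B' \<in> Mat (dim_col f) (dim_col f)" "A' * f = f * B'"
 have f: "f \<in> Mat (dim_row f) (dim_col f)" by simp
 show "(A - A') * f = f * (B - B')" unfolding minus_mult_distrib_mat[OF a(1,4) f] mult_minus_distrib_mat[OF f a(2,5)] a(3,6) ..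
qed (simp_all add: minus_carrier_mat)

lemma intertwines_smult: "intertwines f A B ==> intertwines f (z \<cdot>\<^sub>m A) (z \<cdot>\<^sub>m B)"
proof (unfold intertwines_def, elim conjE, intro conjI)
 assume a: "A \<in> Mat (dim_row f) (dim_row f)" "B \<in> Mat (dim_col f) (dim_col f)" "A * f = f * B"
 have f: "f \<in> Mat (dim_row f) (dim_col f)" by simp
 show "(z \<cdot>\<^sub>m A) * f = f * (z \<cdot>\<^sub>m B)" unfolding mult_smult_assoc_mat[OF a(1) f] mult_smult_distrib[OF f a(2)] a(3) ..
qed simp_all

lemma intertwines_pow: "intertwines f A B ==> intertwines f (A ^\<^sub>m k) (B ^\<^sub>m k)"
proof (induction k)
 case 0
 then show ?case by (auto simp: intertwines_def)
next
 case (Suc k)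
 then show ?case using intertwines_mult[of f "A ^\<^sub>m k" "B ^\<^sub>m k" A B] by simp
qed

lemma intertwines_hom:
 assumes "comm_ring_hom \<tau>" "intertwines f A B"
 shows "intertwines (map_mat \<tau> f) (map_mat \<tau> A) (map_mat \<tau> B)"
proof -
 interpret comm_ring_hom \<tau> by (rule assms(1))
 have a: "A \<in> Mat (dim_row f) (dim_row f)" "B \<in> Mat (dim_col f) (dim_col f)" "A * f = f * B" "f \<in> Mat (dim_row f) (dim_col f)"
  using assms(2) unfolding intertwines_def by simp_all
 have "map_mat \<tau> A * map_mat \<tau> f = map_mat \<tau> (A * f)" by (rule mat_hom_mult[OF a(1,4), symmetric])
 also have "... = map_mat \<tau> f * map_mat \<tau> B" unfolding a(3) by (rule mat_hom_mult[OF a(4,2)])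
 finally show ?thesis using a(1,2) unfolding intertwines_def by simp
qed

lemma intertwines_self: "A \<in> Mat n n ==> intertwines A A A"
 by (rule intertwinesI[of _ n _ n]) (assumption | rule refl)+

section \<open>Powers of a matrix over the algebraic closure of a finite field\<close>

lemma finite_mats_with_entries:
 assumes "finite S"
 shows "finite {A \<in> Mat r c. \<forall>i<r. \<forall>j<c. A $$ (i,j) \<in> S}"
proof -
 have "{A \<in> Mat r c. \<forall>i<r. \<forall>j<c. A $$ (i,j) \<in> S} \<subseteq> (%f. mat r c f) ` (PiE ({..<r} \<times> {..<c}) (%_. S))"
 proof
  fix A assume "A \<in> {A \<in> Mat r c. \<forall>i<r. \<forall>j<c. A $$ (i,j) \<in> S}"
  then show "A \<in> (%f. mat r c f) ` (PiE ({..<r} \<times> {..<c}) (%_. S))"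
   by (intro image_eqI[of _ _ "restrict (%ij. A $$ ij) ({..<r} \<times> {..<c})"]) auto
 qed
 then show ?thesis by (rule finite_subset) (intro finite_imageI finite_PiE, auto simp: assms)
qed

text \<open>The entries lie in a finite subfield, so the powers of \<open>A\<close> repeat.\<close>

lemma idempotent_power:
 fixes A :: "'a::{field,finite} alg_closure mat"
 assumes A: "A \<in> Mat n n"
 shows "\<exists>M\<ge>1. A ^\<^sub>m M * A ^\<^sub>m M = A ^\<^sub>m M"
proof -
 obtain m where m: "m >= 1" "\<forall>x\<in>elements_mat A. frob m x = x"
  using frob_periodic_finite[OF finite_elements_mat] by blast
 interpret comm_ring_hom "frob m :: 'a alg_closure => _" by (rule frob_hom)
 let ?S = "{B \<in> Mat n n. \<forall>i<n. \<forall>j<n. B $$ (i,j) \<in> {x :: 'a alg_closure. frob m x = x}}"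
 have Am: "map_mat (frob m) A = A" using m(2) A by (intro eq_matI) auto
 have fixed: "B \<in> ?S" if B: "B \<in> Mat n n" "map_mat (frob m) B = B" for B
 proof -
  have "frob m (B $$ (i,j)) = map_mat (frob m) B $$ (i,j)" if "i < n" "j < n" for i j using that B(1) by simp
  then show ?thesis using B unfolding B(2) by simp
 qed
 have "A ^\<^sub>m k \<in> ?S" for k
  by (rule fixed[OF pow_carrier_mat[OF A]]) (simp only: mat_hom_pow[OF A] Am)
 then have "range (%k. A ^\<^sub>m k) \<subseteq> ?S" by (rule image_subsetI)
 then have "finite (range (%k. A ^\<^sub>m k))"
  using finite_mats_with_entries[OF frob_fixed_points(1)[OF m(1)]] by (rule finite_subset)
 from finite_range_repeats[OF this] obtain i j where ij: "i < j" "A ^\<^sub>m i = A ^\<^sub>m j" by blast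
 define p where "p = j - i"
 have p: "p >= 1" "A ^\<^sub>m i = A ^\<^sub>m (i + p)" using ij by (simp_all add: p_def)
 have shift: "A ^\<^sub>m (t + p) = A ^\<^sub>m t" if "t >= i" for t
 proof -
  have "A ^\<^sub>m (t + p) = A ^\<^sub>m ((t - i) + (i + p))" using that by simp
  also have "... = A ^\<^sub>m (t - i) * A ^\<^sub>m i" unfolding mat_pow_add[OF A, of "t - i"] p(2)[symmetric] ..
  also have "... = A ^\<^sub>m t" using that by (simp flip: mat_pow_add[OF A])
  finally show ?thesis .
 qed
 have shift': "A ^\<^sub>m (t + p * k) = A ^\<^sub>m t" if "t >= i" for t k
 proof (induction k)
  case (Suc k)
  have "A ^\<^sub>m (t + p * Suc k) = A ^\<^sub>m ((t + p * k) + p)" by (simp add: algebra_simps)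
  also have "... = A ^\<^sub>m t" using shift[of "t + p * k"] that Suc by simp
  finally show ?case .
 qed simp
 let ?M = "p * Suc i"
 have "?M >= i" using p(1) by (cases p) auto
 then have "A ^\<^sub>m ?M * A ^\<^sub>m ?M = A ^\<^sub>m ?M" unfolding mat_pow_add[OF A, symmetric] by (rule shift')
 then show ?thesis using p(1) by (intro exI[of _ ?M]) auto
qed

lemma idempotent_power_uniform:
 fixes A :: "'x => 'a::{field,finite} alg_closure mat"
 assumes "finite I" "!!x. x \<in> I ==> A x \<in> Mat (v x) (v x)"
 shows "\<exists>M\<ge>1. \<forall>x\<in>I. A x ^\<^sub>m M * A x ^\<^sub>m M = A x ^\<^sub>m M"
 using assms
proof (induction I rule: finite_induct)
 case empty
 then show ?case by auto
next
 case (insert y I)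
 have "\<exists>M\<ge>1. \<forall>x\<in>I. A x ^\<^sub>m M * A x ^\<^sub>m M = A x ^\<^sub>m M" by (rule insert.IH) (simp add: insert.prems)
 then obtain M where M: "M >= 1" "!!x. x \<in> I ==> A x ^\<^sub>m M * A x ^\<^sub>m M = A x ^\<^sub>m M" by blast
 have yc: "A y \<in> Mat (v y) (v y)" by (rule insert.prems) simp
 obtain M' where M': "M' >= 1" "A y ^\<^sub>m M' * A y ^\<^sub>m M' = A y ^\<^sub>m M'" using idempotent_power[OF yc] by blast
 show ?case
 proof (intro exI[of _ "M * M'"] conjI ballI)
  show "1 <= M * M'" using M(1) M'(1) by (metis mult_le_mono nat_mult_1)
  fix x assume x: "x \<in> insert y I"
  show "A x ^\<^sub>m (M * M') * A x ^\<^sub>m (M * M') = A x ^\<^sub>m (M * M')"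
  proof (cases "x \<in> I")
   case True
   show ?thesis unfolding mat_pow_idem[OF insert.prems[OF x] M(2)[OF True] M'(1)] by (rule M(2)[OF True])
  next
   case False
   then have "x = y" using x by simp
   show ?thesis unfolding \<open>x = y\<close> mult.commute[of M M'] mat_pow_idem[OF yc M'(2) M(1)] by (rule M'(2))
  qed
 qed
qed

section \<open>Eigenvalues and nilpotent matrices\<close>

lemma singular_kernel:
 fixes A :: "'b::field mat"
 assumes A: "A \<in> Mat n n" and "A \<notin> carrier (GL n)"
 obtains U where "U \<in> Mat n 1" "U ~= 0\<^sub>m n 1" "A * U = 0\<^sub>m n 1"
proof (rule left_inv_cases[OF A])
 assume "left_inv A"
 then obtain B where B: "B \<in> Mat n n" "B * A = 1\<^sub>m n" using left_invE[OF _ A] by metis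
 then have "A * B = 1\<^sub>m n" using mat_mult_left_right_inverse[OF B(1) A] by simp
 then have "A \<in> carrier (GL n)" by (rule GL_I[OF A B(1)])
 then show thesis using assms(2) by simp
qed (rule that)

lemma eigenvector_exists:
 fixes A :: "'b::alg_closed_field mat"
 assumes A: "A \<in> Mat n n" and "n >= 1"
 obtains \<sigma> U where "U \<in> Mat n 1" "U ~= 0\<^sub>m n 1" "(A - \<sigma> \<cdot>\<^sub>m 1\<^sub>m n) * U = 0\<^sub>m n 1"
proof -
 have "degree (char_poly A) = n" using degree_monic_char_poly[OF A] by simp
 then obtain \<sigma> where "poly (char_poly A) \<sigma> = 0" using alg_closed_imp_poly_has_root[of "char_poly A"] assms(2) by auto
 then have "det (char_matrix A \<sigma>) = 0" by (simp add: eigenvalue_det[OF A, symmetric] eigenvalue_root_char_poly[OF A])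
 moreover have "char_matrix A \<sigma> = A - \<sigma> \<cdot>\<^sub>m 1\<^sub>m n" using A by (intro eq_matI) (auto simp: char_matrix_def)
 ultimately have "A - \<sigma> \<cdot>\<^sub>m 1\<^sub>m n \<notin> carrier (GL n)" by (simp add: GL_iff_det)
 moreover have "A - \<sigma> \<cdot>\<^sub>m 1\<^sub>m n \<in> Mat n n" by auto
 ultimately show thesis using singular_kernel[of "A - \<sigma> \<cdot>\<^sub>m 1\<^sub>m n" n] that[of _ \<sigma>] by metis
qed

text \<open>All roots of the characteristic polynomial of a nilpotent matrix are zero.\<close>

lemma det_scalar_plus_nilpotent:
 fixes N :: "'b::alg_closed_field mat"
 assumes N: "N \<in> Mat n n" and nil: "N ^\<^sub>m M = 0\<^sub>m n n"
 shows "det (c \<cdot>\<^sub>m 1\<^sub>m n + N) = c ^ n"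
proof -
 have root: "k = 0" if "poly (char_poly N) k = 0" for k
 proof -
  from that have "eigenvalue N k" by (simp add: eigenvalue_root_char_poly[OF N])
  then obtain v where v: "eigenvector N v k" unfolding eigenvalue_def by blast
  have v': "v \<in> carrier_vec n" "v ~= 0\<^sub>v n" using v N by (auto simp: eigenvector_def)
  have zero: "0\<^sub>m n n *\<^sub>v v = 0\<^sub>v n" using v'(1) by (intro eq_vecI) auto
  have kv: "k ^ M \<cdot>\<^sub>v v = 0\<^sub>v n" using eigenvector_pow[OF N v, of M] unfolding nil zero by (rule sym)
  obtain i where i: "i < n" "vec_index v i ~= 0"
  proof (rule ccontr)
   assume "\<not> thesis"
   then have "!!i. i < n ==> vec_index v i = 0" using that by blast
   then have "v = 0\<^sub>v n" using v'(1) by (intro eq_vecI) auto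
   then show False using v'(2) by simp
  qed
  have "k ^ M * vec_index v i = 0" using arg_cong[OF kv, of "%u. vec_index u i"] i(1) v'(1) by simp
  then show ?thesis using i(2) by simp
 qed
 have monic: "degree (char_poly N) = n" "lead_coeff (char_poly N) = 1" using degree_monic_char_poly[OF N] by auto
 then have "char_poly N ~= 0" by auto
 then obtain R where R: "size R = n" "char_poly N = (\<Prod>x\<in>#R. [:-x, 1:])"
  using alg_closed_imp_factorization[of "char_poly N"] monic by auto
 have "poly (char_poly N) x = 0" if xR: "x \<in># R" for x
 proof -
  obtain R' where "R = add_mset x R'" using multi_member_split[OF xR] by blast
  then show ?thesis unfolding R(2) by simp
 qed
 then have "\<forall>x\<in>#R. x = 0" using root by blast
 then have "(\<Prod>x\<in>#R. [:-x, 1:]) = (\<Prod>x\<in>#R. [:0, 1:])" by (intro arg_cong[of _ _ prod_mset] image_mset_cong) auto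
 then have cp: "char_poly N = [:0, 1:] ^ n" unfolding R(2) using R(1) by simp
 have "(-c) ^ n = poly (char_poly N) (-c)" unfolding cp by (simp add: poly_power)
 also have "... = det (- (char_matrix N (-c)))" by (rule char_poly_matrix[OF N])
 also have "- (char_matrix N (-c)) = (-1) \<cdot>\<^sub>m (c \<cdot>\<^sub>m 1\<^sub>m n + N)" using N by (intro eq_matI) (auto simp: char_matrix_def)
 also have "det ... = (-1) ^ n * det (c \<cdot>\<^sub>m 1\<^sub>m n + N)" using N by simp
 finally have "(-1) ^ n * c ^ n = (-1) ^ n * det (c \<cdot>\<^sub>m 1\<^sub>m n + N)" by (simp flip: power_mult_distrib)
 then show ?thesis by simp
qed

section \<open>Generic tuples and splittings of the weights\<close>

text \<open>Lists for each diagonal position the block that contains it.\<close>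

fun block_index :: "nat list => nat list" where
 "block_index [] = []"
| "block_index (m # p) = replicate m 0 @ map Suc (block_index p)"

lemma length_block_index [simp]: "length (block_index p) = sum_list p"
 by (induction p) auto

lemma block_index_less: "j \<in> set (block_index p) ==> j < length p"
 by (induction p arbitrary: j) (auto split: if_splits)

lemma count_block_index: "count (mset (block_index p)) j = (if j < length p then p ! j else 0)"
proof (induction p arbitrary: j)
 case (Cons m p)
 show ?case
 proof (cases j)
  case 0
  have "0 \<notin># mset (map Suc (block_index p))" by auto
  then show ?thesis using 0 by (simp add: count_eq_zero_iff)
 next
  case (Suc i)
  have "count (image_mset Suc (mset xs)) (Suc i) = count (mset xs) i" for xs
   by (induction xs) simp_all
  then show ?thesis using Suc Cons.IH[of i] by simp
 qed
qed simp

lemma prod_list_block_index: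
 fixes f :: "nat => 'c::comm_monoid_mult"
 shows "prod_list (map f (block_index p)) = (\<Prod>j<length p. f j ^ (p ! j))"
proof (induction p arbitrary: f)
 case (Cons m p)
 have "prod_list (map f (block_index (m # p))) = f 0 ^ m * prod_list (map (%j. f (Suc j)) (block_index p))"
  by (simp add: prod_list_replicate comp_def)
 then show ?case unfolding Cons.IH by (simp add: prod.lessThan_Suc_shift del: prod.lessThan_Suc)
qed simp

definition row_index :: "nat => (nat => nat) => nat list" where
 "row_index L c = concat (map (%j. replicate (c j) j) [0..<L])"

lemma row_index_Suc: "row_index (Suc L) c = row_index L c @ replicate (c L) L"
 by (simp add: row_index_def)

lemma length_row_index: "length (row_index L c) = (\<Sum>j<L. c j)"
 by (induction L) (simp_all add: row_index_Suc, simp add: row_index_def)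

lemma count_row_index: "count (mset (row_index L c)) j = (if j < L then c j else 0)"
 by (induction L) (auto simp: row_index_Suc, simp add: row_index_def)

lemma prod_list_row_index:
 fixes f :: "nat => 'c::comm_monoid_mult"
 shows "prod_list (map f (row_index L c)) = (\<Prod>j<L. f j ^ c j)"
 by (induction L) (simp_all add: row_index_Suc prod_list_replicate, simp add: row_index_def)

lemma prod_list_zip_rows:
 fixes f :: "nat => nat => 'c::comm_monoid_mult"
 assumes "!!c. c \<in> set cs ==> length (rw c) = N c"
 shows "prod_list (map2 f (concat (map rw cs)) (block_index (map N cs)))
  = (\<Prod>s<length cs. prod_list (map (%j. f j s) (rw (cs ! s))))"
 using assms
proof (induction cs arbitrary: f)
 case (Cons c cs)
 have c: "length (rw c) = N c" using Cons.prems by simp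
 have "map2 f (rw c) (replicate (N c) 0) = map (%j. f j 0) (rw c)"
  using c by (intro nth_equalityI) auto
 moreover have "map2 f xs (map Suc ys) = map2 (%j s. f j (Suc s)) xs ys" for xs ys
  by (simp add: zip_map2 comp_def case_prod_unfold)
 ultimately have "prod_list (map2 f (concat (map rw (c # cs))) (block_index (map N (c # cs))))
  = prod_list (map (%j. f j 0) (rw c)) * prod_list (map2 (%j s. f j (Suc s)) (concat (map rw cs)) (block_index (map N cs)))"
  using c by (simp add: zip_append)
 also have "... = (\<Prod>s<length (c # cs). prod_list (map (%j. f j s) (rw ((c # cs) ! s))))"
  using Cons.IH[of "%j s. f j (Suc s)"] Cons.prems by (simp add: prod.lessThan_Suc_shift del: prod.lessThan_Suc)
 finally show ?case .
qed simp

definition diagonal :: "'a::zero list => 'a mat" where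
 "diagonal zs = mat (length zs) (length zs) (%(a,b). if a = b then zs ! a else 0)"

lemma diagonal_carrier [simp]: "diagonal zs \<in> Mat (length zs) (length zs)"
 "dim_row (diagonal zs) = length zs" "dim_col (diagonal zs) = length zs"
 by (simp_all add: diagonal_def)

lemma diagonal_append:
 "diagonal (xs @ ys) = four_block_mat (diagonal xs) (0\<^sub>m (length xs) (length ys)) (0\<^sub>m (length ys) (length xs)) (diagonal ys)"
 by (rule eq_matI) (auto simp: diagonal_def nth_append)

lemma det_diagonal: "det (diagonal zs) = prod_list (zs :: 'a::field list)"
proof -
 have "upper_triangular (diagonal zs)" by (auto simp: diagonal_def)
 then have "det (diagonal zs) = prod_list (diag_mat (diagonal zs))" by (rule det_upper_triangular[OF _ diagonal_carrier(1)])
 also have "diag_mat (diagonal zs) = zs" by (intro nth_equalityI) (auto simp: diag_mat_def diagonal_def)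
 finally show ?thesis .
qed

lemma linear_character_prod_list: "\<alpha> \<in> linear_characters ==> \<alpha> (prod_list zs) = prod_list (map \<alpha> zs)"
 by (induction zs) (auto simp: linear_characters_def)

lemma levi_char_diagonal:
 assumes "length zs = sum_list p" "!!j. j < length p ==> \<alpha> j \<in> linear_characters"
 shows "levi_char p \<alpha> (diagonal zs) = prod_list (map2 \<alpha> (block_index p) zs)"
 using assms
proof (induction p arbitrary: \<alpha> zs)
 case Nil
 then show ?case by (simp add: levi_char_def)
next
 case (Cons m p)
 define xs ys where "xs = take m zs" and "ys = drop m zs"
 have l: "length xs = m" "length ys = sum_list p" "zs = xs @ ys" using Cons.prems(1) by (auto simp: xs_def ys_def)
 have "levi_char (m # p) \<alpha> (diagonal zs) = \<alpha> 0 (det (diagonal xs)) * levi_char p (%j. \<alpha> (Suc j)) (diagonal ys)"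
  unfolding l(3) diagonal_append l(1,2) using diagonal_carrier(1)[of xs] diagonal_carrier(1)[of ys] unfolding l(1,2) by (rule levi_char_Cons)
 also have "levi_char p (%j. \<alpha> (Suc j)) (diagonal ys) = prod_list (map2 (%j. \<alpha> (Suc j)) (block_index p) ys)"
  using Cons.prems(2)[of "Suc _"] by (intro Cons.IH[OF l(2)]) auto
 also have "\<alpha> 0 (det (diagonal xs)) = prod_list (map (\<alpha> 0) xs)"
  using Cons.prems(2)[of 0] by (simp add: det_diagonal linear_character_prod_list)
 also have "map (\<alpha> 0) xs = map2 \<alpha> (replicate m 0) xs" using l(1) by (intro nth_equalityI) auto
 also have "map2 (%j. \<alpha> (Suc j)) (block_index p) ys = map2 \<alpha> (map Suc (block_index p)) ys"
  by (simp add: zip_map1 comp_def case_prod_unfold)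
 also have "prod_list (map2 \<alpha> (replicate m 0) xs) * prod_list (map2 \<alpha> (map Suc (block_index p)) ys)
  = prod_list (map2 \<alpha> (block_index (m # p)) zs)"
  unfolding l(3) using l(1,2) by (simp add: zip_append)
 finally show ?case .
qed

lemma diagonal_torus: "0 \<notin> set zs ==> diagonal zs \<in> levi (replicate (length zs) 1)"
proof (induction zs)
 case Nil
 have "diagonal [] = 1\<^sub>m 0" by (rule eq_matI) auto
 then show ?case by (simp add: levi_Nil)
next
 case (Cons z zs)
 have s: "sum_list (replicate (length zs) 1) = length zs" by (simp add: sum_list_replicate)
 have "diagonal (z # zs) = diagonal ([z] @ zs)" by simp
 also have "... = four_block_mat (diagonal [z]) (0\<^sub>m 1 (length zs)) (0\<^sub>m (length zs) 1) (diagonal zs)"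
  unfolding diagonal_append by simp
 finally have eq: "diagonal (z # zs) = ..." .
 have "diagonal [z] \<in> carrier (GL 1)" using Cons.prems diagonal_carrier(1)[of "[z]"] by (simp add: GL_iff_det det_diagonal)
 moreover have "diagonal zs \<in> levi (replicate (length zs) 1)" using Cons by simp
 moreover have "replicate (length (z # zs)) 1 = 1 # replicate (length zs) (1 :: nat)" by simp
 ultimately show ?case unfolding eq \<open>replicate (length (z # zs)) 1 = 1 # replicate (length zs) (1 :: nat)\<close> levi_Cons s by blast
qed

text \<open>Restricting the Levi character to diagonal matrices with a single entry different from \<open>1\<close> identifies the characters
of the factors of the torus.\<close>

lemma torus_characters:
 assumes lin: "!!j. j < length p ==> \<alpha> j \<in> linear_characters" and lin': "!!m. m < n ==> \<beta> m \<in> linear_characters"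
  and p: "sum_list p = n"
  and eq: "\<forall>t\<in>levi (replicate n 1). levi_char p \<alpha> t = (\<Prod>m<n. \<beta> m (t $$ (m, m)))"
  and m: "m < n" and z: "z ~= (0 :: 'a::field)"
 shows "\<beta> m z = \<alpha> (block_index p ! m) z"
proof -
 define zs where "zs = (replicate n 1)[m := z]"
 have zs: "length zs = n" "0 \<notin> set zs" using z set_update_subset_insert[of "replicate n 1" m z] by (auto simp: zs_def)
 have one: "\<gamma> 1 = 1" if "\<gamma> \<in> linear_characters" for \<gamma> :: "'a => complex" using that by (simp add: linear_characters_def)
 have "diagonal zs \<in> levi (replicate n 1)" using diagonal_torus[OF zs(2)] zs(1) by simp
 then have "levi_char p \<alpha> (diagonal zs) = (\<Prod>m'<n. \<beta> m' (diagonal zs $$ (m', m')))" using eq by blast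
 also have "... = (\<Prod>m'<n. if m' = m then \<beta> m z else 1)"
  using lin' zs(1) m by (intro prod.cong) (auto simp: diagonal_def zs_def one)
 also have "... = \<beta> m z" using m by simp
 finally have "\<beta> m z = levi_char p \<alpha> (diagonal zs)" by simp
 also have "... = prod_list (map2 \<alpha> (block_index p) zs)" using zs(1) p lin by (intro levi_char_diagonal) auto
 also have "... = (\<Prod>m'<n. \<alpha> (block_index p ! m') (zs ! m'))"
  using zs(1) p by (simp add: prod.list_conv_set_nth atLeast0LessThan)
 also have "... = (\<Prod>m'<n. if m' = m then \<alpha> (block_index p ! m) z else 1)"
 proof (intro prod.cong refl)
  fix m' assume "m' \<in> {..<n}"
  then have m': "m' < n" by simp
  have "\<alpha> (block_index p ! m') 1 = 1" by (rule one, rule lin, rule block_index_less, rule nth_mem) (use p m' in simp)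
  then show "\<alpha> (block_index p ! m') (zs ! m') = (if m' = m then \<alpha> (block_index p ! m) z else 1)"
   using m m' by (simp add: zs_def)
 qed
 also have "... = \<alpha> (block_index p ! m) z" using m by simp
 finally show ?thesis .
qed

lemma one_in_levi: "1\<^sub>m (sum_list p) \<in> levi p"
proof (induction p)
 case (Cons m p)
 have "1\<^sub>m (m + sum_list p) = four_block_mat (1\<^sub>m m) (0\<^sub>m m (sum_list p)) (0\<^sub>m (sum_list p) m) (1\<^sub>m (sum_list p))" by simp
 then show ?case using Cons GL_one_closed unfolding levi_Cons sum_list.Cons by blast
qed (simp add: levi_Nil)

text \<open>Commuting with \<open>1 + E\<close> for an elementary matrix \<open>E\<close> means commuting with \<open>E\<close>.\<close>

lemma GL_central_diagonal:
 fixes a :: "'a::field mat"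
 assumes a: "a \<in> carrier (GL m)" and central: "!!l. l \<in> carrier (GL m) ==> a * l = l * a"
 shows "\<exists>c. c ~= 0 & (\<forall>r<m. a $$ (r,r) = c)"
proof (cases "m = 0")
 case True
 then show ?thesis by (intro exI[of _ 1]) auto
next
 case False
 have ac: "a \<in> Mat m m" using a by (rule GL_mat)
 define E :: "nat => nat => 'a mat" where "E r s = mat m m (%(i,j). if i = r & j = s then 1 else 0)" for r s
 have Ec: "E r s \<in> Mat m m" for r s by (simp add: E_def)
 have cancel: "Y = Z" if e: "a + Y = a + Z" and YZ: "Y \<in> Mat m m" "Z \<in> Mat m m" for Y Z
 proof (rule eq_matI)
  fix i j assume "i < dim_row Z" "j < dim_col Z"
  then show "Y $$ (i,j) = Z $$ (i,j)" using arg_cong[OF e, of "%A. A $$ (i,j)"] ac YZ by simp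
 qed (use YZ in auto)
 have com: "a * E r s = E r s * a" if rs: "r < m" "s < m" "r ~= s" for r s
 proof -
  have "E r s * E r s = 0\<^sub>m m m"
  proof (rule eq_matI)
   fix i j assume "i < dim_row (0\<^sub>m m m :: 'a mat)" "j < dim_col (0\<^sub>m m m :: 'a mat)"
   then have ij: "i < m" "j < m" by auto
   have "(\<Sum>l<m. E r s $$ (i,l) * E r s $$ (l,j)) = 0" using rs ij by (intro sum.neutral) (auto simp: E_def)
   then show "(E r s * E r s) $$ (i,j) = 0\<^sub>m m m $$ (i,j)" using ij mat_mult_entry[OF Ec Ec ij] by simp
  qed (use Ec in auto)
  moreover have "(1\<^sub>m m + E r s) * (1\<^sub>m m - E r s) = (1\<^sub>m m - E r s) + (E r s - E r s * E r s)"
   unfolding add_mult_distrib_mat[OF one_carrier_mat Ec minus_carrier_mat[OF Ec]] mult_minus_distrib_mat[OF Ec one_carrier_mat Ec]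
   using Ec[of r s] by (simp add: mat_one_left mat_one_right)
  moreover have "(1\<^sub>m m - E r s) + (E r s - 0\<^sub>m m m) = 1\<^sub>m m" using Ec[of r s] by (intro eq_matI) auto
  ultimately have "1\<^sub>m m + E r s \<in> carrier (GL m)" using Ec[of r s] by (intro GL_I[of _ _ "1\<^sub>m m - E r s"]) (auto simp: minus_carrier_mat)
  then have c: "a * (1\<^sub>m m + E r s) = (1\<^sub>m m + E r s) * a" by (rule central)
  have "a * (1\<^sub>m m + E r s) = a + a * E r s" unfolding mult_add_distrib_mat[OF ac one_carrier_mat Ec] using ac by simp
  moreover have "(1\<^sub>m m + E r s) * a = a + E r s * a" unfolding add_mult_distrib_mat[OF one_carrier_mat Ec ac] using ac by simp
  ultimately have s: "a + a * E r s = a + E r s * a" using c by simp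
  have car: "a * E r s \<in> Mat m m" "E r s * a \<in> Mat m m" using ac Ec[of r s] by auto
  show ?thesis by (rule cancel[OF s car])
 qed
 have left: "(a * E r s) $$ (i,j) = (if j = s then a $$ (i,r) else 0)" if "r < m" "i < m" "j < m" for r s i j
 proof -
  have "(a * E r s) $$ (i,j) = (\<Sum>l<m. a $$ (i,l) * E r s $$ (l,j))" using that by (intro mat_mult_entry[OF ac Ec])
  also have "... = (\<Sum>l<m. if l = r then (if j = s then a $$ (i,r) else 0) else 0)"
   using that by (intro sum.cong) (auto simp: E_def)
  finally show ?thesis using that by simp
 qed
 have right: "(E r s * a) $$ (i,j) = (if i = r then a $$ (s,j) else 0)" if "s < m" "i < m" "j < m" for r s i j
 proof -
  have "(E r s * a) $$ (i,j) = (\<Sum>l<m. E r s $$ (i,l) * a $$ (l,j))" using that by (intro mat_mult_entry[OF Ec ac])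
  also have "... = (\<Sum>l<m. if l = s then (if i = r then a $$ (s,j) else 0) else 0)"
   using that by (intro sum.cong) (auto simp: E_def)
  finally show ?thesis using that by simp
 qed
 have const: "a $$ (r,r) = a $$ (0,0)" if "r < m" for r
 proof (cases "r = 0")
  case nz: False
  show ?thesis using com[of r 0] left[of r r 0 0] right[of 0 r 0 r] that nz False by simp
 qed simp
 have off: "a $$ (t,0) = 0" if t: "t < m" "t ~= 0" for t
  using com[of 0 t] left[of 0 t t t] right[of t t t 0] t by simp
 have "a $$ (0,0) ~= 0"
 proof
  assume z: "a $$ (0,0) = 0"
  obtain b where b: "b \<in> Mat m m" "b * a = 1\<^sub>m m" using GL_E[OF a] by metis
  have "(b * a) $$ (0,0) = (\<Sum>l<m. b $$ (0,l) * a $$ (l,0))" using False by (intro mat_mult_entry[OF b(1) ac]) auto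
  also have "... = 0" using off z by (intro sum.neutral ballI) (metis lessThan_iff mult_zero_right)
  finally show False unfolding b(2) using False by simp
 qed
 then show ?thesis using const by blast
qed

lemma levi_center_diagonal:
 "z \<in> levi_center p ==> \<exists>\<zeta>. (\<forall>j<length p. \<zeta> j ~= 0) & (\<forall>r<sum_list p. z $$ (r,r) = \<zeta> (block_index p ! r))"
 for z :: "'a::field mat"
proof (induction p arbitrary: z)
 case Nil
 then show ?case by simp
next
 case (Cons m p)
 let ?s = "sum_list p"
 have z: "z \<in> levi (m # p)" "!!l. l \<in> levi (m # p) ==> z * l = l * z" using Cons.prems by (auto simp: levi_center_def)
 obtain a d where ad: "z = four_block_mat a (0\<^sub>m m ?s) (0\<^sub>m ?s m) d" "a \<in> carrier (GL m)" "d \<in> levi p"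
  using z(1) unfolding levi_Cons by blast
 have c: "a \<in> Mat m m" "d \<in> Mat ?s ?s"
  using GL_mat[OF ad(2)] GL_mat[OF levi_carrier[OF ad(3)]] by auto
 have com: "a * a' = a' * a & d * d' = d' * d" if a': "a' \<in> carrier (GL m)" and d': "d' \<in> levi p" for a' d'
 proof -
  have c': "a' \<in> Mat m m" "d' \<in> Mat ?s ?s"
   using GL_mat[OF a'] GL_mat[OF levi_carrier[OF d']] by auto
  have "four_block_mat a' (0\<^sub>m m ?s) (0\<^sub>m ?s m) d' \<in> levi (m # p)" unfolding levi_Cons using a' d' by blast
  from z(2)[OF this] have "four_block_mat (a * a') (a * 0\<^sub>m m ?s + 0\<^sub>m m ?s * d') (0\<^sub>m ?s m) (d * d')
   = four_block_mat (a' * a) (a' * 0\<^sub>m m ?s + 0\<^sub>m m ?s * d) (0\<^sub>m ?s m) (d' * d)"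
   unfolding ad(1) upper_mult[OF c(1) zero_carrier_mat c(2) c'(1) zero_carrier_mat c'(2)] upper_mult[OF c'(1) zero_carrier_mat c'(2) c(1) zero_carrier_mat c(2)] .
  then show ?thesis using c c' by (subst (asm) upper_eq_iff) auto
 qed
 obtain c0 where c0: "c0 ~= 0" "!!r. r < m ==> a $$ (r,r) = c0"
  using GL_central_diagonal[OF ad(2)] com[OF _ one_in_levi] by blast
 have "d \<in> levi_center p" using ad(3) com[OF GL_one_closed] by (auto simp: levi_center_def)
 from Cons.IH[OF this] obtain \<zeta> where \<zeta>: "!!j. j < length p ==> \<zeta> j ~= 0" "!!r. r < ?s ==> d $$ (r,r) = \<zeta> (block_index p ! r)" by blast
 show ?case
 proof (intro exI[of _ "case_nat c0 \<zeta>"] conjI allI impI)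
  fix j assume "j < length (m # p)"
  then show "case_nat c0 \<zeta> j ~= 0" using c0 \<zeta>(1) by (cases j) auto
 next
  fix r assume r: "r < sum_list (m # p)"
  show "z $$ (r,r) = case_nat c0 \<zeta> (block_index (m # p) ! r)"
  proof (cases "r < m")
   case True
   then show ?thesis using c c0(2) by (simp add: ad(1) nth_append)
  next
   case False
   then have "r - m < ?s" using r by simp
   then show ?thesis using False c r \<zeta>(2)[of "r - m"] by (simp add: ad(1) nth_append)
  qed
 qed
qed

text \<open>The value of the product of the torus characters when \<open>z\<close> stands at \<open>c i j\<close> positions of the \<open>j\<close>-th block for
the \<open>i\<close>-th factor, and \<open>1\<close> elsewhere.\<close>

definition weight_char :: "nat => (nat => nat list) => (nat => nat => 'a => complex) => (nat => nat => nat) => 'a => complex" where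
 "weight_char k \<mu> \<alpha> c z = (\<Prod>i=1..k. \<Prod>j<length (\<mu> i). \<alpha> i j z ^ c i j)"

text \<open>The form in which genericity is used: the multiplicities \<open>\<mu>\<close> cannot be split into two or more
nonzero parts that all have trivial characters.\<close>

definition generic_weights :: "nat => nat => (nat => nat list) => (nat => nat => 'a::field => complex) => bool" where
 "generic_weights n k \<mu> \<alpha> \<longleftrightarrow> (\<forall>z. z ~= 0 --> weight_char k \<mu> \<alpha> (%i j. \<mu> i ! j) z = 1) &
   (\<forall>cs. length cs >= 2 -->
    (\<forall>c\<in>set cs. \<exists>N\<ge>1. \<forall>i\<in>{1..k}. (\<Sum>j<length (\<mu> i). c i j) = N) -->
    (\<forall>i\<in>{1..k}. \<forall>j<length (\<mu> i). (\<Sum>c\<leftarrow>cs. c i j) = \<mu> i ! j) -->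
    (\<exists>c\<in>set cs. \<exists>z. z ~= 0 & weight_char k \<mu> \<alpha> c z ~= 1))"

text \<open>A splitting of \<open>\<mu>\<close> into parts of sizes \<open>N\<close> corresponds to a partition of \<open>n\<close> and, for each \<open>i\<close>, to a
permutation that sorts the diagonal positions by parts. On the center of the corresponding Levi subgroup, the product of the torus
characters is the product of the characters of the parts; were these all trivial, it would contradict genericity.\<close>

theorem generic_tuple_weights:
 fixes \<X> :: "nat => 'a::field mat => complex"
 assumes k: "k >= 1" and part: "!!i. i \<in> {1..k} ==> is_partition n (\<mu> i)" and gen: "generic_tuple n k \<mu> \<X>"
 obtains \<alpha> where "!!i. i \<in> {1..k} ==> semisimple_split_data (\<mu> i) (\<alpha> i) (\<X> i)" "generic_weights n k \<mu> \<alpha>"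
proof -
 from gen obtain \<alpha> \<beta> where
  ab: "\<forall>i\<in>{1..k}. semisimple_split_data (\<mu> i) (\<alpha> i) (\<X> i) & (\<forall>m<n. \<beta> i m \<in> linear_characters) &
    (\<forall>t\<in>levi (replicate n 1). levi_char (\<mu> i) (\<alpha> i) t = (\<Prod>m<n. \<beta> i m (t $$ (m, m))))"
  and w: "\<forall>w. (\<forall>i\<in>{1..k}. w i permutes {..<n}) -->
    (\<forall>z\<in>levi_center [n]. (\<Prod>i=1..k. \<Prod>m<n. \<beta> i (w i m) (z $$ (m, m))) = 1) &
    (\<forall>p. is_partition n p --> p ~= [n] --> (\<exists>z\<in>levi_center p. (\<Prod>i=1..k. \<Prod>m<n. \<beta> i (w i m) (z $$ (m, m))) ~= 1))"
  unfolding generic_tuple_def by (elim exE conjE) (rule that)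
 have sum: "sum_list (\<mu> i) = n" if "i \<in> {1..k}" for i using part[OF that] by (simp add: is_partition_def)
 have \<beta>: "\<beta> i m z = \<alpha> i (block_index (\<mu> i) ! m) z" if "i \<in> {1..k}" "m < n" "z ~= 0" for i m z
 proof (rule torus_characters[OF _ _ sum[OF that(1)] _ that(2,3)])
  show "\<forall>t\<in>levi (replicate n 1). levi_char (\<mu> i) (\<alpha> i) t = (\<Prod>m<n. \<beta> i m (t $$ (m, m)))" using ab that(1) by blast
 qed (use ab that(1) in \<open>auto simp: semisimple_split_data_def\<close>)
 have data: "semisimple_split_data (\<mu> i) (\<alpha> i) (\<X> i)" if "i \<in> {1..k}" for i using ab that by blast
 have scalar: "weight_char k \<mu> \<alpha> (%i j. \<mu> i ! j) z = 1" if z: "z ~= 0" for z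
 proof -
  have levi_n: "levi [n] = carrier (GL n :: 'a mat monoid)"
  proof -
   have "four_block_mat a (0\<^sub>m n 0) (0\<^sub>m 0 n) (1\<^sub>m 0) = a" if "a \<in> carrier (GL n)" for a :: "'a mat"
    using GL_mat[OF that] by (intro eq_matI) auto
   then have "(\<exists>a. x = four_block_mat a (0\<^sub>m n 0) (0\<^sub>m 0 n) (1\<^sub>m 0) & a \<in> carrier (GL n)) \<longleftrightarrow> x \<in> carrier (GL n)" for x :: "'a mat"
    by metis
   then show ?thesis unfolding levi_Cons levi_Nil by auto
  qed
  have "z \<cdot>\<^sub>m 1\<^sub>m n \<in> carrier (GL n)" using z by (simp add: GL_iff_det)
  moreover have "(z \<cdot>\<^sub>m 1\<^sub>m n) * l = l * (z \<cdot>\<^sub>m 1\<^sub>m n)" if "l \<in> carrier (GL n)" for l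
  proof -
   note l = GL_mat[OF that]
   show ?thesis unfolding mult_smult_distrib[OF l one_carrier_mat] mult_smult_assoc_mat[OF one_carrier_mat l]
    using l by (simp add: mat_one_left mat_one_right)
  qed
  ultimately have "z \<cdot>\<^sub>m 1\<^sub>m n \<in> levi_center [n]" unfolding levi_center_def levi_n by blast
  moreover have "\<forall>i\<in>{1..k}. id permutes {..<n}" by (simp add: permutes_id)
  ultimately have "(\<Prod>i=1..k. \<Prod>m<n. \<beta> i (id m) ((z \<cdot>\<^sub>m 1\<^sub>m n) $$ (m, m))) = 1"
   using spec[OF w, of "%_. id"] by blast
  moreover have "(\<Prod>m<n. \<beta> i (id m) ((z \<cdot>\<^sub>m 1\<^sub>m n) $$ (m, m))) = (\<Prod>j<length (\<mu> i). \<alpha> i j z ^ (\<mu> i ! j))" if i: "i \<in> {1..k}" for i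
  proof -
   have "(\<Prod>m<n. \<beta> i (id m) ((z \<cdot>\<^sub>m 1\<^sub>m n) $$ (m, m))) = (\<Prod>m<n. \<alpha> i (block_index (\<mu> i) ! m) z)"
    using \<beta>[OF i _ z] by (intro prod.cong) auto
   also have "... = prod_list (map (%j. \<alpha> i j z) (block_index (\<mu> i)))"
    by (simp add: prod.list_conv_set_nth sum[OF i] atLeast0LessThan)
   finally show ?thesis unfolding prod_list_block_index .
  qed
  ultimately show ?thesis by (simp add: weight_char_def)
 qed
 have split: "\<exists>c\<in>set cs. \<exists>z. z ~= 0 & weight_char k \<mu> \<alpha> c z ~= 1"
  if len: "length cs >= 2" and pos: "\<forall>c\<in>set cs. \<exists>N\<ge>1. \<forall>i\<in>{1..k}. (\<Sum>j<length (\<mu> i). c i j) = N"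
   and tot: "\<forall>i\<in>{1..k}. \<forall>j<length (\<mu> i). (\<Sum>c\<leftarrow>cs. c i j) = \<mu> i ! j" for cs
 proof (rule ccontr)
  assume "\<not> ?thesis"
  then have triv: "weight_char k \<mu> \<alpha> c z = 1" if "c \<in> set cs" "z ~= 0" for c z using that by blast
  define N where "N c = (\<Sum>j<length (\<mu> 1). c 1 j)" for c :: "nat => nat => nat"
  have N: "N c >= 1" "!!i. i \<in> {1..k} ==> (\<Sum>j<length (\<mu> i). c i j) = N c" if c: "c \<in> set cs" for c
  proof -
   obtain N' where N': "N' >= 1" "!!i. i \<in> {1..k} ==> (\<Sum>j<length (\<mu> i). c i j) = N'" using pos c by blast
   have "N c = N'" unfolding N_def using k by (intro N'(2)) auto
   then show "N c >= 1" "!!i. i \<in> {1..k} ==> (\<Sum>j<length (\<mu> i). c i j) = N c" using N' by auto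
  qed
  \<comment> \<open>Partitions are weakly decreasing.\<close>
  define ds where "ds = rev (sort_key N cs)"
  have ds: "set ds = set cs" "length ds = length cs" "!!f :: _ => nat. (\<Sum>c\<leftarrow>ds. f c) = (\<Sum>c\<leftarrow>cs. f c)"
  proof -
   have m: "mset ds = mset cs" by (simp add: ds_def)
   then show "set ds = set cs" "length ds = length cs" by (metis mset_eq_setD, metis mset_eq_length)
   fix f :: "_ => nat"
   have "sum_mset (image_mset f (mset ds)) = sum_mset (image_mset f (mset cs))" using m by simp
   then show "(\<Sum>c\<leftarrow>ds. f c) = (\<Sum>c\<leftarrow>cs. f c)" by (simp only: mset_map[symmetric] sum_mset_sum_list)
  qed
  define p where "p = map N ds"
  have row_sum: "(\<Sum>c\<leftarrow>cs. \<Sum>j<length (\<mu> i). c i j) = n" if i: "i \<in> {1..k}" for i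
  proof -
   have "(\<Sum>c\<leftarrow>cs'. \<Sum>j<length (\<mu> i). c i j) = (\<Sum>j<length (\<mu> i). \<Sum>c\<leftarrow>cs'. c i j)" for cs' :: "(nat => nat => nat) list"
    by (induction cs') (simp_all add: sum.distrib)
   also have "(\<Sum>j<length (\<mu> i). \<Sum>c\<leftarrow>cs. c i j) = (\<Sum>j<length (\<mu> i). \<mu> i ! j)" using tot i by (intro sum.cong) auto
   also have "... = n" using sum[OF i] by (simp add: sum_list_sum_nth atLeast0LessThan)
   finally show ?thesis .
  qed
  have sum_p: "sum_list p = n"
  proof -
   have "sum_list p = (\<Sum>c\<leftarrow>cs. N c)" by (simp add: p_def ds(3))
   also have "... = n" unfolding N_def using row_sum[of 1] k by simp
   finally show ?thesis .
  qed
  have "sorted_wrt (\<ge>) p"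
  proof -
   have "p = rev (map N (sort_key N cs))" by (simp add: p_def ds_def rev_map)
   moreover have "sorted (map N (sort_key N cs))" by simp
   ultimately show ?thesis by (simp add: sorted_wrt_rev)
  qed
  moreover have "0 \<notin> set p" using N(1) ds(1) unfolding p_def set_map by (metis image_iff not_one_le_zero)
  ultimately have part_p: "is_partition n p" using sum_p by (simp add: is_partition_def)
  have "length p >= 2" using len by (simp add: p_def ds(2))
  then have p_ne: "p ~= [n]" by auto
  define rw where "rw i c = row_index (length (\<mu> i)) (c i)" for i and c :: "nat => nat => nat"
  define A where "A i = concat (map (rw i) ds)" for i
  have row_len: "length (rw i c) = N c" if "i \<in> {1..k}" "c \<in> set ds" for i c
   using N(2)[of c i] that ds(1) by (simp add: rw_def length_row_index)
  have mset_A: "mset (A i) = mset (block_index (\<mu> i))" if i: "i \<in> {1..k}" for i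
  proof (rule multiset_eqI)
   fix j
   have cnt: "count (mset (concat (map (rw i) cs'))) j = (\<Sum>c\<leftarrow>cs'. if j < length (\<mu> i) then c i j else 0)" for cs'
    by (induction cs') (auto simp: rw_def count_row_index)
   have "count (mset (A i)) j = (\<Sum>c\<leftarrow>cs. if j < length (\<mu> i) then c i j else 0)"
    unfolding A_def cnt ds(3) ..
   also have "... = count (mset (block_index (\<mu> i))) j"
   proof (cases "j < length (\<mu> i)")
    case True
    then show ?thesis using tot i by (simp add: count_block_index)
   next
    case False
    then show ?thesis by (simp add: count_block_index sum_list_0)
   qed
   finally show "count (mset (A i)) j = count (mset (block_index (\<mu> i))) j" .
  qed
  have "\<forall>i\<in>{1..k}. \<exists>\<pi>. \<pi> permutes {..<n} & permute_list \<pi> (block_index (\<mu> i)) = A i"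
  proof
   fix i assume i: "i \<in> {1..k}"
   obtain \<pi> where "\<pi> permutes {..<length (block_index (\<mu> i))}" "permute_list \<pi> (block_index (\<mu> i)) = A i"
    using mset_eq_permutation[OF mset_A[OF i]] by blast
   then show "\<exists>\<pi>. \<pi> permutes {..<n} & permute_list \<pi> (block_index (\<mu> i)) = A i"
    using sum[OF i] by (intro exI[of _ \<pi>]) simp
  qed
  from bchoice[OF this] obtain \<pi> where
   \<pi>: "!!i. i \<in> {1..k} ==> \<pi> i permutes {..<n}" "!!i. i \<in> {1..k} ==> permute_list (\<pi> i) (block_index (\<mu> i)) = A i" by blast
  have "\<exists>z\<in>levi_center p. (\<Prod>i=1..k. \<Prod>m<n. \<beta> i (\<pi> i m) (z $$ (m, m))) ~= 1"
   using spec[OF w, of \<pi>] \<pi>(1) part_p p_ne by blast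
  then obtain z where z: "z \<in> levi_center p" "(\<Prod>i=1..k. \<Prod>m<n. \<beta> i (\<pi> i m) (z $$ (m, m))) ~= 1" by blast
  from levi_center_diagonal[OF z(1)] obtain \<zeta> where
   \<zeta>: "!!s. s < length p ==> \<zeta> s ~= 0" "!!r. r < n ==> z $$ (r,r) = \<zeta> (block_index p ! r)" unfolding sum_p by blast
  have "(\<Prod>m<n. \<beta> i (\<pi> i m) (z $$ (m, m))) = (\<Prod>s<length ds. \<Prod>j<length (\<mu> i). \<alpha> i j (\<zeta> s) ^ (ds ! s) i j)" if i: "i \<in> {1..k}" for i
  proof -
   have lenA: "length (A i) = n" using mset_eq_length[OF mset_A[OF i]] sum[OF i] by simp
   have "(\<Prod>m<n. \<beta> i (\<pi> i m) (z $$ (m, m))) = (\<Prod>m<n. \<alpha> i (A i ! m) (\<zeta> (block_index p ! m)))"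
   proof (rule prod.cong[OF refl])
    fix m assume "m \<in> {..<n}"
    then have m: "m < n" by simp
    have nz: "z $$ (m,m) ~= 0" unfolding \<zeta>(2)[OF m] using m sum_p by (intro \<zeta>(1), intro block_index_less[of _ p] nth_mem) simp
    have "\<pi> i m < n" using permutes_in_image[OF \<pi>(1)[OF i], of m] m by simp
    then have "\<beta> i (\<pi> i m) (z $$ (m, m)) = \<alpha> i (block_index (\<mu> i) ! \<pi> i m) (z $$ (m,m))" by (rule \<beta>[OF i _ nz])
    also have "block_index (\<mu> i) ! \<pi> i m = A i ! m"
     unfolding \<pi>(2)[OF i, symmetric] using m sum[OF i] \<pi>(1)[OF i] by (subst permute_list_nth) auto
    finally show "\<beta> i (\<pi> i m) (z $$ (m, m)) = \<alpha> i (A i ! m) (\<zeta> (block_index p ! m))" unfolding \<zeta>(2)[OF m] .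
   qed
   also have "... = prod_list (map2 (%j s. \<alpha> i j (\<zeta> s)) (A i) (block_index p))"
    using lenA sum_p by (simp add: prod.list_conv_set_nth atLeast0LessThan)
   also have "... = (\<Prod>s<length ds. prod_list (map (%j. \<alpha> i j (\<zeta> s)) (rw i (ds ! s))))"
    unfolding A_def p_def using row_len[OF i] by (rule prod_list_zip_rows)
   finally show ?thesis unfolding rw_def prod_list_row_index .
  qed
  then have "(\<Prod>i=1..k. \<Prod>m<n. \<beta> i (\<pi> i m) (z $$ (m, m)))
   = (\<Prod>i=1..k. \<Prod>s<length ds. \<Prod>j<length (\<mu> i). \<alpha> i j (\<zeta> s) ^ (ds ! s) i j)" by (rule prod.cong[OF refl])
  also have "... = (\<Prod>s<length ds. weight_char k \<mu> \<alpha> (ds ! s) (\<zeta> s))" unfolding weight_char_def by (rule prod.swap)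
  also have "... = 1"
  proof (intro prod.neutral ballI)
   fix s assume "s \<in> {..<length ds}"
   then have s: "s < length ds" by simp
   show "weight_char k \<mu> \<alpha> (ds ! s) (\<zeta> s) = 1"
    using nth_mem[OF s] ds(1) \<zeta>(1)[of s] s by (intro triv) (auto simp: p_def)
  qed
  finally show False using z(2) by simp
 qed
 have "generic_weights n k \<mu> \<alpha>" unfolding generic_weights_def
  by (intro conjI allI impI) (erule scalar, rule split)
 then show thesis using data by (intro that) auto
qed

section \<open>Eigenprojections of endomorphisms\<close>

lemma eigen_power:
 fixes A :: "'b::comm_ring_1 mat"
 assumes A: "A \<in> Mat n n" and U: "U \<in> Mat n m" and eq: "A * U = s \<cdot>\<^sub>m U"
 shows "A ^\<^sub>m k * U = s ^ k \<cdot>\<^sub>m U"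
proof (induction k)
 case 0
 then show ?case using A U by (auto intro: eq_matI)
next
 case (Suc k)
 have P: "A ^\<^sub>m k \<in> Mat n n" by (rule pow_carrier_mat[OF A])
 have "A ^\<^sub>m Suc k * U = A ^\<^sub>m k * (A * U)" using assoc_mult_mat[OF P A U] by simp
 also have "... = s \<cdot>\<^sub>m (A ^\<^sub>m k * U)" unfolding eq by (rule mult_smult_distrib[OF P U])
 also have "... = s ^ Suc k \<cdot>\<^sub>m U" unfolding Suc.IH using U by (intro eq_matI) auto
 finally show ?case .
qed

lemma smult_mat_eq_0: "s \<cdot>\<^sub>m U = 0\<^sub>m n m ==> s ~= 0 ==> U \<in> Mat n m ==> U = 0\<^sub>m n m" for s :: "'b::field"
proof (rule eq_matI)
 assume *: "s \<cdot>\<^sub>m U = 0\<^sub>m n m" "s ~= 0" "U \<in> Mat n m"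
 fix i j assume "i < dim_row (0\<^sub>m n m :: 'b mat)" "j < dim_col (0\<^sub>m n m :: 'b mat)"
 then show "U $$ (i,j) = 0\<^sub>m n m $$ (i,j)" using arg_cong[OF *(1), of "%A. A $$ (i,j)"] *(2,3) by simp
qed auto

lemma shift_eigen:
 fixes A :: "'b::field mat"
 assumes A: "A \<in> Mat n n" and U: "U \<in> Mat n m"
 shows "(A - s \<cdot>\<^sub>m 1\<^sub>m n) * U = 0\<^sub>m n m \<longleftrightarrow> A * U = s \<cdot>\<^sub>m U"
  and "A * U = s \<cdot>\<^sub>m U ==> (A - t \<cdot>\<^sub>m 1\<^sub>m n) * U = (s - t) \<cdot>\<^sub>m U"
proof -
 have d: "(A - s \<cdot>\<^sub>m 1\<^sub>m n) * U = A * U - s \<cdot>\<^sub>m U" for s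
  using minus_mult_distrib_mat[OF A smult_carrier_mat[OF one_carrier_mat] U] mult_smult_assoc_mat[OF one_carrier_mat U, of s] U by simp
 have AU: "A * U \<in> Mat n m" using A U by (rule mult_carrier_mat)
 have "Y - s \<cdot>\<^sub>m U = 0\<^sub>m n m \<longleftrightarrow> Y = s \<cdot>\<^sub>m U" if Y: "Y \<in> Mat n m" for Y
 proof
  assume z: "Y - s \<cdot>\<^sub>m U = 0\<^sub>m n m"
  show "Y = s \<cdot>\<^sub>m U"
  proof (rule eq_matI)
   fix i j assume "i < dim_row (s \<cdot>\<^sub>m U)" "j < dim_col (s \<cdot>\<^sub>m U)"
   then show "Y $$ (i,j) = (s \<cdot>\<^sub>m U) $$ (i,j)" using arg_cong[OF z, of "%B. B $$ (i,j)"] U Y by simp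
  qed (use Y U in auto)
 qed (use U in \<open>auto intro: eq_matI\<close>)
 from this[OF AU] show "(A - s \<cdot>\<^sub>m 1\<^sub>m n) * U = 0\<^sub>m n m \<longleftrightarrow> A * U = s \<cdot>\<^sub>m U" unfolding d .
 assume e: "A * U = s \<cdot>\<^sub>m U"
 show "(A - t \<cdot>\<^sub>m 1\<^sub>m n) * U = (s - t) \<cdot>\<^sub>m U" unfolding d e using U by (intro eq_matI) (auto simp: algebra_simps)
qed

lemma shift_pow_commute:
 fixes A :: "'b::field mat"
 assumes A: "A \<in> Mat n n" and E: "E \<in> Mat n n" and "E * A = A * E"
 shows "E * (A - s \<cdot>\<^sub>m 1\<^sub>m n) ^\<^sub>m k = (A - s \<cdot>\<^sub>m 1\<^sub>m n) ^\<^sub>m k * E"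
proof -
 have "intertwines E A A" by (rule intertwinesI[OF A A E assms(3)[symmetric]])
 then have "intertwines E ((A - s \<cdot>\<^sub>m 1\<^sub>m n) ^\<^sub>m k) ((A - s \<cdot>\<^sub>m 1\<^sub>m n) ^\<^sub>m k)"
  by (intro intertwines_pow intertwines_diff intertwines_smult intertwines_one[OF E])
 then show ?thesis using intertwinesD by metis
qed

text \<open>If \<open>E ~= 0\<close>, some \<open>W = (A - s)^p E ~= 0\<close> consists of eigenvectors for \<open>s\<close>, on which \<open>(A - t)^M\<close> acts as
\<open>(s - t)^M\<close>; but it kills \<open>W\<close>.\<close>

lemma distinct_eigenvalues_disjoint:
 fixes A :: "'b::field mat"
 assumes A: "A \<in> Mat n n" and E: "E \<in> Mat n n" and "s ~= t"
  and s: "(A - s \<cdot>\<^sub>m 1\<^sub>m n) ^\<^sub>m M * E = 0\<^sub>m n n" and t: "(A - t \<cdot>\<^sub>m 1\<^sub>m n) ^\<^sub>m M * E = 0\<^sub>m n n"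
 shows "E = 0\<^sub>m n n"
proof -
 define S where "S = A - s \<cdot>\<^sub>m 1\<^sub>m n"
 define T where "T = A - t \<cdot>\<^sub>m 1\<^sub>m n"
 have ST: "S \<in> Mat n n" "T \<in> Mat n n" by (auto simp: S_def T_def minus_carrier_mat)
 define p where "p = (LEAST p. S ^\<^sub>m p * E = 0\<^sub>m n n)"
 have p: "S ^\<^sub>m p * E = 0\<^sub>m n n" unfolding p_def using s unfolding S_def[symmetric] by (rule LeastI)
 show ?thesis
 proof (cases p)
  case 0
  then show ?thesis using p E ST by simp
 next
  case (Suc p')
  define W where "W = S ^\<^sub>m p' * E"
  have Sp: "S ^\<^sub>m p' \<in> Mat n n" by (rule pow_carrier_mat[OF ST(1)])
  have Wc: "W \<in> Mat n n" unfolding W_def using Sp E by auto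
  have "W ~= 0\<^sub>m n n" unfolding W_def using Suc not_less_Least[of p' "%p. S ^\<^sub>m p * E = 0\<^sub>m n n"] by (simp add: p_def)
  have "S * S ^\<^sub>m p' = S ^\<^sub>m Suc p'" using mat_pow_add[OF ST(1), of 1 p'] ST(1) by simp
  then have "S * W = S ^\<^sub>m Suc p' * E" unfolding W_def using assoc_mult_mat[OF ST(1) Sp E] by simp
  then have "S * W = 0\<^sub>m n n" using p Suc by simp
  then have "A * W = s \<cdot>\<^sub>m W" unfolding S_def shift_eigen(1)[OF A Wc] .
  then have "T * W = (s - t) \<cdot>\<^sub>m W" unfolding T_def by (rule shift_eigen(2)[OF A Wc])
  then have TW: "T ^\<^sub>m M * W = (s - t) ^ M \<cdot>\<^sub>m W" by (rule eigen_power[OF ST(2) Wc])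
  have TM: "T ^\<^sub>m M \<in> Mat n n" by (rule pow_carrier_mat[OF ST(2)])
  have "A * A = A * A" ..
  have TA: "T ^\<^sub>m M * A = A * T ^\<^sub>m M" unfolding T_def by (rule shift_pow_commute[OF A A, symmetric]) simp
  have "T ^\<^sub>m M * S ^\<^sub>m p' = S ^\<^sub>m p' * T ^\<^sub>m M" unfolding S_def by (rule shift_pow_commute[OF A TM TA])
  then have "T ^\<^sub>m M * W = S ^\<^sub>m p' * (T ^\<^sub>m M * E)" unfolding W_def
   using assoc_mult_mat[OF TM Sp E] assoc_mult_mat[OF Sp TM E] by simp
  also have "... = 0\<^sub>m n n" unfolding T_def t by (rule right_mult_zero_mat[OF Sp])
  finally have "(s - t) ^ M \<cdot>\<^sub>m W = 0\<^sub>m n n" unfolding TW .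
  then have "W = 0\<^sub>m n n" by (rule smult_mat_eq_0[OF _ _ Wc]) (use \<open>s ~= t\<close> in simp)
  then show ?thesis using \<open>W ~= 0\<^sub>m n n\<close> by simp
 qed
qed

lemma idem_rank_hom:
 fixes \<tau> :: "'b::field => 'c::field"
 assumes "comm_ring_hom \<tau>" "idem_rank e m \<rho>"
 shows "idem_rank (map_mat \<tau> e) m \<rho>"
proof -
 interpret comm_ring_hom \<tau> by (rule assms(1))
 obtain h where h: "e \<in> Mat m m" "\<rho> <= m" "h \<in> carrier (GL m)" "h * e = unit_diag m m \<rho> * h"
  using assms(2) unfolding idem_rank_def by blast
 note hc = GL_mat[OF h(3)]
 obtain h' where h': "h' \<in> Mat m m" "h * h' = 1\<^sub>m m" using GL_E[OF h(3)] by metis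
 have ud: "map_mat \<tau> (unit_diag m m \<rho>) = unit_diag m m \<rho>" by (intro eq_matI) (auto simp: unit_diag_def)
 have "map_mat \<tau> h * map_mat \<tau> h' = 1\<^sub>m m" unfolding mat_hom_mult[OF hc h'(1), symmetric] h'(2) by (rule mat_hom_one)
 then have G: "map_mat \<tau> h \<in> carrier (GL m)" using hc h'(1) by (intro GL_I[of _ _ "map_mat \<tau> h'"]) auto
 have "map_mat \<tau> h * map_mat \<tau> e = map_mat \<tau> (h * e)" by (rule mat_hom_mult[OF hc h(1), symmetric])
 also have "... = unit_diag m m \<rho> * map_mat \<tau> h" unfolding h(4) mat_hom_mult[OF unit_diag_carrier(1) hc] ud ..
 finally show ?thesis unfolding idem_rank_def using h(1,2) G by auto
qed

definition lin_comb :: "nat => nat => (nat => 'b::field) => (nat => 'b mat) => 'b mat" where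
 "lin_comb m r z e = mat m m (%(a,b). \<Sum>i<r. z i * e i $$ (a,b))"

lemma lin_comb_carrier [simp]: "lin_comb m r z e \<in> Mat m m"
 "dim_row (lin_comb m r z e) = m" "dim_col (lin_comb m r z e) = m"
 by (simp_all add: lin_comb_def)

lemma lin_comb_0: "lin_comb m 0 z e = 0\<^sub>m m m"
 by (intro eq_matI) (auto simp: lin_comb_def)

lemma lin_comb_Suc: "e r \<in> Mat m m ==> lin_comb m (Suc r) z e = lin_comb m r z e + z r \<cdot>\<^sub>m e r"
 by (intro eq_matI) (auto simp: lin_comb_def)

lemma lin_comb_intertwines:
 assumes f: "f \<in> Mat m m'" and "!!i. i < r ==> intertwines f (e i) (e' i)"
  and "!!i. i < r ==> e i \<in> Mat m m" "!!i. i < r ==> e' i \<in> Mat m' m'"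
 shows "intertwines f (lin_comb m r z e) (lin_comb m' r z e')"
 using assms(2-)
proof (induction r)
 case 0
 then show ?case using intertwines_zero[OF f] by (simp add: lin_comb_0)
next
 case (Suc r)
 have "lin_comb m (Suc r) z e = lin_comb m r z e + z r \<cdot>\<^sub>m e r"
  "lin_comb m' (Suc r) z e' = lin_comb m' r z e' + z r \<cdot>\<^sub>m e' r"
  using Suc.prems by (intro lin_comb_Suc; simp)+
 then show ?case using Suc by (auto intro!: intertwines_add intertwines_smult)
qed

lemma lin_comb_mult:
 assumes e: "!!i. i < r ==> e i \<in> Mat m m" and E: "E \<in> Mat m m"
  and "!!i. i < r ==> e i * E = 0\<^sub>m m m" "!!i. i < r ==> E * e i = 0\<^sub>m m m"
 shows "lin_comb m r z e * E = 0\<^sub>m m m" "E * lin_comb m r z e = 0\<^sub>m m m"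
proof -
 have "lin_comb m r z e * E = 0\<^sub>m m m & E * lin_comb m r z e = 0\<^sub>m m m"
  using assms(1,3,4)
 proof (induction r)
  case 0
  then show ?case using E by (simp add: lin_comb_0)
 next
  case (Suc r)
  have er: "e r \<in> Mat m m" using Suc.prems by simp
  have zr: "z r \<cdot>\<^sub>m e r \<in> Mat m m" using er by simp
  have IH: "lin_comb m r z e * E = 0\<^sub>m m m" "E * lin_comb m r z e = 0\<^sub>m m m" using Suc by auto
  show ?case unfolding lin_comb_Suc[where e = e, OF er] add_mult_distrib_mat[OF lin_comb_carrier(1) zr E]
    mult_add_distrib_mat[OF E lin_comb_carrier(1) zr] IH mult_smult_assoc_mat[OF er E] mult_smult_distrib[OF E er]
   using Suc.prems(2,3)[of r] by auto
 qed
 then show "lin_comb m r z e * E = 0\<^sub>m m m" "E * lin_comb m r z e = 0\<^sub>m m m" by auto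
qed

context
 fixes e :: "nat => 'b::field mat" and m r \<rho> :: nat
 assumes orth: "!!i j. i < r ==> j < r ==> i ~= j ==> e i * e j = 0\<^sub>m m m"
  and rank: "!!i. i < r ==> idem_rank (e i) m \<rho>"
begin

lemma orth_carrier: "i < r ==> e i \<in> Mat m m"
 using rank by (auto simp: idem_rank_def)

lemma orth_combination_det: "t <= r ==> det (1\<^sub>m m + lin_comb m t z e) = (\<Prod>i<t. 1 + z i) ^ \<rho>"
proof (induction t)
 case 0
 have "1\<^sub>m m + 0\<^sub>m m m = (1\<^sub>m m :: 'b mat)" by auto
 then show ?case by (simp add: lin_comb_0)
next
 case (Suc t)
 let ?W = "lin_comb m t z e"
 have et: "e t \<in> Mat m m" using orth_carrier[of t] Suc.prems by simp
 have zet: "z t \<cdot>\<^sub>m e t \<in> Mat m m" using et by simp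
 have We: "?W * e t = 0\<^sub>m m m"
  using Suc.prems by (intro lin_comb_mult et orth orth_carrier) auto
 have Wc: "?W \<in> Mat m m" by simp
 have "(1\<^sub>m m + ?W) * (1\<^sub>m m + z t \<cdot>\<^sub>m e t) = (1\<^sub>m m + z t \<cdot>\<^sub>m e t) + (?W + z t \<cdot>\<^sub>m (?W * e t))"
  unfolding add_mult_distrib_mat[OF one_carrier_mat Wc add_carrier_mat[OF zet]] mult_add_distrib_mat[OF Wc one_carrier_mat zet]
   mult_smult_distrib[OF Wc et] using et by (simp add: mat_one_left mat_one_right)
 also have "... = 1\<^sub>m m + lin_comb m (Suc t) z e"
  unfolding We lin_comb_Suc[where e = e, OF et] using et by (intro eq_matI) (auto simp del: index_mult_mat(1))
 finally have "det (1\<^sub>m m + lin_comb m (Suc t) z e) = det (1\<^sub>m m + ?W) * det (1\<^sub>m m + z t \<cdot>\<^sub>m e t)"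
  using det_mult[of "1\<^sub>m m + ?W" m "1\<^sub>m m + z t \<cdot>\<^sub>m e t"] et by simp
 also have "det (1\<^sub>m m + z t \<cdot>\<^sub>m e t) = (1 + z t) ^ \<rho>"
  using idem_rank_det[OF rank[of t], of "1 + z t"] Suc.prems by simp
 finally show ?case using Suc by (simp add: power_mult_distrib)
qed

lemma orth_sum_idem: "t <= r ==> lin_comb m t (%_. 1) e * lin_comb m t (%_. 1) e = lin_comb m t (%_. 1) e"
proof (induction t)
 case 0
 then show ?case by (simp add: lin_comb_0)
next
 case (Suc t)
 let ?W = "lin_comb m t (%_. 1) e"
 have et: "e t \<in> Mat m m" using orth_carrier[of t] Suc.prems by simp
 obtain F G where FG: "F \<in> Mat m \<rho>" "G \<in> Mat \<rho> m" "e t = F * G" "G * F = 1\<^sub>m \<rho>"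
  using idem_rank_factorization[OF rank[of t]] Suc.prems by (metis Suc_le_lessD)
 have "(F * G) * (F * G) = F * ((G * F) * G)" using FG(1,2) by (simp add: mat_assoc del: assoc_mult_mat)
 also have "... = F * G" unfolding FG(4) using FG(1,2) by simp
 finally have ee: "e t * e t = e t" unfolding FG(3) .
 have We: "?W * e t = 0\<^sub>m m m" "e t * ?W = 0\<^sub>m m m"
  using Suc.prems by (intro lin_comb_mult et orth orth_carrier; auto)+
 have Wc: "?W \<in> Mat m m" by simp
 have eq: "lin_comb m (Suc t) (%_. 1) e = ?W + e t"
  unfolding lin_comb_Suc[where e = e, OF et] by (intro eq_matI) (use et in auto)
 have IH: "?W * ?W = ?W" using Suc by simp
 have "(?W + e t) * (?W + e t) = (?W * ?W + ?W * e t) + (e t * ?W + e t * e t)"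
  using add_mult_distrib_mat[OF Wc et add_carrier_mat[OF et]] mult_add_distrib_mat[OF Wc Wc et] mult_add_distrib_mat[OF et Wc et]
  by (simp only:)
 also have "... = ?W + e t" using right_add_zero_mat[OF Wc] left_add_zero_mat[OF et] by (simp only: We ee IH)
 finally show ?case unfolding eq .
qed

end

text \<open>Ranks of orthogonal idempotents add up. Both sides are read off from determinants as exponents of \<open>z\<close>, for all \<open>z\<close> in an
infinite field.\<close>

lemma orth_sum_rank:
 fixes e :: "nat => 'b::alg_closed_field mat"
 assumes orth: "!!i j. i < r ==> j < r ==> i ~= j ==> e i * e j = 0\<^sub>m m m"
  and rank: "!!i. i < r ==> idem_rank (e i) m \<rho>"
 shows "idem_rank (lin_comb m r (%_. 1) e) m (r * \<rho>)"
proof -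
 let ?S = "lin_comb m r (%_. 1) e"
 obtain \<kappa> where \<kappa>: "idem_rank ?S m \<kappa>"
 proof -
  have "?S * ?S = ?S" by (rule orth_sum_idem[where r = r and \<rho> = \<rho>]) (use orth rank in auto)
  then show thesis using idem_rank_exists[OF lin_comb_carrier(1)] that by metis
 qed
 have "z ^ \<kappa> = z ^ (r * \<rho>)" for z :: 'b
 proof -
  have "lin_comb m r (%_. z - 1) e = (z - 1) \<cdot>\<^sub>m ?S"
   by (intro eq_matI) (auto simp: lin_comb_def sum_distrib_left)
  then have "det (1\<^sub>m m + (z - 1) \<cdot>\<^sub>m ?S) = (\<Prod>i<r. 1 + (z - 1)) ^ \<rho>"
   using orth_combination_det[where e = e and r = r and t = r and m = m and \<rho> = \<rho> and z = "%_. z - 1"] orth rank by simp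
  then show ?thesis unfolding idem_rank_det[OF \<kappa>] by (simp add: power_mult)
 qed
 then have "poly (monom 1 \<kappa> - monom 1 (r * \<rho>)) z = 0" for z :: 'b by (simp add: poly_monom)
 then have "monom 1 \<kappa> - monom (1 :: 'b) (r * \<rho>) = 0" using nonzero_poly_has_nonroot by metis
 then have "monom 1 \<kappa> = monom (1 :: 'b) (r * \<rho>)" by simp
 from arg_cong[OF this, of degree] have "\<kappa> = r * \<rho>" by (simp add: degree_monom_eq)
 then show ?thesis using \<kappa> by simp
qed

section \<open>Endomorphisms of quiver representations\<close>

lemma rep_arc: "\<phi> \<in> quiver_reps Q v K ==> a \<in> arcs Q ==> \<phi> a \<in> Mat (v (head Q a)) (v (tail Q a))"
 by (auto simp: quiver_reps_def PiE_iff)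

lemma arc_ends: "finite_quiver Q ==> a \<in> arcs Q ==> head Q a \<in> verts Q & tail Q a \<in> verts Q"
 by (auto simp: finite_quiver_def)

lemma rep_endo_iff:
 assumes "finite_quiver Q" "\<phi> \<in> quiver_reps Q v UNIV"
 shows "rep_endo Q v \<phi> e \<longleftrightarrow> (\<forall>x\<in>verts Q. e x \<in> Mat (v x) (v x)) &
  (\<forall>a\<in>arcs Q. intertwines (\<phi> a) (e (head Q a)) (e (tail Q a)))"
 unfolding rep_endo_def
proof (intro conj_cong refl ball_cong iffI)
 fix a assume e: "\<forall>x\<in>verts Q. e x \<in> Mat (v x) (v x)" and a: "a \<in> arcs Q"
 show "intertwines (\<phi> a) (e (head Q a)) (e (tail Q a))" if "e (head Q a) * \<phi> a = \<phi> a * e (tail Q a)"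
  using e arc_ends[OF assms(1) a] by (intro intertwinesI[OF _ _ rep_arc[OF assms(2) a] that]) auto
qed (rule intertwinesD)

context
 fixes Q :: "('v, 'e) pre_digraph" and v :: "'v => nat" and \<phi> :: "'e => 'b::field mat"
 assumes Q: "finite_quiver Q" and \<phi>: "\<phi> \<in> quiver_reps Q v UNIV"
begin

lemma rep_endo_mult: "rep_endo Q v \<phi> e ==> rep_endo Q v \<phi> e' ==> rep_endo Q v \<phi> (%x. e x * e' x)"
 unfolding rep_endo_iff[OF Q \<phi>] by (auto intro: intertwines_mult mult_carrier_mat)

lemma rep_endo_diff: "rep_endo Q v \<phi> e ==> rep_endo Q v \<phi> e' ==> rep_endo Q v \<phi> (%x. e x - e' x)"
 unfolding rep_endo_iff[OF Q \<phi>] by (intro conjI ballI intertwines_diff minus_carrier_mat) simp_all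

lemma rep_endo_smult: "rep_endo Q v \<phi> e ==> rep_endo Q v \<phi> (%x. z \<cdot>\<^sub>m e x)"
 unfolding rep_endo_iff[OF Q \<phi>] by (intro conjI ballI intertwines_smult smult_carrier_mat) simp_all

lemma rep_endo_pow: "rep_endo Q v \<phi> e ==> rep_endo Q v \<phi> (%x. e x ^\<^sub>m k)"
 unfolding rep_endo_iff[OF Q \<phi>] by (intro conjI ballI intertwines_pow pow_carrier_mat) simp_all

lemma rep_endo_one: "rep_endo Q v \<phi> (%x. 1\<^sub>m (v x))"
 unfolding rep_endo_iff[OF Q \<phi>] by (intro conjI ballI intertwines_one rep_arc[OF \<phi>]) simp_all

lemma rep_endo_zero: "rep_endo Q v \<phi> (%x. 0\<^sub>m (v x) (v x))"
 unfolding rep_endo_iff[OF Q \<phi>] by (intro conjI ballI intertwines_zero rep_arc[OF \<phi>]) simp_all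

lemma rep_endo_carrier: "rep_endo Q v \<phi> e ==> x \<in> verts Q ==> e x \<in> Mat (v x) (v x)"
 by (simp add: rep_endo_def)

lemma rep_endo_shift: "rep_endo Q v \<phi> e ==> rep_endo Q v \<phi> (%x. e x - z \<cdot>\<^sub>m 1\<^sub>m (v x))"
 by (intro rep_endo_diff rep_endo_smult rep_endo_one)

lemma rep_endo_combination:
 assumes "!!i. i < r ==> rep_endo Q v \<phi> (e i)"
 shows "rep_endo Q v \<phi> (%x. lin_comb (v x) r z (%i. e i x))"
 unfolding rep_endo_iff[OF Q \<phi>]
proof (intro conjI ballI)
 fix a assume a: "a \<in> arcs Q"
 show "intertwines (\<phi> a) (lin_comb (v (head Q a)) r z (%i. e i (head Q a))) (lin_comb (v (tail Q a)) r z (%i. e i (tail Q a)))"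
  using assms a arc_ends[OF Q a] unfolding rep_endo_iff[OF Q \<phi>]
  by (intro lin_comb_intertwines rep_arc[OF \<phi> a]) simp_all
qed simp

end

text \<open>Extension of scalars to the algebraic closure.\<close>

definition ac_rep :: "('v, 'e) pre_digraph => ('e => 'a::field mat) => 'e => 'a alg_closure mat" where
 "ac_rep Q \<phi> = (\<lambda>a\<in>arcs Q. ac_mat (\<phi> a))"

lemma ac_rep_reps: "\<phi> \<in> quiver_reps Q v UNIV ==> ac_rep Q \<phi> \<in> quiver_reps Q v UNIV"
 by (auto simp: ac_rep_def quiver_reps_def PiE_iff)

lemma ac_rep_arc: "a \<in> arcs Q ==> ac_rep Q \<phi> a = ac_mat (\<phi> a)"
 by (simp add: ac_rep_def)

lemma ac_rep_endo:
 assumes Q: "finite_quiver Q" and \<phi>: "\<phi> \<in> quiver_reps Q v UNIV" and h: "rep_endo Q v \<phi> h"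
 shows "rep_endo Q v (ac_rep Q \<phi>) (%x. ac_mat (h x))"
 using h unfolding rep_endo_iff[OF Q \<phi>] rep_endo_iff[OF Q ac_rep_reps[OF \<phi>]]
 by (auto simp: ac_rep_arc intro: intertwines_hom[OF to_ac_hom])

lemma frob_map_to_ac: "map_mat (frob i) (ac_mat A) = ac_mat A"
 by (intro eq_matI) auto

lemma frob_rep_endo:
 assumes Q: "finite_quiver Q" and \<phi>: "\<phi> \<in> quiver_reps Q v UNIV" and e: "rep_endo Q v (ac_rep Q \<phi>) e"
 shows "rep_endo Q v (ac_rep Q \<phi>) (%x. map_mat (frob i) (e x))"
 unfolding rep_endo_iff[OF Q ac_rep_reps[OF \<phi>]]
proof (intro conjI ballI)
 fix x assume "x \<in> verts Q"
 then show "map_mat (frob i) (e x) \<in> Mat (v x) (v x)" using rep_endo_carrier[OF Q ac_rep_reps[OF \<phi>] e] by simp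
next
 fix a assume a: "a \<in> arcs Q"
 have "intertwines (ac_rep Q \<phi> a) (e (head Q a)) (e (tail Q a))" using e a unfolding rep_endo_iff[OF Q ac_rep_reps[OF \<phi>]] by blast
 from intertwines_hom[OF frob_hom this, of i]
 show "intertwines (ac_rep Q \<phi> a) (map_mat (frob i) (e (head Q a))) (map_mat (frob i) (e (tail Q a)))"
  unfolding ac_rep_arc[OF a] frob_map_to_ac .
qed

lemma to_ac_matI:
 fixes A :: "'a::{field,finite} alg_closure mat"
 assumes "map_mat (frob 1) A = A"
 shows "\<exists>B. A = ac_mat B & dim_row B = dim_row A & dim_col B = dim_col A"
proof -
 have "A $$ (i,j) \<in> range to_ac" if "i < dim_row A" "j < dim_col A" for i j
 proof -
  have "frob 1 (A $$ (i,j)) = map_mat (frob 1) A $$ (i,j)" using that by simp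
  then show ?thesis unfolding assms by (rule frob_fixed)
 qed
 then have "A = ac_mat (map_mat of_ac A)" by (intro eq_matI) (auto simp: to_ac_of_ac)
 then show ?thesis by (intro exI[of _ "map_mat of_ac A"]) simp
qed

lemma map_to_ac_shift: "A \<in> Mat n n ==> ac_mat (A - c \<cdot>\<^sub>m 1\<^sub>m n) = ac_mat A - to_ac c \<cdot>\<^sub>m 1\<^sub>m n"
 by (intro eq_matI) auto

lemma map_frob_shift:
 "map_mat (frob i) (ac_mat A - c \<cdot>\<^sub>m 1\<^sub>m n) = ac_mat A - frob i c \<cdot>\<^sub>m 1\<^sub>m n"
 if "A \<in> Mat n n" for A :: "'a::{field,finite} mat"
proof -
 interpret comm_ring_hom "frob i :: 'a alg_closure => _" by (rule frob_hom)
 show ?thesis using that by (intro eq_matI) (auto simp: hom_minus hom_mult)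
qed

lemma map_to_ac_inj: "ac_mat A = ac_mat B ==> A = B" for A :: "'a::field mat"
proof -
 interpret inj_semiring_hom "to_ac :: 'a => 'a alg_closure" by unfold_locales (auto simp: inj_def)
 show "ac_mat A = ac_mat B ==> A = B" by (rule mat_hom_inj)
qed

lemma pow_mult_zero:
 fixes A :: "'b::comm_ring_1 mat"
 assumes A: "A \<in> Mat n n" and U: "U \<in> Mat n m" and "A * U = 0\<^sub>m n m" and "k >= 1"
 shows "A ^\<^sub>m k * U = 0\<^sub>m n m"
proof -
 have "0 \<cdot>\<^sub>m U = 0\<^sub>m n m" using U by (intro eq_matI) auto
 then have "A * U = 0 \<cdot>\<^sub>m U" using assms(3) by simp
 from eigen_power[OF A U this, of k] show ?thesis using \<open>0 \<cdot>\<^sub>m U = 0\<^sub>m n m\<close> \<open>k >= 1\<close> by (simp add: power_0_left)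
qed

text \<open>An endomorphism over \<open>F\<close> and a vertex at which its eigenvalues in \<open>L\<close> are considered.\<close>

locale base_change =
 fixes Q :: "('v, 'e) pre_digraph" and v :: "'v => nat" and \<phi> :: "'e => 'a::{field,finite} mat" and h :: "'v => 'a mat" and b :: 'v
 assumes Q: "finite_quiver Q" and \<phi>: "\<phi> \<in> quiver_reps Q v UNIV" and h: "rep_endo Q v \<phi> h"
  and base: "b \<in> verts Q" "v b >= 1"
begin

lemma ac_Q: "ac_rep Q \<phi> \<in> quiver_reps Q v UNIV" by (rule ac_rep_reps[OF \<phi>])

lemma hc: "x \<in> verts Q ==> h x \<in> Mat (v x) (v x)" by (rule rep_endo_carrier[OF Q \<phi> h])

definition shifted :: "'a alg_closure => 'v => 'a alg_closure mat" where
 "shifted \<sigma> x = ac_mat (h x) - \<sigma> \<cdot>\<^sub>m 1\<^sub>m (v x)"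

lemma shifted_endo: "rep_endo Q v (ac_rep Q \<phi>) (shifted \<sigma>)"
 unfolding shifted_def by (rule rep_endo_shift[OF Q ac_Q ac_rep_endo[OF Q \<phi> h]])

lemma shifted_carrier: "x \<in> verts Q ==> shifted \<sigma> x \<in> Mat (v x) (v x)"
 by (rule rep_endo_carrier[OF Q ac_Q shifted_endo])

lemma eigenprojection_exists:
 obtains \<sigma> U M where "U \<in> Mat (v b) 1" "U ~= 0\<^sub>m (v b) 1" "shifted \<sigma> b * U = 0\<^sub>m (v b) 1" "M >= 1"
  "!!x. x \<in> verts Q ==> shifted \<sigma> x ^\<^sub>m M * shifted \<sigma> x ^\<^sub>m M = shifted \<sigma> x ^\<^sub>m M"
proof -
 have Ho: "ac_mat (h b) \<in> Mat (v b) (v b)" using hc[OF base(1)] by simp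
 obtain \<sigma> U where U: "U \<in> Mat (v b) 1" "U ~= 0\<^sub>m (v b) 1" "(ac_mat (h b) - \<sigma> \<cdot>\<^sub>m 1\<^sub>m (v b)) * U = 0\<^sub>m (v b) 1"
  by (rule eigenvector_exists[OF Ho base(2)])
 have "finite (verts Q)" using Q by (simp add: finite_quiver_def)
 from idempotent_power_uniform[OF this, of "shifted \<sigma>" v] shifted_carrier
 obtain M where "M >= 1" "!!x. x \<in> verts Q ==> shifted \<sigma> x ^\<^sub>m M * shifted \<sigma> x ^\<^sub>m M = shifted \<sigma> x ^\<^sub>m M" by blast
 then show thesis using U by (intro that[of U \<sigma> M]) (simp_all add: shifted_def)
qed

text \<open>Some power of \<open>h - \<sigma>\<close>, with \<open>\<sigma>\<close> an eigenvalue at \<open>b\<close>, is idempotent and not \<open>1\<close>, so it is zero. The Frobenius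
conjugate of \<open>\<sigma>\<close> is an eigenvalue too, so it equals \<open>\<sigma>\<close>, which thus lies in \<open>F\<close>.\<close>

theorem automorphism_det:
 assumes nidem: "\<not> (\<exists>e. idem_endo Q v (ac_rep Q \<phi>) e)" and inv: "!!x. x \<in> verts Q ==> h x \<in> carrier (GL (v x))"
 shows "\<exists>c. c ~= 0 & (\<forall>x\<in>verts Q. det (h x) = c ^ v x)"
proof -
 obtain \<sigma> U M where U: "U \<in> Mat (v b) 1" "U ~= 0\<^sub>m (v b) 1" "shifted \<sigma> b * U = 0\<^sub>m (v b) 1" and M: "M >= 1"
  "!!x. x \<in> verts Q ==> shifted \<sigma> x ^\<^sub>m M * shifted \<sigma> x ^\<^sub>m M = shifted \<sigma> x ^\<^sub>m M"
  using eigenprojection_exists by metis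
 define e where "e x = shifted \<sigma> x ^\<^sub>m M" for x
 have endo: "rep_endo Q v (ac_rep Q \<phi>) e" unfolding e_def by (rule rep_endo_pow[OF Q ac_Q shifted_endo])
 have "e b * U = 0\<^sub>m (v b) 1" unfolding e_def by (rule pow_mult_zero[OF shifted_carrier[OF base(1)] U(1,3) M(1)])
 then have "e b ~= 1\<^sub>m (v b)" using U(1,2) by auto
 moreover have "\<not> idem_endo Q v (ac_rep Q \<phi>) e" using nidem by blast
 ultimately have e0: "e x = 0\<^sub>m (v x) (v x)" if "x \<in> verts Q" for x
  unfolding idem_endo_def using endo M(2) base(1) that unfolding e_def by blast
 have HU: "ac_mat (h b) * U = \<sigma> \<cdot>\<^sub>m U"
  using U(3) shift_eigen(1)[OF _ U(1), of "ac_mat (h b)" \<sigma>] hc[OF base(1)] unfolding shifted_def by auto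
 have "frob 1 \<sigma> = \<sigma>"
 proof (rule ccontr)
  assume ne: "frob 1 \<sigma> ~= \<sigma>"
  interpret f: comm_ring_hom "frob 1 :: 'a alg_closure => _" by (rule frob_hom)
  define U' where "U' = map_mat (frob 1) U"
  have U'c: "U' \<in> Mat (v b) 1" using U(1) by (simp add: U'_def)
  have Ho: "ac_mat (h b) \<in> Mat (v b) (v b)" using hc[OF base(1)] by simp
  have "map_mat (frob 1) (ac_mat (h b) * U) = ac_mat (h b) * U'"
   unfolding f.mat_hom_mult[OF Ho U(1)] frob_map_to_ac U'_def ..
  moreover have "map_mat (frob 1) (\<sigma> \<cdot>\<^sub>m U) = frob 1 \<sigma> \<cdot>\<^sub>m U'" unfolding U'_def by (intro eq_matI) (auto simp: f.hom_mult simp del: One_nat_def)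
  ultimately have "ac_mat (h b) * U' = frob 1 \<sigma> \<cdot>\<^sub>m U'" using HU by simp
  from shift_eigen(2)[OF Ho U'c this, of \<sigma>] have "shifted \<sigma> b * U' = (frob 1 \<sigma> - \<sigma>) \<cdot>\<^sub>m U'" unfolding shifted_def .
  from eigen_power[OF shifted_carrier[OF base(1)] U'c this, of M]
  have "(frob 1 \<sigma> - \<sigma>) ^ M \<cdot>\<^sub>m U' = 0\<^sub>m (v b) 1" using e0[OF base(1)] U'c unfolding e_def by simp
  then have U'0: "U' = 0\<^sub>m (v b) 1" using ne by (intro smult_mat_eq_0[OF _ _ U'c]) auto
  have "U $$ (i,j) = 0" if "i < v b" "j < 1" for i j
  proof -
   have "frob 1 (U $$ (i,j)) = U' $$ (i,j)" using that U(1) by (simp add: U'_def)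
   then have "frob 1 (U $$ (i,j)) = 0" unfolding U'0 using that by simp
   then show ?thesis unfolding frob_eq_0_iff .
  qed
  then have "U = 0\<^sub>m (v b) 1" using U(1) by (intro eq_matI) auto
  then show False using U(2) by simp
 qed
 then obtain c where c: "\<sigma> = to_ac c" using frob_fixed by blast
 interpret t: comm_ring_hom "to_ac :: 'a => 'a alg_closure" by (rule to_ac_hom)
 have det: "det (h x) = c ^ v x" if x: "x \<in> verts Q" for x
 proof -
  have "\<sigma> \<cdot>\<^sub>m 1\<^sub>m (v x) + shifted \<sigma> x = ac_mat (h x)" using hc[OF x] by (intro eq_matI) (auto simp: shifted_def)
  moreover have "det (\<sigma> \<cdot>\<^sub>m 1\<^sub>m (v x) + shifted \<sigma> x) = \<sigma> ^ v x"
   using e0[OF x] unfolding e_def by (rule det_scalar_plus_nilpotent[OF shifted_carrier[OF x]])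
  ultimately have "to_ac (det (h x)) = to_ac (c ^ v x)" by (simp add: t.hom_det c)
  then show ?thesis by (simp only: to_ac_eq_iff)
 qed
 have "det (h b) ~= 0" using inv[OF base(1)] by (simp add: GL_iff_det)
 then have "c ~= 0" using det[OF base(1)] base(2) by (auto simp: power_0_left)
 then show ?thesis using det by blast
qed

text \<open>With \<open>\<rho>\<close> the rank of the projection to the generalized eigenspace of an eigenvalue at \<open>b\<close>, and \<open>r\<close> the number of
conjugates of the eigenvalue: the conjugate projections are orthogonal of equal rank. If \<open>\<zeta>\<close> has norm \<open>c\<close>, the element
that acts as the \<open>i\<close>-th conjugate of \<open>\<zeta>\<close> on the \<open>i\<close>-th eigenspace and trivially on the rest is invariant
under Frobenius, so it is defined over \<open>F\<close>; its determinant is \<open>c^\<rho>\<close>.\<close>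

theorem spectral_splitting:
 obtains r \<rho> where "r >= 1" "\<rho> b >= 1" "!!x. x \<in> verts Q ==> r * \<rho> x <= v x"
  "!!a. a \<in> arcs Q ==> left_inv (\<phi> a) ==>
    \<rho> (tail Q a) <= \<rho> (head Q a) & v (tail Q a) - r * \<rho> (tail Q a) <= v (head Q a) - r * \<rho> (head Q a)"
  "!!c. c ~= 0 ==> \<exists>u. rep_endo Q v \<phi> u & (\<forall>x\<in>verts Q. u x \<in> carrier (GL (v x)) & det (u x) = c ^ \<rho> x)"
  "r = 1 ==> \<rho> b = v b ==> \<exists>s M. (h b - s \<cdot>\<^sub>m 1\<^sub>m (v b)) ^\<^sub>m M = 0\<^sub>m (v b) (v b)"
proof -
 obtain \<sigma> U M where U: "U \<in> Mat (v b) 1" "U ~= 0\<^sub>m (v b) 1" "shifted \<sigma> b * U = 0\<^sub>m (v b) 1" and M: "M >= 1"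
  "!!x. x \<in> verts Q ==> shifted \<sigma> x ^\<^sub>m M * shifted \<sigma> x ^\<^sub>m M = shifted \<sigma> x ^\<^sub>m M"
  using eigenprojection_exists by metis
 define P where "P x = shifted \<sigma> x ^\<^sub>m M" for x
 define e where "e i x = map_mat (frob i) (1\<^sub>m (v x) - P x)" for i x
 define r where "r = (LEAST r. r >= 1 & frob r \<sigma> = \<sigma>)"
 have r: "r >= 1" "frob r \<sigma> = \<sigma>" unfolding r_def using LeastI_ex[OF frob_periodic[of \<sigma>]] by auto
 have r_min: "frob t \<sigma> ~= \<sigma>" if "t >= 1" "t < r" for t
  using not_less_Least[of t "%r. r >= 1 & frob r \<sigma> = \<sigma>"] that unfolding r_def by blast
 have Pc: "P x \<in> Mat (v x) (v x)" if "x \<in> verts Q" for x unfolding P_def by (rule pow_carrier_mat[OF shifted_carrier[OF that]])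
 have PP: "P x * P x = P x" if "x \<in> verts Q" for x unfolding P_def by (rule M(2)[OF that])
 have idc: "1\<^sub>m (v x) - P x \<in> Mat (v x) (v x)" if "x \<in> verts Q" for x using Pc[OF that] by (rule minus_carrier_mat)
 have Pe: "P x * (1\<^sub>m (v x) - P x) = 0\<^sub>m (v x) (v x)" if x: "x \<in> verts Q" for x
  unfolding mult_minus_distrib_mat[OF Pc[OF x] one_carrier_mat Pc[OF x]] PP[OF x] using Pc[OF x] by simp
 have idem: "(1\<^sub>m (v x) - P x) * (1\<^sub>m (v x) - P x) = 1\<^sub>m (v x) - P x" if x: "x \<in> verts Q" for x
  unfolding minus_mult_distrib_mat[OF one_carrier_mat Pc[OF x] idc[OF x]] Pe[OF x] using idc[OF x] Pc[OF x] by (intro eq_matI) (auto simp: mat_one_left)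
 have ec: "e i x \<in> Mat (v x) (v x)" if "x \<in> verts Q" for i x using idc[OF that] by (simp add: e_def)
 have endo0: "rep_endo Q v (ac_rep Q \<phi>) (%x. 1\<^sub>m (v x) - P x)" unfolding P_def
  by (rule rep_endo_diff[OF Q ac_Q rep_endo_one[OF Q ac_Q] rep_endo_pow[OF Q ac_Q shifted_endo]])
 have endo: "rep_endo Q v (ac_rep Q \<phi>) (e i)" for i
  unfolding e_def by (rule frob_rep_endo[OF Q \<phi> endo0])
 have annihilate: "(ac_mat (h x) - frob i \<sigma> \<cdot>\<^sub>m 1\<^sub>m (v x)) ^\<^sub>m M * e i x = 0\<^sub>m (v x) (v x)" if x: "x \<in> verts Q" for i x
 proof -
  interpret f: comm_ring_hom "frob i :: 'a alg_closure => _" by (rule frob_hom)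
  have "map_mat (frob i) (P x) = (ac_mat (h x) - frob i \<sigma> \<cdot>\<^sub>m 1\<^sub>m (v x)) ^\<^sub>m M"
   unfolding P_def f.mat_hom_pow[OF shifted_carrier[OF x]] unfolding shifted_def map_frob_shift[OF hc[OF x]] ..
  moreover have "map_mat (frob i) (P x) * e i x = map_mat (frob i) (P x * (1\<^sub>m (v x) - P x))"
   unfolding e_def by (rule f.mat_hom_mult[OF Pc[OF x] idc[OF x], symmetric])
  moreover have "map_mat (frob i) (P x * (1\<^sub>m (v x) - P x)) = 0\<^sub>m (v x) (v x)" unfolding Pe[OF x] by (intro eq_matI) auto
  ultimately show ?thesis by simp
 qed
 have e_H: "e i x * ac_mat (h x) = ac_mat (h x) * e i x" if x: "x \<in> verts Q" for i x
 proof -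
  let ?H = "ac_mat (h x)"
  have Hc: "?H \<in> Mat (v x) (v x)" using hc[OF x] by simp
  have "intertwines ?H (1\<^sub>m (v x) - P x) (1\<^sub>m (v x) - P x)" unfolding P_def shifted_def
   by (intro intertwines_diff intertwines_pow intertwines_smult intertwines_one[OF Hc] intertwines_self[OF Hc])
  from intertwines_hom[OF frob_hom this, of i] have "intertwines ?H (e i x) (e i x)" unfolding frob_map_to_ac e_def .
  then show ?thesis by (rule intertwinesD)
 qed
 have distinct: "frob i \<sigma> ~= frob j \<sigma>" if "i < r" "j < r" "i ~= j" for i j
 proof -
  have "frob i \<sigma> ~= frob j \<sigma>" if "i < j" "j < r" for i j
  proof
   assume "frob i \<sigma> = frob j \<sigma>"
   then have "frob i (frob (j - i) \<sigma>) = frob i \<sigma>" using that by (simp add: frob_comp)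
   then have "frob (j - i) \<sigma> = \<sigma>" by (rule frob_inj)
   then show False using r_min[of "j - i"] that by simp
  qed
  from this[of i j] this[of j i] that show ?thesis by (cases i j rule: linorder_cases) auto
 qed
 have orth: "e i x * e j x = 0\<^sub>m (v x) (v x)" if x: "x \<in> verts Q" and ij: "i < r" "j < r" "i ~= j" for i j x
 proof (rule distinct_eigenvalues_disjoint[OF _ _ distinct[OF ij]])
  let ?H = "ac_mat (h x)" and ?S = "%i. (ac_mat (h x) - frob i \<sigma> \<cdot>\<^sub>m 1\<^sub>m (v x)) ^\<^sub>m M"
  show Hc: "?H \<in> Mat (v x) (v x)" using hc[OF x] by simp
  show "e i x * e j x \<in> Mat (v x) (v x)" using ec[OF x] ec[OF x] by (rule mult_carrier_mat)
  have Sc: "?S i \<in> Mat (v x) (v x)" for i using Hc by (intro pow_carrier_mat minus_carrier_mat) auto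
  show "?S i * (e i x * e j x) = 0\<^sub>m (v x) (v x)"
   unfolding assoc_mult_mat[OF Sc ec[OF x] ec[OF x], symmetric] annihilate[OF x] by (rule left_mult_zero_mat[OF ec[OF x]])
  have "?S j * e i x = e i x * ?S j" by (rule shift_pow_commute[OF Hc ec[OF x] e_H[OF x], symmetric])
  then have "?S j * (e i x * e j x) = e i x * (?S j * e j x)"
   unfolding assoc_mult_mat[OF Sc ec[OF x] ec[OF x], symmetric] using assoc_mult_mat[OF ec[OF x] Sc ec[OF x]] by simp
  then show "?S j * (e i x * e j x) = 0\<^sub>m (v x) (v x)" unfolding annihilate[OF x] using right_mult_zero_mat[OF ec[OF x]] by simp
 qed
 have "\<forall>x\<in>verts Q. \<exists>\<rho>. idem_rank (1\<^sub>m (v x) - P x) (v x) \<rho>" using idem_rank_exists[OF idc idem] by blast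
 from bchoice[OF this] obtain \<rho> where "!!x. x \<in> verts Q ==> idem_rank (1\<^sub>m (v x) - P x) (v x) (\<rho> x)" by blast
 then have rank: "idem_rank (e i x) (v x) (\<rho> x)" if "x \<in> verts Q" for i x
  unfolding e_def using that by (intro idem_rank_hom[OF frob_hom]) blast
 define S where "S x = lin_comb (v x) r (%_. 1) (%i. e i x)" for x
 have S_rank: "idem_rank (S x) (v x) (r * \<rho> x)" if "x \<in> verts Q" for x
  unfolding S_def by (rule orth_sum_rank) (use that orth rank in auto)
 have S_endo: "rep_endo Q v (ac_rep Q \<phi>) S" unfolding S_def by (rule rep_endo_combination[OF Q ac_Q endo])
 show thesis
 proof (rule that[of r \<rho>])
  show "r >= 1" by (rule r(1))
  show "r * \<rho> x <= v x" if "x \<in> verts Q" for x using S_rank[OF that] by (simp add: idem_rank_def)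
  have e0: "e 0 x = 1\<^sub>m (v x) - P x" for x unfolding e_def by (intro eq_matI) (auto simp: frob_0)
  show "\<rho> b >= 1"
  proof (rule ccontr)
   assume "\<not> \<rho> b >= 1"
   then have "\<rho> b = 0" by simp
   then have z: "1\<^sub>m (v b) - P b = 0\<^sub>m (v b) (v b)" using rank[OF base(1), of 0] unfolding e0 by (metis idem_rank_0)
   have PU: "P b * U = 0\<^sub>m (v b) 1" unfolding P_def by (rule pow_mult_zero[OF shifted_carrier[OF base(1)] U(1,3) M(1)])
   have "(1\<^sub>m (v b) - P b) * U = U" unfolding minus_mult_distrib_mat[OF one_carrier_mat Pc[OF base(1)] U(1)] PU
    using U(1) by (intro eq_matI) (auto simp: mat_one_left)
   then have "U = 0\<^sub>m (v b) 1" unfolding z using left_mult_zero_mat[OF U(1)] by simp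
   then show False using U(2) by simp
  qed
  show "\<rho> (tail Q a) <= \<rho> (head Q a) & v (tail Q a) - r * \<rho> (tail Q a) <= v (head Q a) - r * \<rho> (head Q a)"
   if a: "a \<in> arcs Q" and li: "left_inv (\<phi> a)" for a
  proof
   note ends = arc_ends[OF Q a]
   have fc: "ac_rep Q \<phi> a \<in> Mat (v (head Q a)) (v (tail Q a))" by (rule rep_arc[OF ac_Q a])
   have \<phi>c: "\<phi> a \<in> Mat (v (head Q a)) (v (tail Q a))" by (rule rep_arc[OF \<phi> a])
   interpret t: comm_ring_hom "to_ac :: 'a => 'a alg_closure" by (rule to_ac_hom)
   obtain B where B: "B \<in> Mat (v (tail Q a)) (v (head Q a))" "B * \<phi> a = 1\<^sub>m (v (tail Q a))"
    using left_invE[OF li \<phi>c] by metis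
   have "ac_mat B * ac_rep Q \<phi> a = 1\<^sub>m (v (tail Q a))"
    unfolding ac_rep_arc[OF a] t.mat_hom_mult[OF B(1) \<phi>c, symmetric] B(2) by (rule t.mat_hom_one)
   then have li': "left_inv (ac_rep Q \<phi> a)" using B(1) by (intro left_invI[OF fc]) auto
   have com: "f (head Q a) * ac_rep Q \<phi> a = ac_rep Q \<phi> a * f (tail Q a)" if "rep_endo Q v (ac_rep Q \<phi>) f" for f
    using that a unfolding rep_endo_def by blast
   show "\<rho> (tail Q a) <= \<rho> (head Q a)"
    by (rule idem_rank_mono[OF rank rank fc li' com[OF endo[of 0]]]) (use ends in auto)
   show "v (tail Q a) - r * \<rho> (tail Q a) <= v (head Q a) - r * \<rho> (head Q a)"
    by (rule idem_rank_mono[OF idem_rank_compl[OF S_rank] idem_rank_compl[OF S_rank] fc li' com[OF rep_endo_diff[OF Q ac_Q rep_endo_one[OF Q ac_Q] S_endo]]])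
     (use ends in auto)
  qed
  show "\<exists>u. rep_endo Q v \<phi> u & (\<forall>x\<in>verts Q. u x \<in> carrier (GL (v x)) & det (u x) = c ^ \<rho> x)" if c: "c ~= 0" for c
  proof -
   let ?q = "card (UNIV :: 'a set)"
   obtain \<zeta> :: "'a alg_closure" where \<zeta>: "(\<Prod>i<r. frob i \<zeta>) = to_ac c"
   proof -
    let ?s = "\<Sum>i<r. ?q ^ i"
    have "?q ^ 0 <= ?s" using r(1) by (intro member_le_sum) auto
    then have s: "?s >= 1" by simp
    then obtain \<zeta> :: "'a alg_closure" where "\<zeta> ^ ?s = to_ac c" using nth_root_exists[of ?s "to_ac c"] by auto
    then show thesis by (intro that[of \<zeta>]) (simp add: frob_def power_sum)
   qed
   have nz: "frob i \<zeta> ~= 0" for i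
   proof
    assume "frob i \<zeta> = 0"
    then have "frob 0 \<zeta> = 0" by (simp add: frob_eq_0_iff)
    then have "(\<Prod>i<r. frob i \<zeta>) = 0" using r(1) by (intro prod_zero bexI[of _ 0]) auto
    then show False using \<zeta> c by simp
   qed
   have per: "frob r \<zeta> = \<zeta>"
   proof -
    interpret f: comm_ring_hom "frob 1 :: 'a alg_closure => _" by (rule frob_hom)
    have "(\<Prod>i<r. frob (Suc i) \<zeta>) = frob 1 (\<Prod>i<r. frob i \<zeta>)" unfolding f.hom_prod frob_comp by simp
    also have "... = to_ac c" unfolding \<zeta> by simp
    finally have 1: "(\<Prod>i<Suc r. frob i \<zeta>) = \<zeta> * to_ac c" unfolding prod.lessThan_Suc_shift by (simp add: frob_0)
    have "(\<Prod>i<Suc r. frob i \<zeta>) = to_ac c * frob r \<zeta>" unfolding prod.lessThan_Suc \<zeta> ..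
    then have "to_ac c * frob r \<zeta> = to_ac c * \<zeta>" using 1 by (metis mult.commute)
    then show ?thesis using c by simp
   qed
   define W where "W x = lin_comb (v x) r (%i. frob i \<zeta> - 1) (%i. e i x)" for x
   have fixed: "map_mat (frob 1) (W x) = W x" if x: "x \<in> verts Q" for x
   proof (rule eq_matI)
    interpret f: comm_ring_hom "frob 1 :: 'a alg_closure => _" by (rule frob_hom)
    fix i j assume "i < dim_row (W x)" "j < dim_col (W x)"
    then have ij: "i < v x" "j < v x" by (simp_all add: W_def)
    define T where "T t = (frob t \<zeta> - 1) * e t x $$ (i,j)" for t
    have dims: "dim_row (P x) = v x" "dim_col (P x) = v x" using Pc[OF x] by auto
    have eT: "frob 1 (T t) = T (Suc t)" for t
     unfolding T_def f.hom_mult f.hom_minus f.hom_one frob_comp using ij dims by (simp add: e_def frob_comp)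
    have "T r = T 0"
    proof -
     have "map_mat (frob r) (P x) = P x"
     proof -
      interpret fr: comm_ring_hom "frob r :: 'a alg_closure => _" by (rule frob_hom)
      show ?thesis unfolding P_def fr.mat_hom_pow[OF shifted_carrier[OF x]] unfolding shifted_def map_frob_shift[OF hc[OF x]] r(2) ..
     qed
     then have "e r x = e 0 x"
     proof -
      assume *: "map_mat (frob r) (P x) = P x"
      interpret fr: comm_ring_hom "frob r :: 'a alg_closure => _" by (rule frob_hom)
      show ?thesis
      proof (rule eq_matI)
       fix i j assume "i < dim_row (e 0 x)" "j < dim_col (e 0 x)"
       then have ij: "i < v x" "j < v x" using ec[OF x, of 0] by auto
       have "frob r (P x $$ (i,j)) = P x $$ (i,j)" using arg_cong[OF *, of "%A. A $$ (i,j)"] ij dims by simp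
       then show "e r x $$ (i,j) = e 0 x $$ (i,j)" using ij dims by (simp add: e_def frob_0 fr.hom_minus)
      qed (use ec[OF x, of r] ec[OF x, of 0] in auto)
     qed
     then show ?thesis by (simp add: T_def per frob_0)
    qed
    have "map_mat (frob 1) (W x) $$ (i,j) = frob 1 (\<Sum>t<r. T t)" using ij by (simp add: W_def lin_comb_def T_def)
    also have "... = (\<Sum>t<r. T (Suc t))" unfolding f.hom_sum eT ..
    also have "... = (\<Sum>t<r. T t)"
    proof -
     have "T 0 + (\<Sum>t<r. T (Suc t)) = (\<Sum>t<r. T t) + T r" unfolding sum.lessThan_Suc_shift[symmetric] sum.lessThan_Suc ..
     then show ?thesis unfolding \<open>T r = T 0\<close> by simp
    qed
    also have "... = W x $$ (i,j)" using ij by (simp add: W_def lin_comb_def T_def)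
    finally show "map_mat (frob 1) (W x) $$ (i,j) = W x $$ (i,j)" .
   qed (simp_all add: W_def)
   have "\<forall>x\<in>verts Q. \<exists>B. W x = ac_mat B & B \<in> Mat (v x) (v x)"
   proof
    fix x assume "x \<in> verts Q"
    from to_ac_matI[OF fixed[OF this]] show "\<exists>B. W x = ac_mat B & B \<in> Mat (v x) (v x)"
     by (auto simp: W_def intro!: carrier_matI)
   qed
   from bchoice[OF this] obtain B where B: "!!x. x \<in> verts Q ==> W x = ac_mat (B x)" "!!x. x \<in> verts Q ==> B x \<in> Mat (v x) (v x)" by blast
   define u where "u x = 1\<^sub>m (v x) + B x" for x
   interpret t: comm_ring_hom "to_ac :: 'a => 'a alg_closure" by (rule to_ac_hom)
   have uc: "u x \<in> Mat (v x) (v x)" if "x \<in> verts Q" for x using B(2)[OF that] by (simp add: u_def)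
   have u_ac: "ac_mat (u x) = 1\<^sub>m (v x) + W x" if "x \<in> verts Q" for x
    unfolding B(1)[OF that] u_def using B(2)[OF that] by (intro eq_matI) auto
   have det: "det (u x) = c ^ \<rho> x" if x: "x \<in> verts Q" for x
   proof -
    have "to_ac (det (u x)) = det (1\<^sub>m (v x) + W x)" unfolding u_ac[OF x, symmetric] by simp
    also have "... = (\<Prod>i<r. 1 + (frob i \<zeta> - 1)) ^ \<rho> x"
     unfolding W_def by (rule orth_combination_det[where r = r]) (use orth rank x in auto)
    also have "... = to_ac (c ^ \<rho> x)" using \<zeta> by simp
    finally show ?thesis by (simp only: to_ac_eq_iff)
   qed
   have "rep_endo Q v (ac_rep Q \<phi>) W" unfolding W_def by (rule rep_endo_combination[OF Q ac_Q endo])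
   then have Wcom: "W (head Q a) * ac_rep Q \<phi> a = ac_rep Q \<phi> a * W (tail Q a)" if "a \<in> arcs Q" for a
    using that unfolding rep_endo_def by blast
   have "intertwines (\<phi> a) (B (head Q a)) (B (tail Q a))" if a: "a \<in> arcs Q" for a
   proof -
    note ends = arc_ends[OF Q a]
    note \<phi>c = rep_arc[OF \<phi> a]
    note Bc = B(2)[OF conjunct1[OF ends]] B(2)[OF conjunct2[OF ends]]
    have "ac_mat (B (head Q a) * \<phi> a) = ac_mat (\<phi> a * B (tail Q a))"
     unfolding t.mat_hom_mult[OF Bc(1) \<phi>c] t.mat_hom_mult[OF \<phi>c Bc(2)]
     using Wcom[OF a] B(1)[OF conjunct1[OF ends]] B(1)[OF conjunct2[OF ends]] by (simp add: ac_rep_arc[OF a])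
    then show ?thesis by (rule intertwinesI[OF Bc \<phi>c map_to_ac_inj])
   qed
   then have "rep_endo Q v \<phi> u" unfolding rep_endo_iff[OF Q \<phi>] u_def
    using B(2) by (auto intro!: intertwines_add intertwines_one[OF rep_arc[OF \<phi>]])
   moreover have "u x \<in> carrier (GL (v x))" if "x \<in> verts Q" for x using uc[OF that] det[OF that] c by (simp add: GL_iff_det)
   ultimately show ?thesis using det by blast
  qed
  show "\<exists>s M. (h b - s \<cdot>\<^sub>m 1\<^sub>m (v b)) ^\<^sub>m M = 0\<^sub>m (v b) (v b)" if "r = 1" and full: "\<rho> b = v b"
  proof -
   have "frob 1 \<sigma> = \<sigma>" using r(2) \<open>r = 1\<close> by simp
   then obtain s where s: "\<sigma> = to_ac s" using frob_fixed by blast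
   have E: "1\<^sub>m (v b) - P b = 1\<^sub>m (v b)" using rank[OF base(1), of 0] unfolding e0 full by (rule idem_rank_full)
   have P0: "P b = 0\<^sub>m (v b) (v b)"
   proof (rule eq_matI)
    fix i j assume "i < dim_row (0\<^sub>m (v b) (v b) :: 'a alg_closure mat)" "j < dim_col (0\<^sub>m (v b) (v b) :: 'a alg_closure mat)"
    then have ij: "i < v b" "j < v b" by auto
    have "(1\<^sub>m (v b) - P b) $$ (i,j) = 1\<^sub>m (v b) $$ (i,j) - P b $$ (i,j)" using ij Pc[OF base(1)] by simp
    then show "P b $$ (i,j) = 0\<^sub>m (v b) (v b) $$ (i,j)" unfolding E using ij by simp
   qed (use Pc[OF base(1)] in auto)
   interpret t: comm_ring_hom "to_ac :: 'a => 'a alg_closure" by (rule to_ac_hom)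
   have dc: "h b - s \<cdot>\<^sub>m 1\<^sub>m (v b) \<in> Mat (v b) (v b)" by (intro minus_carrier_mat) simp
   have "ac_mat ((h b - s \<cdot>\<^sub>m 1\<^sub>m (v b)) ^\<^sub>m M) = P b"
    unfolding t.mat_hom_pow[OF dc] map_to_ac_shift[OF hc[OF base(1)]] P_def shifted_def s ..
   also have "... = ac_mat (0\<^sub>m (v b) (v b))" unfolding P0 by (intro eq_matI) auto
   finally show ?thesis using map_to_ac_inj by blast
  qed
 qed
qed

end

section \<open>Idempotents in local endomorphism rings\<close>

primrec mat_seq_prod :: "nat => (nat => 'b::comm_ring_1 mat) => nat => 'b mat" where
 "mat_seq_prod n s 0 = 1\<^sub>m n"
| "mat_seq_prod n s (Suc i) = mat_seq_prod n s i * s i"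

lemma mat_seq_prod_carrier: "(!!i. s i \<in> Mat n n) ==> mat_seq_prod n s i \<in> Mat n n"
 by (induction i) (auto intro: mult_carrier_mat)

lemma mat_seq_prod_add:
 assumes "!!i. s i \<in> Mat n n"
 shows "mat_seq_prod n s (i + j) = mat_seq_prod n s i * mat_seq_prod n (%t. s (i + t)) j"
proof (induction j)
 case 0
 then show ?case using right_mult_one_mat[OF mat_seq_prod_carrier[of s, OF assms]] by simp
next
 case (Suc j)
 have c: "mat_seq_prod n s i \<in> Mat n n" "mat_seq_prod n (%t. s (i + t)) j \<in> Mat n n"
  by (intro mat_seq_prod_carrier assms)+
 show ?case using assoc_mult_mat[OF c assms] Suc by simp
qed

lemma mat_seq_prod_cong: "(!!t. t < i ==> s t = s' t) ==> mat_seq_prod n s i = mat_seq_prod n s' i"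
 by (induction i) auto

text \<open>A finite semigroup of nilpotent elements is nilpotent: among sufficiently many partial
 products \<open>p\<^sub>i = s\<^sub>0 \<cdots> s\<^sub>i\<close> two coincide, say \<open>p\<^sub>i = p\<^sub>i t\<close> with \<open>t\<close> nilpotent, and then
 \<open>p\<^sub>i = p\<^sub>i t\<^sup>M = 0\<close>.\<close>

lemma finite_nil_semigroup_nilpotent:
 fixes \<N> :: "'b::comm_ring_1 mat set"
 assumes fin: "finite \<N>" and car: "\<N> \<subseteq> Mat n n"
  and mult: "!!A B. A \<in> \<N> ==> B \<in> \<N> ==> A * B \<in> \<N>" and nil: "!!A. A \<in> \<N> ==> \<exists>M. A ^\<^sub>m M = 0\<^sub>m n n"
  and s: "!!i. s i \<in> \<N>"
 shows "mat_seq_prod n s (Suc (card \<N>)) = 0\<^sub>m n n"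
proof -
 have prod_mem: "mat_seq_prod n s (Suc i) \<in> \<N>" if s: "!!i. s i \<in> \<N>" for s i
 proof (induction i)
  case 0
  then show ?case using s[of 0] car by auto
 next
  case (Suc i)
  then show ?case using mult[OF _ s] by simp
 qed
 have sc: "s i \<in> Mat n n" for i using s car by blast
 have "\<not> inj_on (%i. mat_seq_prod n s (Suc i)) {..card \<N>}"
 proof
  assume "inj_on (%i. mat_seq_prod n s (Suc i)) {..card \<N>}"
  moreover have "(%i. mat_seq_prod n s (Suc i)) ` {..card \<N>} \<subseteq> \<N>" using prod_mem[of s, OF s] by blast
  ultimately have "card {..card \<N>} <= card \<N>" using card_inj_on_le fin by blast
  then show False by simp
 qed
 then obtain i j where "i <= card \<N>" "j <= card \<N>" "i ~= j" "mat_seq_prod n s (Suc i) = mat_seq_prod n s (Suc j)"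
  unfolding inj_on_def by blast
 then obtain i j where ij: "i < j" "j <= card \<N>" "mat_seq_prod n s (Suc i) = mat_seq_prod n s (Suc j)"
  by (cases i j rule: linorder_cases) auto
 define P where "P = mat_seq_prod n s (Suc i)"
 \<comment> \<open>The nilpotent factor between two equal partial products.\<close>
 define T where "T = mat_seq_prod n (%t. s (Suc i + t)) (Suc (j - Suc i))"
 have Pc: "P \<in> Mat n n" unfolding P_def by (rule mat_seq_prod_carrier[OF sc])
 have T: "T \<in> \<N>" unfolding T_def by (rule prod_mem[OF s])
 then have Tc: "T \<in> Mat n n" using car by blast
 have "P * T = mat_seq_prod n s (Suc i + Suc (j - Suc i))" unfolding P_def T_def by (rule mat_seq_prod_add[OF sc, symmetric])
 also have "Suc i + Suc (j - Suc i) = Suc j" using ij(1) by simp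
 finally have PT: "P * T = P" unfolding P_def ij(3) .
 have PTM: "P * T ^\<^sub>m M = P" for M
 proof (induction M)
  case 0
  then show ?case using Pc Tc by simp
 next
  case (Suc M)
  then show ?case using assoc_mult_mat[OF Pc pow_carrier_mat[OF Tc] Tc, of M] PT by simp
 qed
 obtain M where TM: "T ^\<^sub>m M = 0\<^sub>m n n" using nil[OF T] by blast
 have P0: "P = 0\<^sub>m n n" using PTM[of M] unfolding TM right_mult_zero_mat[OF Pc] by (rule sym)
 have "mat_seq_prod n s (Suc (card \<N>)) = mat_seq_prod n s (Suc i + (card \<N> - i))"
  by (rule arg_cong) (use ij in simp)
 also have "... = P * mat_seq_prod n (%t. s (Suc i + t)) (card \<N> - i)"
  unfolding P_def by (rule mat_seq_prod_add[OF sc])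
 also have "... = 0\<^sub>m n n" unfolding P0 by (rule left_mult_zero_mat[OF mat_seq_prod_carrier[OF sc]])
 finally show ?thesis .
qed

lemma mat_triple_combination:
 fixes Z :: "'b::field mat"
 assumes P: "P \<in> Mat n n" and Y: "Y \<in> Mat n n" and Z: "Z \<in> Mat n n"
  and N: "!!b. b \<in> B ==> N b \<in> Mat n n"
  and eq: "!!i j. i < n ==> j < n ==> Z $$ (i,j) = (\<Sum>b\<in>B. z b * N b $$ (i,j))" and ij: "i < n" "j < n"
 shows "(P * (Z * Y)) $$ (i,j) = (\<Sum>b\<in>B. z b * (P * (N b * Y)) $$ (i,j))"
proof -
 have ZY: "Z * Y \<in> Mat n n" using Z Y by (rule mult_carrier_mat)
 have NY: "N b * Y \<in> Mat n n" if "b \<in> B" for b using N[OF that] Y by (rule mult_carrier_mat)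
 have 1: "(Z * Y) $$ (l,j) = (\<Sum>b\<in>B. z b * (N b * Y) $$ (l,j))" if l: "l < n" for l
 proof -
  have "(Z * Y) $$ (l,j) = (\<Sum>m<n. (\<Sum>b\<in>B. z b * N b $$ (l,m)) * Y $$ (m,j))"
   unfolding mat_mult_entry[OF Z Y l ij(2)] using l by (intro sum.cong) (auto simp: eq)
  also have "... = (\<Sum>b\<in>B. \<Sum>m<n. z b * N b $$ (l,m) * Y $$ (m,j))" unfolding sum_distrib_right by (rule sum.swap)
  also have "... = (\<Sum>b\<in>B. z b * (N b * Y) $$ (l,j))"
   by (intro sum.cong refl) (simp add: mat_mult_entry[OF N Y l ij(2)] sum_distrib_left mult.assoc)
  finally show ?thesis .
 qed
 have "(P * (Z * Y)) $$ (i,j) = (\<Sum>l<n. P $$ (i,l) * (\<Sum>b\<in>B. z b * (N b * Y) $$ (l,j)))"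
  unfolding mat_mult_entry[OF P ZY ij] using 1 by (intro sum.cong) auto
 also have "... = (\<Sum>b\<in>B. \<Sum>l<n. P $$ (i,l) * (z b * (N b * Y) $$ (l,j)))" unfolding sum_distrib_left by (rule sum.swap)
 also have "... = (\<Sum>b\<in>B. z b * (P * (N b * Y)) $$ (i,j))"
  by (intro sum.cong refl) (simp add: mat_mult_entry[OF P NY ij] sum_distrib_left mult_ac)
 finally show ?thesis .
qed

lemma nilpotent_kernel:
 fixes N :: "'b::field mat"
 assumes N: "N \<in> Mat n n" and nil: "N ^\<^sub>m M = 0\<^sub>m n n" and "n >= 1"
 obtains U where "U \<in> Mat n 1" "U ~= 0\<^sub>m n 1" "N * U = 0\<^sub>m n 1"
proof (rule singular_kernel[OF N])
 show "N \<notin> carrier (GL n)"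
 proof
  assume G: "N \<in> carrier (GL n)"
  have "N ^\<^sub>m k \<in> carrier (GL n)" for k
  proof (induction k)
   case 0
   then show ?case using N GL_one_closed by simp
  next
   case (Suc k)
   then show ?case using GL_mult_closed[OF _ G] by simp
  qed
  then have "0\<^sub>m n n \<in> carrier (GL n :: 'b mat monoid)" using nil by metis
  then obtain B :: "'b mat" where B: "B \<in> Mat n n" "0\<^sub>m n n * B = 1\<^sub>m n" using GL_E by metis
  then have "0\<^sub>m n n = (1\<^sub>m n :: 'b mat)" using left_mult_zero_mat[OF B(1)] by simp
  from arg_cong[OF this, of "%A. A $$ (0,0)"] show False using \<open>n >= 1\<close> by simp
 qed
qed (rule that)

text \<open>By assumption, the matrices at \<open>b\<close> of endomorphisms are scalars plus nilpotents. The nilpotent ones form a finite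
semigroup: a product of two of them is singular, so its scalar part is zero. An idempotent over \<open>L\<close>
is a combination of endomorphisms over \<open>F\<close>, so at \<open>b\<close> it is \<open>c\<close> plus a combination of nilpotents in this semigroup; long products of
those vanish, so \<open>e b - c\<close> is nilpotent.\<close>

theorem local_idempotent:
 fixes \<phi> :: "'e => 'a::{field,finite} mat"
 assumes Q: "finite_quiver Q" and \<phi>: "\<phi> \<in> quiver_reps Q v UNIV" and b: "b \<in> verts Q" "v b >= 1"
  and local: "!!h. rep_endo Q v \<phi> h ==> \<exists>s M. (h b - s \<cdot>\<^sub>m 1\<^sub>m (v b)) ^\<^sub>m M = 0\<^sub>m (v b) (v b)"
  and e: "rep_endo Q v (ac_rep Q \<phi>) e" and idem: "e b * e b = e b"
 shows "e b = 0\<^sub>m (v b) (v b) \<or> e b = 1\<^sub>m (v b)"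
proof -
 define n where "n = v b"
 have n: "n >= 1" using b(2) by (simp add: n_def)
 note ac_Q = ac_rep_reps[OF \<phi>]
 have ec: "e x \<in> Mat (v x) (v x)" if "x \<in> verts Q" for x by (rule rep_endo_carrier[OF Q ac_Q e that])
 have ebc: "e b \<in> Mat n n" unfolding n_def by (rule ec[OF b(1)])
 interpret t: comm_ring_hom "to_ac :: 'a => 'a alg_closure" by (rule to_ac_hom)
 have "finite (\<Union>x\<in>verts Q. elements_mat (e x))" using Q by (auto simp: finite_quiver_def finite_elements_mat)
 then obtain B t where
  B: "finite (B :: 'a alg_closure set)" "!!\<beta>. \<beta> \<in> B ==> base_linear (t \<beta>)"
   "!!z. z \<in> (\<Union>x\<in>verts Q. elements_mat (e x)) ==> z = (\<Sum>\<beta>\<in>B. to_ac (t \<beta> z) * \<beta>)"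
  by (rule base_coordinates) (rule that)
 have comp: "rep_endo Q v \<phi> (%x. map_mat (t \<beta>) (e x))" if \<beta>: "\<beta> \<in> B" for \<beta>
  unfolding rep_endo_iff[OF Q \<phi>]
 proof (intro conjI ballI)
  fix a assume a: "a \<in> arcs Q"
  note ends = arc_ends[OF Q a]
  note \<phi>c = rep_arc[OF \<phi> a]
  have "map_mat (t \<beta>) (e (head Q a) * ac_mat (\<phi> a)) = map_mat (t \<beta>) (ac_mat (\<phi> a) * e (tail Q a))"
   using e a unfolding rep_endo_def ac_rep_arc[OF a, symmetric] by simp
  then have "map_mat (t \<beta>) (e (head Q a)) * \<phi> a = \<phi> a * map_mat (t \<beta>) (e (tail Q a))"
   using base_linear_mult_right[OF B(2)[OF \<beta>] \<phi>c ec[OF conjunct1[OF ends]]] base_linear_mult_left[OF B(2)[OF \<beta>] \<phi>c ec[OF conjunct2[OF ends]]] by simp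
  then show "intertwines (\<phi> a) (map_mat (t \<beta>) (e (head Q a))) (map_mat (t \<beta>) (e (tail Q a)))"
   using ec[OF conjunct1[OF ends]] ec[OF conjunct2[OF ends]] by (intro intertwinesI[OF _ _ \<phi>c]) auto
 qed (use ec in auto)
 have "\<forall>\<beta>\<in>B. \<exists>s. \<exists>M. (map_mat (t \<beta>) (e b) - s \<cdot>\<^sub>m 1\<^sub>m (v b)) ^\<^sub>m M = 0\<^sub>m (v b) (v b)" using local[OF comp] by blast
 from bchoice[OF this] obtain s where s: "!!\<beta>. \<beta> \<in> B ==> \<exists>M. (map_mat (t \<beta>) (e b) - s \<beta> \<cdot>\<^sub>m 1\<^sub>m n) ^\<^sub>m M = 0\<^sub>m n n"
  unfolding n_def by blast
 define N where "N \<beta> = map_mat (t \<beta>) (e b) - s \<beta> \<cdot>\<^sub>m 1\<^sub>m n" for \<beta>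
 define \<N> where "\<N> = {A. \<exists>h. rep_endo Q v \<phi> h & h b = A & (\<exists>M. A ^\<^sub>m M = 0\<^sub>m n n)}"
 have car: "\<N> \<subseteq> Mat n n" unfolding \<N>_def n_def using rep_endo_carrier[OF Q \<phi> _ b(1)] by blast
 have fin: "finite \<N>" using car finite_carrier_mat by (rule finite_subset)
 have zero: "0\<^sub>m n n \<in> \<N>"
 proof -
  have "0\<^sub>m n n ^\<^sub>m 1 = (0\<^sub>m n n :: 'a mat)" by simp
  then show ?thesis unfolding \<N>_def n_def using rep_endo_zero[OF Q \<phi>] by blast
 qed
 have mult: "A * A' \<in> \<N>" if A: "A \<in> \<N>" "A' \<in> \<N>" for A A'
 proof -
  obtain h M h' M' where h: "rep_endo Q v \<phi> h" "h b = A" "A ^\<^sub>m M = 0\<^sub>m n n" "rep_endo Q v \<phi> h'" "h' b = A'" "A' ^\<^sub>m M' = 0\<^sub>m n n"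
   using A unfolding \<N>_def by blast
  have Ac: "A \<in> Mat n n" "A' \<in> Mat n n" using A car by auto
  have AA: "A * A' \<in> Mat n n" using Ac by (rule mult_carrier_mat)
  have hh: "rep_endo Q v \<phi> (%x. h x * h' x)" by (rule rep_endo_mult[OF Q \<phi> h(1,4)])
  obtain \<tau> M'' where \<tau>: "(A * A' - \<tau> \<cdot>\<^sub>m 1\<^sub>m n) ^\<^sub>m M'' = 0\<^sub>m n n" using local[OF hh] h(2,5) unfolding n_def by blast
  obtain U where U: "U \<in> Mat n 1" "U ~= 0\<^sub>m n 1" "A' * U = 0\<^sub>m n 1" using nilpotent_kernel[OF Ac(2) h(6) n] by metis
  have "A * A' * U = 0\<^sub>m n 1" using assoc_mult_mat[OF Ac U(1)] U(3) right_mult_zero_mat[OF Ac(1)] by simp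
  also have "... = 0 \<cdot>\<^sub>m U" using U(1) by (intro eq_matI) auto
  finally have "(A * A' - \<tau> \<cdot>\<^sub>m 1\<^sub>m n) * U = (0 - \<tau>) \<cdot>\<^sub>m U" by (rule shift_eigen(2)[OF AA U(1)])
  then have "(A * A' - \<tau> \<cdot>\<^sub>m 1\<^sub>m n) ^\<^sub>m M'' * U = (0 - \<tau>) ^ M'' \<cdot>\<^sub>m U"
   by (rule eigen_power[OF minus_carrier_mat[OF smult_carrier_mat[OF one_carrier_mat]] U(1)])
  then have "(0 - \<tau>) ^ M'' \<cdot>\<^sub>m U = 0\<^sub>m n 1" unfolding \<tau> using left_mult_zero_mat[OF U(1)] by simp
  then have "(0 - \<tau>) ^ M'' = 0" using U(2) smult_mat_eq_0[OF _ _ U(1)] by blast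
  then have "\<tau> = 0" by simp
  have "W - 0 \<cdot>\<^sub>m 1\<^sub>m n = W" if "W \<in> Mat n n" for W :: "'a mat" using that by (intro eq_matI) auto
  from this[OF AA] have "A * A' - 0 \<cdot>\<^sub>m 1\<^sub>m n = A * A'" .
  then have "(A * A') ^\<^sub>m M'' = 0\<^sub>m n n" using \<tau> unfolding \<open>\<tau> = 0\<close> by simp
  then show ?thesis unfolding \<N>_def using hh h(2,5) by blast
 qed
 have N_mem: "N \<beta> \<in> \<N>" if \<beta>: "\<beta> \<in> B" for \<beta>
 proof -
  have "rep_endo Q v \<phi> (%x. map_mat (t \<beta>) (e x) - s \<beta> \<cdot>\<^sub>m 1\<^sub>m (v x))" by (rule rep_endo_shift[OF Q \<phi> comp[OF \<beta>]])
  then show ?thesis unfolding \<N>_def N_def n_def using s[OF \<beta>] unfolding n_def by blast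
 qed
 define c where "c = (\<Sum>\<beta>\<in>B. to_ac (s \<beta>) * \<beta>)"
 define Y where "Y = e b - c \<cdot>\<^sub>m 1\<^sub>m n"
 have Yc: "Y \<in> Mat n n" unfolding Y_def by (intro minus_carrier_mat) simp
 have Nc: "ac_mat (N \<beta>) \<in> Mat n n" for \<beta> unfolding N_def using minus_carrier_mat[of "s \<beta> \<cdot>\<^sub>m 1\<^sub>m n" n n] by simp
 have Y_entry: "Y $$ (i,j) = (\<Sum>\<beta>\<in>B. \<beta> * ac_mat (N \<beta>) $$ (i,j))" if ij: "i < n" "j < n" for i j
 proof -
  have mem: "e b $$ (i,j) \<in> (\<Union>x\<in>verts Q. elements_mat (e x))" using ij ebc b(1) by auto
  have "Y $$ (i,j) = e b $$ (i,j) - c * 1\<^sub>m n $$ (i,j)" unfolding Y_def using ij ebc by simp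
  also have "... = (\<Sum>\<beta>\<in>B. to_ac (t \<beta> (e b $$ (i,j))) * \<beta> - to_ac (s \<beta>) * \<beta> * 1\<^sub>m n $$ (i,j))"
   unfolding c_def sum_distrib_right sum_subtractf B(3)[OF mem, symmetric] ..
  also have "... = (\<Sum>\<beta>\<in>B. \<beta> * ac_mat (N \<beta>) $$ (i,j))"
   using ij ebc by (intro sum.cong refl) (auto simp: N_def algebra_simps)
  finally show ?thesis .
 qed
 define d where "d = Suc (card \<N>)"
 have "ac_mat (mat_seq_prod n \<sigma> (d - k)) * Y ^\<^sub>m k = 0\<^sub>m n n" if "k <= d" "!!i. \<sigma> i \<in> \<N>" for k \<sigma>
  using that
 proof (induction k arbitrary: \<sigma>)
  case 0
  have "mat_seq_prod n \<sigma> (Suc (card \<N>)) = 0\<^sub>m n n"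
   by (rule finite_nil_semigroup_nilpotent[OF fin car mult _ 0(2)]) (auto simp: \<N>_def)
  moreover have "ac_mat (0\<^sub>m n n) = (0\<^sub>m n n :: 'a alg_closure mat)" by (intro eq_matI) auto
  ultimately show ?case using Yc by (simp add: d_def)
 next
  case (Suc k)
  let ?P = "mat_seq_prod n \<sigma> (d - Suc k)"
  have \<sigma>c: "\<sigma> i \<in> Mat n n" for i using Suc.prems(2) car by blast
  have Pc: "?P \<in> Mat n n" by (rule mat_seq_prod_carrier[OF \<sigma>c])
  have PLc: "ac_mat ?P \<in> Mat n n" using Pc by simp
  have Ykc: "Y ^\<^sub>m k \<in> Mat n n" by (rule pow_carrier_mat[OF Yc])
  have YY: "Y ^\<^sub>m Suc k = Y * Y ^\<^sub>m k" using mat_pow_add[OF Yc, of 1 k] Yc by simp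
  have z: "ac_mat ?P * (ac_mat (N \<beta>) * Y ^\<^sub>m k) = 0\<^sub>m n n" if \<beta>: "\<beta> \<in> B" for \<beta>
  proof -
   define \<sigma>' where "\<sigma>' = \<sigma>(d - Suc k := N \<beta>)"
   have "\<sigma>' i \<in> \<N>" for i using Suc.prems(2) N_mem[OF \<beta>] by (simp add: \<sigma>'_def)
   then have "ac_mat (mat_seq_prod n \<sigma>' (d - k)) * Y ^\<^sub>m k = 0\<^sub>m n n" using Suc.prems(1) by (intro Suc.IH) auto
   moreover have "d - k = Suc (d - Suc k)" using Suc.prems(1) by simp
   then have "mat_seq_prod n \<sigma>' (d - k) = mat_seq_prod n \<sigma>' (d - Suc k) * N \<beta>" by (simp add: \<sigma>'_def)
   moreover have "mat_seq_prod n \<sigma>' (d - Suc k) = ?P" by (rule mat_seq_prod_cong) (simp add: \<sigma>'_def)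
   moreover have "N \<beta> \<in> Mat n n" using N_mem[OF \<beta>] car by blast
   ultimately show ?thesis using t.mat_hom_mult[OF Pc, of "N \<beta>" n] assoc_mult_mat[OF PLc Nc Ykc] by simp
  qed
  show ?case
  proof (rule eq_matI)
   fix i j assume "i < dim_row (0\<^sub>m n n :: 'a alg_closure mat)" "j < dim_col (0\<^sub>m n n :: 'a alg_closure mat)"
   then have ij: "i < n" "j < n" by auto
   have "(ac_mat ?P * Y ^\<^sub>m Suc k) $$ (i,j) = (\<Sum>\<beta>\<in>B. \<beta> * (ac_mat ?P * (ac_mat (N \<beta>) * Y ^\<^sub>m k)) $$ (i,j))"
    unfolding YY by (rule mat_triple_combination[OF PLc Ykc Yc Nc Y_entry ij])
   also have "... = 0" using ij z by (intro sum.neutral ballI) (simp del: index_mult_mat(1))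
   finally show "(ac_mat ?P * Y ^\<^sub>m Suc k) $$ (i,j) = 0\<^sub>m n n $$ (i,j)" using ij by simp
  qed (use PLc pow_carrier_mat[OF Yc, of "Suc k"] in \<open>auto simp del: pow_mat.simps\<close>)
 qed
 from this[of d "%_. 0\<^sub>m n n"] zero have "ac_mat (1\<^sub>m n) * Y ^\<^sub>m d = 0\<^sub>m n n" by simp
 then have Yd: "Y ^\<^sub>m d = 0\<^sub>m n n" unfolding t.mat_hom_one using left_mult_one_mat[OF pow_carrier_mat[OF Yc]] by simp
 show ?thesis
 proof (cases "c = 1")
  case False
  have "e b * e b = 1 \<cdot>\<^sub>m e b" unfolding idem using ebc by (intro eq_matI) auto
  from shift_eigen(2)[OF ebc ebc this, of c] have "Y * e b = (1 - c) \<cdot>\<^sub>m e b" unfolding Y_def .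
  from eigen_power[OF Yc ebc this, of d] have "(1 - c) ^ d \<cdot>\<^sub>m e b = 0\<^sub>m n n" unfolding Yd using left_mult_zero_mat[OF ebc] by simp
  then have "e b = 0\<^sub>m n n" by (rule smult_mat_eq_0[OF _ _ ebc]) (use False in simp)
  then show ?thesis unfolding n_def by simp
 next
  case True
  define f where "f = 1\<^sub>m n - e b"
  have fc: "f \<in> Mat n n" unfolding f_def by (rule minus_carrier_mat[OF ebc])
  have "e b * f = e b - e b" unfolding f_def mult_minus_distrib_mat[OF ebc one_carrier_mat ebc] idem using ebc by simp
  also have "... = 0 \<cdot>\<^sub>m f" using ebc fc by (intro eq_matI) auto
  finally have "Y * f = (0 - 1) \<cdot>\<^sub>m f" unfolding Y_def True by (rule shift_eigen(2)[OF ebc fc])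
  from eigen_power[OF Yc fc this, of d] have "(0 - 1) ^ d \<cdot>\<^sub>m f = 0\<^sub>m n n" unfolding Yd using left_mult_zero_mat[OF fc] by simp
  then have f0: "f = 0\<^sub>m n n" by (rule smult_mat_eq_0[OF _ _ fc]) simp
  have "e b = 1\<^sub>m n"
  proof (rule eq_matI)
   fix i j assume "i < dim_row (1\<^sub>m n :: 'a alg_closure mat)" "j < dim_col (1\<^sub>m n :: 'a alg_closure mat)"
   then have ij: "i < n" "j < n" by auto
   have "f $$ (i,j) = 1\<^sub>m n $$ (i,j) - e b $$ (i,j)" unfolding f_def using ij ebc by simp
   then show "e b $$ (i,j) = 1\<^sub>m n $$ (i,j)" unfolding f0 using ij by simp
  qed (use ebc in auto)
  then show ?thesis unfolding n_def by simp
 qed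
qed

section \<open>Absolutely indecomposable representations of the comet-shaped quiver\<close>

text \<open>The central vertex is the start of every leg.\<close>

definition legv :: "nat => nat => comet_vertex" where
 "legv i j = (if j = 0 then Center else Leg i j)"

text \<open>The character \<open>\<theta>\<close> of the gauge group. A leg ends with a space of dimension zero, which has no vertex.\<close>

definition comet_char :: "nat => (nat => nat list) => (nat => nat => 'a::field => complex) => (comet_vertex => 'a mat) => complex" where
 "comet_char k \<mu> \<alpha> h = (\<Prod>i=1..k. \<Prod>j<length (\<mu> i).
   \<alpha> i j (det (h (legv i j)) / (if Suc j < length (\<mu> i) then det (h (Leg i (Suc j))) else 1)))"

locale comet =
 fixes g k n :: nat and \<mu> :: "nat => nat list"
 assumes k: "k >= 1" and n: "n >= 1" and part: "!!i. i \<in> {1..k} ==> is_partition n (\<mu> i)"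
begin

abbreviation "CQ \<equiv> comet_quiver g k \<mu>"
abbreviation "cdim \<equiv> comet_dim n \<mu>"

lemma sum_parts: "i \<in> {1..k} ==> sum_list (\<mu> i) = n"
 using part by (simp add: is_partition_def)

lemma length_parts: "i \<in> {1..k} ==> length (\<mu> i) >= 1"
 using sum_parts n by (cases "\<mu> i") force+

lemma Center_vert: "Center \<in> verts CQ" and dim_Center: "cdim Center = n"
 by (simp_all add: comet_quiver_def)

lemma leg_vert: "i \<in> {1..k} ==> j < length (\<mu> i) ==> legv i j \<in> verts CQ"
 by (auto simp: comet_quiver_def legv_def)

lemma vert_cases:
 assumes "x \<in> verts CQ"
 obtains i j where "x = legv i j" "i \<in> {1..k}" "j < length (\<mu> i)"
proof (cases x)
 case Center
 then show ?thesis using k length_parts[of 1] by (intro that[of 1 0]) (auto simp: legv_def Suc_le_eq)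
next
 case (Leg i j)
 then show ?thesis using assms that[of i j] by (auto simp: comet_quiver_def legv_def)
qed

lemma finite_comet_arcs: "finite (verts CQ)" "finite (arcs CQ)"
proof -
 let ?S = "SIGMA i:{1..k}. {1..length (\<mu> i) - 1}"
 have "{Leg i j | i j. i \<in> {1..k} & j \<in> {1..length (\<mu> i) - 1}} = (%(i,j). Leg i j) ` ?S"
  "{Leg_Arrow i j | i j. i \<in> {1..k} & j \<in> {1..length (\<mu> i) - 1}} = (%(i,j). Leg_Arrow i j) ` ?S" by auto
 then show "finite (verts CQ)" "finite (arcs CQ)" by (simp_all add: comet_quiver_def)
qed

lemma finite_comet: "finite_quiver CQ"
 unfolding finite_quiver_def using finite_comet_arcs by (auto simp: comet_quiver_def)

lemma leg_arc: "i \<in> {1..k} ==> 1 <= j ==> j < length (\<mu> i) ==> Leg_Arrow i j \<in> arcs CQ"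
 by (auto simp: comet_quiver_def)

lemma leg_arc_ends: "1 <= j ==> tail CQ (Leg_Arrow i j) = legv i j"
 "1 <= j ==> head CQ (Leg_Arrow i j) = legv i (j - 1)"
 by (auto simp: comet_quiver_def legv_def)

lemma arc_cases:
 assumes "a \<in> arcs CQ"
 obtains l where "a = Loop l" "l \<in> {1..g}" | i j where "a = Leg_Arrow i j" "i \<in> {1..k}" "1 <= j" "j < length (\<mu> i)"
 using assms by (auto simp: comet_quiver_def)

lemma loop_ends: "tail CQ (Loop l) = Center" "head CQ (Loop l) = Center"
 by (simp_all add: comet_quiver_def)

lemma dim_leg: "i \<in> {1..k} ==> cdim (legv i j) = sum_list (drop j (\<mu> i))"
proof -
 assume i: "i \<in> {1..k}"
 have "sum_list (take j (\<mu> i)) + sum_list (drop j (\<mu> i)) = n"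
  unfolding sum_list_append[symmetric] append_take_drop_id by (rule sum_parts[OF i])
 then show ?thesis using sum_parts[OF i] by (auto simp: legv_def)
qed

lemma dim_leg_step:
 assumes "i \<in> {1..k}" "j < length (\<mu> i)"
 shows "sum_list (drop j (\<mu> i)) = \<mu> i ! j + sum_list (drop (Suc j) (\<mu> i))"
 using Cons_nth_drop_Suc[OF assms(2)] by (metis sum_list.Cons)

definition leg_injective :: "(comet_arrow => 'b::field mat) => bool" where
 "leg_injective \<phi> \<longleftrightarrow> (\<forall>i\<in>{1..k}. \<forall>j. 1 <= j --> j < length (\<mu> i) --> left_inv (\<phi> (Leg_Arrow i j)))"

text \<open>If a vector \<open>U\<close> at \<open>[i, j\<^sub>0]\<close> is killed by the arrow starting there, let \<open>u\<close> be a preimage of \<open>U\<close>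
 as far out in the leg as possible, and let \<open>\<xi>\<close> be a functional with \<open>\<xi> U = 1\<close> that
 vanishes on what comes from further out. The vectors that \<open>u\<close> and the functionals
 that \<open>\<xi>\<close> induce at the vertices in between give rank one idempotents that form an endomorphism.\<close>

theorem leg_injective_if_no_idempotent:
 fixes \<phi> :: "comet_arrow => 'b::field mat"
 assumes \<phi>: "\<phi> \<in> quiver_reps CQ cdim UNIV" and nidem: "\<not> (\<exists>e. idem_endo CQ cdim \<phi> e)"
 shows "leg_injective \<phi>"
 unfolding leg_injective_def
proof (intro ballI allI impI, rule ccontr)
 fix i j0 assume i: "i \<in> {1..k}" and j0: "1 <= j0" "j0 < length (\<mu> i)" and ninj: "\<not> left_inv (\<phi> (Leg_Arrow i j0))"
 define L where "L = length (\<mu> i)"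
 define d where "d j = sum_list (drop j (\<mu> i))" for j
 have dim: "cdim (legv i j) = d j" for j unfolding d_def by (rule dim_leg[OF i])
 have dL: "d L = 0" by (simp add: d_def L_def)
 define M where "M j = (if j < L then \<phi> (Leg_Arrow i j) else 0\<^sub>m (d (j - 1)) (d j))" for j
 have Mc: "M j \<in> Mat (d (j - 1)) (d j)" if "1 <= j" for j
 proof (cases "j < L")
  case True
  then show ?thesis using rep_arc[OF \<phi> leg_arc[OF i that]] leg_arc_ends[OF that, of i] by (simp add: M_def L_def dim)
 qed (simp add: M_def)
 obtain U where U: "U \<in> Mat (d j0) 1" "U ~= 0\<^sub>m (d j0) 1" "M j0 * U = 0\<^sub>m (d (j0 - 1)) 1"
 proof (rule left_inv_cases[OF Mc[OF j0(1)]])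
  assume "left_inv (M j0)"
  then show thesis using ninj j0(2) by (simp add: M_def L_def)
 qed (rule that)
 define C where "C = rec_nat (1\<^sub>m (d j0)) (%t Y. Y * M (j0 + Suc t))"
 have C0: "C 0 = 1\<^sub>m (d j0)" and CS: "C (Suc t) = C t * M (j0 + Suc t)" for t by (simp_all add: C_def)
 have Cc: "C t \<in> Mat (d j0) (d (j0 + t))" for t
 proof (induction t)
  case (Suc t)
  then show ?case unfolding CS using Mc[of "j0 + Suc t"] by (intro mult_carrier_mat) auto
 qed (simp add: C0)
 \<comment> \<open>Whether \<open>U\<close> comes from \<open>t\<close> vertices further out.\<close>
 define hit where "hit t \<longleftrightarrow> (\<exists>V\<in>Mat (d (j0 + t)) 1. C t * V = U)" for t
 have "hit 0" unfolding hit_def C0 using U(1) by (intro bexI[of _ U]) auto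
 have "\<not> hit (L - j0)"
 proof
  assume "hit (L - j0)"
  moreover have "d (j0 + (L - j0)) = 0" using dL j0(2) by (simp add: L_def)
  ultimately obtain V where V: "V \<in> Mat 0 1" "C (L - j0) * V = U" unfolding hit_def by auto
  have "C (L - j0) \<in> Mat (d j0) 0" using Cc[of "L - j0"] \<open>d (j0 + (L - j0)) = 0\<close> by simp
  then have "C (L - j0) * V = 0\<^sub>m (d j0) 1" using V(1) by (intro eq_matI) (auto simp: scalar_prod_def)
  then show False using V(2) U(2) by simp
 qed
 define t' where "t' = (LEAST t. \<not> hit t)"
 have t': "\<not> hit t'" "t' <= L - j0" unfolding t'_def using LeastI[of "%t. \<not> hit t"] Least_le[of "%t. \<not> hit t"] \<open>\<not> hit (L - j0)\<close> by metis+
 have "t' ~= 0" using t'(1) \<open>hit 0\<close> by metis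
 then obtain t where t: "t' = Suc t" by (cases t') auto
 have "hit t" using not_less_Least[of t "%t. \<not> hit t"] t unfolding t'_def by auto
 then obtain u where u: "u \<in> Mat (d (j0 + t)) 1" "C t * u = U" unfolding hit_def by blast
 obtain \<xi> where \<xi>: "\<xi> \<in> Mat 1 (d j0)" "\<xi> * C (Suc t) = 0\<^sub>m 1 (d (j0 + Suc t))" "\<xi> * U = 1\<^sub>m 1"
  using separating_functional[OF Cc U(1)] t'(1) unfolding hit_def t by metis
 have tL: "j0 + t < L" using t' t j0(2) by (simp add: L_def)
 define D where "D = rec_nat (1\<^sub>m (d (j0 + t))) (%r Y. M (j0 + t - r) * Y)"
 have D0: "D 0 = 1\<^sub>m (d (j0 + t))" and DS: "D (Suc r) = M (j0 + t - r) * D r" for r by (simp_all add: D_def)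
 have Dc: "D r \<in> Mat (d (j0 + t - r)) (d (j0 + t))" if "r <= t" for r
  using that
 proof (induction r)
  case (Suc r)
  have "M (j0 + t - r) \<in> Mat (d (j0 + t - Suc r)) (d (j0 + t - r))" using Mc[of "j0 + t - r"] Suc.prems j0(1) by simp
  then show ?case unfolding DS using Suc by (intro mult_carrier_mat) auto
 qed (simp add: D0)
 have CD: "C (t - r) * D r = C t" if "r <= t" for r
  using that
 proof (induction r)
  case 0
  then show ?case using right_mult_one_mat[OF Cc] by (simp add: D0)
 next
  case (Suc r)
  have e: "t - r = Suc (t - Suc r)" "j0 + t - r = j0 + Suc (t - Suc r)" using Suc.prems by auto
  have Mr: "M (j0 + Suc (t - Suc r)) \<in> Mat (d (j0 + (t - Suc r))) (d (j0 + Suc (t - Suc r)))"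
   using Mc[of "j0 + Suc (t - Suc r)"] by simp
  have Dr: "D r \<in> Mat (d (j0 + Suc (t - Suc r))) (d (j0 + t))" using Dc[of r] Suc.prems unfolding e(2) by simp
  have "C (t - Suc r) * D (Suc r) = C (Suc (t - Suc r)) * D r"
   unfolding DS e(2) CS using assoc_mult_mat[OF Cc Mr Dr] by simp
  then show ?case unfolding e(1)[symmetric] using Suc by simp
 qed
 define w where "w a = D (t - a) * u" for a
 define \<eta> where "\<eta> a = \<xi> * C a" for a
 have wc: "w a \<in> Mat (d (j0 + a)) 1" if "a <= t" for a
  using Dc[of "t - a"] u(1) that unfolding w_def by (intro mult_carrier_mat) auto
 have \<eta>c: "\<eta> a \<in> Mat 1 (d (j0 + a))" for a unfolding \<eta>_def by (rule mult_carrier_mat[OF \<xi>(1) Cc])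
 have Mw: "M (j0 + Suc a) * w (Suc a) = w a" if "Suc a <= t" for a
 proof -
  have e: "t - a = Suc (t - Suc a)" "j0 + t - (t - Suc a) = j0 + Suc a" using that by auto
  have Ma: "M (j0 + Suc a) \<in> Mat (d (j0 + a)) (d (j0 + Suc a))" using Mc[of "j0 + Suc a"] by simp
  have Da: "D (t - Suc a) \<in> Mat (d (j0 + Suc a)) (d (j0 + t))" using Dc[of "t - Suc a"] that by simp
  show ?thesis unfolding w_def e(1) DS e(2) by (rule assoc_mult_mat[OF Ma Da u(1), symmetric])
 qed
 have M0: "M j0 * w 0 = 0\<^sub>m (d (j0 - 1)) 1"
 proof -
  have "D t = C t" using CD[of t] Dc[of t] by (simp add: C0)
  then show ?thesis using U(3) u(2) by (simp add: w_def)
 qed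
 have \<eta>M: "\<eta> a * M (j0 + Suc a) = \<eta> (Suc a)" for a
  unfolding \<eta>_def CS using assoc_mult_mat[OF \<xi>(1) Cc, of "M (j0 + Suc a)"] Mc[of "j0 + Suc a"] by simp
 have \<eta>w: "\<eta> a * w a = 1\<^sub>m 1" if "a <= t" for a
 proof -
  have Da: "D (t - a) \<in> Mat (d (j0 + a)) (d (j0 + t))" using Dc[of "t - a"] that by simp
  have "\<eta> a * w a = \<xi> * ((C a * D (t - a)) * u)"
   unfolding \<eta>_def w_def using \<xi>(1) Cc[of a] Da u(1) by (simp add: mat_assoc del: assoc_mult_mat)
  also have "C a * D (t - a) = C t" using CD[of "t - a"] that by simp
  finally show ?thesis using u(2) \<xi>(3) by simp
 qed
 define f where "f j = (if j0 <= j & j <= j0 + t then w (j - j0) * \<eta> (j - j0) else 0\<^sub>m (d j) (d j))" for j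
 define e where "e x = (case x of Center => 0\<^sub>m n n | Leg i' j => if i' = i then f j else 0\<^sub>m (cdim x) (cdim x))" for x
 have fc: "f j \<in> Mat (d j) (d j)" for j
 proof (cases "j0 <= j & j <= j0 + t")
  case True
  then have "j - j0 <= t" "j0 + (j - j0) = j" by auto
  then have "w (j - j0) * \<eta> (j - j0) \<in> Mat (d j) (d j)" using mult_carrier_mat[OF wc \<eta>c, of "j - j0" "j - j0"] by simp
  then show ?thesis unfolding f_def if_P[OF True] .
 next
  case False
  show ?thesis unfolding f_def if_not_P[OF False] by simp
 qed
 have e_leg: "e (legv i j) = f j" for j
  using j0(1) dim[of 0] by (auto simp: e_def legv_def f_def)
 have ec: "e x \<in> Mat (cdim x) (cdim x)" for x
 proof (cases x)
  case (Leg i' j)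
  show ?thesis
  proof (cases "i' = i")
   case True
   show ?thesis
   proof (cases "j = 0")
    case j: True
    then have "f j = 0\<^sub>m (d j) (d j)" using j0(1) by (simp add: f_def)
    moreover have "d j = cdim x" using j Leg True sum_parts[OF i] by (simp add: d_def)
    ultimately show ?thesis using Leg True by (simp add: e_def)
   next
    case False
    then have "legv i j = x" using Leg True by (simp add: legv_def)
    then show ?thesis using e_leg[of j] fc[of j] dim[of j] by simp
   qed
  qed (simp add: e_def Leg)
 qed (simp add: e_def)
 have f_idem: "f j * f j = f j" for j
 proof (cases "j0 <= j & j <= j0 + t")
  case True
  let ?a = "j - j0"
  have a: "?a <= t" using True by auto
  have "w ?a * \<eta> ?a * (w ?a * \<eta> ?a) = w ?a * ((\<eta> ?a * w ?a) * \<eta> ?a)" using wc[OF a] \<eta>c[of ?a] by (simp add: mat_assoc del: assoc_mult_mat)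
  then show ?thesis unfolding \<eta>w[OF a] left_mult_one_mat[OF \<eta>c] unfolding f_def if_P[OF True] .
 next
  case False
  show ?thesis unfolding f_def if_not_P[OF False] by simp
 qed
 have f_com: "f (j - 1) * M j = M j * f j" if j: "1 <= j" "j < L" for j
 proof -
  have Mj: "M j \<in> Mat (d (j - 1)) (d j)" by (rule Mc[OF j(1)])
  have l0: "0\<^sub>m (d (j - 1)) (d (j - 1)) * M j = 0\<^sub>m (d (j - 1)) (d j)" by (rule left_mult_zero_mat[OF Mj])
  have r0: "M j * 0\<^sub>m (d j) (d j) = 0\<^sub>m (d (j - 1)) (d j)" by (rule right_mult_zero_mat[OF Mj])
  consider "j < j0" | "j = j0" | "j0 < j" "j <= j0 + t" | "j = j0 + Suc t" | "j > j0 + Suc t" by linarith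
  then show ?thesis
  proof cases
   case 1
   then have "f (j - 1) = 0\<^sub>m (d (j - 1)) (d (j - 1))" "f j = 0\<^sub>m (d j) (d j)" by (auto simp: f_def)
   then show ?thesis using l0 r0 by simp
  next
   case 2
   have "M j0 * (w 0 * \<eta> 0) = (M j0 * w 0) * \<eta> 0" using Mc[OF j0(1)] wc[of 0] \<eta>c[of 0] by (simp add: mat_assoc del: assoc_mult_mat)
   also have "... = 0\<^sub>m (d (j0 - 1)) (d j0)" unfolding M0 using left_mult_zero_mat[OF \<eta>c[of 0]] by simp
   finally have "M j * f j = 0\<^sub>m (d (j - 1)) (d j)" using 2 by (simp add: f_def)
   moreover have "f (j - 1) = 0\<^sub>m (d (j - 1)) (d (j - 1))" using 2 j0(1) by (auto simp: f_def)
   ultimately show ?thesis using l0 by simp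
  next
   case 3
   define a where "a = j - j0 - 1"
   have a: "j = j0 + Suc a" "Suc a <= t" using 3 by (auto simp: a_def)
   have Ma: "M (j0 + Suc a) \<in> Mat (d (j0 + a)) (d (j0 + Suc a))" using Mc[of "j0 + Suc a"] by simp
   have "f (j - 1) * M j = (w a * \<eta> a) * M (j0 + Suc a)" using a by (simp add: f_def)
   also have "... = w a * \<eta> (Suc a)" unfolding \<eta>M[symmetric] by (rule assoc_mult_mat[OF wc \<eta>c Ma]) (use a in simp)
   also have "... = (M (j0 + Suc a) * w (Suc a)) * \<eta> (Suc a)" unfolding Mw[OF a(2)] ..
   also have "... = M (j0 + Suc a) * (w (Suc a) * \<eta> (Suc a))" by (rule assoc_mult_mat[OF Ma wc[OF a(2)] \<eta>c])
   also have "... = M j * f j" using a by (simp add: f_def)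
   finally show ?thesis .
  next
   case 4
   have Mt: "M (j0 + Suc t) \<in> Mat (d (j0 + t)) (d (j0 + Suc t))" using Mc[of "j0 + Suc t"] by simp
   have "f (j - 1) * M j = (w t * \<eta> t) * M (j0 + Suc t)" using 4 by (simp add: f_def)
   also have "... = w t * \<eta> (Suc t)" unfolding \<eta>M[symmetric] by (rule assoc_mult_mat[OF wc \<eta>c Mt]) simp
   also have "\<eta> (Suc t) = 0\<^sub>m 1 (d (j0 + Suc t))" unfolding \<eta>_def by (rule \<xi>(2))
   also have "w t * ... = 0\<^sub>m (d (j0 + t)) (d (j0 + Suc t))" by (rule right_mult_zero_mat[OF wc]) simp
   finally show ?thesis using 4 r0 by (simp add: f_def)
  next
   case 5
   then have "f (j - 1) = 0\<^sub>m (d (j - 1)) (d (j - 1))" "f j = 0\<^sub>m (d j) (d j)" by (auto simp: f_def)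
   then show ?thesis using l0 r0 by simp
  qed
 qed
 have "rep_endo CQ cdim \<phi> e" unfolding rep_endo_def
 proof (intro conjI ballI ec)
  fix a assume a: "a \<in> arcs CQ"
  have \<phi>a: "\<phi> a \<in> Mat (cdim (head CQ a)) (cdim (tail CQ a))" by (rule rep_arc[OF \<phi> a])
  have zero: "e (head CQ a) * \<phi> a = \<phi> a * e (tail CQ a)" if "e (head CQ a) = 0\<^sub>m (cdim (head CQ a)) (cdim (head CQ a))" "e (tail CQ a) = 0\<^sub>m (cdim (tail CQ a)) (cdim (tail CQ a))"
   unfolding that left_mult_zero_mat[OF \<phi>a] right_mult_zero_mat[OF \<phi>a] ..
  show "e (head CQ a) * \<phi> a = \<phi> a * e (tail CQ a)" using a
  proof (cases rule: arc_cases)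
   case (1 l)
   show ?thesis by (rule zero) (simp_all add: 1 loop_ends e_def)
  next
   case (2 i' j)
   show ?thesis
   proof (cases "i' = i")
    case True
    show ?thesis using f_com[of j] 2 unfolding 2(1) True leg_arc_ends[OF 2(3)] e_leg by (simp add: M_def L_def True)
   next
    case False
    show ?thesis by (rule zero) (use False 2 in \<open>auto simp: leg_arc_ends e_def legv_def\<close>)
   qed
  qed
 qed
 moreover have "e x * e x = e x" for x
  using f_idem by (cases x) (auto simp: e_def)
 moreover have "\<exists>x\<in>verts CQ. e x ~= 0\<^sub>m (cdim x) (cdim x)"
 proof (intro bexI notI)
  show "legv i j0 \<in> verts CQ" by (rule leg_vert[OF i j0(2)])
  assume "e (legv i j0) = 0\<^sub>m (cdim (legv i j0)) (cdim (legv i j0))"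
  then have z: "w 0 * \<eta> 0 = 0\<^sub>m (d j0) (d j0)" unfolding e_leg dim by (simp add: f_def)
  have w0: "w 0 \<in> Mat (d j0) 1" "\<eta> 0 \<in> Mat 1 (d j0)" using wc[of 0] \<eta>c[of 0] by auto
  have "(w 0 * \<eta> 0) * w 0 = w 0 * (\<eta> 0 * w 0)" using w0 by (simp add: mat_assoc del: assoc_mult_mat)
  then have "w 0 = 0\<^sub>m (d j0) 1" unfolding z \<eta>w[OF le0] using left_mult_zero_mat[OF w0(1)] right_mult_one_mat[OF w0(1)] by simp
  then have "\<eta> 0 * w 0 = 0\<^sub>m 1 1" using right_mult_zero_mat[OF w0(2)] by simp
  then have "0\<^sub>m 1 1 = (1\<^sub>m 1 :: 'b mat)" unfolding \<eta>w[OF le0] by simp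
  from arg_cong[OF this, of "%A. A $$ (0,0)"] show False by simp
 qed
 moreover have "\<exists>x\<in>verts CQ. e x ~= 1\<^sub>m (cdim x)"
 proof (intro bexI notI)
  assume "e Center = 1\<^sub>m (cdim Center)"
  then have "0\<^sub>m n n = (1\<^sub>m n :: 'b mat)" by (simp add: e_def)
  from arg_cong[OF this, of "%A. A $$ (0,0)"] show False using n by simp
 qed (rule Center_vert)
 ultimately have "idem_endo CQ cdim \<phi> e" unfolding idem_endo_def by blast
 then show False using nidem by blast
qed

lemma leg_injective_ac:
 fixes \<phi> :: "comet_arrow => 'a::field mat"
 assumes \<phi>: "\<phi> \<in> quiver_reps CQ cdim UNIV"
 shows "leg_injective (ac_rep CQ \<phi>) \<longleftrightarrow> leg_injective \<phi>"
proof -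
 interpret t: comm_ring_hom "to_ac :: 'a => 'a alg_closure" by (rule to_ac_hom)
 have "left_inv (ac_mat A :: 'a alg_closure mat) \<longleftrightarrow> left_inv A" if A: "A \<in> Mat r c" for A :: "'a mat" and r c
 proof
  assume "left_inv A"
  then obtain B where B: "B \<in> Mat c r" "B * A = 1\<^sub>m c" using left_invE[OF _ A] by metis
  have "ac_mat B * ac_mat A = (1\<^sub>m c :: 'a alg_closure mat)"
   unfolding t.mat_hom_mult[OF B(1) A, symmetric] B(2) by (rule t.mat_hom_one)
  then show "left_inv (ac_mat A :: 'a alg_closure mat)" using A B(1) by (intro left_invI[of _ r c "ac_mat B"]) auto
 next
  assume li: "left_inv (ac_mat A :: 'a alg_closure mat)"
  show "left_inv A"
  proof (rule left_inv_cases[OF A])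
   fix U assume U: "U \<in> Mat c 1" "U ~= 0\<^sub>m c 1" "A * U = 0\<^sub>m r 1"
   have Ac: "ac_mat A \<in> Mat r c" "ac_mat U \<in> Mat c 1" using A U(1) by auto
   obtain B where B: "B \<in> Mat c r" "B * ac_mat A = (1\<^sub>m c :: 'a alg_closure mat)" using left_invE[OF li Ac(1)] by metis
   have "ac_mat A * ac_mat U = (ac_mat (0\<^sub>m r 1) :: 'a alg_closure mat)"
    unfolding t.mat_hom_mult[OF A U(1), symmetric] U(3) ..
   also have "... = 0\<^sub>m r 1" by (intro eq_matI) auto
   finally have "B * (ac_mat A * ac_mat U) = 0\<^sub>m c 1" using right_mult_zero_mat[OF B(1)] by simp
   then have "ac_mat U = (0\<^sub>m c 1 :: 'a alg_closure mat)"
    unfolding assoc_mult_mat[OF B(1) Ac, symmetric] B(2) using Ac(2) by simp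
   also have "... = ac_mat (0\<^sub>m c 1)" by (intro eq_matI) auto
   finally have "U = 0\<^sub>m c 1" by (rule map_to_ac_inj)
   then show ?thesis using U(2) by simp
  qed
 qed
 then have "left_inv (ac_rep CQ \<phi> a) \<longleftrightarrow> left_inv (\<phi> a)" if "a \<in> arcs CQ" for a
  using rep_arc[OF \<phi> that] ac_rep_arc[OF that, of \<phi>] by simp
 then show ?thesis unfolding leg_injective_def using leg_arc by blast
qed

text \<open>Injective leg maps embed every vertex into the center, compatibly with endomorphisms.\<close>

lemma leg_injective_endo_zero:
 fixes \<phi> :: "comet_arrow => 'b::field mat"
 assumes \<phi>: "\<phi> \<in> quiver_reps CQ cdim UNIV" and inj: "leg_injective \<phi>" and f: "rep_endo CQ cdim \<phi> f"
  and z: "f Center = 0\<^sub>m n n" and x: "x \<in> verts CQ"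
 shows "f x = 0\<^sub>m (cdim x) (cdim x)"
proof -
 have leg: "f (legv i j) = 0\<^sub>m (cdim (legv i j)) (cdim (legv i j))" if i: "i \<in> {1..k}" and "j < length (\<mu> i)" for i j
  using that(2)
 proof (induction j)
  case 0
  then show ?case using z by (simp add: legv_def)
 next
  case (Suc j)
  let ?a = "Leg_Arrow i (Suc j)" and ?x = "legv i (Suc j)" and ?y = "legv i j"
  have a: "?a \<in> arcs CQ" using leg_arc[OF i, of "Suc j"] Suc.prems by simp
  have ends: "head CQ ?a = ?y" "tail CQ ?a = ?x" using leg_arc_ends[of "Suc j" i] by auto
  have \<phi>a: "\<phi> ?a \<in> Mat (cdim ?y) (cdim ?x)" using rep_arc[OF \<phi> a] unfolding ends .
  have fx: "f ?x \<in> Mat (cdim ?x) (cdim ?x)" by (rule rep_endo_carrier[OF finite_comet \<phi> f leg_vert[OF i Suc.prems]])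
  have "left_inv (\<phi> ?a)" using inj i Suc.prems unfolding leg_injective_def by auto
  then obtain B where B: "B \<in> Mat (cdim ?x) (cdim ?y)" "B * \<phi> ?a = 1\<^sub>m (cdim ?x)" using left_invE[OF _ \<phi>a] by metis
  have "f ?y * \<phi> ?a = \<phi> ?a * f ?x" using f a ends unfolding rep_endo_def by metis
  moreover have "f ?y = 0\<^sub>m (cdim ?y) (cdim ?y)" using Suc by simp
  ultimately have "\<phi> ?a * f ?x = 0\<^sub>m (cdim ?y) (cdim ?x)" using left_mult_zero_mat[OF \<phi>a] by simp
  then have "B * \<phi> ?a * f ?x = 0\<^sub>m (cdim ?x) (cdim ?x)" unfolding assoc_mult_mat[OF B(1) \<phi>a fx] using right_mult_zero_mat[OF B(1)] by simp
  then show ?case unfolding B(2) using fx by simp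
 qed
 show ?thesis using x by (rule vert_cases) (simp add: leg)
qed

lemma comet_char_weights:
 assumes lin: "!!i j. i \<in> {1..k} ==> j < length (\<mu> i) ==> \<alpha> i j \<in> linear_characters" and z: "z ~= 0"
  and det: "!!i j. i \<in> {1..k} ==> j < length (\<mu> i) ==> det (h (legv i j)) = z ^ \<kappa> i j"
  and step: "!!i j. i \<in> {1..k} ==> j < length (\<mu> i) ==> \<kappa> i j = c i j + (if Suc j < length (\<mu> i) then \<kappa> i (Suc j) else 0)"
 shows "comet_char k \<mu> \<alpha> h = weight_char k \<mu> \<alpha> c z"
 unfolding comet_char_def weight_char_def
proof (intro prod.cong refl)
 fix i j assume i: "i \<in> {1..k}" and "j \<in> {..<length (\<mu> i)}"
 then have j: "j < length (\<mu> i)" by simp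
 have "(if Suc j < length (\<mu> i) then det (h (Leg i (Suc j))) else 1) = z ^ (if Suc j < length (\<mu> i) then \<kappa> i (Suc j) else 0)"
  using det[OF i, of "Suc j"] by (simp add: legv_def)
 then have "det (h (legv i j)) / (if Suc j < length (\<mu> i) then det (h (Leg i (Suc j))) else 1) = z ^ c i j"
  unfolding det[OF i j] using step[OF i j] z by (simp add: power_add)
 moreover have "\<alpha> i j (z ^ m) = \<alpha> i j z ^ m" for m
  using lin[OF i j] by (induction m) (auto simp: linear_characters_def)
 ultimately show "\<alpha> i j (det (h (legv i j)) / (if Suc j < length (\<mu> i) then det (h (Leg i (Suc j))) else 1)) = \<alpha> i j z ^ c i j" by simp
qed

text \<open>For the direction from right to left, the increments along the legs of the ranks from
\<open>spectral_splitting\<close> are the parts of a splitting of \<open>\<mu>\<close> that genericity excludes.\<close>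

theorem comet_absolutely_indecomposable_iff:
 fixes \<phi> :: "comet_arrow => 'a::{field,finite} mat"
 assumes lin: "!!i j. i \<in> {1..k} ==> j < length (\<mu> i) ==> \<alpha> i j \<in> linear_characters"
  and gen: "generic_weights n k \<mu> \<alpha>" and \<phi>: "\<phi> \<in> quiver_reps CQ cdim UNIV"
 shows "absolutely_indecomposable CQ cdim \<phi> \<longleftrightarrow> leg_injective \<phi> &
  (\<forall>h. rep_endo CQ cdim \<phi> h --> (\<forall>x\<in>verts CQ. h x \<in> carrier (GL (cdim x))) --> comet_char k \<mu> \<alpha> h = 1)"
proof -
 have ai: "absolutely_indecomposable CQ cdim \<phi> \<longleftrightarrow> \<not> (\<exists>e. idem_endo CQ cdim (ac_rep CQ \<phi>) e)"
  unfolding absolutely_indecomposable_iff[OF finite_comet \<phi>] ac_rep_def using Center_vert dim_Center n by fastforce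
 have bc: "base_change CQ cdim \<phi> h Center" if "rep_endo CQ cdim \<phi> h" for h
  by (unfold_locales) (use that finite_comet \<phi> Center_vert n in auto)
 note ac = ac_rep_reps[OF \<phi>]
 have scalar: "weight_char k \<mu> \<alpha> (%i j. \<mu> i ! j) z = 1" if "z ~= 0" for z
  using gen that unfolding generic_weights_def by blast
 show ?thesis
 proof
  assume "absolutely_indecomposable CQ cdim \<phi>"
  then have nidem: "\<not> (\<exists>e. idem_endo CQ cdim (ac_rep CQ \<phi>) e)" unfolding ai .
  show "leg_injective \<phi> & (\<forall>h. rep_endo CQ cdim \<phi> h --> (\<forall>x\<in>verts CQ. h x \<in> carrier (GL (cdim x))) --> comet_char k \<mu> \<alpha> h = 1)"
  proof (intro conjI allI impI)
   show "leg_injective \<phi>" using leg_injective_if_no_idempotent[OF ac nidem] unfolding leg_injective_ac[OF \<phi>] .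
   fix h assume h: "rep_endo CQ cdim \<phi> h" "\<forall>x\<in>verts CQ. h x \<in> carrier (GL (cdim x))"
   obtain c where c: "c ~= 0" "!!x. x \<in> verts CQ ==> det (h x) = c ^ cdim x"
    using base_change.automorphism_det[OF bc[OF h(1)] nidem] h(2) by blast
   have "comet_char k \<mu> \<alpha> h = weight_char k \<mu> \<alpha> (%i j. \<mu> i ! j) c"
   proof (rule comet_char_weights[OF lin c(1)])
    show "det (h (legv i j)) = c ^ sum_list (drop j (\<mu> i))" if "i \<in> {1..k}" "j < length (\<mu> i)" for i j
     using c(2)[OF leg_vert[OF that]] dim_leg[OF that(1)] by simp
    show "sum_list (drop j (\<mu> i)) = \<mu> i ! j + (if Suc j < length (\<mu> i) then sum_list (drop (Suc j) (\<mu> i)) else 0)"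
     if "i \<in> {1..k}" "j < length (\<mu> i)" for i j
     using dim_leg_step[OF that] by auto
   qed
   then show "comet_char k \<mu> \<alpha> h = 1" using scalar[OF c(1)] by simp
  qed
 next
  assume *: "leg_injective \<phi> & (\<forall>h. rep_endo CQ cdim \<phi> h --> (\<forall>x\<in>verts CQ. h x \<in> carrier (GL (cdim x))) --> comet_char k \<mu> \<alpha> h = 1)"
  then have inj: "leg_injective \<phi>" and triv: "!!h. rep_endo CQ cdim \<phi> h ==> (!!x. x \<in> verts CQ ==> h x \<in> carrier (GL (cdim x))) ==> comet_char k \<mu> \<alpha> h = 1"
   by blast+
  have local: "\<exists>s M. (h Center - s \<cdot>\<^sub>m 1\<^sub>m (cdim Center)) ^\<^sub>m M = 0\<^sub>m (cdim Center) (cdim Center)" if h: "rep_endo CQ cdim \<phi> h" for h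
  proof -
   obtain r \<rho> where r: "r >= 1" "\<rho> Center >= 1" "!!x. x \<in> verts CQ ==> r * \<rho> x <= cdim x"
    and mono: "!!a. a \<in> arcs CQ ==> left_inv (\<phi> a) ==>
     \<rho> (tail CQ a) <= \<rho> (head CQ a) & cdim (tail CQ a) - r * \<rho> (tail CQ a) <= cdim (head CQ a) - r * \<rho> (head CQ a)"
    and aut: "!!c. c ~= 0 ==> \<exists>u. rep_endo CQ cdim \<phi> u & (\<forall>x\<in>verts CQ. u x \<in> carrier (GL (cdim x)) & det (u x) = c ^ \<rho> x)"
    and fin: "r = 1 ==> \<rho> Center = cdim Center ==> ?thesis"
    using base_change.spectral_splitting[OF bc[OF h]] by blast
   define R where "R i j = (if j < length (\<mu> i) then \<rho> (legv i j) else 0)" for i j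
   define V where "V i j = sum_list (drop j (\<mu> i))" for i j
   define c where "c i j = R i j - R i (Suc j)" for i j
   \<comment> \<open>What the \<open>r\<close> conjugates leave over.\<close>
   define c' where "c' i j = \<mu> i ! j - r * c i j" for i j
   have R0: "R i 0 = \<rho> Center" if "i \<in> {1..k}" for i using length_parts[OF that] by (auto simp: R_def legv_def)
   have RV: "r * R i j <= V i j" if "i \<in> {1..k}" for i j
    using r(3)[OF leg_vert[OF that]] dim_leg[OF that] by (simp add: R_def V_def)
   have step: "R i (Suc j) <= R i j & V i (Suc j) - r * R i (Suc j) <= V i j - r * R i j" if i: "i \<in> {1..k}" for i j
   proof (cases "Suc j < length (\<mu> i)")
    case True
    have a: "Leg_Arrow i (Suc j) \<in> arcs CQ" using leg_arc[OF i _ True] by simp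
    have "left_inv (\<phi> (Leg_Arrow i (Suc j)))" using inj i True unfolding leg_injective_def by auto
    from mono[OF a this] show ?thesis using True leg_arc_ends[of "Suc j" i] dim_leg[OF i] by (simp add: R_def V_def)
   qed (simp add: R_def V_def)
   have V_step: "V i j = \<mu> i ! j + V i (Suc j)" if "i \<in> {1..k}" "j < length (\<mu> i)" for i j
    using dim_leg_step[OF that] by (simp add: V_def)
   have R_step: "R i j = c i j + R i (Suc j)" if "i \<in> {1..k}" for i j using step[OF that, of j] by (simp add: c_def)
   have c_le: "r * c i j <= \<mu> i ! j" if ij: "i \<in> {1..k}" "j < length (\<mu> i)" for i j
   proof -
    have "r * R i j = r * c i j + r * R i (Suc j)" unfolding R_step[OF ij(1), of j] by (rule distrib_left)
    then show ?thesis using step[OF ij(1), of j] RV[OF ij(1), of j] RV[OF ij(1), of "Suc j"] V_step[OF ij] by linarith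
   qed
   have c_sum: "(\<Sum>j<length (\<mu> i). c i j) = \<rho> Center" if i: "i \<in> {1..k}" for i
   proof -
    have "(\<Sum>j<l. c i j) + R i l = R i 0" for l
    proof (induction l)
     case (Suc l)
     have "(\<Sum>j<Suc l. c i j) + R i (Suc l) = (\<Sum>j<l. c i j) + (c i l + R i (Suc l))" by simp
     then show ?case unfolding R_step[OF i, of l, symmetric] Suc .
    qed simp
    from this[of "length (\<mu> i)"] show ?thesis using R0[OF i] by (simp add: R_def)
   qed
   have \<mu>_sum: "(\<Sum>j<length (\<mu> i). \<mu> i ! j) = n" if i: "i \<in> {1..k}" for i
    using sum_parts[OF i] by (simp add: sum_list_sum_nth atLeast0LessThan)
   have c'_sum: "(\<Sum>j<length (\<mu> i). c' i j) = n - r * \<rho> Center" if i: "i \<in> {1..k}" for i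
   proof -
    have "(\<Sum>j<length (\<mu> i). c' i j) + (\<Sum>j<length (\<mu> i). r * c i j) = (\<Sum>j<length (\<mu> i). \<mu> i ! j)"
     unfolding sum.distrib[symmetric] using c_le[OF i] by (intro sum.cong) (auto simp: c'_def)
    then show ?thesis unfolding \<mu>_sum[OF i] sum_distrib_left[symmetric] c_sum[OF i] by simp
   qed
   have c_triv: "weight_char k \<mu> \<alpha> c z = 1" if z: "z ~= 0" for z
   proof -
    obtain u where u: "rep_endo CQ cdim \<phi> u" "!!x. x \<in> verts CQ ==> u x \<in> carrier (GL (cdim x))" "!!x. x \<in> verts CQ ==> det (u x) = z ^ \<rho> x"
     using aut[OF z] by blast
    have "comet_char k \<mu> \<alpha> u = weight_char k \<mu> \<alpha> c z"
    proof (rule comet_char_weights[OF lin z])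
     show "det (u (legv i j)) = z ^ R i j" if "i \<in> {1..k}" "j < length (\<mu> i)" for i j
      using u(3)[OF leg_vert[OF that]] that(2) by (simp add: R_def)
     show "R i j = c i j + (if Suc j < length (\<mu> i) then R i (Suc j) else 0)" if "i \<in> {1..k}" "j < length (\<mu> i)" for i j
      using R_step[OF that(1), of j] by (simp add: R_def)
    qed
    then show ?thesis using triv[OF u(1,2)] by simp
   qed
   have c'_triv: "weight_char k \<mu> \<alpha> c' z = 1" if z: "z ~= 0" for z
   proof -
    have "weight_char k \<mu> \<alpha> (%i j. \<mu> i ! j) z = weight_char k \<mu> \<alpha> c' z * weight_char k \<mu> \<alpha> c z ^ r"
     unfolding weight_char_def prod_power_distrib prod.distrib[symmetric]
    proof (intro prod.cong refl)
     fix i j assume "i \<in> {1..k}" "j \<in> {..<length (\<mu> i)}"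
     then have "\<mu> i ! j = c' i j + c i j * r" using c_le[of i j] by (simp add: c'_def mult.commute)
     then show "\<alpha> i j z ^ (\<mu> i ! j) = \<alpha> i j z ^ c' i j * (\<alpha> i j z ^ c i j) ^ r" by (simp add: power_add power_mult)
    qed
    then show ?thesis using scalar[OF z] c_triv[OF z] by simp
   qed
   show ?thesis
   proof (cases "r = 1 & n = \<rho> Center")
    case True
    then show ?thesis using fin dim_Center by simp
   next
    case False
    define cs where "cs = replicate r c @ (if n = r * \<rho> Center then [] else [c'])"
    have le: "r * \<rho> Center <= n" using r(3)[OF Center_vert] dim_Center by simp
    have len: "length cs >= 2" using False r(1) by (auto simp: cs_def)
    have set: "set cs \<subseteq> {c, c'}" "c' \<in> set cs ==> c' ~= c ==> n ~= r * \<rho> Center" by (auto simp: cs_def split: if_splits)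
    have pos: "\<forall>d\<in>set cs. \<exists>N\<ge>1. \<forall>i\<in>{1..k}. (\<Sum>j<length (\<mu> i). d i j) = N"
    proof
     fix d assume d: "d \<in> set cs"
     show "\<exists>N\<ge>1. \<forall>i\<in>{1..k}. (\<Sum>j<length (\<mu> i). d i j) = N"
     proof (cases "d = c")
      case True
      then show ?thesis using c_sum r(2) by blast
     next
      case False
      then have "d = c'" "n ~= r * \<rho> Center" using d set by auto
      then show ?thesis using c'_sum le by (intro exI[of _ "n - r * \<rho> Center"]) auto
     qed
    qed
    have tot: "\<forall>i\<in>{1..k}. \<forall>j<length (\<mu> i). (\<Sum>d\<leftarrow>cs. d i j) = \<mu> i ! j"
    proof (intro ballI allI impI)
     fix i j assume ij: "i \<in> {1..k}" "j < length (\<mu> i)"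
     have rep: "(\<Sum>d\<leftarrow>replicate r c. d i j) = r * c i j" by (simp add: sum_list_replicate)
     show "(\<Sum>d\<leftarrow>cs. d i j) = \<mu> i ! j"
     proof (cases "n = r * \<rho> Center")
      case True
      then have "(\<Sum>j<length (\<mu> i). c' i j) = 0" using c'_sum[OF ij(1)] by simp
      then have "c' i j = 0" using ij(2) by simp
      then show ?thesis using True rep c_le[OF ij] by (simp add: cs_def c'_def)
     next
      case False
      then show ?thesis using rep c_le[OF ij] by (simp add: cs_def c'_def)
     qed
    qed
    have "\<exists>d\<in>set cs. \<exists>z. z ~= 0 & weight_char k \<mu> \<alpha> d z ~= 1"
     using gen len pos tot unfolding generic_weights_def by blast
    then show ?thesis using c_triv c'_triv set(1) by blast
   qed
  qed
  have "\<not> idem_endo CQ cdim (ac_rep CQ \<phi>) e" for e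
  proof
   assume ie: "idem_endo CQ cdim (ac_rep CQ \<phi>) e"
   then have e: "rep_endo CQ cdim (ac_rep CQ \<phi>) e" "e Center * e Center = e Center"
    "\<exists>x\<in>verts CQ. e x ~= 0\<^sub>m (cdim x) (cdim x)" "\<exists>x\<in>verts CQ. e x ~= 1\<^sub>m (cdim x)"
    using Center_vert unfolding idem_endo_def by blast+
   have inj': "leg_injective (ac_rep CQ \<phi>)" using inj unfolding leg_injective_ac[OF \<phi>] .
   have "e Center = 0\<^sub>m (cdim Center) (cdim Center) \<or> e Center = 1\<^sub>m (cdim Center)"
    by (rule local_idempotent[OF finite_comet \<phi> Center_vert _ _ e(1,2)]) (use n dim_Center in simp, rule local)
   then show False
   proof
    assume "e Center = 0\<^sub>m (cdim Center) (cdim Center)"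
    then show False using leg_injective_endo_zero[OF ac inj' e(1)] e(3) dim_Center by auto
   next
    assume c1: "e Center = 1\<^sub>m (cdim Center)"
    have f: "rep_endo CQ cdim (ac_rep CQ \<phi>) (%x. 1\<^sub>m (cdim x) - e x)"
     by (rule rep_endo_diff[OF finite_comet ac rep_endo_one[OF finite_comet ac] e(1)])
    have z: "1\<^sub>m (cdim x) - e x = 0\<^sub>m (cdim x) (cdim x)" if "x \<in> verts CQ" for x
     by (rule leg_injective_endo_zero[OF ac inj' f _ that]) (simp add: c1)
    have "e x = 1\<^sub>m (cdim x)" if x: "x \<in> verts CQ" for x
    proof (rule eq_matI)
     note exc = rep_endo_carrier[OF finite_comet ac e(1) x]
     fix i j assume "i < dim_row (1\<^sub>m (cdim x) :: 'a alg_closure mat)" "j < dim_col (1\<^sub>m (cdim x) :: 'a alg_closure mat)"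
     then have ij: "i < cdim x" "j < cdim x" by auto
     have "(1\<^sub>m (cdim x) - e x) $$ (i,j) = 1\<^sub>m (cdim x) $$ (i,j) - e x $$ (i,j)" using ij exc by simp
     then show "e x $$ (i,j) = 1\<^sub>m (cdim x) $$ (i,j)" unfolding z[OF x] using ij by simp
    qed (use rep_endo_carrier[OF finite_comet ac e(1) x] in auto)
    then show False using e(4) by blast
   qed
  qed
  then show "absolutely_indecomposable CQ cdim \<phi>" unfolding ai by blast
 qed
qed

end

section \<open>Counting leg-injective representations\<close>

context comet
begin

lemma verts_split: "verts CQ = insert Center ((%(i,j). Leg i j) ` (SIGMA i:{1..k}. {1..<length (\<mu> i)}))"
proof -
 have "{1..length (\<mu> i) - 1} = {1..<length (\<mu> i)}" for i by auto
 then show ?thesis by (auto simp: comet_quiver_def)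
qed

lemma arcs_split: "arcs CQ = Loop ` {1..g} \<union> (%(i,j). Leg_Arrow i j) ` (SIGMA i:{1..k}. {1..<length (\<mu> i)})"
proof -
 have "{1..length (\<mu> i) - 1} = {1..<length (\<mu> i)}" for i by auto
 then show ?thesis by (auto simp: comet_quiver_def)
qed

lemma prod_verts:
 fixes F :: "_ => 'c::comm_monoid_mult"
 shows "(\<Prod>x\<in>verts CQ. F x) = F Center * (\<Prod>i=1..k. \<Prod>j\<in>{1..<length (\<mu> i)}. F (Leg i j))"
proof -
 have "(\<Prod>x\<in>(%(i,j). Leg i j) ` (SIGMA i:{1..k}. {1..<length (\<mu> i)}). F x) = (\<Prod>(i,j)\<in>(SIGMA i:{1..k}. {1..<length (\<mu> i)}). F (Leg i j))"
  by (subst prod.reindex) (auto simp: inj_on_def case_prod_unfold)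
 also have "... = (\<Prod>i=1..k. \<Prod>j\<in>{1..<length (\<mu> i)}. F (Leg i j))" by (simp add: prod.Sigma)
 finally show ?thesis unfolding verts_split by (subst prod.insert) auto
qed

lemma prod_arcs:
 fixes F :: "_ => 'c::comm_monoid_mult"
 shows "(\<Prod>a\<in>arcs CQ. F a) = (\<Prod>l=1..g. F (Loop l)) * (\<Prod>i=1..k. \<Prod>j\<in>{1..<length (\<mu> i)}. F (Leg_Arrow i j))"
proof -
 have "(\<Prod>x\<in>(%(i,j). Leg_Arrow i j) ` (SIGMA i:{1..k}. {1..<length (\<mu> i)}). F x) = (\<Prod>(i,j)\<in>(SIGMA i:{1..k}. {1..<length (\<mu> i)}). F (Leg_Arrow i j))"
  by (subst prod.reindex) (auto simp: inj_on_def case_prod_unfold)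
 also have "... = (\<Prod>i=1..k. \<Prod>j\<in>{1..<length (\<mu> i)}. F (Leg_Arrow i j))" by (simp add: prod.Sigma)
 moreover have "(\<Prod>x\<in>Loop ` {1..g}. F x) = (\<Prod>l=1..g. F (Loop l))" by (subst prod.reindex) (auto simp: inj_on_def)
 ultimately show ?thesis unfolding arcs_split by (subst prod.union_disjoint) auto
qed

abbreviation leg_families :: "(comet_vertex => 'b set) => (nat => nat => 'b) set" where
 "leg_families S \<equiv> PiE {1..k} (%i. PiE {1..<length (\<mu> i)} (%j. S (Leg i j)))"

lemma sum_verts_split:
 fixes F :: "'b => (nat => nat => 'b) => 'c::comm_monoid_add"
 assumes "finite (S Center)" "!!i j. finite (S (Leg i j))"
 shows "(\<Sum>h\<in>PiE (verts CQ) S. F (h Center) (\<lambda>i\<in>{1..k}. \<lambda>j\<in>{1..<length (\<mu> i)}. h (Leg i j)))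
  = (\<Sum>x\<in>S Center. \<Sum>y\<in>leg_families S. F x y)"
proof -
 define glue :: "'b \<times> (nat => nat => 'b) => comet_vertex => 'b" where "glue = (%(x, y). \<lambda>v\<in>verts CQ. case v of Center => x | Leg i j => y i j)"
 define cut where "cut h = (h Center, \<lambda>i\<in>{1..k}. \<lambda>j\<in>{1..<length (\<mu> i)}. h (Leg i j))" for h :: "comet_vertex => 'b"
 have "(\<Sum>h\<in>PiE (verts CQ) S. F (h Center) (\<lambda>i\<in>{1..k}. \<lambda>j\<in>{1..<length (\<mu> i)}. h (Leg i j)))
  = (\<Sum>(x,y)\<in>S Center \<times> leg_families S. F x y)"
 proof (rule sum.reindex_bij_witness[of _ glue cut])
  fix h assume h: "h \<in> PiE (verts CQ) S"
  show "glue (cut h) = h"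
  proof
   fix v
   show "glue (cut h) v = h v"
   proof (cases "v \<in> verts CQ")
    case True
    show ?thesis
    proof (cases v)
     case Center
     then show ?thesis using True by (simp add: glue_def cut_def)
    next
     case (Leg i j)
     then have "i \<in> {1..k}" "j \<in> {1..<length (\<mu> i)}" using True by (auto simp: verts_split)
     then show ?thesis using True Leg by (simp add: glue_def cut_def)
    qed
   next
    case False
    then show ?thesis using PiE_arb[OF h False] by (simp add: glue_def cut_def)
   qed
  qed
  show "cut h \<in> S Center \<times> leg_families S" using h by (auto simp: cut_def verts_split)
  show "(case cut h of (x, y) => F x y) = F (h Center) (\<lambda>i\<in>{1..k}. \<lambda>j\<in>{1..<length (\<mu> i)}. h (Leg i j))" by (simp add: cut_def)
 next
  fix p assume p: "p \<in> S Center \<times> leg_families S"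
  then obtain x y where xy: "p = (x, y)" "x \<in> S Center" "y \<in> leg_families S" by auto
  show "cut (glue p) = p"
  proof -
   have "(\<lambda>i\<in>{1..k}. \<lambda>j\<in>{1..<length (\<mu> i)}. glue p (Leg i j)) = y"
   proof
    fix i
    show "(\<lambda>i\<in>{1..k}. \<lambda>j\<in>{1..<length (\<mu> i)}. glue p (Leg i j)) i = y i"
    proof (cases "i \<in> {1..k}")
     case True
     then have yi: "y i \<in> PiE {1..<length (\<mu> i)} (%j. S (Leg i j))" using xy(3) by (auto simp: PiE_iff)
     have "(\<lambda>j\<in>{1..<length (\<mu> i)}. glue p (Leg i j)) = y i"
     proof
      fix j
      show "(\<lambda>j\<in>{1..<length (\<mu> i)}. glue p (Leg i j)) j = y i j"
      proof (cases "j \<in> {1..<length (\<mu> i)}")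
       case True
       then have "Leg i j \<in> verts CQ" using \<open>i \<in> {1..k}\<close> by (auto simp: verts_split)
       then show ?thesis using True by (simp add: glue_def xy(1))
      next
       case False
       show ?thesis unfolding restrict_apply if_not_P[OF False] PiE_arb[OF yi False] ..
      qed
     qed
     then show ?thesis using True by simp
    next
     case False
     show ?thesis unfolding restrict_apply if_not_P[OF False] PiE_arb[OF xy(3) False] ..
    qed
   qed
   moreover have "glue p Center = x" using Center_vert by (simp add: glue_def xy(1))
   ultimately show ?thesis by (simp add: cut_def xy(1))
  qed
  show "glue p \<in> PiE (verts CQ) S" using xy(2,3) by (auto simp: glue_def xy(1) verts_split PiE_iff)
 qed
 also have "... = (\<Sum>x\<in>S Center. \<Sum>y\<in>leg_families S. F x y)" by (rule sum.cartesian_product[symmetric])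
 finally show ?thesis .
qed

definition gauge_group :: "(comet_vertex => 'b::field mat) monoid" where
 "gauge_group = product_group (verts CQ) (%x. GL (cdim x))"

lemma gauge_group_carrier: "carrier gauge_group = PiE (verts CQ) (%x. carrier (GL (cdim x)))"
 by (simp add: gauge_group_def)

lemma gauge_group_group: "Group.group gauge_group"
 unfolding gauge_group_def by (rule product_group) (rule GL_group)

lemma gauge_group_mult: "x \<in> verts CQ ==> (h \<otimes>\<^bsub>gauge_group\<^esub> h') x = h x * h' x"
 by (simp add: gauge_group_def GL_mult)

lemma gauge_group_one: "x \<in> verts CQ ==> \<one>\<^bsub>gauge_group\<^esub> x = 1\<^sub>m (cdim x)"
 by (simp add: gauge_group_def GL_one)

definition inj_reps :: "(comet_arrow => 'b::field mat) set" where
 "inj_reps = {\<phi> \<in> quiver_reps CQ cdim UNIV. leg_injective \<phi>}"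

text \<open>Base change at all vertices; its orbits are the isomorphism classes.\<close>

definition gauge_act :: "(comet_vertex => 'b::field mat) => (comet_arrow => 'b mat) => comet_arrow => 'b mat" where
 "gauge_act h \<phi> = (\<lambda>a\<in>arcs CQ. h (head CQ a) * \<phi> a * inv\<^bsub>GL (cdim (tail CQ a))\<^esub> (h (tail CQ a)))"

lemma gauge_act_iff:
 fixes \<phi> :: "comet_arrow => 'b::field mat"
 assumes h: "!!x. x \<in> verts CQ ==> h x \<in> carrier (GL (cdim x))" and \<phi>: "\<phi> \<in> quiver_reps CQ cdim UNIV" and \<psi>: "\<psi> \<in> quiver_reps CQ cdim UNIV"
 shows "gauge_act h \<phi> = \<psi> \<longleftrightarrow> (\<forall>a\<in>arcs CQ. h (head CQ a) * \<phi> a = \<psi> a * h (tail CQ a))"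
proof -
 have arc: "h (head CQ a) * \<phi> a * inv\<^bsub>GL (cdim (tail CQ a))\<^esub> (h (tail CQ a)) = \<psi> a \<longleftrightarrow> h (head CQ a) * \<phi> a = \<psi> a * h (tail CQ a)"
  if a: "a \<in> arcs CQ" for a
 proof -
  note ends = arc_ends[OF finite_comet a]
  let ?hx = "h (head CQ a)" and ?hy = "h (tail CQ a)" and ?y = "cdim (tail CQ a)"
  have G: "?hy \<in> carrier (GL ?y)" using h ends by blast
  note I = GL_mat[OF GL_inv_closed[OF G]]
  have c: "?hx \<in> Mat (cdim (head CQ a)) (cdim (head CQ a))" "?hy \<in> Mat ?y ?y"
   using GL_mat[OF h] ends by blast+
  note p = rep_arc[OF \<phi> a] rep_arc[OF \<psi> a]
  have hp: "?hx * \<phi> a \<in> Mat (cdim (head CQ a)) ?y" using c p by auto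
  show ?thesis
  proof
   assume "?hx * \<phi> a * inv\<^bsub>GL ?y\<^esub> ?hy = \<psi> a"
   then have "\<psi> a * ?hy = (?hx * \<phi> a) * (inv\<^bsub>GL ?y\<^esub> ?hy * ?hy)" using assoc_mult_mat[OF hp I c(2)] by simp
   then show "?hx * \<phi> a = \<psi> a * ?hy" unfolding GL_l_inv[OF G] using right_mult_one_mat[OF hp] by simp
  next
   assume *: "?hx * \<phi> a = \<psi> a * ?hy"
   show "?hx * \<phi> a * inv\<^bsub>GL ?y\<^esub> ?hy = \<psi> a"
    unfolding * assoc_mult_mat[OF p(2) c(2) I] GL_r_inv[OF G] by (rule right_mult_one_mat[OF p(2)])
  qed
 qed
 have ext: "gauge_act h \<phi> \<in> extensional (arcs CQ)" "\<psi> \<in> extensional (arcs CQ)"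
  using \<psi> by (auto simp: gauge_act_def quiver_reps_def PiE_def)
 have "gauge_act h \<phi> = \<psi> \<longleftrightarrow> (\<forall>a\<in>arcs CQ. gauge_act h \<phi> a = \<psi> a)"
  using extensionalityI[OF ext] by auto
 then show ?thesis using arc by (simp add: gauge_act_def)
qed

lemma gauge_act_closed:
 fixes \<phi> :: "comet_arrow => 'b::field mat"
 assumes h: "h \<in> carrier gauge_group" and \<phi>: "\<phi> \<in> inj_reps"
 shows "gauge_act h \<phi> \<in> inj_reps"
proof -
 have hx: "h x \<in> carrier (GL (cdim x))" if "x \<in> verts CQ" for x using h that by (auto simp: gauge_group_carrier)
 have \<phi>': "\<phi> \<in> quiver_reps CQ cdim UNIV" "leg_injective \<phi>" using \<phi> by (auto simp: inj_reps_def)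
 have arc: "gauge_act h \<phi> a \<in> Mat (cdim (head CQ a)) (cdim (tail CQ a))" if a: "a \<in> arcs CQ" for a
 proof -
  note ends = arc_ends[OF finite_comet a]
  have "h (head CQ a) * \<phi> a * inv\<^bsub>GL (cdim (tail CQ a))\<^esub> (h (tail CQ a)) \<in> Mat (cdim (head CQ a)) (cdim (tail CQ a))"
   by (rule mult_carrier_mat[OF mult_carrier_mat[OF GL_mat[OF hx[OF conjunct1[OF ends]]] rep_arc[OF \<phi>'(1) a]]
      GL_mat[OF GL_inv_closed[OF hx[OF conjunct2[OF ends]]]]])
  then show ?thesis using a by (simp add: gauge_act_def)
 qed
 have rep: "gauge_act h \<phi> \<in> quiver_reps CQ cdim UNIV"
  unfolding quiver_reps_def using arc by (auto simp: gauge_act_def PiE_iff)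
 have "left_inv (gauge_act h \<phi> (Leg_Arrow i j))" if i: "i \<in> {1..k}" and j: "1 <= j" "j < length (\<mu> i)" for i j
 proof -
  let ?a = "Leg_Arrow i j"
  have a: "?a \<in> arcs CQ" by (rule leg_arc[OF i j])
  note ends = arc_ends[OF finite_comet a]
  let ?x = "cdim (head CQ ?a)" and ?y = "cdim (tail CQ ?a)"
  have G: "h (head CQ ?a) \<in> carrier (GL ?x)" "h (tail CQ ?a) \<in> carrier (GL ?y)" using hx ends by auto
  note c = GL_mat[OF G(1)] GL_mat[OF G(2)] GL_mat[OF GL_inv_closed[OF G(1)]] GL_mat[OF GL_inv_closed[OF G(2)]]
  note p = rep_arc[OF \<phi>'(1) a]
  have "left_inv (\<phi> ?a)" using \<phi>'(2) i j unfolding leg_injective_def by blast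
  then obtain B where B: "B \<in> Mat ?y ?x" "B * \<phi> ?a = 1\<^sub>m ?y" using left_invE[OF _ p] by metis
  let ?hx = "h (head CQ ?a)" and ?hy = "h (tail CQ ?a)" and ?ix = "inv\<^bsub>GL ?x\<^esub> (h (head CQ ?a))" and ?iy = "inv\<^bsub>GL ?y\<^esub> (h (tail CQ ?a))"
  have "(?hy * (B * ?ix)) * (?hx * \<phi> ?a * ?iy) = ?hy * ((B * ((?ix * ?hx) * \<phi> ?a)) * ?iy)"
   using c B(1) p by (simp add: mat_assoc del: assoc_mult_mat)
  also have "... = ?hy * ((B * \<phi> ?a) * ?iy)" unfolding GL_l_inv[OF G(1)] using p by simp
  also have "... = 1\<^sub>m ?y" unfolding B(2) left_mult_one_mat[OF c(4)] by (rule GL_r_inv[OF G(2)])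
  finally show ?thesis using a c B(1) p arc[OF a]
   by (intro left_invI[of _ ?x ?y "?hy * (B * ?ix)"]) (auto simp: gauge_act_def)
 qed
 then show ?thesis unfolding inj_reps_def leg_injective_def using rep by auto
qed

lemma gauge_action:
 "group_action (gauge_group :: (comet_vertex => 'b::field mat) monoid) inj_reps (%h. restrict (gauge_act h) inj_reps)"
proof (rule group_actionI[OF gauge_group_group gauge_act_closed])
 fix \<phi> :: "comet_arrow => 'b mat" assume \<phi>: "\<phi> \<in> inj_reps"
 then have \<phi>': "\<phi> \<in> quiver_reps CQ cdim UNIV" by (simp add: inj_reps_def)
 have "\<one>\<^bsub>gauge_group\<^esub> x \<in> carrier (GL (cdim x) :: 'b mat monoid)" if "x \<in> verts CQ" for x
  unfolding gauge_group_one[OF that] by (rule GL_one_closed)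
 moreover have "\<forall>a\<in>arcs CQ. \<one>\<^bsub>gauge_group\<^esub> (head CQ a) * \<phi> a = \<phi> a * \<one>\<^bsub>gauge_group\<^esub> (tail CQ a)"
 proof
  fix a assume a: "a \<in> arcs CQ"
  note ends = arc_ends[OF finite_comet a]
  show "\<one>\<^bsub>gauge_group\<^esub> (head CQ a) * \<phi> a = \<phi> a * \<one>\<^bsub>gauge_group\<^esub> (tail CQ a)"
   unfolding gauge_group_one[OF conjunct1[OF ends]] gauge_group_one[OF conjunct2[OF ends]]
    left_mult_one_mat[OF rep_arc[OF \<phi>' a]] right_mult_one_mat[OF rep_arc[OF \<phi>' a]] ..
 qed
 ultimately show "gauge_act \<one>\<^bsub>gauge_group\<^esub> \<phi> = \<phi>" by (subst gauge_act_iff[OF _ \<phi>' \<phi>']) auto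
 fix h h' :: "comet_vertex => 'b mat" assume h: "h \<in> carrier gauge_group" "h' \<in> carrier gauge_group"
 have hx: "h x \<in> carrier (GL (cdim x))" "h' x \<in> carrier (GL (cdim x))" if "x \<in> verts CQ" for x
  using h that by (auto simp: gauge_group_carrier)
 have "gauge_act h' \<phi> \<in> inj_reps" by (rule gauge_act_closed[OF h(2) \<phi>])
 moreover from this have "gauge_act h (gauge_act h' \<phi>) \<in> inj_reps" by (rule gauge_act_closed[OF h(1)])
 ultimately have r: "gauge_act h' \<phi> \<in> quiver_reps CQ cdim UNIV" "gauge_act h (gauge_act h' \<phi>) \<in> quiver_reps CQ cdim UNIV"
  by (auto simp: inj_reps_def)
 have e: "\<forall>a\<in>arcs CQ. h' (head CQ a) * \<phi> a = gauge_act h' \<phi> a * h' (tail CQ a)"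
  using gauge_act_iff[OF hx(2) \<phi>' r(1)] by blast
 have e': "\<forall>a\<in>arcs CQ. h (head CQ a) * gauge_act h' \<phi> a = gauge_act h (gauge_act h' \<phi>) a * h (tail CQ a)"
  using gauge_act_iff[OF hx(1) r] by blast
 show "gauge_act (h \<otimes>\<^bsub>gauge_group\<^esub> h') \<phi> = gauge_act h (gauge_act h' \<phi>)"
 proof (subst gauge_act_iff[OF _ \<phi>' r(2)])
  show "(h \<otimes>\<^bsub>gauge_group\<^esub> h') x \<in> carrier (GL (cdim x))" if "x \<in> verts CQ" for x
   unfolding gauge_group_mult[OF that] using hx[OF that] by (rule GL_mult_closed)
  show "\<forall>a\<in>arcs CQ. (h \<otimes>\<^bsub>gauge_group\<^esub> h') (head CQ a) * \<phi> a = gauge_act h (gauge_act h' \<phi>) a * (h \<otimes>\<^bsub>gauge_group\<^esub> h') (tail CQ a)"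
  proof
   fix a assume a: "a \<in> arcs CQ"
   note ends = arc_ends[OF finite_comet a]
   note x = conjunct1[OF ends] and y = conjunct2[OF ends]
   note c = GL_mat[OF hx(1)[OF x]] GL_mat[OF hx(2)[OF x]] GL_mat[OF hx(1)[OF y]] GL_mat[OF hx(2)[OF y]]
   note p = rep_arc[OF \<phi>' a] rep_arc[OF r(1) a] rep_arc[OF r(2) a]
   have "h (head CQ a) * h' (head CQ a) * \<phi> a = h (head CQ a) * (h' (head CQ a) * \<phi> a)" by (rule assoc_mult_mat[OF c(1,2) p(1)])
   also have "... = (h (head CQ a) * gauge_act h' \<phi> a) * h' (tail CQ a)"
    unfolding bspec[OF e a] by (rule assoc_mult_mat[OF c(1) p(2) c(4), symmetric])
   also have "... = gauge_act h (gauge_act h' \<phi>) a * (h (tail CQ a) * h' (tail CQ a))"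
    unfolding bspec[OF e' a] by (rule assoc_mult_mat[OF p(3) c(3,4)])
   finally show "(h \<otimes>\<^bsub>gauge_group\<^esub> h') (head CQ a) * \<phi> a = gauge_act h (gauge_act h' \<phi>) a * (h \<otimes>\<^bsub>gauge_group\<^esub> h') (tail CQ a)"
    unfolding gauge_group_mult[OF x] gauge_group_mult[OF y] .
  qed
 qed
qed

text \<open>A representation is fixed iff each of its arrows intertwines, so the arrows can be counted independently.\<close>

lemma card_fixed_reps:
 fixes h :: "comet_vertex => 'a::{field,finite} mat"
 assumes h: "h \<in> carrier gauge_group"
 shows "card {\<phi> \<in> inj_reps. gauge_act h \<phi> = \<phi>}
  = card (centralizer n (h Center)) ^ g * (\<Prod>i=1..k. \<Prod>j\<in>{1..<length (\<mu> i)}. emb_count (h (legv i (j - 1))) (h (legv i j)))"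
proof -
 have hx: "h x \<in> carrier (GL (cdim x))" if "x \<in> verts CQ" for x using h that by (auto simp: gauge_group_carrier)
 define T where "T a = (case a of Loop l => centralizer n (h Center)
  | Leg_Arrow i j => {f \<in> Mat (dim_row (h (legv i (j - 1)))) (dim_row (h (legv i j))).
    left_inv f & h (legv i (j - 1)) * f = f * h (legv i j)})" for a
 have dim: "dim_row (h (legv i j)) = cdim (legv i j)" if "i \<in> {1..k}" "j < length (\<mu> i)" for i j
  using GL_mat[OF hx[OF leg_vert[OF that]]] by auto
 have "{\<phi> \<in> inj_reps. gauge_act h \<phi> = \<phi>} = PiE (arcs CQ) T"
 proof (intro Set.set_eqI iffI)
  fix \<phi> assume "\<phi> \<in> {\<phi> \<in> inj_reps. gauge_act h \<phi> = \<phi>}"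
  then have \<phi>: "\<phi> \<in> quiver_reps CQ cdim UNIV" "leg_injective \<phi>" "gauge_act h \<phi> = \<phi>" by (auto simp: inj_reps_def)
  then have com: "\<forall>a\<in>arcs CQ. h (head CQ a) * \<phi> a = \<phi> a * h (tail CQ a)" using gauge_act_iff[OF hx \<phi>(1,1)] by blast
  have "\<phi> a \<in> T a" if a: "a \<in> arcs CQ" for a
   using a
  proof (cases rule: arc_cases)
   case (1 l)
   then show ?thesis using bspec[OF com a] rep_arc[OF \<phi>(1) a] dim_Center by (simp add: T_def centralizer_def loop_ends)
  next
   case (2 i j)
   have "j - 1 < length (\<mu> i)" using 2 by simp
   then show ?thesis using bspec[OF com a] rep_arc[OF \<phi>(1) a] \<phi>(2) 2 dim[OF 2(2)]
    by (simp add: T_def leg_arc_ends leg_injective_def)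
  qed
  moreover have "\<phi> \<in> extensional (arcs CQ)" using \<phi>(1) by (simp add: quiver_reps_def PiE_iff)
  ultimately show "\<phi> \<in> PiE (arcs CQ) T" by (simp add: PiE_iff)
 next
  fix \<phi> assume \<phi>: "\<phi> \<in> PiE (arcs CQ) T"
  have loop: "\<phi> (Loop l) \<in> centralizer n (h Center)" if "Loop l \<in> arcs CQ" for l
   using PiE_mem[OF \<phi> that] by (simp add: T_def)
  have leg: "\<phi> (Leg_Arrow i j) \<in> Mat (cdim (legv i (j - 1))) (cdim (legv i j)) & left_inv (\<phi> (Leg_Arrow i j)) &
    h (legv i (j - 1)) * \<phi> (Leg_Arrow i j) = \<phi> (Leg_Arrow i j) * h (legv i j)"
   if ij: "i \<in> {1..k}" "1 <= j" "j < length (\<mu> i)" for i j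
  proof -
   have "j - 1 < length (\<mu> i)" using ij by simp
   then show ?thesis using PiE_mem[OF \<phi> leg_arc[OF ij]] dim[OF ij(1)] ij by (simp add: T_def)
  qed
  have car: "\<phi> a \<in> Mat (cdim (head CQ a)) (cdim (tail CQ a)) & h (head CQ a) * \<phi> a = \<phi> a * h (tail CQ a)" if a: "a \<in> arcs CQ" for a
   using a
  proof (cases rule: arc_cases)
   case (1 l)
   then show ?thesis using loop[of l] a dim_Center by (simp add: centralizer_def loop_ends)
  next
   case (2 i j)
   then show ?thesis using leg[OF 2(2-4)] by (simp add: leg_arc_ends)
  qed
  have rep: "\<phi> \<in> quiver_reps CQ cdim UNIV" using car \<phi> by (auto simp: quiver_reps_def PiE_iff)
  have "leg_injective \<phi>" unfolding leg_injective_def using leg by blast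
  moreover have "gauge_act h \<phi> = \<phi>" using gauge_act_iff[OF hx rep rep] car by blast
  ultimately show "\<phi> \<in> {\<phi> \<in> inj_reps. gauge_act h \<phi> = \<phi>}" using rep by (simp add: inj_reps_def)
 qed
 then have "card {\<phi> \<in> inj_reps. gauge_act h \<phi> = \<phi>} = (\<Prod>a\<in>arcs CQ. card (T a))"
  using card_PiE[OF finite_comet_arcs(2)] by simp
 also have "... = (\<Prod>l=1..g. card (centralizer n (h Center))) * (\<Prod>i=1..k. \<Prod>j\<in>{1..<length (\<mu> i)}. emb_count (h (legv i (j - 1))) (h (legv i j)))"
  unfolding prod_arcs by (simp add: T_def emb_count_def)
 finally show ?thesis by simp
qed

lemma comet_char_mult:
 assumes lin: "!!i j. i \<in> {1..k} ==> j < length (\<mu> i) ==> \<alpha> i j \<in> linear_characters"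
  and h: "h \<in> carrier gauge_group" "h' \<in> carrier gauge_group"
 shows "comet_char k \<mu> \<alpha> (h \<otimes>\<^bsub>gauge_group\<^esub> h') = comet_char k \<mu> \<alpha> h * comet_char k \<mu> \<alpha> h'"
 unfolding comet_char_def prod.distrib[symmetric]
proof (intro prod.cong refl)
 fix i j assume i: "i \<in> {1..k}" and "j \<in> {..<length (\<mu> i)}"
 then have j: "j < length (\<mu> i)" by simp
 have det: "det ((h \<otimes>\<^bsub>gauge_group\<^esub> h') x) = det (h x) * det (h' x)" if "x \<in> verts CQ" for x
  unfolding gauge_group_mult[OF that] using h that by (intro det_mult[of _ "cdim x"] GL_mat) (auto simp: gauge_group_carrier)
 have "Leg i (Suc j) \<in> verts CQ" if "Suc j < length (\<mu> i)" using leg_vert[OF i that] by (simp add: legv_def)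
 then have e: "det ((h \<otimes>\<^bsub>gauge_group\<^esub> h') (legv i j)) / (if Suc j < length (\<mu> i) then det ((h \<otimes>\<^bsub>gauge_group\<^esub> h') (Leg i (Suc j))) else 1)
  = (det (h (legv i j)) / (if Suc j < length (\<mu> i) then det (h (Leg i (Suc j))) else 1)) * (det (h' (legv i j)) / (if Suc j < length (\<mu> i) then det (h' (Leg i (Suc j))) else 1))"
  using det[OF leg_vert[OF i j]] det[of "Leg i (Suc j)"] by simp
 have m: "\<alpha> i j (x * y) = \<alpha> i j x * \<alpha> i j y" for x y using lin[OF i j] by (simp add: linear_characters_def)
 show "\<alpha> i j (det ((h \<otimes>\<^bsub>gauge_group\<^esub> h') (legv i j)) / (if Suc j < length (\<mu> i) then det ((h \<otimes>\<^bsub>gauge_group\<^esub> h') (Leg i (Suc j))) else 1))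
  = \<alpha> i j (det (h (legv i j)) / (if Suc j < length (\<mu> i) then det (h (Leg i (Suc j))) else 1)) *
   \<alpha> i j (det (h' (legv i j)) / (if Suc j < length (\<mu> i) then det (h' (Leg i (Suc j))) else 1))"
  unfolding e by (rule m)
qed

lemma comet_char_cong: "(!!x. x \<in> verts CQ ==> h x = h' x) ==> comet_char k \<mu> \<alpha> h = comet_char k \<mu> \<alpha> h'"
proof -
 assume e: "!!x. x \<in> verts CQ ==> h x = h' x"
 have "h (Leg i (Suc j)) = h' (Leg i (Suc j))" if "i \<in> {1..k}" "Suc j < length (\<mu> i)" for i j
  using e[OF leg_vert[OF that]] by (simp add: legv_def)
 then show ?thesis unfolding comet_char_def using e[OF leg_vert] by (intro prod.cong refl) auto
qed

end

section \<open>The multiplicity of the trivial character\<close>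

lemma chain_weight_cong: "p ~= [] ==> (!!j. j < length p ==> h j = h' j) ==> chain_weight p \<alpha> h = chain_weight p \<alpha> h'"
proof -
 assume p: "p ~= []" and e: "!!j. j < length p ==> h j = h' j"
 have "h (j - 1) = h' (j - 1)" if "j \<in> {1..<length p}" for j using that by (intro e) auto
 then show ?thesis unfolding chain_weight_def using e by (intro arg_cong2[of _ _ _ _ "(*)"] prod.cong refl) auto
qed

text \<open>Fixing the matrix \<open>x\<close> at the center, the legs contribute independent factors, which \<open>chain_sum\<close> evaluates.\<close>

lemma (in comet) symmetry_sum:
 fixes \<alpha> :: "nat => nat => 'a::{field,finite} => complex"
 shows "(\<Sum>h\<in>carrier gauge_group. comet_char k \<mu> \<alpha> h * of_nat (card {\<phi> \<in> inj_reps. gauge_act h \<phi> = \<phi>}))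
  = (\<Sum>x\<in>carrier (GL n). of_nat (card (centralizer n x)) ^ g * (\<Prod>i=1..k. ind_weight (\<mu> i) (\<alpha> i) x)) *
   (\<Prod>i=1..k. \<Prod>j\<in>{1..<length (\<mu> i)}. of_nat (card (carrier (GL (sum_list (drop j (\<mu> i)))) :: 'a mat set)))"
proof -
 define S :: "comet_vertex => 'a mat set" where "S x = carrier (GL (cdim x))" for x
 define F where "F x y = of_nat (card (centralizer n x)) ^ g * (\<Prod>i=1..k. chain_weight (\<mu> i) (\<alpha> i) ((y i)(0 := x)))"
  for x :: "'a mat" and y :: "nat => nat => 'a mat"
 have ne: "\<mu> i ~= []" if "i \<in> {1..k}" for i using length_parts[OF that] by auto
 have "(\<Sum>h\<in>carrier gauge_group. comet_char k \<mu> \<alpha> h * of_nat (card {\<phi> \<in> inj_reps. gauge_act h \<phi> = \<phi>}))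
  = (\<Sum>h\<in>PiE (verts CQ) S. F (h Center) (\<lambda>i\<in>{1..k}. \<lambda>j\<in>{1..<length (\<mu> i)}. h (Leg i j)))"
 proof (rule sum.cong)
  show "carrier gauge_group = PiE (verts CQ) S" unfolding gauge_group_carrier S_def ..
  fix h assume "h \<in> PiE (verts CQ) S"
  then have h: "h \<in> carrier gauge_group" unfolding gauge_group_carrier S_def .
  let ?E = "%i. \<Prod>j\<in>{1..<length (\<mu> i)}. emb_count (h (legv i (j - 1))) (h (legv i j))"
  have "comet_char k \<mu> \<alpha> h * of_nat (\<Prod>i=1..k. ?E i) = (\<Prod>i=1..k. chain_weight (\<mu> i) (\<alpha> i) (%j. h (legv i j)))"
  proof -
   have "legv i (Suc j) = Leg i (Suc j)" for i j by (simp add: legv_def)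
   then show ?thesis unfolding comet_char_def chain_weight_def prod.distrib of_nat_prod by (simp only:)
  qed
  also have "... = (\<Prod>i=1..k. chain_weight (\<mu> i) (\<alpha> i) (((\<lambda>i\<in>{1..k}. \<lambda>j\<in>{1..<length (\<mu> i)}. h (Leg i j)) i)(0 := h Center)))"
   by (intro prod.cong refl chain_weight_cong ne) (auto simp: legv_def)
  finally have weight: "comet_char k \<mu> \<alpha> h * of_nat (\<Prod>i=1..k. ?E i) = ..." .
  show "comet_char k \<mu> \<alpha> h * of_nat (card {\<phi> \<in> inj_reps. gauge_act h \<phi> = \<phi>})
   = F (h Center) (\<lambda>i\<in>{1..k}. \<lambda>j\<in>{1..<length (\<mu> i)}. h (Leg i j))"
   unfolding F_def card_fixed_reps[OF h] weight[symmetric] of_nat_mult of_nat_power by (rule mult.left_commute)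
 qed
 also have "... = (\<Sum>x\<in>S Center. \<Sum>y\<in>leg_families S. F x y)"
  by (rule sum_verts_split) (simp_all add: S_def finite_GL)
 also have "... = (\<Sum>x\<in>carrier (GL n). of_nat (card (centralizer n x)) ^ g * (\<Prod>i=1..k. ind_weight (\<mu> i) (\<alpha> i) x) *
   (\<Prod>i=1..k. \<Prod>j\<in>{1..<length (\<mu> i)}. of_nat (card (carrier (GL (sum_list (drop j (\<mu> i)))) :: 'a mat set))))"
 proof (rule sum.cong)
  show "S Center = carrier (GL n)" by (simp add: S_def)
  fix x :: "'a mat" assume x: "x \<in> carrier (GL n)"
  have leg: "(\<Sum>z\<in>PiE {1..<length (\<mu> i)} (%j. S (Leg i j)). chain_weight (\<mu> i) (\<alpha> i) (z(0 := x)))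
   = ind_weight (\<mu> i) (\<alpha> i) x * (\<Prod>j\<in>{1..<length (\<mu> i)}. of_nat (card (carrier (GL (sum_list (drop j (\<mu> i)))) :: 'a mat set)))"
   if i: "i \<in> {1..k}" for i
  proof -
   have "S (Leg i j) = carrier (GL (sum_list (drop j (\<mu> i))))" if "j \<in> {1..<length (\<mu> i)}" for j
    using dim_leg[OF i, of j] that by (simp add: S_def legv_def)
   then have "PiE {1..<length (\<mu> i)} (%j. S (Leg i j)) = PiE {1..<length (\<mu> i)} (%j. carrier (GL (sum_list (drop j (\<mu> i)))))"
    by (rule PiE_cong)
   then show ?thesis using chain_sum[OF ne[OF i], of x "\<alpha> i"] x sum_parts[OF i] by simp
  qed
  have "(\<Sum>y\<in>leg_families S. F x y) = of_nat (card (centralizer n x)) ^ g * (\<Sum>y\<in>leg_families S. \<Prod>i=1..k. chain_weight (\<mu> i) (\<alpha> i) ((y i)(0 := x)))"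
   unfolding F_def sum_distrib_left ..
  also have "(\<Sum>y\<in>leg_families S. \<Prod>i=1..k. chain_weight (\<mu> i) (\<alpha> i) ((y i)(0 := x)))
   = (\<Prod>i=1..k. \<Sum>z\<in>PiE {1..<length (\<mu> i)} (%j. S (Leg i j)). chain_weight (\<mu> i) (\<alpha> i) (z(0 := x)))"
   by (rule prod_sum_PiE[symmetric]) (auto intro!: finite_PiE simp: S_def finite_GL)
  also have "... = (\<Prod>i=1..k. ind_weight (\<mu> i) (\<alpha> i) x * (\<Prod>j\<in>{1..<length (\<mu> i)}. of_nat (card (carrier (GL (sum_list (drop j (\<mu> i)))) :: 'a mat set))))"
   using leg by (rule prod.cong[OF refl])
  finally show "(\<Sum>y\<in>leg_families S. F x y) = of_nat (card (centralizer n x)) ^ g * (\<Prod>i=1..k. ind_weight (\<mu> i) (\<alpha> i) x) *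
   (\<Prod>i=1..k. \<Prod>j\<in>{1..<length (\<mu> i)}. of_nat (card (carrier (GL (sum_list (drop j (\<mu> i)))) :: 'a mat set)))"
   unfolding prod.distrib by (simp only: mult.assoc)
 qed
 finally show ?thesis unfolding sum_distrib_right .
qed

lemma (in comet) card_symmetry_group:
 "card (carrier (gauge_group :: (comet_vertex => 'a::{field,finite} mat) monoid)) = card (carrier (GL n) :: 'a mat set) *
   (\<Prod>i=1..k. \<Prod>j\<in>{1..<length (\<mu> i)}. card (carrier (GL (sum_list (drop j (\<mu> i)))) :: 'a mat set))"
proof -
 have "cdim (Leg i j) = sum_list (drop j (\<mu> i))" if "i \<in> {1..k}" "j \<in> {1..<length (\<mu> i)}" for i j
  using dim_leg[OF that(1), of j] that(2) by (simp add: legv_def)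
 then have "(\<Prod>i=1..k. \<Prod>j\<in>{1..<length (\<mu> i)}. card (carrier (GL (cdim (Leg i j))) :: 'a mat set))
  = (\<Prod>i=1..k. \<Prod>j\<in>{1..<length (\<mu> i)}. card (carrier (GL (sum_list (drop j (\<mu> i)))) :: 'a mat set))"
  by (intro prod.cong refl) simp
 then show ?thesis unfolding gauge_group_carrier card_PiE[OF finite_comet_arcs(1)] prod_verts dim_Center by simp
qed

lemma finite_quiver_reps:
 assumes "finite (arcs Q)"
 shows "finite (quiver_reps Q v (UNIV :: 'a::{field,finite} set))"
 unfolding quiver_reps_def
proof (intro finite_PiE assms)
 fix a
 have "{A \<in> Mat (v (head Q a)) (v (tail Q a)). elements_mat A \<subseteq> (UNIV :: 'a set)} \<subseteq> Mat (v (head Q a)) (v (tail Q a))" by blast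
 then show "finite {A \<in> Mat (v (head Q a)) (v (tail Q a)). elements_mat A \<subseteq> (UNIV :: 'a set)}"
  using finite_carrier_mat by (rule finite_subset)
qed

theorem (in comet) centralizer_sum_counts_absolutely_indecomposables:
 fixes \<alpha> :: "nat => nat => 'a::{field,finite} => complex"
 assumes lin: "!!i j. i \<in> {1..k} ==> j < length (\<mu> i) ==> \<alpha> i j \<in> linear_characters"
  and gen: "generic_weights n k \<mu> \<alpha>"
 shows "(\<Sum>x\<in>carrier (GL n). of_nat (card (centralizer n x)) ^ g * (\<Prod>i=1..k. ind_weight (\<mu> i) (\<alpha> i) x))
  = of_nat (card (carrier (GL n) :: 'a mat set)) * of_nat (A_mu TYPE('a) g k n \<mu>)"
proof -
 let ?G = "gauge_group :: (comet_vertex => 'a mat) monoid"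
 let ?E = "inj_reps :: (comet_arrow => 'a mat) set"
 let ?act = "%h. restrict (gauge_act h) ?E"
 let ?S = "{\<phi> \<in> ?E. \<forall>h\<in>carrier ?G. ?act h \<phi> = \<phi> --> comet_char k \<mu> \<alpha> h = 1}"
 let ?R = "{(\<phi>, \<psi>). \<phi> \<in> quiver_reps CQ cdim (UNIV :: 'a set) & \<psi> \<in> quiver_reps CQ cdim UNIV & rep_iso CQ cdim UNIV \<phi> \<psi>}"
 interpret A: group_action ?G ?E ?act by (rule gauge_action)
 have finG: "finite (carrier ?G)" unfolding gauge_group_carrier by (intro finite_PiE finite_comet_arcs finite_GL)
 have finE: "finite ?E" unfolding inj_reps_def
  by (rule finite_subset[OF _ finite_quiver_reps[OF finite_comet_arcs(2), of cdim]]) blast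
 have one: "comet_char k \<mu> \<alpha> \<one>\<^bsub>?G\<^esub> = 1"
 proof -
  have "comet_char k \<mu> \<alpha> \<one>\<^bsub>?G\<^esub> = comet_char k \<mu> \<alpha> (%x. 1\<^sub>m (cdim x))" by (rule comet_char_cong) (rule gauge_group_one)
  also have "... = 1" unfolding comet_char_def using lin by (intro prod.neutral ballI) (auto simp: linear_characters_def)
  finally show ?thesis .
 qed
 have "(\<Sum>h\<in>carrier ?G. comet_char k \<mu> \<alpha> h * of_nat (card {\<phi> \<in> ?E. ?act h \<phi> = \<phi>}))
  = of_nat (card (carrier ?G)) * of_nat (card (orbit ?G ?act ` ?S))"
  by (rule A.weighted_burnside[OF finG finE comet_char_mult[OF lin] one])
 moreover have "{\<phi> \<in> ?E. ?act h \<phi> = \<phi>} = {\<phi> \<in> ?E. gauge_act h \<phi> = \<phi>}" for h by auto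
 ultimately have "(\<Sum>h\<in>carrier ?G. comet_char k \<mu> \<alpha> h * of_nat (card {\<phi> \<in> ?E. gauge_act h \<phi> = \<phi>}))
  = of_nat (card (carrier ?G)) * of_nat (card (orbit ?G ?act ` ?S))" by simp
 moreover define K where "K = (\<Prod>i=1..k. \<Prod>j\<in>{1..<length (\<mu> i)}. card (carrier (GL (sum_list (drop j (\<mu> i)))) :: 'a mat set))"
 ultimately have main: "(\<Sum>x\<in>carrier (GL n). of_nat (card (centralizer n x)) ^ g * (\<Prod>i=1..k. ind_weight (\<mu> i) (\<alpha> i) x)) * of_nat K
  = of_nat (card (carrier (GL n) :: 'a mat set)) * of_nat K * of_nat (card (orbit ?G ?act ` ?S))"
  unfolding symmetry_sum card_symmetry_group K_def by simp
 have "K ~= 0" unfolding K_def using card_GL_pos[where 'a = 'a] by simp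
 then have *: "(\<Sum>x\<in>carrier (GL n). of_nat (card (centralizer n x)) ^ g * (\<Prod>i=1..k. ind_weight (\<mu> i) (\<alpha> i) x))
  = of_nat (card (carrier (GL n) :: 'a mat set)) * of_nat (card (orbit ?G ?act ` ?S))" using main by simp
 have act_iff: "gauge_act h \<phi> = \<phi> \<longleftrightarrow> rep_endo CQ cdim \<phi> h" if h: "h \<in> carrier ?G" and \<phi>: "\<phi> \<in> quiver_reps CQ cdim UNIV" for h \<phi>
 proof -
  have hx: "h x \<in> carrier (GL (cdim x))" if "x \<in> verts CQ" for x using h that by (auto simp: gauge_group_carrier)
  have "\<forall>x\<in>verts CQ. h x \<in> Mat (cdim x) (cdim x)" using GL_mat[OF hx] by simp
  moreover have "gauge_act h \<phi> = \<phi> \<longleftrightarrow> (\<forall>a\<in>arcs CQ. h (head CQ a) * \<phi> a = \<phi> a * h (tail CQ a))"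
   by (rule gauge_act_iff[OF _ \<phi> \<phi>]) (rule hx)
  ultimately show ?thesis unfolding rep_endo_def by simp
 qed
 have S: "?S = {\<phi> \<in> quiver_reps CQ cdim UNIV. absolutely_indecomposable CQ cdim \<phi>}"
 proof (rule Set.set_eqI)
  fix \<phi>
  have "(\<forall>h\<in>carrier ?G. gauge_act h \<phi> = \<phi> --> comet_char k \<mu> \<alpha> h = 1) \<longleftrightarrow>
   (\<forall>h. rep_endo CQ cdim \<phi> h --> (\<forall>x\<in>verts CQ. h x \<in> carrier (GL (cdim x))) --> comet_char k \<mu> \<alpha> h = 1)"
   if \<phi>: "\<phi> \<in> quiver_reps CQ cdim UNIV"
  proof (intro iffI ballI allI impI)
   fix h assume *: "\<forall>h\<in>carrier ?G. gauge_act h \<phi> = \<phi> --> comet_char k \<mu> \<alpha> h = 1"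
    and h: "rep_endo CQ cdim \<phi> h" "\<forall>x\<in>verts CQ. h x \<in> carrier (GL (cdim x))"
   let ?h = "restrict h (verts CQ)"
   have mem: "?h \<in> carrier ?G" using h(2) by (auto simp: gauge_group_carrier)
   have "rep_endo CQ cdim \<phi> ?h" using h(1) arc_ends[OF finite_comet] by (simp add: rep_endo_def)
   then have "comet_char k \<mu> \<alpha> ?h = 1" using * mem act_iff[OF mem \<phi>] by blast
   then show "comet_char k \<mu> \<alpha> h = 1" using comet_char_cong[of h ?h] by simp
  next
   fix h assume *: "\<forall>h. rep_endo CQ cdim \<phi> h --> (\<forall>x\<in>verts CQ. h x \<in> carrier (GL (cdim x))) --> comet_char k \<mu> \<alpha> h = 1"
    and h: "h \<in> carrier ?G" "gauge_act h \<phi> = \<phi>"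
   have "\<forall>x\<in>verts CQ. h x \<in> carrier (GL (cdim x))" using h(1) by (auto simp: gauge_group_carrier)
   then show "comet_char k \<mu> \<alpha> h = 1" using * act_iff[OF h(1) \<phi>] h(2) by blast
  qed
  then show "\<phi> \<in> ?S \<longleftrightarrow> \<phi> \<in> {\<phi> \<in> quiver_reps CQ cdim UNIV. absolutely_indecomposable CQ cdim \<phi>}"
   using comet_absolutely_indecomposable_iff[OF lin gen, of \<phi>] by (auto simp: inj_reps_def)
 qed
 have orb: "orbit ?G ?act \<phi> = ?R `` {\<phi>}" if \<phi>: "\<phi> \<in> ?E" for \<phi>
 proof -
  have \<phi>': "\<phi> \<in> quiver_reps CQ cdim UNIV" using \<phi> by (simp add: inj_reps_def)
  show ?thesis
  proof (rule Set.set_eqI)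
   fix \<psi>
   have "\<psi> \<in> orbit ?G ?act \<phi> \<longleftrightarrow> (\<exists>h\<in>carrier ?G. gauge_act h \<phi> = \<psi>)" unfolding orbit_def using \<phi> by auto
   also have "... \<longleftrightarrow> \<psi> \<in> quiver_reps CQ cdim UNIV & rep_iso CQ cdim UNIV \<phi> \<psi>"
   proof
    assume "\<exists>h\<in>carrier ?G. gauge_act h \<phi> = \<psi>"
    then obtain h where h: "h \<in> carrier ?G" "gauge_act h \<phi> = \<psi>" by blast
    have \<psi>: "\<psi> \<in> quiver_reps CQ cdim UNIV" using gauge_act_closed[OF h(1) \<phi>] unfolding h(2) by (simp add: inj_reps_def)
    have hx: "h x \<in> carrier (GL (cdim x))" if "x \<in> verts CQ" for x using h(1) that by (auto simp: gauge_group_carrier)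
    then show "\<psi> \<in> quiver_reps CQ cdim UNIV & rep_iso CQ cdim UNIV \<phi> \<psi>"
     using gauge_act_iff[OF hx \<phi>' \<psi>] h(2) \<psi> unfolding rep_iso_def by blast
   next
    assume "\<psi> \<in> quiver_reps CQ cdim UNIV & rep_iso CQ cdim UNIV \<phi> \<psi>"
    then obtain h where \<psi>: "\<psi> \<in> quiver_reps CQ cdim UNIV" and h: "!!x. x \<in> verts CQ ==> h x \<in> carrier (GL (cdim x))"
     "\<forall>a\<in>arcs CQ. h (head CQ a) * \<phi> a = \<psi> a * h (tail CQ a)" unfolding rep_iso_def by blast
    let ?h = "restrict h (verts CQ)"
    have mem: "?h \<in> carrier ?G" using h(1) by (auto simp: gauge_group_carrier)
    have hx: "?h x \<in> carrier (GL (cdim x))" if "x \<in> verts CQ" for x using h(1) that by simp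
    have "\<forall>a\<in>arcs CQ. ?h (head CQ a) * \<phi> a = \<psi> a * ?h (tail CQ a)" using h(2) arc_ends[OF finite_comet] by simp
    then have "gauge_act ?h \<phi> = \<psi>" using gauge_act_iff[OF hx \<phi>' \<psi>] by blast
    then show "\<exists>h\<in>carrier ?G. gauge_act h \<phi> = \<psi>" using mem by blast
   qed
   finally show "\<psi> \<in> orbit ?G ?act \<phi> \<longleftrightarrow> \<psi> \<in> ?R `` {\<phi>}" using \<phi>' by simp
  qed
 qed
 have "orbit ?G ?act ` ?S = ?S // ?R" unfolding quotient_def using orb by auto
 then have "card (orbit ?G ?act ` ?S) = A_mu TYPE('a) g k n \<mu>" unfolding A_mu_def num_abs_indec_def S by simp
 then show ?thesis using * by simp
qed

lemma card_centralizer_transpose: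
 assumes x: "x \<in> Mat n n"
 shows "card (centralizer n x\<^sup>T) = card (centralizer n (x :: 'a::field mat))"
proof -
 have tr: "A\<^sup>T \<in> centralizer n y\<^sup>T" if "A \<in> centralizer n y" "y \<in> Mat n n" for A y :: "'a mat"
 proof -
  have A: "A \<in> Mat n n" "A * y = y * A" using that by (auto simp: centralizer_def)
  have "A\<^sup>T * y\<^sup>T = (y * A)\<^sup>T" using transpose_mult[OF that(2) A(1)] by simp
  also have "... = y\<^sup>T * A\<^sup>T" unfolding A(2)[symmetric] by (rule transpose_mult[OF A(1) that(2)])
  finally show ?thesis using A(1) by (simp add: centralizer_def)
 qed
 have "bij_betw transpose_mat (centralizer n x) (centralizer n x\<^sup>T)"
  by (rule bij_betw_byWitness[of _ transpose_mat]) (use tr[OF _ x] tr[of _ "x\<^sup>T"] x in auto)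
 then show ?thesis by (simp add: bij_betw_same_card)
qed

theorem theorem1p4p1:
  fixes g k n :: nat
    and \<mu> :: "nat \<Rightarrow> nat list"
    and \<X> :: "nat \<Rightarrow> 'a::{field,finite} mat \<Rightarrow> complex"
  assumes "k \<ge> 1" and "n \<ge> 1"
    and "\<And>i. i \<in> {1..k} \<Longrightarrow> is_partition n (\<mu> i)"
    and "\<And>i. i \<in> {1..k} \<Longrightarrow> semisimple_split_character (\<mu> i) (\<X> i)"
    and "generic_tuple n k \<mu> \<X>"
  shows "class_inner (GL n) (\<lambda>x. Lambda g n x * (\<Prod>i=1..k. \<X> i x)) (\<lambda>_. 1)
           = of_nat (A_mu TYPE('a) g k n \<mu>)"
proof -
  interpret comet g k n \<mu> by (unfold_locales) (use assms in auto)
  obtain \<alpha> where \<alpha>: "\<And>i. i \<in> {1..k} \<Longrightarrow> semisimple_split_data (\<mu> i) (\<alpha> i) (\<X> i)" and gen: "generic_weights n k \<mu> \<alpha>"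
    using generic_tuple_weights[OF assms(1,3,5)] by blast
  have lin: "\<alpha> i j \<in> linear_characters" if "i \<in> {1..k}" "j < length (\<mu> i)" for i j
    using \<alpha>[OF that(1)] that(2) by (simp add: semisimple_split_data_def)
  let ?F = "\<lambda>x. Lambda g n x * (\<Prod>i=1..k. \<X> i x)"
  have F: "?F x\<^sup>T = of_nat (card (centralizer n x)) ^ g * (\<Prod>i=1..k. ind_weight (\<mu> i) (\<alpha> i) x)" if x: "x \<in> carrier (GL n)" for x :: "'a mat"
  proof -
    have xT: "x\<^sup>T \<in> carrier (GL n)" by (rule GL_transpose(1)[OF x])
    have "Lambda g n x\<^sup>T = of_nat (card (centralizer n x\<^sup>T)) ^ g"
      unfolding Lambda_def krull_dim_GL_centralizer[OF GL_mat[OF xT], symmetric] by (simp add: power_mult mult.commute[of g])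
    also have "\<dots> = of_nat (card (centralizer n x)) ^ g" unfolding card_centralizer_transpose[OF GL_mat[OF x]] ..
    finally have L: "Lambda g n x\<^sup>T = of_nat (card (centralizer n x)) ^ g" .
    have "\<X> i x\<^sup>T = ind_weight (\<mu> i) (\<alpha> i) x" if i: "i \<in> {1..k}" for i
    proof -
      have "\<X> i x\<^sup>T = HC_induction (\<mu> i) (levi_char (\<mu> i) (\<alpha> i)) x\<^sup>T"
        using \<alpha>[OF i] xT sum_parts[OF i] by (simp add: semisimple_split_data_def)
      also have "\<dots> = ind_weight (\<mu> i) (\<alpha> i) x" using x sum_parts[OF i] by (intro HC_induction_transpose) simp
      finally show ?thesis .
    qed
    then show ?thesis unfolding L by (intro arg_cong2[of _ _ _ _ "(*)"] refl prod.cong) auto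
  qed
  have "(\<Sum>x\<in>carrier (GL n). ?F x) = (\<Sum>x\<in>carrier (GL n). ?F x\<^sup>T)"
    by (rule sum.reindex_bij_witness[of _ transpose_mat transpose_mat]) (auto simp: GL_transpose(1))
  also have "\<dots> = (\<Sum>x\<in>carrier (GL n). of_nat (card (centralizer n x)) ^ g * (\<Prod>i=1..k. ind_weight (\<mu> i) (\<alpha> i) x))"
    using F by (rule sum.cong[OF refl])
  also have "\<dots> = of_nat (card (carrier (GL n) :: 'a mat set)) * of_nat (A_mu TYPE('a) g k n \<mu>)"
    by (rule centralizer_sum_counts_absolutely_indecomposables[OF lin gen])
  finally show ?thesis unfolding class_inner_def using card_GL_pos[of n, where 'a = 'a] by simp
qed

end
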